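(* Let $w:\mathbb{R}^d\to\mathbb{R}$ and let $g:\mathbb{R}^d\to[0,\infty)$ with $g\in L^1(\mathbb{R}^d)\cap L^\infty(\mathbb{R}^d)$. Suppose one of the following assumptions holds. (i) (Smallness) $w\in L^1(\mathbb{R}^d)$ and $g\in H^{3/2+\delta_0}_{\lceil d/2\rceil}(\mathbb{R}^d)$, for some $0<\delta_0\ll1/2$, satisfy $$C_1\|w\|_{L^1}\|g\|_{H^{3/2+\delta_0}_{\lceil d/2\rceil}}<1 ,$$ where $C_1=C_1(d,\delta_0)$ is a constant, independent of $\hbar$, $w$ and $g$, for which $|\widetilde{\mathscr L}(\lambda,k;\hbar)|\leq C_1\|w\|_{L^1}\|g\|_{H^{3/2+\delta_0}_{\lceil d/2\rceil}}$ holds for all $\operatorname{Re}\lambda\geq0$, $k\in\mathbb{R}^d$, $\hbar\in[0,1]$ (such a constant exists). (ii) (Repulsive interaction and decreasing marginal) $w\in L^1(\mathbb{R}^d)$ with $\widehat w(k)\geq0$, and $g\in H^{3/2+\delta_0}_{1+\lceil d/2\rceil}(\mathbb{R}^d)$ is radial and satisfies, for all $k\in\mathbb{R}^d\setminus\{0\}$, $$g_k'(u)<0\ \text{ if }u>0,\qquad g_k'(u)>0\ \text{ if }u<0 .$$ (iii) (Generalised uniform Penrose condition) $w\in L^1(\mathbb{R}^d)$ and $g\in H^{3/2+\delta_0}_{1+\lceil d/2\rceil}(\mathbb{R}^d)$, and, for all $\tau\in\mathbb{R}$ and $k\neq0$, $$g_k'\big(\tfrac{\tau}{|k|}\big)=0\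 \Longrightarrow\ -\widehat w(k)\,\mathrm{p.v.}\!\int_{\mathbb{R}}\frac{g_k'(p_1)}{p_1-\frac{\tau}{|k|}}\,dp_1>-1 ,$$ together with the same implication with $\widehat w(k)$ replaced by $\widehat w(0)$, and, for $\hbar\in(0,1]$, $$g_k\big(\tfrac{\tau}{|k|}+\tfrac{\hbar|k|}{2}\big)=g_k\big(\tfrac{\tau}{|k|}-\tfrac{\hbar|k|}{2}\big)\ \Longrightarrow\ \widehat w(k)\frac{1}{\hbar|k|}\,\mathrm{p.v.}\!\int_{\mathbb{R}}g_k(p_1)\left[\frac{1}{p_1-\frac{\tau}{|k|}+\frac{\hbar|k|}{2}}-\frac{1}{p_1-\frac{\tau}{|k|}-\frac{\hbar|k|}{2}}\right]dp_1>-1 .$$ Then the uniform Penrose condition holds: there exists $c_{\mathrm P}>0$ such that for all $\hbar\in(0,1]$ $$\inf_{\operatorname{Re}\lambda\geq0,\;k\in\mathbb{R}^d}\big|1+\widetilde{\mathscr L}(\lambda,k;\hbar)\big|\geq c_{\mathrm P} .$$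
   Context: Fourier transform: $\widehat f(k)=\int_{\mathbb{R}^d}e^{-ik\cdot x}f(x)\,dx$. Weighted Sobolev norm: $\|g\|_{H^\sigma_m}:=\sum_{|\alpha|\leq m}\|v^\alpha\langle\nabla\rangle^\sigma g\|_{L^2}$, with $\langle x\rangle=(1+|x|^2)^{1/2}$. The parameter $\delta_0$ is a small positive constant. For $\hbar\in(0,1]$, $\operatorname{Re}\lambda\geq0$, $$\widetilde{\mathscr L}(\lambda,k;\hbar)=\frac2\hbar\,\widehat w(k)\int_0^\infty e^{-\lambda t}\sin\big(\tfrac12\hbar t|k|^2\big)\widehat g(kt)\,dt,$$ and for $\hbar=0$ it denotes the limit $\hbar\to0$: $\widetilde{\mathscr L}(\lambda,k;0)=\widehat w(k)\int_0^\infty e^{-\lambda s/|k|}s\,\widehat g\big(\tfrac{k}{|k|}s\big)\,ds$ for $k\neq0$, and $\widetilde{\mathscr L}(\lambda,0;\hbar)=0$ for all $\hbar\in[0,1]$. For $k\neq0$, $g_k$ denotes the marginal of $g$ along the direction $-k$: $g_k(u):=\int_{\{k\}^\perp}g\big(-\tfrac{k}{|k|}u+w'\big)\,dw'$, $u\in\mathbb{R}$ (integration over the hyperplane orthogonal to $k$). "p.v." denotes the Cauchy principal value. *)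

theory Defs
  imports "HOL-Analysis.Analysis" "HOL-Library.Complex_Order"
begin

text \<open>The dimension is d = CARD('n).\<close>

definition fourier :: "(real ^ 'n \<Rightarrow> real) \<Rightarrow> real ^ 'n \<Rightarrow> complex" where
  "fourier f k = (LINT x|lborel. exp (- (\<i> * complex_of_real (k \<bullet> x))) * complex_of_real (f x))"

definition L1_norm :: "(real ^ 'n \<Rightarrow> real) \<Rightarrow> real" where
  "L1_norm f = (LINT x|lborel. \<bar>f x\<bar>)"

definition in_L2 :: "(real ^ 'n \<Rightarrow> real) \<Rightarrow> bool" where
  "in_L2 f \<longleftrightarrow> f \<in> borel_measurable borel \<and> integrable lborel (\<lambda>x. (f x)\<^sup>2)"

definition L2_norm :: "(real ^ 'n \<Rightarrow> real) \<Rightarrow> real" where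
  "L2_norm f = sqrt (LINT x|lborel. (f x)\<^sup>2)"

definition ess_bounded :: "(real ^ 'n \<Rightarrow> real) \<Rightarrow> bool" where
  "ess_bounded f \<longleftrightarrow> f \<in> borel_measurable borel \<and> (\<exists>M. AE x in lborel. \<bar>f x\<bar> \<le> M)"

definition japanese_bracket :: "'a::real_normed_vector \<Rightarrow> real" where
  "japanese_bracket x = sqrt (1 + (norm x)\<^sup>2)"

text \<open>F is the Fourier--Plancherel transform of the square-integrable function h: the
  transforms of the truncations of h to large balls (which are integrable) converge to F
  in the mean-square sense.\<close>

definition has_fourier_L2 :: "(real ^ 'n \<Rightarrow> real) \<Rightarrow> (real ^ 'n \<Rightarrow> complex) \<Rightarrow> bool" where
  "has_fourier_L2 h F \<longleftrightarrow> in_L2 h \<and> F \<in> borel_measurable borel \<and>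
     ((\<lambda>R. \<integral>\<^sup>+ k. ennreal ((cmod (F k - fourier (\<lambda>x. indicator (cball 0 R) x * h x) k))\<^sup>2) \<partial>lborel)
        \<longlongrightarrow> 0) at_top"

text \<open>The function obtained from g by the Fourier multiplier with symbol the s-th power of the
  bracket of k. It is used for integrable g only, so that the transform of g is a genuine integral;
  it is determined up to null sets, and real-valued because the symbol is real and even.\<close>

definition is_bessel :: "real \<Rightarrow> (real ^ 'n \<Rightarrow> real) \<Rightarrow> (real ^ 'n \<Rightarrow> real) \<Rightarrow> bool" where
  "is_bessel s g h \<longleftrightarrow>
     has_fourier_L2 h (\<lambda>k. complex_of_real (japanese_bracket k powr s) * fourier g k)"

definition bessel :: "real \<Rightarrow> (real ^ 'n \<Rightarrow> real) \<Rightarrow> real ^ 'n \<Rightarrow> real" where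
  "bessel s g = (SOME h. is_bessel s g h)"

definition multi_indices :: "nat \<Rightarrow> ('n::finite \<Rightarrow> nat) set" where
  "multi_indices m = {\<alpha>. (\<Sum>i\<in>UNIV. \<alpha> i) \<le> m}"

definition monomial :: "('n::finite \<Rightarrow> nat) \<Rightarrow> real ^ 'n \<Rightarrow> real" where
  "monomial \<alpha> v = (\<Prod>i\<in>UNIV. (v $ i) ^ \<alpha> i)"

definition in_weighted_sobolev :: "real \<Rightarrow> nat \<Rightarrow> (real ^ 'n \<Rightarrow> real) \<Rightarrow> bool" where
  "in_weighted_sobolev s m g \<longleftrightarrow> (\<exists>h. is_bessel s g h) \<and>
     (\<forall>\<alpha>\<in>multi_indices m. in_L2 (\<lambda>v. monomial \<alpha> v * bessel s g v))"

definition weighted_sobolev_norm :: "real \<Rightarrow> nat \<Rightarrow> (real ^ 'n \<Rightarrow> real) \<Rightarrow> real" where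
  "weighted_sobolev_norm s m g =
     (\<Sum>\<alpha>\<in>multi_indices m. L2_norm (\<lambda>v. monomial \<alpha> v * bessel s g v))"

text \<open>The last argument is the semiclassical parameter; it is meant to lie in the
  closed unit interval.\<close>

definition Ltilde ::
  "(real ^ 'n \<Rightarrow> real) \<Rightarrow> (real ^ 'n \<Rightarrow> real) \<Rightarrow> complex \<Rightarrow> real ^ 'n \<Rightarrow> real \<Rightarrow> complex" where
  "Ltilde w g z k hb =
    (if k = 0 then 0
     else if hb = 0 then
       fourier w k * (LBINT s:{0..}. exp (- (z * complex_of_real (s / norm k))) *
                        complex_of_real s * fourier g (s *\<^sub>R (k /\<^sub>R norm k)))
     else
       complex_of_real (2 / hb) * fourier w k *
         (LBINT t:{0..}. exp (- (z * complex_of_real t)) *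
            complex_of_real (sin (1 / 2 * hb * t * (norm k)\<^sup>2)) * fourier g (t *\<^sub>R k)))"

text \<open>Lebesgue measure of dimension d - 1 on the hyperplane orthogonal to k (nonzero), built from an
  orthonormal basis of the hyperplane in the same way as lborel is built from Basis. By
  rotation invariance the choice of the basis is immaterial; for d = 1 it is the unit mass at 0.\<close>

definition hyperplane_measure :: "real ^ 'n \<Rightarrow> (real ^ 'n) measure" where
  "hyperplane_measure k =
    (let B = (SOME B. pairwise orthogonal B \<and> (\<forall>b\<in>B. norm b = 1) \<and> span B = {x. k \<bullet> x = 0})
     in distr (\<Pi>\<^sub>M b\<in>B. lborel) borel (\<lambda>c. \<Sum>b\<in>B. c b *\<^sub>R b))"

text \<open>As g is a Lebesgue class, the integral over hyperplanes determines the marginal only for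
  almost every u. Pointwise values and derivatives of the marginal refer to its continuous
  representative, which is unique, and exists and is continuously differentiable for all g
  in the Sobolev spaces considered here.\<close>

definition marginal :: "(real ^ 'n \<Rightarrow> real) \<Rightarrow> real ^ 'n \<Rightarrow> real \<Rightarrow> real" where
  "marginal g k = (THE G. continuous_on UNIV G \<and>
     (AE u in lborel. G u = (LINT w'|hyperplane_measure k. g (- (u *\<^sub>R (k /\<^sub>R norm k)) + w'))))"

text \<open>Cauchy principal value for an integrand with singularities in the finite set S.\<close>

definition pv_integral :: "real set \<Rightarrow> (real \<Rightarrow> real) \<Rightarrow> real" where
  "pv_integral S f = Lim (at_right 0) (\<lambda>\<epsilon>. LBINT p:{p. \<forall>s\<in>S. \<epsilon> < \<bar>p - s\<bar>}. f p)"

definition radial :: "(real ^ 'n \<Rightarrow> real) \<Rightarrow> bool" where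
  "radial g \<longleftrightarrow> (\<forall>x y. norm x = norm y \<longrightarrow> g x = g y)"

definition half_dim :: "'n itself \<Rightarrow> nat" where
  "half_dim _ = nat \<lceil>real CARD('n) / 2\<rceil>"

definition admissible_profile :: "(real ^ 'n \<Rightarrow> real) \<Rightarrow> bool" where
  "admissible_profile g \<longleftrightarrow> (\<forall>x. 0 \<le> g x) \<and> integrable lborel g \<and> ess_bounded g"

text \<open>C is a constant that may play the role of C1(d, \<delta>) in the smallness condition.\<close>

definition smallness_constant :: "'n::finite itself \<Rightarrow> real \<Rightarrow> real \<Rightarrow> bool" where
  "smallness_constant T \<delta> C \<longleftrightarrow>
    (\<forall>(w :: real ^ 'n \<Rightarrow> real) g. integrable lborel w \<longrightarrow> admissible_profile g \<longrightarrow>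
       in_weighted_sobolev (3 / 2 + \<delta>) (half_dim T) g \<longrightarrow>
       (\<forall>z k hb. 0 \<le> Re z \<longrightarrow> 0 \<le> hb \<longrightarrow> hb \<le> 1 \<longrightarrow>
          cmod (Ltilde w g z k hb)
            \<le> C * L1_norm w * weighted_sobolev_norm (3 / 2 + \<delta>) (half_dim T) g))"

definition smallness_condition ::
  "real \<Rightarrow> real \<Rightarrow> (real ^ 'n \<Rightarrow> real) \<Rightarrow> (real ^ 'n \<Rightarrow> real) \<Rightarrow> bool" where
  "smallness_condition \<delta> C w g \<longleftrightarrow>
     integrable lborel w \<and> in_weighted_sobolev (3 / 2 + \<delta>) (half_dim TYPE('n)) g \<and>
     C * L1_norm w * weighted_sobolev_norm (3 / 2 + \<delta>) (half_dim TYPE('n)) g < 1"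

text \<open>Inequalities between complex numbers, here and below, are those of Complex\_Order: they
  include the assertion that both sides have the same imaginary part. Thus a bound such as
  fourier w k \<ge> 0 says that fourier w k is real and nonnegative.\<close>

definition repulsive_decreasing_condition ::
  "real \<Rightarrow> (real ^ 'n \<Rightarrow> real) \<Rightarrow> (real ^ 'n \<Rightarrow> real) \<Rightarrow> bool" where
  "repulsive_decreasing_condition \<delta> w g \<longleftrightarrow>
     integrable lborel w \<and> (\<forall>k. fourier w k \<ge> 0) \<and>
     in_weighted_sobolev (3 / 2 + \<delta>) (1 + half_dim TYPE('n)) g \<and> radial g \<and>
     (\<forall>k. k \<noteq> 0 \<longrightarrow>
        (\<forall>u>0. deriv (marginal g k) u < 0) \<and> (\<forall>u<0. deriv (marginal g k) u > 0))"

definition generalised_penrose_condition ::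
  "real \<Rightarrow> (real ^ 'n \<Rightarrow> real) \<Rightarrow> (real ^ 'n \<Rightarrow> real) \<Rightarrow> bool" where
  "generalised_penrose_condition \<delta> w g \<longleftrightarrow>
     integrable lborel w \<and> in_weighted_sobolev (3 / 2 + \<delta>) (1 + half_dim TYPE('n)) g \<and>
     (\<forall>\<tau> k. k \<noteq> 0 \<longrightarrow>
        (deriv (marginal g k) (\<tau> / norm k) = 0 \<longrightarrow>
           - fourier w k * complex_of_real
               (pv_integral {\<tau> / norm k} (\<lambda>p. deriv (marginal g k) p / (p - \<tau> / norm k))) > -1) \<and>
        (deriv (marginal g k) (\<tau> / norm k) = 0 \<longrightarrow>
           - fourier w 0 * complex_of_real
               (pv_integral {\<tau> / norm k} (\<lambda>p. deriv (marginal g k) p / (p - \<tau> / norm k))) > -1) \<and>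
        (\<forall>hb. 0 < hb \<longrightarrow> hb \<le> 1 \<longrightarrow>
           marginal g k (\<tau> / norm k + hb * norm k / 2) = marginal g k (\<tau> / norm k - hb * norm k / 2) \<longrightarrow>
           fourier w k * complex_of_real (1 / (hb * norm k) *
             pv_integral {\<tau> / norm k - hb * norm k / 2, \<tau> / norm k + hb * norm k / 2}
               (\<lambda>p. marginal g k p *
                  (1 / (p - \<tau> / norm k + hb * norm k / 2) - 1 / (p - \<tau> / norm k - hb * norm k / 2))))
             > -1))"

definition uniform_penrose :: "(real ^ 'n \<Rightarrow> real) \<Rightarrow> (real ^ 'n \<Rightarrow> real) \<Rightarrow> bool" where
  "uniform_penrose w g \<longleftrightarrow>
     (\<exists>c>0. \<forall>hb. 0 < hb \<longrightarrow> hb \<le> 1 \<longrightarrow>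
        Inf {cmod (1 + Ltilde w g z k hb) | z k. 0 \<le> Re z} \<ge> c)"

end

theory Submission
  imports Defs "HOL-Probability.Probability" "HOL-Complex_Analysis.Complex_Analysis"
begin

text \<open>Write \<open>e\<close> for the direction of \<open>k\<close>, \<open>r\<close> for the semiclassical parameter times \<open>|k|\<close>, and \<open>\<zeta>\<close> for
  the spectral parameter divided by \<open>|k|\<close>. The substitution \<open>s = t |k|\<close> turns \<open>Ltilde\<close> into the
  transform of \<open>w\<close> at \<open>k\<close> times \<open>D\<close>, where \<open>D\<close> is the integral of
  \<open>exp (- \<zeta> s) (2 / r) sin (r s / 2)\<close> times the transform of \<open>g\<close> at \<open>s e\<close> over \<open>s \<ge> 0\<close>, with \<open>s\<close> in
  place of the sine factor when \<open>r = 0\<close> (\<open>Ltilde_eq_ray_dispersion\<close>). Everything thus concerns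
  Laplace transforms of the restrictions of the transform of \<open>g\<close> to lines through the origin.

  These restrictions are controlled uniformly in the direction by a trace estimate: if
  \<open>(1 + |v|\<^sup>2)\<^sup>m\<close> with \<open>d \<le> 2 m\<close> weights the square of \<open>\<langle>\<nabla>\<rangle>\<^sup>\<sigma> g\<close>, then \<open>\<langle>s\<rangle>\<^sup>\<sigma>\<close> times the transform
  at \<open>s e\<close> is square integrable in \<open>s\<close>, because the reciprocal weight has bounded integrals over
  hyperplanes (\<open>fourier_line_L2_bound\<close>, \<open>weight_density_bound\<close>, \<open>L2_line_bound\<close>). For
  \<open>\<sigma> = 3 / 2 + \<delta>\<close>, the Cauchy--Schwarz inequality bounds the first moment of the transform on the
  line, with a power of \<open>s\<close> to spare (\<open>sobolev_line_bounds\<close>). As the sine factor is at most \<open>|s|\<close>,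
  this gives the constant of the smallness condition, and with it the first case by the triangle
  inequality.

  For the other two cases it suffices that \<open>1 + Ltilde\<close>, extended to all limits of its parameters,
  has no zero (\<open>uniform_penrose_of_pointwise\<close>). The direction ranges over a sphere, the transform of
  \<open>w\<close> vanishes at infinity, and so does \<open>D\<close> as \<open>\<zeta>\<close> grows; hence along a minimising sequence \<open>k\<close> and
  \<open>\<zeta>\<close> stay bounded, and the spare power of \<open>s\<close> makes \<open>D\<close> jointly continuous. The additional limit
  \<open>k = 0\<close>, where \<open>r = 0\<close> but the direction survives, explains the role of the transform of \<open>w\<close> at
  \<open>0\<close> in the Penrose condition.

  Zeros are excluded for each fixed \<open>e\<close> and \<open>r\<close>. Let \<open>w\<close> now stand for the value of its transform
  at \<open>k\<close>, which both conditions force to be real, unless \<open>g\<close> vanishes almost everywhere and \<open>D = 0\<close>.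
  The function \<open>w D\<close> of \<open>\<zeta>\<close> is holomorphic in the open right half plane, continuous up to the
  imaginary axis and vanishes at infinity; by the open mapping theorem its most negative real value
  is attained on the imaginary axis if that value is at most \<open>- 1\<close> (\<open>half_plane_avoids_slit\<close>). At a
  boundary point \<open>\<i> b\<close> the imaginary part of \<open>D\<close> is \<open>\<pi>\<close> times the symmetric difference quotient over
  length \<open>r\<close>, or the derivative if \<open>r = 0\<close>, of the marginal of \<open>g\<close> at \<open>b\<close> (\<open>slope_eq_Im_dispersion\<close>,
  \<open>marginal_eq_dens\<close>), and the real part is minus the principal value integral of that quotient
  against \<open>1 / (p - b)\<close> (\<open>pv_slope\<close>, \<open>pv_integral_dens_pair\<close>). So the generalised Penrose condition
  says precisely that real boundary values of \<open>w D\<close> exceed \<open>- 1\<close>. For a radial \<open>g\<close> with decreasing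
  marginals the quotient vanishes at \<open>b = 0\<close> only and has the sign of \<open>- p\<close>, which makes the real
  part nonnegative there.\<close>

section \<open>Square integrals of Fourier transforms along a line\<close>

lemma borel_measurable_cis [measurable]: "cis \<in> borel_measurable borel"
proof -
  have "(\<lambda>x. exp (\<i> * complex_of_real x)) \<in> borel_measurable borel" by measurable
  then show ?thesis by (simp add: cis_conv_exp[abs_def])
qed

text \<open>Up to scaling, this is the characteristic function of the standard normal distribution.\<close>

lemma gaussian_fourier:
  fixes t x :: real
  assumes t: "0 < t"
  shows "integrable lborel (\<lambda>s. complex_of_real (exp (- (t * s\<^sup>2) / 2)) * cis (- (s * x)))" (is ?I)
    and "(LBINT s. complex_of_real (exp (- (t * s\<^sup>2) / 2)) * cis (- (s * x)))
           = complex_of_real (2 * pi * normal_density 0 (sqrt t) x)" (is ?E)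
proof -
  have t': "sqrt t \<noteq> 0" "sqrt t > 0" using t by auto
  have int: "integrable lborel (\<lambda>u. complex_of_real (std_normal_density u))"
    using integrable_normal_density[of 1 0] by simp
  have "integrable lborel (\<lambda>s. complex_of_real (std_normal_density (0 + sqrt t * s)))"
    using lborel_integrable_real_affine[OF int t'(1), of 0] .
  then have "integrable lborel (\<lambda>s. complex_of_real (sqrt (2 * pi)) * complex_of_real (std_normal_density (0 + sqrt t * s)))"
    by (intro integrable_mult_right)
  also have "(\<lambda>s. complex_of_real (sqrt (2 * pi)) * complex_of_real (std_normal_density (0 + sqrt t * s)))
      = (\<lambda>s. complex_of_real (exp (- (t * s\<^sup>2) / 2)))"
    using t by (auto simp: std_normal_density_def power_mult_distrib fun_eq_iff)
  finally have g: "integrable lborel (\<lambda>s. complex_of_real (exp (- (t * s\<^sup>2) / 2)))" .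
  show ?I
    by (rule Bochner_Integration.integrable_bound[OF g]) (auto simp: norm_mult)
  define y where "y = - (x / sqrt t)"
  have "complex_of_real (exp (- (y\<^sup>2) / 2)) = char std_normal_distribution y"
    by (simp add: char_std_normal_distribution)
  also have "\<dots> = (LBINT u. std_normal_density u *\<^sub>R iexp (y * u))"
    unfolding char_def by (subst integral_density) (auto simp: normal_density_nonneg)
  also have "\<dots> = \<bar>sqrt t\<bar> *\<^sub>R (LBINT s. std_normal_density (0 + sqrt t * s) *\<^sub>R iexp (y * (0 + sqrt t * s)))"
    by (rule lborel_integral_real_affine[OF t'(1)])
  also have "(LBINT s. std_normal_density (0 + sqrt t * s) *\<^sub>R iexp (y * (0 + sqrt t * s))) = 
     (LBINT s. complex_of_real (1 / sqrt (2 * pi)) * (complex_of_real (exp (- (t * s\<^sup>2) / 2)) * cis (- (s * x))))"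
  proof (rule Bochner_Integration.integral_cong[OF refl])
    fix s :: real
    have "y * (sqrt t * s) = - (s * x)" using t by (simp add: y_def)
    then have "iexp (y * (0 + sqrt t * s)) = cis (- (s * x))"
      by (simp add: cis_conv_exp)
    then show "std_normal_density (0 + sqrt t * s) *\<^sub>R iexp (y * (0 + sqrt t * s))
      = complex_of_real (1 / sqrt (2 * pi)) * (complex_of_real (exp (- (t * s\<^sup>2) / 2)) * cis (- (s * x)))"
      using t by (simp add: std_normal_density_def power_mult_distrib scaleR_conv_of_real)
  qed
  also have "\<dots> = complex_of_real (1 / sqrt (2 * pi)) * (LBINT s. complex_of_real (exp (- (t * s\<^sup>2) / 2)) * cis (- (s * x)))"
    by (rule integral_mult_right_zero)
  finally have eq: "complex_of_real (exp (- (y\<^sup>2) / 2)) = complex_of_real (sqrt t / sqrt (2 * pi)) * 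
     (LBINT s. complex_of_real (exp (- (t * s\<^sup>2) / 2)) * cis (- (s * x)))"
    using t by (simp add: scaleR_conv_of_real)
  have "2 * pi * normal_density 0 (sqrt t) x = sqrt (2 * pi) / sqrt t * exp (- (y\<^sup>2) / 2)"
    using t by (simp add: normal_density_def y_def power_divide real_sqrt_mult field_simps)
  then have "complex_of_real (2 * pi * normal_density 0 (sqrt t) x)
     = complex_of_real (sqrt (2 * pi) / sqrt t) * complex_of_real (exp (- (y\<^sup>2) / 2))"
    by (metis of_real_mult)
  then show ?E unfolding eq using t' by simp
qed

lemma
  fixes f :: "'a \<Rightarrow> complex" and g :: "'b \<Rightarrow> complex"
  assumes M: "sigma_finite_measure M" "sigma_finite_measure N" 
    and f: "integrable M f" and g: "integrable N g"
  shows integrable_pair_mult: "integrable (M \<Otimes>\<^sub>M N) (\<lambda>(x, y). f x * g y)"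
    and integral_pair_mult: "integral\<^sup>L (M \<Otimes>\<^sub>M N) (\<lambda>(x, y). f x * g y) = (LINT x|M. f x) * (LINT y|N. g y)"
proof -
  interpret M: sigma_finite_measure M by fact
  interpret N: sigma_finite_measure N by fact
  interpret P: pair_sigma_finite M N ..
  have [measurable]: "f \<in> borel_measurable M" "g \<in> borel_measurable N" using f g by auto
  show *: "integrable (M \<Otimes>\<^sub>M N) (\<lambda>(x, y). f x * g y)"
  proof (rule P.Fubini_integrable)
    show "integrable M (\<lambda>x. LINT y|N. norm (case (x, y) of (x, y) \<Rightarrow> f x * g y))"
      using f by (simp add: norm_mult)
  qed (use g in auto)
  show "integral\<^sup>L (M \<Otimes>\<^sub>M N) (\<lambda>(x, y). f x * g y) = (LINT x|M. f x) * (LINT y|N. g y)"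
    using P.integral_fst'[OF *] by simp
qed

lemma nn_integral_gaussian:
  assumes "0 < t"
  shows "(\<integral>\<^sup>+ u. ennreal (2 * pi * normal_density 0 (sqrt t) (x - u)) \<partial>lborel) = ennreal (2 * pi)"
proof -
  have "(\<integral>\<^sup>+ u. ennreal (2 * pi * normal_density 0 (sqrt t) (x - u)) \<partial>lborel)
     = (\<integral>\<^sup>+ u. ennreal (2 * pi) * ennreal (normal_density x (sqrt t) u) \<partial>lborel)"
  proof (rule nn_integral_cong)
    fix u :: real
    have "normal_density 0 (sqrt t) (x - u) = normal_density x (sqrt t) u"
      by (simp add: normal_density_def power2_commute)
    then show "ennreal (2 * pi * normal_density 0 (sqrt t) (x - u)) = ennreal (2 * pi) * ennreal (normal_density x (sqrt t) u)"
      by (subst ennreal_mult[symmetric]) auto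
  qed
  also have "\<dots> = ennreal (2 * pi) * (\<integral>\<^sup>+ u. ennreal (normal_density x (sqrt t) u) \<partial>lborel)"
    by (rule nn_integral_cmult) simp
  also have "(\<integral>\<^sup>+ u. ennreal (normal_density x (sqrt t) u) \<partial>lborel) = ennreal 1"
    using assms by (subst nn_integral_eq_integral)
      (auto simp: integrable_normal_density normal_density_nonneg integral_normal_density)
  finally show ?thesis by simp
qed

text \<open>A Plancherel estimate which needs only that the image of the measure \<open>(1 / a) M\<close> under \<open>X\<close> has a
  density bounded by \<open>C\<close>. A factor \<open>exp (- t s\<^sup>2 / 2)\<close> makes Fubini's theorem applicable to the integral
  over \<open>s\<close>, which becomes the double integral of \<open>K (X v - X w)\<close> against \<open>f v\<close> and the conjugate of \<open>f w\<close>,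
  where \<open>K / (2 \<pi>)\<close> is the normal density of variance \<open>t\<close>. Schur's test with weight \<open>a\<close> bounds it uniformly
  in \<open>t\<close>, and Fatou's lemma removes the factor as \<open>t\<close> tends to 0.\<close>

lemma fourier_line_L2_bound:
  fixes f :: "'a \<Rightarrow> complex" and X a :: "'a \<Rightarrow> real" and C :: ennreal
  assumes M: "sigma_finite_measure M"
    and [measurable]: "X \<in> borel_measurable M" "a \<in> borel_measurable M"
    and f: "integrable M f"
    and a: "\<And>v. v \<in> space M \<Longrightarrow> 0 < a v"
    and dens: "\<And>\<phi> :: real \<Rightarrow> ennreal. \<phi> \<in> borel_measurable borel \<Longrightarrow>
        (\<integral>\<^sup>+ v. \<phi> (X v) * ennreal (1 / a v) \<partial>M) \<le> C * (\<integral>\<^sup>+ u. \<phi> u \<partial>lborel)"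
  shows "(\<integral>\<^sup>+ s. ennreal ((cmod (LINT v|M. cis (- (s * X v)) * f v))\<^sup>2) \<partial>lborel)
     \<le> ennreal (2 * pi) * C * (\<integral>\<^sup>+ v. ennreal (a v * (cmod (f v))\<^sup>2) \<partial>M)"
proof -
  interpret M: sigma_finite_measure M by fact
  interpret MM: pair_sigma_finite M M ..
  interpret MMM: sigma_finite_measure "M \<Otimes>\<^sub>M M" 
    by (rule MM.sigma_finite_measure_axioms)
  interpret P: pair_sigma_finite lborel "M \<Otimes>\<^sub>M M" ..
  have [measurable]: "f \<in> borel_measurable M" using f by auto
  define F where "F s = (LINT v|M. cis (- (s * X v)) * f v)" for s
  define I where "I = (\<integral>\<^sup>+ v. ennreal (a v * (cmod (f v))\<^sup>2) \<partial>M)"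
  have [measurable]: "F \<in> borel_measurable borel"
    unfolding F_def cis_conv_exp by measurable
  have regularised: "(\<integral>\<^sup>+ s. ennreal (exp (- (t * s\<^sup>2) / 2) * (cmod (F s))\<^sup>2) \<partial>lborel) \<le> ennreal (2 * pi) * C * I"
    if t: "t > 0" for t
  proof -
    define K where "K x = 2 * pi * normal_density 0 (sqrt t) x" for x
    have K0: "K x \<ge> 0" for x by (simp add: K_def)
    have [measurable]: "K \<in> borel_measurable borel" by (simp add: K_def[abs_def])
    have Kneg: "K (x - y) = K (y - x)" for x y by (simp add: K_def normal_density_def power2_commute)
    define ff where "ff = (\<lambda>(v, w). f v * cnj (f w))"
    have ffint: "integrable (M \<Otimes>\<^sub>M M) ff"
      unfolding ff_def using integrable_pair_mult[OF M M f, of "\<lambda>w. cnj (f w)"] f by simp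
    define D where "D = (\<lambda>(v, w). X v - X w)"
    have [measurable]: "D \<in> borel_measurable (M \<Otimes>\<^sub>M M)" unfolding D_def by measurable
    have [measurable]: "ff \<in> borel_measurable (M \<Otimes>\<^sub>M M)" using ffint by auto
    define q where "q s p = complex_of_real (exp (- (t * s\<^sup>2) / 2)) * cis (- (s * D p)) * ff p" for s p
    have qm: "(\<lambda>(s, p). q s p) \<in> borel_measurable (lborel \<Otimes>\<^sub>M (M \<Otimes>\<^sub>M M))"
      unfolding q_def cis_conv_exp by measurable
    have gint: "integrable lborel (\<lambda>s. exp (- (t * s\<^sup>2) / 2))"
      using gaussian_fourier(1)[OF t, of 0, THEN integrable_norm] by (simp add: norm_mult)
    have qint: "integrable (lborel \<Otimes>\<^sub>M (M \<Otimes>\<^sub>M M)) (\<lambda>(s, p). q s p)"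
    proof (rule Bochner_Integration.integrable_bound)
      have "integrable lborel (\<lambda>s. complex_of_real (exp (- (t * s\<^sup>2) / 2)))"
        using gint by simp
      then show "integrable (lborel \<Otimes>\<^sub>M (M \<Otimes>\<^sub>M M)) (\<lambda>(s, p). complex_of_real (exp (- (t * s\<^sup>2) / 2)) * ff p)"
        by (rule integrable_pair_mult[OF sigma_finite_lborel MM.sigma_finite_measure_axioms _ ffint])
    qed (use qm in \<open>auto simp: q_def norm_mult\<close>)
    have inner: "(LINT p|(M \<Otimes>\<^sub>M M). q s p) = complex_of_real (exp (- (t * s\<^sup>2) / 2) * (cmod (F s))\<^sup>2)" for s
    proof -
      define h where "h v = cis (- (s * X v)) * f v" for v
      have [measurable]: "h \<in> borel_measurable M" unfolding h_def by measurable
      have hint: "integrable M h"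
        by (rule Bochner_Integration.integrable_bound[OF f]) (auto simp: h_def norm_mult)
      have "(LINT p|(M \<Otimes>\<^sub>M M). q s p) = (LINT p|(M \<Otimes>\<^sub>M M). complex_of_real (exp (- (t * s\<^sup>2) / 2)) * (case p of (v, w) \<Rightarrow> h v * cnj (h w)))"
      proof (rule Bochner_Integration.integral_cong[OF refl])
        fix p :: "'a \<times> 'a"
        have "cis (- (s * (x - y))) = cis (- (s * x)) * cis (s * y)" for x y
          by (simp add: cis_mult algebra_simps)
        then show "q s p = complex_of_real (exp (- (t * s\<^sup>2) / 2)) * (case p of (v, w) \<Rightarrow> h v * cnj (h w))"
          by (simp add: q_def h_def ff_def D_def cis_cnj mult_ac split: prod.split)
      qed
      also have "\<dots> = complex_of_real (exp (- (t * s\<^sup>2) / 2)) * ((LINT v|M. h v) * (LINT w|M. cnj (h w)))"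
        using integral_pair_mult[OF M M hint, of "\<lambda>w. cnj (h w)"] hint by simp
      also have "(LINT w|M. cnj (h w)) = cnj (LINT w|M. h w)" by (rule Bochner_Integration.integral_cnj)
      also have "(LINT v|M. h v) = F s" by (simp add: F_def h_def)
      finally show ?thesis by (simp add: complex_norm_square[of "F s", symmetric] mult.assoc del: of_real_power)
    qed
    have outer: "(LINT s|lborel. q s p) = complex_of_real (K (D p)) * ff p" for p
      unfolding q_def K_def using gaussian_fourier(2)[OF t, of "D p"] by simp
    have Jint: "integrable lborel (\<lambda>s. exp (- (t * s\<^sup>2) / 2) * (cmod (F s))\<^sup>2)"
    proof -
      have "integrable lborel (\<lambda>s. LINT p|(M \<Otimes>\<^sub>M M). q s p)"
        using P.integrable_fst'[OF qint] by simp
      then show ?thesis unfolding inner using complex_of_real_integrable_eq by blast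
    qed
    have Eint: "integrable (M \<Otimes>\<^sub>M M) (\<lambda>p. complex_of_real (K (D p)) * ff p)"
      using P.integrable_snd[OF qint] by (simp add: outer)
    have "complex_of_real (LINT s|lborel. exp (- (t * s\<^sup>2) / 2) * (cmod (F s))\<^sup>2) = (LINT s|lborel. LINT p|(M \<Otimes>\<^sub>M M). q s p)"
      unfolding inner by (rule integral_complex_of_real[symmetric])
    also have "\<dots> = (LINT p|(M \<Otimes>\<^sub>M M). LINT s|lborel. q s p)"
      by (rule P.Fubini_integral[OF qint, symmetric])
    also have "\<dots> = (LINT p|(M \<Otimes>\<^sub>M M). complex_of_real (K (D p)) * ff p)" by (simp add: outer)
    finally have eq: "complex_of_real (LINT s|lborel. exp (- (t * s\<^sup>2) / 2) * (cmod (F s))\<^sup>2) 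
        = (LINT p|(M \<Otimes>\<^sub>M M). complex_of_real (K (D p)) * ff p)" .
    have "(LINT s|lborel. exp (- (t * s\<^sup>2) / 2) * (cmod (F s))\<^sup>2) \<le> cmod (LINT p|(M \<Otimes>\<^sub>M M). complex_of_real (K (D p)) * ff p)"
      unfolding eq[symmetric] by simp
    also have "\<dots> \<le> (LINT p|(M \<Otimes>\<^sub>M M). cmod (complex_of_real (K (D p)) * ff p))" by (rule integral_norm_bound)
    finally have le: "(LINT s|lborel. exp (- (t * s\<^sup>2) / 2) * (cmod (F s))\<^sup>2) \<le> (LINT p|(M \<Otimes>\<^sub>M M). cmod (complex_of_real (K (D p)) * ff p))" .
    define h1 where "h1 v w = ennreal (K (X v - X w) / 2 * ((a v * (cmod (f v))\<^sup>2) / a w))" for v w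
    have h1m [measurable]: "(\<lambda>(v, w). h1 v w) \<in> borel_measurable (M \<Otimes>\<^sub>M M)" unfolding h1_def by measurable
    \<comment> \<open>Schur's test: the two halves of the arithmetic--geometric mean inequality have equal integrals, and
      the integral over the second variable is the bound \<open>dens\<close> applied to a Gaussian.\<close>
    have h1_inner: "(\<integral>\<^sup>+ w. h1 v w \<partial>M) \<le> ennreal pi * C * ennreal (a v * (cmod (f v))\<^sup>2)" if v: "v \<in> space M" for v
    proof -
      have "(\<integral>\<^sup>+ w. h1 v w \<partial>M) = (\<integral>\<^sup>+ w. ennreal (a v * (cmod (f v))\<^sup>2) * (ennreal (K (X v - X w) / 2) * ennreal (1 / a w)) \<partial>M)"
        unfolding h1_def using a v K0
        by (intro nn_integral_cong) (auto simp: ennreal_mult'[symmetric] less_imp_le mult_ac)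
      also have "\<dots> = ennreal (a v * (cmod (f v))\<^sup>2) * (\<integral>\<^sup>+ w. ennreal (K (X v - X w) / 2) * ennreal (1 / a w) \<partial>M)"
        by (rule nn_integral_cmult) measurable
      also have "\<dots> \<le> ennreal (a v * (cmod (f v))\<^sup>2) * (C * (\<integral>\<^sup>+ u. ennreal (K (X v - u) / 2) \<partial>lborel))"
        by (intro mult_left_mono dens[of "\<lambda>u. ennreal (K (X v - u) / 2)"]) auto
      also have "(\<integral>\<^sup>+ u. ennreal (K (X v - u) / 2) \<partial>lborel) = (\<integral>\<^sup>+ u. ennreal (1 / 2) * ennreal (K (X v - u)) \<partial>lborel)"
        using K0 by (intro nn_integral_cong) (subst ennreal_mult[symmetric], auto)
      also have "\<dots> = ennreal (1 / 2) * ennreal (2 * pi)"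
        unfolding K_def using nn_integral_gaussian[OF t, of "X v"] by (subst nn_integral_cmult) simp_all
      also have "\<dots> = ennreal pi" by (subst ennreal_mult[symmetric]) auto
      finally show ?thesis by (simp add: mult_ac)
    qed
    have h1_total: "(\<integral>\<^sup>+ v. \<integral>\<^sup>+ w. h1 v w \<partial>M \<partial>M) \<le> ennreal pi * C * I"
    proof -
      have "(\<integral>\<^sup>+ v. \<integral>\<^sup>+ w. h1 v w \<partial>M \<partial>M) \<le> (\<integral>\<^sup>+ v. ennreal pi * C * ennreal (a v * (cmod (f v))\<^sup>2) \<partial>M)"
        by (intro nn_integral_mono h1_inner)
      also have "\<dots> = ennreal pi * C * I" unfolding I_def by (rule nn_integral_cmult) measurable
      finally show ?thesis .
    qed
    have amgm: "ennreal (cmod (complex_of_real (K (D p)) * ff p)) \<le> (case p of (v, w) \<Rightarrow> h1 v w + h1 w v)"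
      if "p \<in> space (M \<Otimes>\<^sub>M M)" for p
    proof -
      obtain v w where p: "p = (v, w)" by (cases p)
      with that have vw: "v \<in> space M" "w \<in> space M" by (auto simp: space_pair_measure)
      note av = a[OF vw(1)] and aw = a[OF vw(2)]
      define x where "x = sqrt (a v / a w) * cmod (f v)"
      define y where "y = sqrt (a w / a v) * cmod (f w)"
      have xy: "x * y = cmod (f v) * cmod (f w)"
        using av aw by (simp add: x_def y_def real_sqrt_divide)
      have "cmod (complex_of_real (K (D p)) * ff p) = K (X v - X w) * (x * y)"
        by (simp add: p D_def ff_def norm_mult K0 xy)
      also have "\<dots> \<le> K (X v - X w) * ((x\<^sup>2 + y\<^sup>2) / 2)"
        using sum_squares_bound[of x y] by (intro mult_left_mono K0) simp
      also have "\<dots> = K (X v - X w) / 2 * ((a v * (cmod (f v))\<^sup>2) / a w) + K (X w - X v) / 2 * ((a w * (cmod (f w))\<^sup>2) / a v)"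
        using av aw by (simp add: x_def y_def power_mult_distrib Kneg[of "X w"] algebra_simps)
      finally have "ennreal (cmod (complex_of_real (K (D p)) * ff p)) \<le> ennreal \<dots>" by (rule ennreal_leI)
      also have "\<dots> = h1 v w + h1 w v"
        unfolding h1_def using av aw K0 by (simp flip: ennreal_plus)
      finally show ?thesis by (simp add: p)
    qed
    have "(\<integral>\<^sup>+ s. ennreal (exp (- (t * s\<^sup>2) / 2) * (cmod (F s))\<^sup>2) \<partial>lborel) = ennreal (LINT s|lborel. exp (- (t * s\<^sup>2) / 2) * (cmod (F s))\<^sup>2)"
      by (rule nn_integral_eq_integral[OF Jint]) simp
    also have "\<dots> \<le> ennreal (LINT p|(M \<Otimes>\<^sub>M M). cmod (complex_of_real (K (D p)) * ff p))"
      using le by (rule ennreal_leI)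
    also have "\<dots> = (\<integral>\<^sup>+ p. ennreal (cmod (complex_of_real (K (D p)) * ff p)) \<partial>(M \<Otimes>\<^sub>M M))"
      using Eint by (intro nn_integral_eq_integral[symmetric]) auto
    also have "\<dots> \<le> (\<integral>\<^sup>+ p. (case p of (v, w) \<Rightarrow> h1 v w + h1 w v) \<partial>(M \<Otimes>\<^sub>M M))"
      by (intro nn_integral_mono amgm)
    also have "\<dots> = (\<integral>\<^sup>+ v. \<integral>\<^sup>+ w. h1 v w + h1 w v \<partial>M \<partial>M)"
      by (subst M.nn_integral_fst[symmetric]) (auto intro!: nn_integral_cong)
    also have "\<dots> = (\<integral>\<^sup>+ v. \<integral>\<^sup>+ w. h1 v w \<partial>M \<partial>M) + (\<integral>\<^sup>+ v. \<integral>\<^sup>+ w. h1 w v \<partial>M \<partial>M)"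
    proof -
      have "(\<integral>\<^sup>+ w. h1 v w + h1 w v \<partial>M) = (\<integral>\<^sup>+ w. h1 v w \<partial>M) + (\<integral>\<^sup>+ w. h1 w v \<partial>M)" if "v \<in> space M" for v
        using that by (intro nn_integral_add) measurable
      then have "(\<integral>\<^sup>+ v. \<integral>\<^sup>+ w. h1 v w + h1 w v \<partial>M \<partial>M) = (\<integral>\<^sup>+ v. (\<integral>\<^sup>+ w. h1 v w \<partial>M) + (\<integral>\<^sup>+ w. h1 w v \<partial>M) \<partial>M)"
        by (rule nn_integral_cong)
      also have "\<dots> = (\<integral>\<^sup>+ v. \<integral>\<^sup>+ w. h1 v w \<partial>M \<partial>M) + (\<integral>\<^sup>+ v. \<integral>\<^sup>+ w. h1 w v \<partial>M \<partial>M)"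
        by (rule nn_integral_add) measurable
      finally show ?thesis .
    qed
    also have "(\<integral>\<^sup>+ v. \<integral>\<^sup>+ w. h1 w v \<partial>M \<partial>M) = (\<integral>\<^sup>+ w. \<integral>\<^sup>+ v. h1 w v \<partial>M \<partial>M)"
      by (rule MM.Fubini') measurable
    also have "(\<integral>\<^sup>+ v. \<integral>\<^sup>+ w. h1 v w \<partial>M \<partial>M) + (\<integral>\<^sup>+ v. \<integral>\<^sup>+ w. h1 v w \<partial>M \<partial>M) \<le> ennreal pi * C * I + ennreal pi * C * I"
      by (intro add_mono h1_total)
    also have "\<dots> = (ennreal pi + ennreal pi) * (C * I)" by (simp add: distrib_right mult.assoc)
    also have "ennreal pi + ennreal pi = ennreal (2 * pi)" by (subst ennreal_plus[symmetric]) auto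
    also have "ennreal (2 * pi) * (C * I) = ennreal (2 * pi) * C * I" by (simp add: mult.assoc)
    finally show ?thesis .
  qed
  have "(\<integral>\<^sup>+ s. ennreal ((cmod (F s))\<^sup>2) \<partial>lborel) 
     = (\<integral>\<^sup>+ s. liminf (\<lambda>n. ennreal (exp (- (1 / real (Suc n) * s\<^sup>2) / 2) * (cmod (F s))\<^sup>2)) \<partial>lborel)"
  proof (rule nn_integral_cong)
    fix s :: real
    have "(\<lambda>n. exp (- (1 / real (Suc n) * s\<^sup>2) / 2) * (cmod (F s))\<^sup>2) \<longlonglongrightarrow> exp (- (0 * s\<^sup>2) / 2) * (cmod (F s))\<^sup>2"
      using LIMSEQ_inverse_real_of_nat by (intro tendsto_intros) (auto simp: inverse_eq_divide)
    then have "(\<lambda>n. ennreal (exp (- (1 / real (Suc n) * s\<^sup>2) / 2) * (cmod (F s))\<^sup>2)) \<longlonglongrightarrow> ennreal ((cmod (F s))\<^sup>2)"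
      by (intro tendsto_ennrealI) simp
    then show "ennreal ((cmod (F s))\<^sup>2) = liminf (\<lambda>n. ennreal (exp (- (1 / real (Suc n) * s\<^sup>2) / 2) * (cmod (F s))\<^sup>2))"
      by (intro lim_imp_Liminf[symmetric]) auto
  qed
  also have "\<dots> \<le> liminf (\<lambda>n. \<integral>\<^sup>+ s. ennreal (exp (- (1 / real (Suc n) * s\<^sup>2) / 2) * (cmod (F s))\<^sup>2) \<partial>lborel)"
    by (rule nn_integral_liminf) measurable
  also have "\<dots> \<le> liminf (\<lambda>n. ennreal (2 * pi) * C * I)"
    by (intro Liminf_mono always_eventually allI regularised) simp
  also have "\<dots> = ennreal (2 * pi) * C * I" by (simp add: Liminf_const)
  finally show ?thesis unfolding F_def I_def .
qed

section \<open>Rotation invariance and disintegration of Lebesgue measure\<close>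

lemma nn_integral_lborel_shift:
  fixes f :: "'a :: euclidean_space \<Rightarrow> ennreal"
  assumes [measurable]: "f \<in> borel_measurable borel"
  shows "(\<integral>\<^sup>+ x. f (c + x) \<partial>lborel) = (\<integral>\<^sup>+ x. f x \<partial>lborel)"
proof -
  have "(\<integral>\<^sup>+ x. f x \<partial>lborel) = (\<integral>\<^sup>+ x. f x \<partial>distr lborel borel ((+) c))"
    by (simp add: lborel_distr_plus)
  also have "\<dots> = (\<integral>\<^sup>+ x. f (c + x) \<partial>lborel)"
    by (rule nn_integral_distr) auto
  finally show ?thesis ..
qed

text \<open>Translation invariance determines Lebesgue measure up to a factor, and the factor is 1 because \<open>T\<close>
  preserves the unit ball. In integrals: with \<open>b\<close> the indicator of the unit ball, the double integral of
  \<open>f x * b (T y - x)\<close> factorises after a translation of \<open>y\<close>, as well as after translations of \<open>x\<close> and then \<open>y\<close>.\<close>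

lemma distr_lborel_orthogonal_transformation:
  fixes T :: "'a :: euclidean_space \<Rightarrow> 'a"
  assumes T: "orthogonal_transformation T"
  shows "distr lborel borel T = lborel"
proof (rule measure_eqI)
  have lin: "linear T" using T by (rule orthogonal_transformation_linear)
  have [measurable]: "T \<in> borel_measurable borel"
    using linear_continuous_on[of T UNIV] lin
    by (auto simp: linear_linear intro!: borel_measurable_continuous_onI)
  fix A assume "A \<in> sets (distr lborel borel T)"
  then have [measurable]: "A \<in> sets borel" by simp
  define b :: "'a \<Rightarrow> ennreal" where "b = indicator (ball 0 1)"
  define f :: "'a \<Rightarrow> ennreal" where "f = indicator A"
  have [measurable]: "b \<in> borel_measurable borel" "f \<in> borel_measurable borel"
    unfolding b_def f_def by (auto intro!: borel_measurable_indicator)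
  have b_neg: "b (- x) = b x" for x by (auto simp: b_def indicator_def)
  have b_T: "b (T x) = b x" for x
    using orthogonal_transformation_norm[OF T, of x] by (auto simp: b_def indicator_def)
  have "surj T" using T by (rule orthogonal_transformation_surj)
  then have preimage: "\<exists>z. x = T z" for x by (rule surjD)
  define m where "m = (\<integral>\<^sup>+ x. b x \<partial>lborel)"
  have "m = emeasure lborel (ball (0 :: 'a) 1)" by (simp add: m_def b_def)
  moreover have "emeasure lborel (ball (0 :: 'a) 1) \<noteq> 0"
    using content_ball_pos[of 1 "0 :: 'a"] by (auto simp: measure_def)
  ultimately have m: "m \<noteq> 0" "m \<noteq> top"
    using emeasure_lborel_ball_finite[of "0 :: 'a" 1] by (simp_all add: less_top)
  have "(\<integral>\<^sup>+ x. f x \<partial>lborel) * m = (\<integral>\<^sup>+ x. f x * m \<partial>lborel)"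
    by (simp add: nn_integral_multc)
  also have "\<dots> = (\<integral>\<^sup>+ x. \<integral>\<^sup>+ y. f x * b (T y - x) \<partial>lborel \<partial>lborel)"
  proof (rule nn_integral_cong)
    fix x :: 'a
    obtain z where x: "x = T z" using preimage by blast
    have "(\<integral>\<^sup>+ y. f x * b (T y - x) \<partial>lborel) = f x * (\<integral>\<^sup>+ y. b (T y - x) \<partial>lborel)"
      by (rule nn_integral_cmult) measurable
    also have "(\<integral>\<^sup>+ y. b (T y - x) \<partial>lborel) = (\<integral>\<^sup>+ y. b (- z + y) \<partial>lborel)"
      unfolding x by (simp add: linear_diff[OF lin, symmetric] b_T)
    also have "\<dots> = m" unfolding m_def by (rule nn_integral_lborel_shift) simp
    finally show "f x * m = (\<integral>\<^sup>+ y. f x * b (T y - x) \<partial>lborel)" ..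
  qed
  also have "\<dots> = (\<integral>\<^sup>+ y. \<integral>\<^sup>+ x. f x * b (T y - x) \<partial>lborel \<partial>lborel)"
    by (rule lborel_pair.Fubini') measurable
  also have "\<dots> = (\<integral>\<^sup>+ y. \<integral>\<^sup>+ x. f (T y + x) * b x \<partial>lborel \<partial>lborel)"
  proof (rule nn_integral_cong)
    fix y :: 'a
    show "(\<integral>\<^sup>+ x. f x * b (T y - x) \<partial>lborel) = (\<integral>\<^sup>+ x. f (T y + x) * b x \<partial>lborel)"
      using nn_integral_lborel_shift[of "\<lambda>x. f x * b (T y - x)" "T y"] by (simp add: b_neg)
  qed
  also have "\<dots> = (\<integral>\<^sup>+ x. \<integral>\<^sup>+ y. f (T y + x) * b x \<partial>lborel \<partial>lborel)"
    by (rule lborel_pair.Fubini') measurable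
  also have "\<dots> = (\<integral>\<^sup>+ x. (\<integral>\<^sup>+ y. f (T y) \<partial>lborel) * b x \<partial>lborel)"
  proof (rule nn_integral_cong)
    fix x :: 'a
    obtain z where x: "x = T z" using preimage by blast
    have "(\<integral>\<^sup>+ y. f (T y + x) * b x \<partial>lborel) = (\<integral>\<^sup>+ y. f (T y + x) \<partial>lborel) * b x"
      by (rule nn_integral_multc) measurable
    also have "(\<integral>\<^sup>+ y. f (T y + x) \<partial>lborel) = (\<integral>\<^sup>+ y. f (T (z + y)) \<partial>lborel)"
      unfolding x by (simp add: linear_add[OF lin] add.commute)
    also have "\<dots> = (\<integral>\<^sup>+ y. f (T y) \<partial>lborel)"
      by (rule nn_integral_lborel_shift[of "\<lambda>y. f (T y)"]) measurable
    finally show "(\<integral>\<^sup>+ y. f (T y + x) * b x \<partial>lborel) = (\<integral>\<^sup>+ y. f (T y) \<partial>lborel) * b x" .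
  qed
  also have "\<dots> = (\<integral>\<^sup>+ y. f (T y) \<partial>lborel) * m"
    unfolding m_def by (rule nn_integral_cmult) measurable
  finally have "(\<integral>\<^sup>+ x. f x \<partial>lborel) * m / m = (\<integral>\<^sup>+ y. f (T y) \<partial>lborel) * m / m"
    by (rule arg_cong)
  then have "(\<integral>\<^sup>+ x. f x \<partial>lborel) = (\<integral>\<^sup>+ y. f (T y) \<partial>lborel)"
    unfolding mult_divide_eq_ennreal[OF m] .
  moreover have "(\<integral>\<^sup>+ y. f (T y) \<partial>lborel) = (\<integral>\<^sup>+ y. f y \<partial>distr lborel borel T)"
    by (rule nn_integral_distr[symmetric]) auto
  ultimately show "emeasure (distr lborel borel T) A = emeasure lborel A"
    by (simp add: f_def)
qed simp

text \<open>This carries the coordinates of Lebesgue measure from the standard basis to another basis.\<close>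

lemma distr_PiM_reindex_bij:
  assumes M: "sigma_finite_measure M" and I: "finite I" and \<beta>: "bij_betw \<beta> I J"
  shows "distr (\<Pi>\<^sub>M i\<in>I. M) (\<Pi>\<^sub>M j\<in>J. M) (\<lambda>f. \<lambda>j\<in>J. f (inv_into I \<beta> j)) = (\<Pi>\<^sub>M j\<in>J. M)"
proof -
  interpret product_sigma_finite "\<lambda>_. M" using M by (simp add: product_sigma_finite_def)
  have J: "finite J" using bij_betw_finite[OF \<beta>] I by simp
  have inv: "inv_into I \<beta> j \<in> I" if "j \<in> J" for j
    using that bij_betw_inv_into[OF \<beta>] by (auto dest: bij_betwE)
  have [measurable]: "(\<lambda>f. \<lambda>j\<in>J. f (inv_into I \<beta> j)) \<in> measurable (\<Pi>\<^sub>M i\<in>I. M) (\<Pi>\<^sub>M j\<in>J. M)"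
    using inv by (intro measurable_restrict) simp
  show ?thesis
  proof (rule PiM_eqI[OF J])
    fix A assume A: "\<And>j. j \<in> J \<Longrightarrow> A j \<in> sets M"
    have "(\<lambda>f. \<lambda>j\<in>J. f (inv_into I \<beta> j)) -` (Pi\<^sub>E J A) \<inter> space (\<Pi>\<^sub>M i\<in>I. M) = Pi\<^sub>E I (\<lambda>i. A (\<beta> i))"
    proof (intro set_eqI iffI)
      fix f assume f: "f \<in> (\<lambda>f. \<lambda>j\<in>J. f (inv_into I \<beta> j)) -` (Pi\<^sub>E J A) \<inter> space (\<Pi>\<^sub>M i\<in>I. M)"
      show "f \<in> Pi\<^sub>E I (\<lambda>i. A (\<beta> i))"
      proof (rule PiE_I)
        fix i assume i: "i \<in> I"
        then have "\<beta> i \<in> J" "inv_into I \<beta> (\<beta> i) = i" using \<beta> by (auto simp: bij_betw_def)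
        moreover have "(\<lambda>j\<in>J. f (inv_into I \<beta> j)) (\<beta> i) \<in> A (\<beta> i)"
          using f \<open>\<beta> i \<in> J\<close> by (intro PiE_mem[of _ J A]) auto
        ultimately show "f i \<in> A (\<beta> i)" by simp
      qed (use f in \<open>auto simp: space_PiM PiE_def extensional_def\<close>)
    next
      fix f assume f: "f \<in> Pi\<^sub>E I (\<lambda>i. A (\<beta> i))"
      have "f (inv_into I \<beta> j) \<in> A j" if "j \<in> J" for j
        using PiE_mem[OF f inv[OF that]] bij_betw_inv_into_right[OF \<beta> that] by simp
      moreover have "f i \<in> space M" if "i \<in> I" for i
        using PiE_mem[OF f that] sets.sets_into_space[OF A[of "\<beta> i"]] that \<beta> by (auto simp: bij_betw_def)
      ultimately show "f \<in> (\<lambda>f. \<lambda>j\<in>J. f (inv_into I \<beta> j)) -` (Pi\<^sub>E J A) \<inter> space (\<Pi>\<^sub>M i\<in>I. M)"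
        using f by (auto simp: space_PiM PiE_def)
    qed
    moreover have "emeasure (\<Pi>\<^sub>M i\<in>I. M) (Pi\<^sub>E I (\<lambda>i. A (\<beta> i))) = (\<Prod>i\<in>I. emeasure M (A (\<beta> i)))"
      using A \<beta> by (intro emeasure_PiM I) (auto simp: bij_betw_def)
    moreover have "(\<Prod>i\<in>I. emeasure M (A (\<beta> i))) = (\<Prod>j\<in>J. emeasure M (A j))"
      by (rule prod.reindex_bij_betw[OF \<beta>])
    moreover have "Pi\<^sub>E J A \<in> sets (\<Pi>\<^sub>M j\<in>J. M)" using A J by (auto intro: sets_PiM_I_finite)
    ultimately show "emeasure (distr (\<Pi>\<^sub>M i\<in>I. M) (\<Pi>\<^sub>M j\<in>J. M) (\<lambda>f. \<lambda>j\<in>J. f (inv_into I \<beta> j))) (Pi\<^sub>E J A)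
      = (\<Prod>j\<in>J. emeasure M (A j))"
      by (simp add: emeasure_distr)
  qed simp
qed

text \<open>A bijection from the standard basis onto \<open>B\<close> extends to an orthogonal map, and Lebesgue measure is
  invariant under that map.\<close>

lemma lborel_orthonormal_basis:
  fixes B :: "(real ^ 'n) set"
  assumes orth: "pairwise orthogonal B" and norm: "\<And>b. b \<in> B \<Longrightarrow> norm b = 1" and span: "span B = UNIV"
  shows "lborel = distr (\<Pi>\<^sub>M b\<in>B. lborel) borel (\<lambda>c. \<Sum>b\<in>B. c b *\<^sub>R b)"
proof -
  have ind: "independent B"
    using orth norm[of 0] by (intro pairwise_orthogonal_independent) auto
  have fin: "finite B" using ind by (rule finiteI_independent)
  have "card B = DIM(real ^ 'n)"
    using dim_eq_card[of B UNIV] ind span by (simp add: dim_UNIV)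
  then obtain \<beta> where \<beta>: "bij_betw \<beta> (Basis :: (real ^ 'n) set) B"
    using finite_same_card_bij[OF finite_Basis fin] by (auto simp del: DIM_cart)
  define T where "T x = (\<Sum>i\<in>Basis. (x \<bullet> i) *\<^sub>R \<beta> i)" for x :: "real ^ 'n"
  have orthT: "orthogonal_transformation T"
  proof -
    have \<beta>\<beta>: "\<beta> i \<bullet> \<beta> j = (if i = j then 1 else 0)" if "i \<in> Basis" "j \<in> Basis" for i j
    proof -
      have B: "\<beta> i \<in> B" "\<beta> j \<in> B" using that \<beta> by (auto simp: bij_betw_def)
      show ?thesis
      proof (cases "i = j")
        case True then show ?thesis using norm[OF B(1)] by (simp add: dot_square_norm)
      next
        case False
        then have "\<beta> i \<noteq> \<beta> j" using \<beta> that by (auto simp: bij_betw_def inj_on_def)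
        then show ?thesis using orth B False by (auto simp: pairwise_def orthogonal_def)
      qed
    qed
    have "T v \<bullet> T w = v \<bullet> w" for v w
    proof -
      have "T v \<bullet> T w = (\<Sum>j\<in>Basis. \<Sum>i\<in>Basis. ((v \<bullet> i) * (w \<bullet> j)) * (\<beta> i \<bullet> \<beta> j))"
        unfolding T_def inner_sum_left inner_sum_right by (simp add: sum_distrib_left mult_ac)
      also have "\<dots> = (\<Sum>i\<in>Basis. \<Sum>j\<in>Basis. ((v \<bullet> i) * (w \<bullet> j)) * (\<beta> i \<bullet> \<beta> j))"
        by (rule sum.swap)
      also have "\<dots> = (\<Sum>i\<in>Basis. \<Sum>j\<in>Basis. if j = i then (v \<bullet> i) * (w \<bullet> j) else 0)"
        by (intro sum.cong refl) (simp add: \<beta>\<beta>)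
      also have "\<dots> = v \<bullet> w"
        by (subst euclidean_inner) (simp add: sum.delta)
      finally show ?thesis .
    qed
    moreover have "linear T"
      unfolding T_def by (intro linearI) (simp_all add: inner_add_left scaleR_add_left sum.distrib scaleR_sum_right)
    ultimately show ?thesis by (simp add: orthogonal_transformation_def)
  qed
  then have [measurable]: "T \<in> borel_measurable borel"
    using linear_continuous_on[of T UNIV]
    by (auto simp: linear_linear dest: orthogonal_transformation_linear intro!: borel_measurable_continuous_onI)
  have inv: "inv_into Basis \<beta> b \<in> Basis" if "b \<in> B" for b
    using that bij_betw_inv_into[OF \<beta>] by (auto dest: bij_betwE)
  have [measurable]: "(\<lambda>f. \<lambda>j\<in>B. f (inv_into Basis \<beta> j)) \<in> measurable (\<Pi>\<^sub>M i\<in>Basis. lborel) (\<Pi>\<^sub>M j\<in>B. lborel)"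
    using inv by (intro measurable_restrict) simp
  have "distr (\<Pi>\<^sub>M b\<in>B. lborel) borel (\<lambda>c. \<Sum>b\<in>B. c b *\<^sub>R b)
     = distr (distr (\<Pi>\<^sub>M i\<in>Basis. lborel) (\<Pi>\<^sub>M j\<in>B. lborel) (\<lambda>f. \<lambda>j\<in>B. f (inv_into Basis \<beta> j))) borel (\<lambda>c. \<Sum>b\<in>B. c b *\<^sub>R b)"
    by (subst distr_PiM_reindex_bij[OF sigma_finite_lborel finite_Basis \<beta>]) simp
  also have "\<dots> = distr (\<Pi>\<^sub>M i\<in>Basis. lborel) borel ((\<lambda>c. \<Sum>b\<in>B. c b *\<^sub>R b) \<circ> (\<lambda>f. \<lambda>j\<in>B. f (inv_into Basis \<beta> j)))"
    by (rule distr_distr) measurable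
  also have "\<dots> = distr (\<Pi>\<^sub>M i\<in>Basis. lborel) borel (T \<circ> (\<lambda>f. \<Sum>i\<in>Basis. f i *\<^sub>R i))"
  proof (rule distr_cong[OF refl refl])
    fix f :: "real ^ 'n \<Rightarrow> real"
    have "(\<Sum>b\<in>B. f (inv_into Basis \<beta> b) *\<^sub>R b) = (\<Sum>i\<in>Basis. f (inv_into Basis \<beta> (\<beta> i)) *\<^sub>R \<beta> i)"
      by (rule sum.reindex_bij_betw[OF \<beta>, symmetric])
    also have "\<dots> = (\<Sum>i\<in>Basis. f i *\<^sub>R \<beta> i)"
      using \<beta> by (intro sum.cong refl) (simp add: bij_betw_def)
    also have "\<dots> = T (\<Sum>i\<in>Basis. f i *\<^sub>R i)"
      unfolding T_def by (intro sum.cong refl) (simp add: inner_sum_left inner_Basis if_distrib sum.delta cong: if_cong)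
    finally show "((\<lambda>c. \<Sum>b\<in>B. c b *\<^sub>R b) \<circ> (\<lambda>f. \<lambda>j\<in>B. f (inv_into Basis \<beta> j))) f = (T \<circ> (\<lambda>f. \<Sum>i\<in>Basis. f i *\<^sub>R i)) f"
      by simp
  qed
  also have "\<dots> = distr (distr (\<Pi>\<^sub>M i\<in>Basis. lborel) borel (\<lambda>f. \<Sum>i\<in>Basis. f i *\<^sub>R i)) borel T"
    by (rule distr_distr[symmetric]) measurable
  also have "\<dots> = lborel"
    unfolding lborel_eq[symmetric] by (rule distr_lborel_orthogonal_transformation[OF orthT])
  finally show ?thesis by simp
qed

text \<open>The basis hidden in the definition of \<open>hyperplane_measure\<close>, together with the unit normal, is an
  orthonormal basis of the whole space.\<close>

lemma hyperplane_measure_orthonormal: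
  fixes e :: "real ^ 'n"
  assumes e: "norm e = 1"
  obtains B where "finite B" "pairwise orthogonal (insert e B)" "\<And>b. b \<in> insert e B \<Longrightarrow> norm b = 1"
    "span (insert e B) = UNIV" "e \<notin> B" "\<And>b. b \<in> B \<Longrightarrow> e \<bullet> b = 0" "card B = CARD('n) - 1"
    "hyperplane_measure e = distr (\<Pi>\<^sub>M b\<in>B. lborel) borel (\<lambda>c. \<Sum>b\<in>B. c b *\<^sub>R b)"
proof -
  define P where "P B \<longleftrightarrow> pairwise orthogonal B \<and> (\<forall>b\<in>B. norm b = 1) \<and> span B = {x. e \<bullet> x = 0}" for B
  define B where "B = (SOME B. P B)"
  have "subspace {x. e \<bullet> x = 0}" by (rule subspace_hyperplane)
  then have "\<exists>B. P B"
  proof (rule orthonormal_basis_subspace)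
    fix B' assume "pairwise orthogonal B'" "\<And>x. x \<in> B' \<Longrightarrow> norm x = 1" "span B' = {x. e \<bullet> x = 0}"
    then have "P B'" by (simp add: P_def)
    then show "\<exists>B. P B" by blast
  qed
  then have "P B" unfolding B_def by (rule someI_ex)
  then have B: "pairwise orthogonal B" "\<And>b. b \<in> B \<Longrightarrow> norm b = 1" "span B = {x. e \<bullet> x = 0}"
    by (auto simp: P_def)
  have perp: "e \<bullet> b = 0" if "b \<in> B" for b using B(3) span_base[OF that] by auto
  have ind: "independent B"
    using B(1) B(2)[of 0] by (intro pairwise_orthogonal_independent) auto
  have "card B = dim {x. e \<bullet> x = 0}" 
    using dim_eq_card[of B "{x. e \<bullet> x = 0}"] ind B(3) span_eq_iff[THEN iffD2, OF \<open>subspace {x. e \<bullet> x = 0}\<close>] by simp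
  also have "\<dots> = CARD('n) - 1" using e by (subst dim_hyperplane) auto
  finally have card: "card B = CARD('n) - 1" .
  have span: "span (insert e B) = UNIV"
  proof -
    have "x \<in> span (insert e B)" for x
    proof -
      have "x - (e \<bullet> x) *\<^sub>R e \<in> span B" using e B(3) by (simp add: inner_diff_right dot_square_norm)
      then show ?thesis unfolding span_insert by blast
    qed
    then show ?thesis by auto
  qed
  have "hyperplane_measure e = distr (\<Pi>\<^sub>M b\<in>B. lborel) borel (\<lambda>c. \<Sum>b\<in>B. c b *\<^sub>R b)"
    by (simp add: hyperplane_measure_def Let_def B_def P_def)
  moreover have "pairwise orthogonal (insert e B)"
    using B(1) perp unfolding pairwise_insert by (simp add: orthogonal_def inner_commute[of _ e])
  moreover have "e \<notin> B" using perp[of e] e by auto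
  moreover have "norm b = 1" if "b \<in> insert e B" for b using that B(2) e by auto
  ultimately show thesis
    using that[of B, OF finiteI_independent[OF ind] _ _ span _ perp card] by blast
qed

text \<open>Fubini's theorem in an orthonormal basis containing \<open>e\<close>.\<close>

lemma
  fixes f :: "real ^ 'n \<Rightarrow> ennreal"
  assumes e: "norm e = 1" and f[measurable]: "f \<in> borel_measurable borel"
  shows nn_integral_hyperplanes: "(\<integral>\<^sup>+ x. f x \<partial>lborel) = (\<integral>\<^sup>+ u. \<integral>\<^sup>+ y. f (u *\<^sub>R e + y) \<partial>hyperplane_measure e \<partial>lborel)"
    and measurable_nn_integral_hyperplane: "(\<lambda>u. \<integral>\<^sup>+ y. f (u *\<^sub>R e + y) \<partial>hyperplane_measure e) \<in> borel_measurable borel"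
proof -
  obtain B where B: "finite B" "pairwise orthogonal (insert e B)" "\<And>b. b \<in> insert e B \<Longrightarrow> norm b = 1"
    "span (insert e B) = UNIV" "e \<notin> B" "\<And>b. b \<in> B \<Longrightarrow> e \<bullet> b = 0" "card B = CARD('n) - 1"
    and hyp: "hyperplane_measure e = distr (\<Pi>\<^sub>M b\<in>B. lborel) borel (\<lambda>c. \<Sum>b\<in>B. c b *\<^sub>R b)"
    by (rule hyperplane_measure_orthonormal[OF e], rule that)
  interpret product_sigma_finite "\<lambda>b :: real ^ 'n. lborel :: real measure" by standard
  interpret PB: sigma_finite_measure "\<Pi>\<^sub>M b\<in>B. (lborel :: real measure)" by (rule sigma_finite) (rule B)
  have inner: "(\<integral>\<^sup>+ y. f (u *\<^sub>R e + y) \<partial>hyperplane_measure e) = (\<integral>\<^sup>+ c. f (u *\<^sub>R e + (\<Sum>b\<in>B. c b *\<^sub>R b)) \<partial>(\<Pi>\<^sub>M b\<in>B. lborel))" for u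
    unfolding hyp by (rule nn_integral_distr) measurable
  show "(\<lambda>u. \<integral>\<^sup>+ y. f (u *\<^sub>R e + y) \<partial>hyperplane_measure e) \<in> borel_measurable borel"
    unfolding inner by measurable
  have "(\<integral>\<^sup>+ x. f x \<partial>lborel) = (\<integral>\<^sup>+ c. f (\<Sum>b\<in>insert e B. c b *\<^sub>R b) \<partial>(\<Pi>\<^sub>M b\<in>insert e B. lborel))"
    by (subst lborel_orthonormal_basis[OF B(2,3,4)]) (auto intro!: nn_integral_distr)
  also have "\<dots> = (\<integral>\<^sup>+ u. \<integral>\<^sup>+ c. f (\<Sum>b\<in>insert e B. (c(e := u)) b *\<^sub>R b) \<partial>(\<Pi>\<^sub>M b\<in>B. lborel) \<partial>lborel)"
    by (rule product_nn_integral_insert_rev) (use B in measurable)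
  also have "\<dots> = (\<integral>\<^sup>+ u. \<integral>\<^sup>+ c. f (u *\<^sub>R e + (\<Sum>b\<in>B. c b *\<^sub>R b)) \<partial>(\<Pi>\<^sub>M b\<in>B. lborel) \<partial>lborel)"
  proof -
    have "(\<Sum>b\<in>insert e B. (c(e := u)) b *\<^sub>R b) = u *\<^sub>R e + (\<Sum>b\<in>B. c b *\<^sub>R b)" for c u
      using B(1,5) by (simp, intro sum.cong) auto
    then show ?thesis by simp
  qed
  finally show "(\<integral>\<^sup>+ x. f x \<partial>lborel) = (\<integral>\<^sup>+ u. \<integral>\<^sup>+ y. f (u *\<^sub>R e + y) \<partial>hyperplane_measure e \<partial>lborel)"
    by (simp add: inner)
qed

section \<open>Polynomial weights\<close>

text \<open>By comparison with \<open>(1 + |c|) powr (- 2 p)\<close>, which has an elementary primitive.\<close>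

lemma nn_integral_bracket_powr_finite:
  fixes p :: real
  assumes p: "1 / 2 < p"
  shows "(\<integral>\<^sup>+ c. ennreal ((1 + c\<^sup>2) powr (- p)) \<partial>lborel) < \<infinity>"
proof -
  define F where "F x = - ((1 + x) powr (1 - 2 * p) / (2 * p - 1))" for x :: real
  have lim: "(F \<longlongrightarrow> - (0 / (2 * p - 1))) at_top"
    unfolding F_def using p
    by (intro tendsto_minus tendsto_divide tendsto_const tendsto_neg_powr filterlim_tendsto_add_at_top[OF tendsto_const] filterlim_ident) auto
  have "(\<integral>\<^sup>+ x. ennreal ((1 + x) powr (- 2 * p)) * indicator {0..} x \<partial>lborel) = ennreal (- (0 / (2 * p - 1)) - F 0)"
  proof (rule nn_integral_FTC_atLeast[OF _ _ _ lim])
    fix x :: real assume x: "0 \<le> x"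
    show "(F has_real_derivative (1 + x) powr (- 2 * p)) (at x)"
    proof -
      have "((\<lambda>x. (1 + x) powr (1 - 2 * p)) has_real_derivative ((1 - 2 * p) * (1 + x) powr (1 - 2 * p - 1)) * 1) (at x)"
        using x by (intro DERIV_chain2[OF has_real_derivative_powr]) (auto intro!: derivative_eq_intros)
      from DERIV_minus[OF DERIV_cdivide[OF this, of "2 * p - 1"]]
      have "(F has_real_derivative - (((1 - 2 * p) * (1 + x) powr (1 - 2 * p - 1)) * 1 / (2 * p - 1))) (at x)"
        unfolding F_def .
      moreover have "- (((1 - 2 * p) * (1 + x) powr (1 - 2 * p - 1)) * 1 / (2 * p - 1)) = (1 + x) powr (- 2 * p)"
        using p by (simp add: field_simps)
      ultimately show ?thesis by simp
    qed
  qed auto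
  then have half: "(\<integral>\<^sup>+ x. ennreal ((1 + x) powr (- 2 * p)) * indicator {0..} x \<partial>lborel) < \<infinity>"
    by simp
  define h where "h x = ennreal ((1 + x) powr (- 2 * p)) * indicator {0..} x" for x :: real
  have [measurable]: "h \<in> borel_measurable borel" unfolding h_def by measurable
  have refl: "(\<integral>\<^sup>+ x. h (- x) \<partial>lborel) = (\<integral>\<^sup>+ x. h x \<partial>lborel)"
    using nn_integral_real_affine[of h "-1" 0] by simp
  have "(\<integral>\<^sup>+ c. ennreal ((1 + c\<^sup>2) powr (- p)) \<partial>lborel) \<le> (\<integral>\<^sup>+ c. ennreal (2 powr p) * (h c + h (- c)) \<partial>lborel)"
  proof (rule nn_integral_mono)
    fix c :: real
    have pw: "(1 + c\<^sup>2) powr (- p) \<le> 2 powr p * (1 + \<bar>c\<bar>) powr (- 2 * p)"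
    proof -
      have "0 \<le> (1 - \<bar>c\<bar>)\<^sup>2" by simp
      then have le: "(1 + \<bar>c\<bar>)\<^sup>2 / 2 \<le> 1 + c\<^sup>2" by (simp add: power2_eq_square algebra_simps)
      have "(1 + c\<^sup>2) powr (- p) \<le> ((1 + \<bar>c\<bar>)\<^sup>2 / 2) powr (- p)"
        using p by (intro powr_mono2' le) auto
      also have "\<dots> = 2 powr p * (1 + \<bar>c\<bar>) powr (- 2 * p)"
      proof -
        have "(1 + \<bar>c\<bar>)\<^sup>2 = (1 + \<bar>c\<bar>) powr 2" by (subst powr_numeral) auto
        then have "((1 + \<bar>c\<bar>)\<^sup>2) powr (- p) = (1 + \<bar>c\<bar>) powr (- 2 * p)"
          by (simp only: powr_powr) simp
        then show ?thesis by (simp add: powr_divide powr_minus_divide[of 2])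
      qed
      finally show ?thesis .
    qed
    have "ennreal ((1 + \<bar>c\<bar>) powr (- 2 * p)) \<le> h c + h (- c)"
      by (cases "0 \<le> c") (auto simp: h_def)
    then have "ennreal (2 powr p) * ennreal ((1 + \<bar>c\<bar>) powr (- 2 * p)) \<le> ennreal (2 powr p) * (h c + h (- c))"
      by (intro mult_left_mono) auto
    moreover have "ennreal ((1 + c\<^sup>2) powr (- p)) \<le> ennreal (2 powr p) * ennreal ((1 + \<bar>c\<bar>) powr (- 2 * p))"
      using pw by (subst ennreal_mult[symmetric]) (auto intro: ennreal_leI)
    ultimately show "ennreal ((1 + c\<^sup>2) powr (- p)) \<le> ennreal (2 powr p) * (h c + h (- c))" by (rule order_trans[rotated])
  qed
  also have "\<dots> = ennreal (2 powr p) * ((\<integral>\<^sup>+ c. h c \<partial>lborel) + (\<integral>\<^sup>+ c. h (- c) \<partial>lborel))"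
    by (simp add: nn_integral_cmult nn_integral_add)
  also have "\<dots> < \<infinity>"
    using half unfolding refl unfolding h_def[abs_def] by (simp add: ennreal_mult_less_top)
  finally show ?thesis .
qed

text \<open>With this weight, the square of \<open>bessel s g\<close> integrates to the sum of the squares of the summands of the
  weighted Sobolev norm.\<close>

definition weight :: "nat \<Rightarrow> real ^ 'n \<Rightarrow> real" where
  "weight m v = (\<Sum>\<alpha>\<in>multi_indices m. (monomial \<alpha> v)\<^sup>2)"

lemma finite_multi_indices: "finite (multi_indices m :: ('n::finite \<Rightarrow> nat) set)"
proof (rule finite_subset)
  show "multi_indices m \<subseteq> PiE (UNIV :: 'n set) (\<lambda>_. {..m})"
  proof
    fix \<alpha> :: "'n \<Rightarrow> nat" assume "\<alpha> \<in> multi_indices m"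
    then have "\<alpha> i \<le> m" for i
      using member_le_sum[of i UNIV \<alpha>] by (auto simp: multi_indices_def)
    then show "\<alpha> \<in> PiE (UNIV :: 'n set) (\<lambda>_. {..m})" by auto
  qed
qed (intro finite_PiE, auto)

text \<open>The constant monomial and the pure powers suffice: the larger of 1 and all \<open>(v $ i)\<^sup>2\<close> is at least
  \<open>(1 + |v|\<^sup>2) / (d + 1)\<close>, and its \<open>m\<close>-th power is one of the squared monomials.\<close>

lemma weight_lower_bound:
  fixes v :: "real ^ 'n"
  assumes m: "1 \<le> m"
  shows "(1 + (norm v)\<^sup>2) ^ m \<le> real (CARD('n) + 1) ^ m * weight m v"
proof -
  define pw :: "'n \<Rightarrow> 'n \<Rightarrow> nat" where "pw i = (\<lambda>j. if j = i then m else 0)" for i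
  have pw_in: "pw i \<in> multi_indices m" for i by (simp add: multi_indices_def pw_def)
  have zero_in: "(\<lambda>_. 0) \<in> (multi_indices m :: ('n \<Rightarrow> nat) set)" by (simp add: multi_indices_def)
  have mono_pw: "monomial (pw i) v = (v $ i) ^ m" for i
    unfolding monomial_def pw_def by (simp add: if_distrib[of "\<lambda>k. _ ^ k"] prod.delta cong: if_cong)
  have ge: "(monomial \<alpha> v)\<^sup>2 \<le> weight m v" if "\<alpha> \<in> multi_indices m" for \<alpha>
    unfolding weight_def by (rule member_le_sum[OF that]) (auto simp: finite_multi_indices)
  have ge1: "1 \<le> weight m v" using ge[OF zero_in] by (simp add: monomial_def)
  have gei: "((v $ i)\<^sup>2) ^ m \<le> weight m v" for i
    using ge[OF pw_in[of i]] by (simp add: mono_pw power_mult[symmetric] mult.commute)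
  define M where "M = Max (insert 1 (range (\<lambda>i. (v $ i)\<^sup>2)))"
  have fin: "finite (insert 1 (range (\<lambda>i. (v $ i)\<^sup>2)))" by simp
  have "M \<in> insert 1 (range (\<lambda>i. (v $ i)\<^sup>2))" unfolding M_def by (rule Max_in) auto
  then have Mm: "M ^ m \<le> weight m v" using ge1 gei by auto
  have M1: "1 \<le> M" unfolding M_def by (rule Max_ge) auto
  have Mi: "(v $ i)\<^sup>2 \<le> M" for i unfolding M_def by (rule Max_ge) auto
  have "(norm v)\<^sup>2 = (\<Sum>i\<in>UNIV. (v $ i)\<^sup>2)"
    unfolding norm_vec_def L2_set_def by (simp add: sum_nonneg)
  also have "\<dots> \<le> (\<Sum>i\<in>(UNIV :: 'n set). M)" by (intro sum_mono Mi)
  finally have "1 + (norm v)\<^sup>2 \<le> real (CARD('n) + 1) * M" using M1 by (simp add: algebra_simps)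
  then have "(1 + (norm v)\<^sup>2) ^ m \<le> (real (CARD('n) + 1) * M) ^ m" by (intro power_mono) auto
  also have "\<dots> \<le> real (CARD('n) + 1) ^ m * weight m v"
    unfolding power_mult_distrib by (intro mult_left_mono Mm) simp
  finally show ?thesis .
qed

lemma weight_pos: "0 < weight m (v :: real ^ 'n)"
proof -
  have "(\<lambda>_. 0) \<in> (multi_indices m :: ('n \<Rightarrow> nat) set)" by (simp add: multi_indices_def)
  then have "(monomial (\<lambda>_. 0) v)\<^sup>2 \<le> weight m v"
    unfolding weight_def by (rule member_le_sum) (auto simp: finite_multi_indices)
  then show ?thesis by (simp add: monomial_def)
qed

lemma borel_measurable_monomial [measurable]: "monomial \<alpha> \<in> borel_measurable borel"
proof -
  have "continuous_on UNIV (\<lambda>v :: real ^ 'a. \<Prod>i\<in>UNIV. (v $ i) ^ \<alpha> i)" by (intro continuous_intros)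
  then show ?thesis unfolding monomial_def[abs_def] by (rule borel_measurable_continuous_onI)
qed

lemma borel_measurable_weight [measurable]: "weight m \<in> borel_measurable borel"
  unfolding weight_def[abs_def] by measurable

text \<open>Seen along any direction \<open>e\<close>, the measure with density \<open>1 / weight m\<close> has a bounded density, with a bound
  independent of \<open>e\<close>. On a hyperplane orthogonal to \<open>e\<close>, \<open>(1 + |v|\<^sup>2)\<^sup>m\<close> dominates the product of
  \<open>(1 + c\<^sub>b\<^sup>2) powr p\<close> over the \<open>d - 1\<close> orthonormal coordinates with \<open>p = m / (d - 1)\<close>, and each factor has
  an integrable reciprocal because \<open>d \<le> 2 m\<close> makes \<open>p\<close> larger than \<open>1 / 2\<close>.\<close>

lemma weight_density_bound:
  assumes m: "1 \<le> m" "CARD('n) \<le> 2 * m"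
  obtains K where "0 \<le> K"
    and "\<And>(e :: real ^ 'n) \<phi>. norm e = 1 \<Longrightarrow> \<phi> \<in> borel_measurable borel \<Longrightarrow>
      (\<integral>\<^sup>+ v. \<phi> (e \<bullet> v) * ennreal (1 / weight m v) \<partial>lborel) \<le> ennreal K * (\<integral>\<^sup>+ u. \<phi> u \<partial>lborel)"
proof -
  \<comment> \<open>In dimension 1 this is a division by zero, but then \<open>p\<close> occurs only in empty products.\<close>
  define p where "p = real m / real (CARD('n) - 1)"
  define J where "J = (\<integral>\<^sup>+ c. ennreal ((1 + c\<^sup>2) powr (- p)) \<partial>lborel)"
  define D where "D = real (CARD('n) + 1) ^ m"
  have D: "0 < D" by (simp add: D_def)
  have finJ: "ennreal D * J ^ (CARD('n) - 1) < \<infinity>"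
  proof (cases "CARD('n) = 1")
    case True then show ?thesis by simp
  next
    case False
    then have "1 < CARD('n)" using zero_less_card_finite[where 'a='n] by linarith
    then have "1 / 2 < p" using m by (simp add: p_def field_simps of_nat_diff)
    then have "J < \<infinity>" unfolding J_def by (rule nn_integral_bracket_powr_finite)
    then have "J ^ (CARD('n) - 1) < \<infinity>" by (simp add: power_less_top_ennreal)
    then show ?thesis by (simp add: ennreal_mult_less_top)
  qed
  define K where "K = enn2real (ennreal D * J ^ (CARD('n) - 1))"
  have K: "ennreal K = ennreal D * J ^ (CARD('n) - 1)" using finJ by (simp add: K_def)
  show thesis
  proof (rule that[of K])
    show "0 \<le> K" by (simp add: K_def)
    fix e :: "real ^ 'n" and \<phi> :: "real \<Rightarrow> ennreal" assume e: "norm e = 1" and [measurable]: "\<phi> \<in> borel_measurable borel"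
    obtain B where B: "finite B" "pairwise orthogonal (insert e B)" "\<And>b. b \<in> insert e B \<Longrightarrow> norm b = 1"
      "span (insert e B) = UNIV" "e \<notin> B" "\<And>b. b \<in> B \<Longrightarrow> e \<bullet> b = 0" "card B = CARD('n) - 1"
      and hyp: "hyperplane_measure e = distr (\<Pi>\<^sub>M b\<in>B. lborel) borel (\<lambda>c. \<Sum>b\<in>B. c b *\<^sub>R b)"
      by (rule hyperplane_measure_orthonormal[OF e], rule that)
    interpret product_sigma_finite "\<lambda>b :: real ^ 'n. lborel :: real measure" by standard
    have inner: "(\<integral>\<^sup>+ y. \<phi> (e \<bullet> (u *\<^sub>R e + y)) * ennreal (1 / weight m (u *\<^sub>R e + y)) \<partial>hyperplane_measure e) \<le> ennreal K * \<phi> u" for u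
    proof -
      have "(\<integral>\<^sup>+ y. \<phi> (e \<bullet> (u *\<^sub>R e + y)) * ennreal (1 / weight m (u *\<^sub>R e + y)) \<partial>hyperplane_measure e)
        = (\<integral>\<^sup>+ c. \<phi> (e \<bullet> (u *\<^sub>R e + (\<Sum>b\<in>B. c b *\<^sub>R b))) * ennreal (1 / weight m (u *\<^sub>R e + (\<Sum>b\<in>B. c b *\<^sub>R b))) \<partial>(\<Pi>\<^sub>M b\<in>B. lborel))"
        unfolding hyp by (rule nn_integral_distr) measurable
      also have "\<dots> \<le> (\<integral>\<^sup>+ c. (\<phi> u * ennreal D) * (\<Prod>b\<in>B. ennreal ((1 + (c b)\<^sup>2) powr (- p))) \<partial>(\<Pi>\<^sub>M b\<in>B. lborel))"
      proof (rule nn_integral_mono)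
        fix c :: "real ^ 'n \<Rightarrow> real"
        define v where "v = u *\<^sub>R e + (\<Sum>b\<in>B. c b *\<^sub>R b)"
        have ev: "e \<bullet> v = u"
          using e B(6) by (simp add: v_def inner_add_right inner_sum_right dot_square_norm)
        have "(norm v)\<^sup>2 = (norm (u *\<^sub>R e))\<^sup>2 + (norm (\<Sum>b\<in>B. c b *\<^sub>R b))\<^sup>2"
          unfolding v_def by (rule norm_add_Pythagorean) (simp add: orthogonal_def inner_sum_right B(6))
        also have "(norm (\<Sum>b\<in>B. c b *\<^sub>R b))\<^sup>2 = (\<Sum>b\<in>B. (norm (c b *\<^sub>R b))\<^sup>2)"
          using B(1,2) by (intro norm_sum_Pythagorean) (auto simp: pairwise_insert orthogonal_clauses pairwise_def)
        also have "\<dots> = (\<Sum>b\<in>B. (c b)\<^sup>2)" using B(3) by (intro sum.cong) auto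
        finally have nv: "(norm v)\<^sup>2 = u\<^sup>2 + (\<Sum>b\<in>B. (c b)\<^sup>2)" using e by simp
        have "(\<Prod>b\<in>B. (1 + (c b)\<^sup>2) powr p) \<le> (\<Prod>b\<in>B. (1 + (norm v)\<^sup>2) powr p)"
        proof (rule prod_mono)
          fix b assume "b \<in> B"
          then have "(c b)\<^sup>2 \<le> (\<Sum>b\<in>B. (c b)\<^sup>2)" using B(1) by (intro member_le_sum) auto
          then have "(c b)\<^sup>2 \<le> (norm v)\<^sup>2" unfolding nv by (simp add: add_increasing)
          then show "0 \<le> (1 + (c b)\<^sup>2) powr p \<and> (1 + (c b)\<^sup>2) powr p \<le> (1 + (norm v)\<^sup>2) powr p"
            by (auto intro!: powr_mono2 simp: p_def)
        qed
        also have "\<dots> \<le> (1 + (norm v)\<^sup>2) ^ m"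
        proof (cases "card B = 0")
          case True
          then show ?thesis using B(1) by (simp add: one_le_power)
        next
          case False
          have "0 < 1 + (norm v)\<^sup>2" by (simp add: add_pos_nonneg)
          then have "((1 + (norm v)\<^sup>2) powr p) ^ card B = (1 + (norm v)\<^sup>2) powr (real (card B) * p)"
            by (simp add: powr_realpow[symmetric] powr_powr mult.commute)
          also have "real (card B) * p = real m" using False B(7) by (simp add: p_def)
          finally show ?thesis using \<open>0 < 1 + (norm v)\<^sup>2\<close> by (simp add: powr_realpow)
        qed
        also have "\<dots> \<le> D * weight m v" unfolding D_def by (rule weight_lower_bound[OF m(1)])
        finally have le: "(\<Prod>b\<in>B. (1 + (c b)\<^sup>2) powr p) \<le> D * weight m v" .
        have pos: "0 < (\<Prod>b\<in>B. (1 + (c b)\<^sup>2) powr p)"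
        proof (intro prod_pos ballI)
          fix b
          have "0 < 1 + (c b)\<^sup>2" by (simp add: add_pos_nonneg)
          then show "0 < (1 + (c b)\<^sup>2) powr p" by simp
        qed
        have "1 / weight m v \<le> D / (\<Prod>b\<in>B. (1 + (c b)\<^sup>2) powr p)"
          using le pos weight_pos[of m v] by (simp add: field_simps)
        also have "\<dots> = D * (\<Prod>b\<in>B. (1 + (c b)\<^sup>2) powr (- p))"
          by (simp add: powr_minus prod_inversef[symmetric] o_def divide_inverse)
        finally have "ennreal (1 / weight m v) \<le> ennreal (D * (\<Prod>b\<in>B. (1 + (c b)\<^sup>2) powr (- p)))" by (rule ennreal_leI)
        also have "\<dots> = ennreal D * (\<Prod>b\<in>B. ennreal ((1 + (c b)\<^sup>2) powr (- p)))"
          using D by (simp add: ennreal_mult prod_nonneg prod_ennreal)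
        finally have "\<phi> u * ennreal (1 / weight m v) \<le> \<phi> u * (ennreal D * (\<Prod>b\<in>B. ennreal ((1 + (c b)\<^sup>2) powr (- p))))"
          by (intro mult_left_mono) auto
        then show "\<phi> (e \<bullet> (u *\<^sub>R e + (\<Sum>b\<in>B. c b *\<^sub>R b))) * ennreal (1 / weight m (u *\<^sub>R e + (\<Sum>b\<in>B. c b *\<^sub>R b)))
          \<le> (\<phi> u * ennreal D) * (\<Prod>b\<in>B. ennreal ((1 + (c b)\<^sup>2) powr (- p)))"
          unfolding v_def[symmetric] ev by (simp add: mult.assoc)
      qed
      also have "\<dots> = (\<phi> u * ennreal D) * (\<integral>\<^sup>+ c. (\<Prod>b\<in>B. ennreal ((1 + (c b)\<^sup>2) powr (- p))) \<partial>(\<Pi>\<^sub>M b\<in>B. lborel))"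
        by (rule nn_integral_cmult) measurable
      also have "(\<integral>\<^sup>+ c. (\<Prod>b\<in>B. ennreal ((1 + (c b)\<^sup>2) powr (- p))) \<partial>(\<Pi>\<^sub>M b\<in>B. lborel)) = (\<Prod>b\<in>B. J)"
        unfolding J_def by (rule product_nn_integral_prod) (use B in auto)
      also have "(\<phi> u * ennreal D) * (\<Prod>b\<in>B. J) = ennreal K * \<phi> u" using B(7) by (simp add: K mult_ac)
      finally show ?thesis .
    qed
    have "(\<integral>\<^sup>+ v. \<phi> (e \<bullet> v) * ennreal (1 / weight m v) \<partial>lborel)
      = (\<integral>\<^sup>+ u. \<integral>\<^sup>+ y. \<phi> (e \<bullet> (u *\<^sub>R e + y)) * ennreal (1 / weight m (u *\<^sub>R e + y)) \<partial>hyperplane_measure e \<partial>lborel)"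
      by (rule nn_integral_hyperplanes[OF e]) measurable
    also have "\<dots> \<le> (\<integral>\<^sup>+ u. ennreal K * \<phi> u \<partial>lborel)" by (intro nn_integral_mono inner)
    also have "\<dots> = ennreal K * (\<integral>\<^sup>+ u. \<phi> u \<partial>lborel)" by (rule nn_integral_cmult) measurable
    finally show "(\<integral>\<^sup>+ v. \<phi> (e \<bullet> v) * ennreal (1 / weight m v) \<partial>lborel) \<le> ennreal K * (\<integral>\<^sup>+ u. \<phi> u \<partial>lborel)" .
  qed
qed

section \<open>Fourier transforms of Sobolev functions on lines\<close>

lemma sets_ball_borel [measurable]: "ball c r \<in> sets borel" "cball c r \<in> sets borel"
  by simp_all

lemma fourier_cis: "fourier f k = (LINT x|lborel. cis (- (k \<bullet> x)) * complex_of_real (f x))"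
  unfolding fourier_def by (simp add: cis_conv_exp)

lemma integrable_fourier_integrand:
  assumes f: "integrable lborel (f :: real ^ 'n \<Rightarrow> real)"
  shows "integrable lborel (\<lambda>x. cis (- (k \<bullet> x)) * complex_of_real (f x))"
proof -
  have [measurable]: "f \<in> borel_measurable borel" using f by auto
  have "integrable lborel (\<lambda>x. complex_of_real (f x))" using f by simp
  then show ?thesis
    by (rule Bochner_Integration.integrable_bound) (auto simp: norm_mult)
qed

lemma norm_fourier_le:
  shows "cmod (fourier f k) \<le> L1_norm f"
proof -
  have "cmod (fourier f k) \<le> (LINT x|lborel. cmod (cis (- (k \<bullet> x)) * complex_of_real (f x)))"
    unfolding fourier_cis by (rule integral_norm_bound)
  then show ?thesis by (simp add: L1_norm_def norm_mult)
qed

lemma continuous_fourier: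
  assumes f: "integrable lborel (f :: real ^ 'n \<Rightarrow> real)"
  shows "continuous_on UNIV (fourier f)"
proof -
  have [measurable]: "f \<in> borel_measurable borel" using f by auto
  have "(fourier f \<circ> u) \<longlonglongrightarrow> fourier f k" if u: "u \<longlonglongrightarrow> k" for u k
    unfolding fourier_cis comp_def
  proof (rule integral_dominated_convergence)
    show "integrable lborel (\<lambda>x. \<bar>f x\<bar>)" using f by auto
    show "AE x in lborel. (\<lambda>n. cis (- (u n \<bullet> x)) * complex_of_real (f x)) \<longlonglongrightarrow> cis (- (k \<bullet> x)) * complex_of_real (f x)"
      unfolding cis_conv_exp by (intro always_eventually allI tendsto_intros u)
  qed (auto simp: norm_mult)
  then show ?thesis unfolding continuous_on_sequentially by auto
qed

lemma borel_measurable_fourier: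
  assumes f: "integrable lborel (f :: real ^ 'n \<Rightarrow> real)"
  shows "fourier f \<in> borel_measurable borel"
  using continuous_fourier[OF f] by (rule borel_measurable_continuous_onI)

text \<open>A trace estimate on every line through the origin, although \<open>F\<close> is tied to \<open>h\<close> in the mean-square sense only.
  The function \<open>h\<close> need not be integrable, so \<open>fourier_line_L2_bound\<close> is applied to its truncations to
  balls, on all parallel lines \<open>y + s e\<close>. After averaging over \<open>y\<close> in a small ball, mean-square convergence of
  the transforms carries the bound over to \<open>F\<close>. By continuity of \<open>F\<close>, the ball can be shrunk to a point as long
  as \<open>s\<close> stays in a bounded window, and the window is enlarged by Fatou's lemma.\<close>

lemma L2_line_bound:
  fixes F :: "real ^ 'n \<Rightarrow> complex"
  assumes h: "has_fourier_L2 h F" and F: "continuous_on UNIV F" and e: "norm e = 1" and K0: "0 \<le> K"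
    and K: "\<And>\<phi>. \<phi> \<in> borel_measurable borel \<Longrightarrow>
      (\<integral>\<^sup>+ v. \<phi> (e \<bullet> v) * ennreal (1 / weight m v) \<partial>lborel) \<le> ennreal K * (\<integral>\<^sup>+ u. \<phi> u \<partial>lborel)"
    and N: "(\<integral>\<^sup>+ v. ennreal (weight m v * (h v)\<^sup>2) \<partial>lborel) \<le> ennreal N" "0 \<le> N"
  shows "(\<integral>\<^sup>+ s. ennreal ((cmod (F (s *\<^sub>R e)))\<^sup>2) \<partial>lborel) \<le> ennreal (4 * pi * K * N)"
proof -
  define hR where "hR R x = indicator (cball 0 R) x * h x" for R and x :: "real ^ 'n"
  define E where "E R = (\<integral>\<^sup>+ k. ennreal ((cmod (F k - fourier (hR R) k))\<^sup>2) \<partial>lborel)" for R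
  have hL2: "in_L2 h" and [measurable]: "F \<in> borel_measurable borel" and E0: "(E \<longlongrightarrow> 0) at_top"
    using h by (auto simp: has_fourier_L2_def E_def[abs_def] hR_def[abs_def])
  have [measurable]: "h \<in> borel_measurable borel" and hint: "integrable lborel (\<lambda>x. (h x)\<^sup>2)"
    using hL2 by (auto simp: in_L2_def)
  have [measurable]: "hR R \<in> borel_measurable borel" for R unfolding hR_def by measurable
  have hR: "integrable lborel (hR R)" for R
  proof (rule Bochner_Integration.integrable_bound)
    show "integrable lborel (\<lambda>x. indicator (cball 0 R) x + (h x)\<^sup>2)"
      by (intro Bochner_Integration.integrable_add hint integrable_real_indicator)
        (use emeasure_lborel_cball_finite[of "0 :: real ^ 'n" R] in simp_all)
    have "\<bar>h x\<bar> \<le> 1 + (h x)\<^sup>2" for x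
      using sum_squares_bound[of 1 "\<bar>h x\<bar>"] by (simp add: power2_eq_square)
    then show "AE x in lborel. norm (hR R x) \<le> norm (indicator (cball 0 R) x + (h x)\<^sup>2)"
      by (intro always_eventually allI) (auto simp: hR_def indicator_def)
  qed simp
  have [measurable]: "fourier (hR R) \<in> borel_measurable borel" for R
    by (rule borel_measurable_fourier[OF hR])
  have lineR: "(\<integral>\<^sup>+ s. ennreal ((cmod (fourier (hR R) (y + s *\<^sub>R e)))\<^sup>2) \<partial>lborel) \<le> ennreal (2 * pi * K * N)" for R y
  proof -
    define f where "f v = cis (- (y \<bullet> v)) * complex_of_real (hR R v)" for v
    have fint: "integrable lborel f" unfolding f_def by (rule integrable_fourier_integrand[OF hR])
    have split: "cis (- ((y + s *\<^sub>R e) \<bullet> v)) = cis (- (s * (e \<bullet> v))) * cis (- (y \<bullet> v))" for s v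
    proof -
      have "- ((y + s *\<^sub>R e) \<bullet> v) = - (s * (e \<bullet> v)) + - (y \<bullet> v)" by (simp add: inner_add_left)
      then show ?thesis by (simp only: cis_mult)
    qed
    have eq: "fourier (hR R) (y + s *\<^sub>R e) = (LINT v|lborel. cis (- (s * (e \<bullet> v))) * f v)" for s
      unfolding fourier_cis f_def split by (simp add: mult.assoc)
    have "(\<integral>\<^sup>+ s. ennreal ((cmod (fourier (hR R) (y + s *\<^sub>R e)))\<^sup>2) \<partial>lborel)
      \<le> ennreal (2 * pi) * ennreal K * (\<integral>\<^sup>+ v. ennreal (weight m v * (cmod (f v))\<^sup>2) \<partial>lborel)"
      unfolding eq by (rule fourier_line_L2_bound[OF sigma_finite_lborel _ _ fint weight_pos K]) auto
    also have "\<dots> \<le> ennreal (2 * pi) * ennreal K * (\<integral>\<^sup>+ v. ennreal (weight m v * (h v)\<^sup>2) \<partial>lborel)"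
    proof (intro mult_left_mono nn_integral_mono ennreal_leI)
      fix v :: "real ^ 'n"
      show "(cmod (f v))\<^sup>2 \<le> (h v)\<^sup>2" by (auto simp: f_def hR_def norm_mult indicator_def)
    qed (auto intro: less_imp_le weight_pos)
    also have "\<dots> \<le> ennreal (2 * pi) * ennreal K * ennreal N"
      by (intro mult_left_mono N) auto
    also have "\<dots> = ennreal (2 * pi * K * N)"
      using K0 N(2) by (simp add: ennreal_mult[symmetric])
    finally show ?thesis .
  qed
  \<comment> \<open>Twice the bound for the truncations, from \<open>|b|\<^sup>2 \<le> 2 |a|\<^sup>2 + 2 |b - a|\<^sup>2\<close>.\<close>
  define A where "A = ennreal (4 * pi * K * N)"
  have average: "(\<integral>\<^sup>+ y. \<integral>\<^sup>+ s. indicator (ball 0 \<eta>) y * indicator {-S..S} s * ennreal ((cmod (F (y + s *\<^sub>R e)))\<^sup>2) \<partial>lborel \<partial>lborel)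
     \<le> emeasure lborel (ball (0 :: real ^ 'n) \<eta>) * A" (is "?L \<le> ?V * A") if S: "0 \<le> S" for S \<eta> :: real
  proof -
    have bound: "?L \<le> ?V * A + 2 * ennreal (2 * S) * E R" for R
    proof -
      have "?L \<le> (\<integral>\<^sup>+ y. \<integral>\<^sup>+ s. indicator (ball 0 \<eta>) y * (2 * ennreal ((cmod (fourier (hR R) (y + s *\<^sub>R e)))\<^sup>2))
          + 2 * (indicator {-S..S} s * ennreal ((cmod (F (y + s *\<^sub>R e) - fourier (hR R) (y + s *\<^sub>R e)))\<^sup>2)) \<partial>lborel \<partial>lborel)"
      proof (intro nn_integral_mono)
        fix y :: "real ^ 'n" and s :: real
        define a where "a = fourier (hR R) (y + s *\<^sub>R e)"
        define b where "b = F (y + s *\<^sub>R e)"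
        have "(cmod b)\<^sup>2 \<le> (cmod a + cmod (b - a))\<^sup>2"
          using norm_triangle_sub[of b a] by (intro power_mono) auto
        also have "\<dots> \<le> 2 * (cmod a)\<^sup>2 + 2 * (cmod (b - a))\<^sup>2"
          using sum_squares_bound[of "cmod a" "cmod (b - a)"] by (simp add: power2_sum)
        finally have "ennreal ((cmod b)\<^sup>2) \<le> ennreal \<dots>" by (rule ennreal_leI)
        also have "\<dots> = 2 * ennreal ((cmod a)\<^sup>2) + 2 * ennreal ((cmod (b - a))\<^sup>2)"
          by (simp add: ennreal_mult)
        finally show "indicator (ball 0 \<eta>) y * indicator {-S..S} s * ennreal ((cmod (F (y + s *\<^sub>R e)))\<^sup>2) \<le>
           indicator (ball 0 \<eta>) y * (2 * ennreal ((cmod (fourier (hR R) (y + s *\<^sub>R e)))\<^sup>2))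
          + 2 * (indicator {-S..S} s * ennreal ((cmod (F (y + s *\<^sub>R e) - fourier (hR R) (y + s *\<^sub>R e)))\<^sup>2))"
          unfolding a_def[symmetric] b_def[symmetric] by (auto simp: indicator_def)
      qed
      also have "\<dots> = (\<integral>\<^sup>+ y. \<integral>\<^sup>+ s. indicator (ball 0 \<eta>) y * (2 * ennreal ((cmod (fourier (hR R) (y + s *\<^sub>R e)))\<^sup>2)) \<partial>lborel \<partial>lborel)
          + (\<integral>\<^sup>+ y. \<integral>\<^sup>+ s. 2 * (indicator {-S..S} s * ennreal ((cmod (F (y + s *\<^sub>R e) - fourier (hR R) (y + s *\<^sub>R e)))\<^sup>2)) \<partial>lborel \<partial>lborel)"
        by (simp add: nn_integral_add)
      also have "\<dots> \<le> ?V * A + 2 * ennreal (2 * S) * E R"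
      proof (rule add_mono)
        have "(\<integral>\<^sup>+ y. \<integral>\<^sup>+ s. indicator (ball 0 \<eta>) y * (2 * ennreal ((cmod (fourier (hR R) (y + s *\<^sub>R e)))\<^sup>2)) \<partial>lborel \<partial>lborel)
          = (\<integral>\<^sup>+ y. indicator (ball 0 \<eta>) y * (2 * (\<integral>\<^sup>+ s. ennreal ((cmod (fourier (hR R) (y + s *\<^sub>R e)))\<^sup>2) \<partial>lborel)) \<partial>lborel)"
          by (simp add: nn_integral_cmult)
        also have "\<dots> \<le> (\<integral>\<^sup>+ y. indicator (ball 0 \<eta>) (y :: real ^ 'n) * (2 * ennreal (2 * pi * K * N)) \<partial>lborel)"
        proof (rule nn_integral_mono)
          fix y :: "real ^ 'n"
          show "indicator (ball 0 \<eta>) y * (2 * (\<integral>\<^sup>+ s. ennreal ((cmod (fourier (hR R) (y + s *\<^sub>R e)))\<^sup>2) \<partial>lborel))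
            \<le> indicator (ball 0 \<eta>) y * (2 * ennreal (2 * pi * K * N))"
            by (intro mult_left_mono lineR) auto
        qed
        also have "(2 * ennreal (2 * pi * K * N)) = A"
        proof -
          have "2 * ennreal (2 * pi * K * N) = ennreal (2 * (2 * pi * K * N))"
            using K0 N(2) by (subst ennreal_mult) auto
          then show ?thesis by (simp add: A_def mult.assoc)
        qed
        also have "(\<integral>\<^sup>+ y. indicator (ball 0 \<eta>) (y :: real ^ 'n) * A \<partial>lborel) = ?V * A"
          by (subst nn_integral_multc) auto
        finally show "(\<integral>\<^sup>+ y. \<integral>\<^sup>+ s. indicator (ball 0 \<eta>) y * (2 * ennreal ((cmod (fourier (hR R) (y + s *\<^sub>R e)))\<^sup>2)) \<partial>lborel \<partial>lborel) \<le> ?V * A" .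
        have "(\<integral>\<^sup>+ y. \<integral>\<^sup>+ s. 2 * (indicator {-S..S} s * ennreal ((cmod (F (y + s *\<^sub>R e) - fourier (hR R) (y + s *\<^sub>R e)))\<^sup>2)) \<partial>lborel \<partial>lborel)
          = (\<integral>\<^sup>+ s. \<integral>\<^sup>+ y. 2 * (indicator {-S..S} s * ennreal ((cmod (F (y + s *\<^sub>R e) - fourier (hR R) (y + s *\<^sub>R e)))\<^sup>2)) \<partial>lborel \<partial>lborel)"
          by (rule lborel_pair.Fubini') measurable
        also have "\<dots> = (\<integral>\<^sup>+ s. 2 * (indicator {-S..S} s * E R) \<partial>lborel)"
        proof (rule nn_integral_cong)
          fix s :: real
          have "(\<integral>\<^sup>+ y. ennreal ((cmod (F (y + s *\<^sub>R e) - fourier (hR R) (y + s *\<^sub>R e)))\<^sup>2) \<partial>lborel) = E R"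
            using nn_integral_lborel_shift[of "\<lambda>y. ennreal ((cmod (F y - fourier (hR R) y))\<^sup>2)" "s *\<^sub>R e"]
            by (simp add: E_def add.commute)
          then show "(\<integral>\<^sup>+ y. 2 * (indicator {-S..S} s * ennreal ((cmod (F (y + s *\<^sub>R e) - fourier (hR R) (y + s *\<^sub>R e)))\<^sup>2)) \<partial>lborel)
            = 2 * (indicator {-S..S} s * E R)"
            by (simp add: nn_integral_cmult)
        qed
        also have "\<dots> = 2 * ennreal (2 * S) * E R"
          using S by (simp add: nn_integral_cmult nn_integral_multc mult.assoc)
        finally show "(\<integral>\<^sup>+ y. \<integral>\<^sup>+ s. 2 * (indicator {-S..S} s * ennreal ((cmod (F (y + s *\<^sub>R e) - fourier (hR R) (y + s *\<^sub>R e)))\<^sup>2)) \<partial>lborel \<partial>lborel) \<le> 2 * ennreal (2 * S) * E R" by simp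
      qed
      finally show ?thesis .
    qed
    have "((\<lambda>R. ?V * A + 2 * ennreal (2 * S) * E R) \<longlongrightarrow> ?V * A + 2 * ennreal (2 * S) * 0) at_top"
      by (intro tendsto_add tendsto_const ennreal_tendsto_cmult E0) (simp add: ennreal_mult_less_top)
    then have "?L \<le> ?V * A + 2 * ennreal (2 * S) * 0"
    proof (rule tendsto_lowerbound)
      show "\<forall>\<^sub>F R in at_top. ?L \<le> ?V * A + 2 * ennreal (2 * S) * E R"
        by (rule always_eventually) (rule allI, rule bound)
    qed simp
    then show ?thesis by simp
  qed
  have window: "(\<integral>\<^sup>+ s. indicator {-S..S} s * ennreal ((cmod (F (s *\<^sub>R e)))\<^sup>2) \<partial>lborel) \<le> A" if S: "0 < S" for S :: real
  proof (rule ennreal_le_epsilon)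
    fix \<epsilon> :: real assume \<epsilon>: "0 < \<epsilon>"
    define \<epsilon>' where "\<epsilon>' = \<epsilon> / (2 * S)"
    have \<epsilon>': "0 < \<epsilon>'" using \<epsilon> S by (simp add: \<epsilon>'_def)
    have "uniformly_continuous_on (cball (0 :: real ^ 'n) (S + 1)) (\<lambda>k. (cmod (F k))\<^sup>2)"
      by (intro compact_uniformly_continuous continuous_intros continuous_on_subset[OF F]) auto
    then obtain d where d: "0 < d" "\<And>x x'. x \<in> cball (0 :: real ^ 'n) (S + 1) \<Longrightarrow> x' \<in> cball (0 :: real ^ 'n) (S + 1) \<Longrightarrow> dist x' x < d \<Longrightarrow>
       dist ((cmod (F x'))\<^sup>2) ((cmod (F x))\<^sup>2) < \<epsilon>'"
      using \<epsilon>' unfolding uniformly_continuous_on_def by blast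
    define \<eta> where "\<eta> = min d 1"
    have \<eta>: "0 < \<eta>" "\<eta> \<le> d" "\<eta> \<le> 1" using d(1) by (auto simp: \<eta>_def)
    let ?V = "emeasure lborel (ball (0 :: real ^ 'n) \<eta>)"
    have "?V = ennreal (measure lborel (ball (0 :: real ^ 'n) \<eta>))"
      using emeasure_lborel_ball_finite[of "0 :: real ^ 'n" \<eta>] by (intro emeasure_eq_ennreal_measure) (auto simp: less_top)
    moreover have "0 < measure lborel (ball (0 :: real ^ 'n) \<eta>)" using \<eta> by (intro content_ball_pos)
    ultimately have V: "?V \<noteq> 0" "?V \<noteq> top" by auto
    let ?I = "(\<integral>\<^sup>+ s. indicator {-S..S} s * ennreal ((cmod (F (s *\<^sub>R e)))\<^sup>2) \<partial>lborel)"
    have "?V * ?I = (\<integral>\<^sup>+ y. indicator (ball 0 \<eta>) (y :: real ^ 'n) * ?I \<partial>lborel)"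
      by (subst nn_integral_multc) auto
    also have "\<dots> = (\<integral>\<^sup>+ y. \<integral>\<^sup>+ s. indicator (ball 0 \<eta>) (y :: real ^ 'n) * (indicator {-S..S} s * ennreal ((cmod (F (s *\<^sub>R e)))\<^sup>2)) \<partial>lborel \<partial>lborel)"
      by (simp add: nn_integral_cmult)
    also have "\<dots> \<le> (\<integral>\<^sup>+ y. \<integral>\<^sup>+ s. indicator (ball 0 \<eta>) y * indicator {-S..S} s * ennreal ((cmod (F (y + s *\<^sub>R e)))\<^sup>2)
        + indicator (ball 0 \<eta>) y * (indicator {-S..S} s * ennreal \<epsilon>') \<partial>lborel \<partial>lborel)"
    proof (intro nn_integral_mono)
      fix y :: "real ^ 'n" and s :: real
      show "indicator (ball 0 \<eta>) y * (indicator {-S..S} s * ennreal ((cmod (F (s *\<^sub>R e)))\<^sup>2)) \<le>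
        indicator (ball 0 \<eta>) y * indicator {-S..S} s * ennreal ((cmod (F (y + s *\<^sub>R e)))\<^sup>2)
        + indicator (ball 0 \<eta>) y * (indicator {-S..S} s * ennreal \<epsilon>')"
      proof (cases "y \<in> ball 0 \<eta> \<and> s \<in> {-S..S}")
        case True
        then have y: "norm y < \<eta>" and s: "\<bar>s\<bar> \<le> S" by auto
        have "norm (y + s *\<^sub>R e) \<le> norm y + \<bar>s\<bar>" using norm_triangle_ineq[of y "s *\<^sub>R e"] e by simp
        then have "dist ((cmod (F (y + s *\<^sub>R e)))\<^sup>2) ((cmod (F (s *\<^sub>R e)))\<^sup>2) < \<epsilon>'"
        proof (intro d(2))
          show "s *\<^sub>R e \<in> cball 0 (S + 1)" using s e by simp
          show "y + s *\<^sub>R e \<in> cball 0 (S + 1)" 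
            using \<open>norm (y + s *\<^sub>R e) \<le> norm y + \<bar>s\<bar>\<close> y s \<eta> by simp
          show "dist (y + s *\<^sub>R e) (s *\<^sub>R e) < d" using y \<eta> by (simp add: dist_norm)
        qed
        then have "(cmod (F (s *\<^sub>R e)))\<^sup>2 \<le> (cmod (F (y + s *\<^sub>R e)))\<^sup>2 + \<epsilon>'" by (simp add: dist_real_def)
        then have "ennreal ((cmod (F (s *\<^sub>R e)))\<^sup>2) \<le> ennreal ((cmod (F (y + s *\<^sub>R e)))\<^sup>2 + \<epsilon>')" by (rule ennreal_leI)
        then show ?thesis using True \<epsilon>' by simp
      qed (auto simp: indicator_def)
    qed
    also have "\<dots> = (\<integral>\<^sup>+ y. \<integral>\<^sup>+ s. indicator (ball 0 \<eta>) y * indicator {-S..S} s * ennreal ((cmod (F (y + s *\<^sub>R e)))\<^sup>2) \<partial>lborel \<partial>lborel)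
        + (\<integral>\<^sup>+ y. \<integral>\<^sup>+ s. indicator (ball 0 \<eta>) (y :: real ^ 'n) * (indicator {-S..S} s * ennreal \<epsilon>') \<partial>lborel \<partial>lborel)"
      by (simp add: nn_integral_add)
    also have "(\<integral>\<^sup>+ y. \<integral>\<^sup>+ s. indicator (ball 0 \<eta>) (y :: real ^ 'n) * (indicator {-S..S} s * ennreal \<epsilon>') \<partial>lborel \<partial>lborel)
        = ?V * (ennreal (2 * S) * ennreal \<epsilon>')"
      using S by (simp add: nn_integral_cmult nn_integral_multc)
    also have "ennreal (2 * S) * ennreal \<epsilon>' = ennreal \<epsilon>"
      using S \<epsilon> by (subst ennreal_mult[symmetric]) (auto simp: \<epsilon>'_def)
    also have "(\<integral>\<^sup>+ y. \<integral>\<^sup>+ s. indicator (ball 0 \<eta>) y * indicator {-S..S} s * ennreal ((cmod (F (y + s *\<^sub>R e)))\<^sup>2) \<partial>lborel \<partial>lborel) + ?V * ennreal \<epsilon>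
       \<le> ?V * A + ?V * ennreal \<epsilon>"
      using average[of S \<eta>] S by (intro add_right_mono) auto
    also have "\<dots> = ?V * (A + ennreal \<epsilon>)" by (simp add: distrib_left)
    finally show "?I \<le> A + ennreal \<epsilon>"
      using V by (simp add: ennreal_mult_le_mult_iff)
  qed
  have "(\<integral>\<^sup>+ s. ennreal ((cmod (F (s *\<^sub>R e)))\<^sup>2) \<partial>lborel)
     = (\<integral>\<^sup>+ s. liminf (\<lambda>n. indicator {-real (Suc n)..real (Suc n)} s * ennreal ((cmod (F (s *\<^sub>R e)))\<^sup>2)) \<partial>lborel)"
  proof (rule nn_integral_cong)
    fix s :: real
    obtain n0 where n0: "\<bar>s\<bar> \<le> real n0" using real_arch_simple by blast
    have "(\<lambda>n. indicator {-real (Suc n)..real (Suc n)} s * ennreal ((cmod (F (s *\<^sub>R e)))\<^sup>2)) \<longlonglongrightarrow> ennreal ((cmod (F (s *\<^sub>R e)))\<^sup>2)"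
    proof (rule tendsto_eventually, rule eventually_sequentiallyI)
      fix n assume "n0 \<le> n"
      then show "indicator {-real (Suc n)..real (Suc n)} s * ennreal ((cmod (F (s *\<^sub>R e)))\<^sup>2) = ennreal ((cmod (F (s *\<^sub>R e)))\<^sup>2)"
        using n0 by (auto simp: indicator_def)
    qed
    then show "ennreal ((cmod (F (s *\<^sub>R e)))\<^sup>2) = liminf (\<lambda>n. indicator {-real (Suc n)..real (Suc n)} s * ennreal ((cmod (F (s *\<^sub>R e)))\<^sup>2))"
      by (intro lim_imp_Liminf[symmetric]) auto
  qed
  also have "\<dots> \<le> liminf (\<lambda>n. \<integral>\<^sup>+ s. indicator {-real (Suc n)..real (Suc n)} s * ennreal ((cmod (F (s *\<^sub>R e)))\<^sup>2) \<partial>lborel)"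
    by (rule nn_integral_liminf) measurable
  also have "\<dots> \<le> liminf (\<lambda>n. A)"
    by (intro Liminf_mono always_eventually allI window) simp
  also have "\<dots> = A" by (simp add: Liminf_const)
  finally show ?thesis unfolding A_def .
qed

lemma japanese_bracket_ge_1: "1 \<le> japanese_bracket x"
  by (simp add: japanese_bracket_def)

lemma japanese_bracket_scaleR_unit: "norm e = 1 \<Longrightarrow> japanese_bracket (s *\<^sub>R e) = japanese_bracket s"
  by (simp add: japanese_bracket_def)

lemma borel_measurable_japanese_bracket [measurable]: "(japanese_bracket :: real \<Rightarrow> real) \<in> borel_measurable borel"
  unfolding japanese_bracket_def[abs_def] by measurable

lemma half_dim_bounds:
  "1 \<le> half_dim TYPE('n::finite)" "CARD('n) \<le> 2 * half_dim TYPE('n)"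
proof -
  have c: "0 < CARD('n)" by simp
  have h: "real CARD('n) / 2 \<le> real (half_dim TYPE('n))"
    unfolding half_dim_def using c by linarith
  then show "CARD('n) \<le> 2 * half_dim TYPE('n)" by linarith
  show "1 \<le> half_dim TYPE('n)" using h c by linarith
qed

lemma in_weighted_sobolev_mono:
  assumes "in_weighted_sobolev s m g" "m' \<le> m"
  shows "in_weighted_sobolev s m' g"
  using assms by (auto simp: in_weighted_sobolev_def multi_indices_def)

lemma weighted_sobolev_norm_nonneg: "0 \<le> weighted_sobolev_norm s m g"
  unfolding weighted_sobolev_norm_def L2_norm_def by (intro sum_nonneg real_sqrt_ge_zero integral_nonneg_AE) simp

lemma sum_power2_le_power2_sum:
  fixes f :: "'a \<Rightarrow> real"
  assumes "finite A" "\<And>i. i \<in> A \<Longrightarrow> 0 \<le> f i"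
  shows "(\<Sum>i\<in>A. (f i)\<^sup>2) \<le> (\<Sum>i\<in>A. f i)\<^sup>2"
  using assms
proof (induction A rule: finite_induct)
  case (insert x A)
  then have "0 \<le> f x * (\<Sum>i\<in>A. f i)" by (intro mult_nonneg_nonneg sum_nonneg) auto
  then show ?case using insert by (simp add: power2_sum)
qed simp

lemma weighted_bessel_bound:
  assumes "in_weighted_sobolev s m g"
  shows "(\<integral>\<^sup>+ v. ennreal (weight m v * (bessel s g v)\<^sup>2) \<partial>lborel) \<le> ennreal ((weighted_sobolev_norm s m g)\<^sup>2)"
proof -
  let ?f = "\<lambda>\<alpha> v. monomial \<alpha> v * bessel s g v"
  have L2: "?f \<alpha> \<in> borel_measurable borel" "integrable lborel (\<lambda>v. (?f \<alpha> v)\<^sup>2)" if "\<alpha> \<in> multi_indices m" for \<alpha>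
    using assms that by (auto simp: in_weighted_sobolev_def in_L2_def)
  have "(\<integral>\<^sup>+ v. ennreal (weight m v * (bessel s g v)\<^sup>2) \<partial>lborel) = (\<integral>\<^sup>+ v. ennreal (\<Sum>\<alpha>\<in>multi_indices m. (?f \<alpha> v)\<^sup>2) \<partial>lborel)"
    by (simp add: weight_def sum_distrib_right power_mult_distrib)
  also have "\<dots> = ennreal (LINT v|lborel. (\<Sum>\<alpha>\<in>multi_indices m. (?f \<alpha> v)\<^sup>2))"
    by (intro nn_integral_eq_integral Bochner_Integration.integrable_sum L2) (auto intro!: AE_I2 sum_nonneg)
  also have "(LINT v|lborel. (\<Sum>\<alpha>\<in>multi_indices m. (?f \<alpha> v)\<^sup>2)) = (\<Sum>\<alpha>\<in>multi_indices m. LINT v|lborel. (?f \<alpha> v)\<^sup>2)"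
    by (intro Bochner_Integration.integral_sum L2)
  also have "\<dots> = (\<Sum>\<alpha>\<in>multi_indices m. (L2_norm (?f \<alpha>))\<^sup>2)"
    unfolding L2_norm_def by (intro sum.cong refl) (simp add: integral_nonneg_AE)
  also have "ennreal \<dots> \<le> ennreal ((weighted_sobolev_norm s m g)\<^sup>2)"
    unfolding weighted_sobolev_norm_def
    by (intro ennreal_leI sum_power2_le_power2_sum finite_multi_indices) (auto simp: L2_norm_def integral_nonneg_AE)
  finally show ?thesis .
qed

lemma ennreal_le_of_power2_le:
  assumes "x\<^sup>2 \<le> (ennreal r)\<^sup>2" "0 \<le> r"
  shows "x \<le> ennreal r"
proof (cases x)
  case (real y)
  then have "y\<^sup>2 \<le> r\<^sup>2" using assms by (simp add: ennreal_power)
  then show ?thesis using real assms by (auto intro!: ennreal_leI dest: power2_le_imp_le)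
next
  case top
  then have "x\<^sup>2 = top" by (simp add: power2_eq_square)
  then show ?thesis using assms by (simp add: ennreal_power top_unique)
qed

text \<open>The function \<open>\<langle>k\<rangle>\<^sup>\<sigma>\<close> times the transform of \<open>g\<close> is the transform of \<open>bessel \<sigma> g\<close> and is continuous, so
  \<open>L2_line_bound\<close> bounds its square integral on every line by the Sobolev norm. For the first moment, the
  Cauchy--Schwarz inequality is used against \<open>|s| \<langle>s\<rangle> powr (\<delta> / 2 - \<sigma>)\<close>, which is square integrable since \<open>\<delta>\<close> is positive.
  The surplus factor \<open>\<langle>s\<rangle> powr (\<delta> / 2)\<close> later makes the tails of the moment small uniformly in \<open>e\<close>.\<close>

lemma sobolev_line_bounds:
  assumes \<delta>: "0 < \<delta>"
  obtains C where "0 \<le> C"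
    and "\<And>(g :: real ^ 'n \<Rightarrow> real) e. integrable lborel g \<Longrightarrow>
      in_weighted_sobolev (3 / 2 + \<delta>) (half_dim TYPE('n)) g \<Longrightarrow> norm e = 1 \<Longrightarrow>
      (\<integral>\<^sup>+ s. ennreal (\<bar>s\<bar> * japanese_bracket s powr (\<delta> / 2) * cmod (fourier g (s *\<^sub>R e))) \<partial>lborel)
        \<le> ennreal (C * weighted_sobolev_norm (3 / 2 + \<delta>) (half_dim TYPE('n)) g)"
    and "\<And>(g :: real ^ 'n \<Rightarrow> real) e. integrable lborel g \<Longrightarrow>
      in_weighted_sobolev (3 / 2 + \<delta>) (half_dim TYPE('n)) g \<Longrightarrow> norm e = 1 \<Longrightarrow>
      (\<integral>\<^sup>+ s. ennreal ((1 + s\<^sup>2) * (cmod (fourier g (s *\<^sub>R e)))\<^sup>2) \<partial>lborel) < \<infinity>"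
proof -
  let ?m = "half_dim TYPE('n)"
  let ?\<sigma> = "3 / 2 + \<delta>"
  obtain K where K: "0 \<le> K" "\<And>(e :: real ^ 'n) \<phi>. norm e = 1 \<Longrightarrow> \<phi> \<in> borel_measurable borel \<Longrightarrow>
      (\<integral>\<^sup>+ v. \<phi> (e \<bullet> v) * ennreal (1 / weight ?m v) \<partial>lborel) \<le> ennreal K * (\<integral>\<^sup>+ u. \<phi> u \<partial>lborel)"
    by (rule weight_density_bound[OF half_dim_bounds], rule that)
  \<comment> \<open>The exponent for which \<open>(|s| \<langle>s\<rangle> powr (\<delta> / 2 - \<sigma>))\<^sup>2 \<le> (1 + s\<^sup>2) powr (- p)\<close>.\<close>
  define p where "p = (1 + \<delta>) / 2"
  define J where "J = (\<integral>\<^sup>+ c. ennreal ((1 + c\<^sup>2) powr (- p)) \<partial>lborel)"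
  have Jfin: "J < \<infinity>" unfolding J_def by (rule nn_integral_bracket_powr_finite) (use \<delta> in \<open>simp add: p_def\<close>)
  then obtain J' where J': "0 \<le> J'" "J = ennreal J'" by (cases J) auto
  define C where "C = sqrt (J' * (4 * pi * K))"
  have F2: "(\<integral>\<^sup>+ s. ennreal ((japanese_bracket s powr ?\<sigma> * cmod (fourier g (s *\<^sub>R e)))\<^sup>2) \<partial>lborel)
      \<le> ennreal (4 * pi * K * (weighted_sobolev_norm ?\<sigma> ?m g)\<^sup>2)"
    if g: "integrable lborel g" "in_weighted_sobolev ?\<sigma> ?m g" and e: "norm e = 1" for g :: "real ^ 'n \<Rightarrow> real" and e
  proof -
    define F where "F k = complex_of_real (japanese_bracket k powr ?\<sigma>) * fourier g k" for k
    have "\<exists>h. is_bessel ?\<sigma> g h" using g(2) by (simp add: in_weighted_sobolev_def)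
    then have "is_bessel ?\<sigma> g (bessel ?\<sigma> g)" unfolding bessel_def by (rule someI_ex)
    then have h: "has_fourier_L2 (bessel ?\<sigma> g) F" by (simp add: is_bessel_def F_def[abs_def])
    have "japanese_bracket k \<noteq> 0" for k :: "real ^ 'n" using japanese_bracket_ge_1[of k] by linarith
    then have cF: "continuous_on UNIV F"
      unfolding F_def japanese_bracket_def using continuous_fourier[OF g(1)] by (intro continuous_intros) auto
    have "(\<integral>\<^sup>+ s. ennreal ((cmod (F (s *\<^sub>R e)))\<^sup>2) \<partial>lborel) \<le> ennreal (4 * pi * K * (weighted_sobolev_norm ?\<sigma> ?m g)\<^sup>2)"
      by (rule L2_line_bound[OF h cF e K(1) K(2)[OF e] weighted_bessel_bound[OF g(2)]]) auto
    then show ?thesis by (simp add: F_def norm_mult japanese_bracket_scaleR_unit[OF e] power_mult_distrib)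
  qed
  have fm: "(\<lambda>s. fourier g (s *\<^sub>R e)) \<in> borel_measurable borel" if g: "integrable lborel g" for g :: "real ^ 'n \<Rightarrow> real" and e
    using borel_measurable_fourier[OF g] by measurable
  show thesis
  proof (rule that[of C])
    show "0 \<le> C" using J' K by (simp add: C_def)
    fix g :: "real ^ 'n \<Rightarrow> real" and e :: "real ^ 'n"
    assume g: "integrable lborel g" "in_weighted_sobolev ?\<sigma> ?m g" and e: "norm e = 1"
    note [measurable] = fm[OF g(1), of e]
    define N where "N = weighted_sobolev_norm ?\<sigma> ?m g"
    have N0: "0 \<le> N" unfolding N_def by (rule weighted_sobolev_norm_nonneg)
    define a where "a s = ennreal (\<bar>s\<bar> * japanese_bracket s powr (\<delta> / 2 - ?\<sigma>))" for s
    define b where "b s = ennreal (japanese_bracket s powr ?\<sigma> * cmod (fourier g (s *\<^sub>R e)))" for s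
    have [measurable]: "a \<in> borel_measurable borel" "b \<in> borel_measurable borel" unfolding a_def b_def by measurable
    have ab: "ennreal (\<bar>s\<bar> * japanese_bracket s powr (\<delta> / 2) * cmod (fourier g (s *\<^sub>R e))) = a s * b s" for s
    proof -
      have "0 < japanese_bracket s" using japanese_bracket_ge_1[of s] by linarith
      then have "\<bar>s\<bar> * japanese_bracket s powr (\<delta> / 2) * cmod (fourier g (s *\<^sub>R e))
        = (\<bar>s\<bar> * japanese_bracket s powr (\<delta> / 2 - ?\<sigma>)) * (japanese_bracket s powr ?\<sigma> * cmod (fourier g (s *\<^sub>R e)))"
      proof -
        have "japanese_bracket s powr (\<delta> / 2 - ?\<sigma>) * japanese_bracket s powr ?\<sigma> = japanese_bracket s powr (\<delta> / 2)"
          by (simp only: powr_add[symmetric]) simp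
        then show ?thesis by (metis mult.assoc)
      qed
      then show ?thesis unfolding a_def b_def by (simp only: ennreal_mult[symmetric] mult_nonneg_nonneg abs_ge_zero powr_ge_zero norm_ge_zero)
    qed
    have a2: "(\<integral>\<^sup>+ s. (a s)\<^sup>2 \<partial>lborel) \<le> J"
      unfolding J_def
    proof (rule nn_integral_mono)
      fix s :: real
      have jb: "japanese_bracket s = (1 + s\<^sup>2) powr (1 / 2)" by (simp add: japanese_bracket_def powr_half_sqrt)
      have pos: "0 < 1 + s\<^sup>2" by (simp add: add_pos_nonneg)
      have "(\<bar>s\<bar> * japanese_bracket s powr (\<delta> / 2 - ?\<sigma>))\<^sup>2 = s\<^sup>2 * ((1 + s\<^sup>2) powr (1 / 2 * (\<delta> / 2 - ?\<sigma>)))\<^sup>2"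
        by (simp only: jb power_mult_distrib power2_abs powr_powr)
      also have "((1 + s\<^sup>2) powr (1 / 2 * (\<delta> / 2 - ?\<sigma>)))\<^sup>2 = (1 + s\<^sup>2) powr (\<delta> / 2 - ?\<sigma>)"
        using pos by (simp add: power2_eq_square powr_add[symmetric])
      also have "s\<^sup>2 * (1 + s\<^sup>2) powr (\<delta> / 2 - ?\<sigma>) \<le> (1 + s\<^sup>2) powr 1 * (1 + s\<^sup>2) powr (\<delta> / 2 - ?\<sigma>)"
        using pos by (intro mult_right_mono) auto
      also have "\<dots> = (1 + s\<^sup>2) powr (- p)"
      proof -
        have "1 + (\<delta> / 2 - ?\<sigma>) = - p" by (simp add: p_def field_simps)
        then show ?thesis by (simp only: powr_add[symmetric])
      qed
      finally show "(a s)\<^sup>2 \<le> ennreal ((1 + s\<^sup>2) powr (- p))"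
        unfolding a_def by (subst ennreal_power) (auto intro: ennreal_leI)
    qed
    have b2: "(\<integral>\<^sup>+ s. (b s)\<^sup>2 \<partial>lborel) \<le> ennreal (4 * pi * K * N\<^sup>2)"
      using F2[OF g e] unfolding b_def N_def by (simp add: ennreal_power)
    have "(\<integral>\<^sup>+ s. a s * b s \<partial>lborel)\<^sup>2 \<le> (\<integral>\<^sup>+ s. (a s)\<^sup>2 \<partial>lborel) * (\<integral>\<^sup>+ s. (b s)\<^sup>2 \<partial>lborel)"
      by (rule Cauchy_Schwarz_nn_integral) auto
    also have "\<dots> \<le> J * ennreal (4 * pi * K * N\<^sup>2)" by (intro mult_mono a2 b2) auto
    also have "\<dots> = ennreal (J' * (4 * pi * K * N\<^sup>2))" using J' K(1) by (simp add: ennreal_mult[symmetric])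
    also have "J' * (4 * pi * K * N\<^sup>2) = (C * N)\<^sup>2"
      using J' K(1) by (simp add: C_def power_mult_distrib)
    also have "ennreal ((C * N)\<^sup>2) = (ennreal (C * N))\<^sup>2"
      using J' K(1) N0 by (simp add: ennreal_power C_def)
    finally have "(\<integral>\<^sup>+ s. a s * b s \<partial>lborel) \<le> ennreal (C * N)"
      using J' K(1) N0 by (intro ennreal_le_of_power2_le) (auto simp: C_def)
    then show "(\<integral>\<^sup>+ s. ennreal (\<bar>s\<bar> * japanese_bracket s powr (\<delta> / 2) * cmod (fourier g (s *\<^sub>R e))) \<partial>lborel) \<le> ennreal (C * N)"
      by (simp add: ab)
    have "(\<integral>\<^sup>+ s. ennreal ((1 + s\<^sup>2) * (cmod (fourier g (s *\<^sub>R e)))\<^sup>2) \<partial>lborel)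
      \<le> (\<integral>\<^sup>+ s. ennreal ((japanese_bracket s powr ?\<sigma> * cmod (fourier g (s *\<^sub>R e)))\<^sup>2) \<partial>lborel)"
    proof (intro nn_integral_mono ennreal_leI)
      fix s :: real
      have "japanese_bracket s powr 1 \<le> japanese_bracket s powr ?\<sigma>"
        using japanese_bracket_ge_1[of s] \<delta> by (intro powr_mono) auto
      then have "(japanese_bracket s)\<^sup>2 \<le> (japanese_bracket s powr ?\<sigma>)\<^sup>2"
        using japanese_bracket_ge_1[of s] by (intro power_mono) auto
      then have "1 + s\<^sup>2 \<le> (japanese_bracket s powr ?\<sigma>)\<^sup>2" by (simp add: japanese_bracket_def)
      then show "(1 + s\<^sup>2) * (cmod (fourier g (s *\<^sub>R e)))\<^sup>2 \<le> (japanese_bracket s powr ?\<sigma> * cmod (fourier g (s *\<^sub>R e)))\<^sup>2"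
        unfolding power_mult_distrib by (intro mult_right_mono) auto
    qed
    also have "\<dots> \<le> ennreal (4 * pi * K * N\<^sup>2)" using F2[OF g e] by (simp add: N_def)
    finally show "(\<integral>\<^sup>+ s. ennreal ((1 + s\<^sup>2) * (cmod (fourier g (s *\<^sub>R e)))\<^sup>2) \<partial>lborel) < \<infinity>"
      by (simp add: le_less_trans)
  qed
qed

section \<open>Riemann--Lebesgue lemmas\<close>

lemma integrable_mult_of_norm_le_1:
  fixes m q :: "'a::euclidean_space \<Rightarrow> complex"
  assumes [measurable]: "m \<in> borel_measurable borel" and bd: "\<And>x. cmod (m x) \<le> 1" and q: "integrable lborel q"
  shows "integrable lborel (\<lambda>x. m x * q x)"
proof (rule Bochner_Integration.integrable_bound[OF q])
  have [measurable]: "q \<in> borel_measurable borel" using q by auto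
  show "(\<lambda>x. m x * q x) \<in> borel_measurable lborel" by measurable
  show "AE x in lborel. norm (m x * q x) \<le> norm (q x)"
    by (intro AE_I2) (simp add: norm_mult bd mult_left_le_one_le)
qed

text \<open>Integrals against multipliers bounded by 1 depend continuously on the other factor in the \<open>L\<^sup>1\<close> norm,
  uniformly in the multiplier.\<close>

lemma tendsto_integral_L1_limit:
  fixes m :: "'i \<Rightarrow> 'a::euclidean_space \<Rightarrow> complex"
  assumes m [measurable]: "\<And>i. m i \<in> borel_measurable borel" and bd: "\<And>i x. cmod (m i x) \<le> 1"
    and f: "f \<in> borel_measurable borel" and h: "\<And>n. h n \<in> borel_measurable borel" and w: "integrable lborel w"
    and lim: "AE x in lborel. (\<lambda>n. h n x) \<longlonglongrightarrow> f x" and dom: "\<And>n. AE x in lborel. cmod (h n x) \<le> w x"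
    and Q: "\<And>n. ((\<lambda>i. LINT x|lborel. m i x * h n x) \<longlongrightarrow> 0) F"
  shows "((\<lambda>i. LINT x|lborel. m i x * f x) \<longlongrightarrow> 0) F"
proof (rule tendstoI)
  fix \<epsilon> :: real assume \<epsilon>: "0 < \<epsilon>"
  note [measurable] = f h
  have fi: "integrable lborel f"
    by (rule integrable_dominated_convergence[OF _ _ w lim dom]) auto
  have hi: "integrable lborel (h n)" for n
    by (rule integrable_dominated_convergence2[OF _ _ w lim dom]) auto
  have "(\<lambda>n. LINT x|lborel. cmod (h n x - f x)) \<longlonglongrightarrow> (LINT (x :: 'a)|lborel. 0)"
  proof (rule integral_dominated_convergence[where w="\<lambda>x. w x + cmod (f x)"])
    show "integrable lborel (\<lambda>x. w x + cmod (f x))" using w fi by auto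
    show "AE x in lborel. (\<lambda>n. cmod (h n x - f x)) \<longlonglongrightarrow> 0"
      using lim by eventually_elim (auto intro!: tendsto_norm_zero simp: LIM_zero_iff)
    show "AE x in lborel. norm (cmod (h n x - f x)) \<le> w x + cmod (f x)" for n
      using dom[of n]
    proof eventually_elim
      case (elim x)
      then show ?case using norm_triangle_ineq4[of "h n x" "f x"] by simp
    qed
  qed auto
  then have "\<forall>\<^sub>F n in sequentially. (LINT x|lborel. cmod (h n x - f x)) < \<epsilon> / 2"
    using \<epsilon> by (intro order_tendstoD(2)) auto
  then obtain n where n: "(LINT x|lborel. cmod (h n x - f x)) < \<epsilon> / 2" by (auto simp: eventually_sequentially)
  have mi: "integrable lborel (\<lambda>x. m i x * q x)" if "integrable lborel q" for i and q :: "'a \<Rightarrow> complex"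
    using m bd that by (rule integrable_mult_of_norm_le_1)
  have "\<forall>\<^sub>F i in F. cmod (LINT x|lborel. m i x * h n x) < \<epsilon> / 2"
    using tendstoD[OF Q[of n], of "\<epsilon> / 2"] \<epsilon> by simp
  then show "\<forall>\<^sub>F i in F. dist (LINT x|lborel. m i x * f x) 0 < \<epsilon>"
  proof eventually_elim
    case (elim i)
    have "(LINT x|lborel. m i x * f x) = (LINT x|lborel. m i x * h n x) - (LINT x|lborel. m i x * (h n x - f x))"
      using mi[OF fi] mi[OF hi] by (simp add: right_diff_distrib)
    then have "cmod (LINT x|lborel. m i x * f x) \<le> cmod (LINT x|lborel. m i x * h n x) + cmod (LINT x|lborel. m i x * (h n x - f x))"
      by (simp add: norm_triangle_ineq4)
    also have "cmod (LINT x|lborel. m i x * (h n x - f x)) \<le> (LINT x|lborel. cmod (m i x * (h n x - f x)))"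
      by (rule integral_norm_bound)
    also have "\<dots> \<le> (LINT x|lborel. cmod (h n x - f x))"
      using integrable_norm[OF mi[of "\<lambda>x. h n x - f x" i]] fi hi[of n] bd
      by (intro integral_mono) (auto simp: norm_mult intro: mult_left_le_one_le)
    finally show ?case using elim n by (simp add: dist_norm)
  qed
qed

text \<open>Boxes are stable under intersection and generate the Borel sets, so a Dynkin class argument extends the
  decay from boxes to Borel sets, and \<open>L\<^sup>1\<close> limits extend it to integrable functions.\<close>

lemma multipliers_tendsto_0_of_boxes:
  fixes m :: "'i \<Rightarrow> 'a::euclidean_space \<Rightarrow> complex" and f :: "'a \<Rightarrow> complex"
  assumes m [measurable]: "\<And>i. m i \<in> borel_measurable borel" and bd: "\<And>i x. cmod (m i x) \<le> 1"
    and box: "\<And>a b. ((\<lambda>i. LINT x|lborel. m i x * indicator (box a b) x) \<longlongrightarrow> 0) F"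
    and f: "integrable lborel f"
  shows "((\<lambda>i. LINT x|lborel. m i x * f x) \<longlongrightarrow> 0) F"
proof -
  define Q where "Q h \<longleftrightarrow> ((\<lambda>i. LINT x|lborel. m i x * h x) \<longlongrightarrow> 0) F" for h :: "'a \<Rightarrow> complex"
  note Qlim = tendsto_integral_L1_limit[where m=m and F=F, OF m bd, folded Q_def]
  define I where "I A x = (indicator A x :: complex)" for A :: "'a set" and x
  have [measurable]: "I A \<in> borel_measurable borel" if "A \<in> sets borel" for A
    unfolding I_def using that by measurable
  have mi: "integrable lborel (\<lambda>x. m i x * q x)" if "integrable lborel q" for i and q :: "'a \<Rightarrow> complex"
    using m bd that by (rule integrable_mult_of_norm_le_1)
  have Qadd: "Q (\<lambda>x. g x + h x)" if "Q g" "Q h" "integrable lborel g" "integrable lborel h" for g h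
    using tendsto_add[OF that(1,2)[unfolded Q_def]] mi[OF that(3)] mi[OF that(4)]
    by (simp add: Q_def distrib_left)
  have Qmult: "Q (\<lambda>x. c * h x)" if "Q h" for c h
    using tendsto_mult_right_zero[OF that[unfolded Q_def], of c]
    by (simp add: Q_def mult.left_commute[of _ c])
  \<comment> \<open>Borel sets are first cut down to bounded boxes, to keep all indicators in the Dynkin argument integrable.\<close>
  define N where "N n = box (- real n *\<^sub>R One) (real n *\<^sub>R (One :: 'a))" for n
  have Nm [measurable]: "N n \<in> sets borel" for n by (simp add: N_def)
  have Nfin: "integrable lborel (\<lambda>x. indicator (N n) x :: real)" for n
    by (auto simp: N_def intro!: integrable_real_indicator emeasure_lborel_box_finite)
  have Iint: "integrable lborel (I (A \<inter> N n))" if "A \<in> sets borel" for A n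
    by (rule Bochner_Integration.integrable_bound[OF Nfin[of n]]) (use that in \<open>auto simp: I_def indicator_def\<close>)
  have inN: "\<forall>\<^sub>F n in sequentially. x \<in> N n" for x :: 'a
  proof -
    obtain n0 where n0: "norm x < real n0" using reals_Archimedean2 by blast
    have "x \<in> N n" if "n0 \<le> n" for n
    proof -
      have ab: "\<bar>x \<bullet> b\<bar> < real n" if "b \<in> Basis" for b
        using Basis_le_norm[OF that, of x] n0 \<open>n0 \<le> n\<close> by linarith
      then have "- real n < x \<bullet> b \<and> x \<bullet> b < real n" if "b \<in> Basis" for b
        using ab[OF that] by linarith
      then show ?thesis by (simp add: N_def mem_box)
    qed
    then show ?thesis by (auto simp: eventually_sequentially)
  qed
  have sets: "Q (I (A \<inter> N n))" if "A \<in> sets borel" for A n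
  proof -
    let ?G = "range (\<lambda>(a, b). box a b :: 'a set)"
    have box_in: "box p q \<in> ?G" for p q using rangeI[of "\<lambda>(a, b). box a b :: 'a set" "(p, q)"] by simp
    have "Int_stable ?G"
    proof (rule Int_stableI)
      fix A B assume "A \<in> ?G" "B \<in> ?G"
      then show "A \<inter> B \<in> ?G" by (auto simp: box_Int_box intro: box_in)
    qed
    moreover have "?G \<subseteq> Pow UNIV" by simp
    moreover have "A \<in> sigma_sets UNIV ?G" using that by (subst (asm) borel_eq_box) (simp add: sets_measure_of)
    ultimately show ?thesis
    proof (induction rule: sigma_sets_induct_disjoint)
      case (basic A)
      then obtain a b where "A = box a b" by auto
      then obtain c d where "A \<inter> N n = box c d" by (auto simp: N_def box_Int_box)
      then show ?case using box[of c d] by (simp add: Q_def I_def)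
    next
      case empty
      then show ?case by (simp add: Q_def I_def)
    next
      case (compl A)
      then have A [measurable]: "A \<in> sets borel" by (subst borel_eq_box) (simp add: sets_measure_of)
      have 1: "Q (I (N n))" using box by (simp add: Q_def I_def N_def)
      have "Q (\<lambda>x. I (UNIV \<inter> N n) x + (-1) * I (A \<inter> N n) x)"
        using 1 by (intro Qadd Qmult compl Iint integrable_mult_right) auto
      moreover have "(\<lambda>x. I (UNIV \<inter> N n) x + (-1) * I (A \<inter> N n) x) = I ((UNIV - A) \<inter> N n)"
        by (auto simp: I_def indicator_def fun_eq_iff)
      ultimately show ?case by simp
    next
      case (union A)
      then have A [measurable]: "A i \<in> sets borel" for i by (subst borel_eq_box) (auto simp: sets_measure_of)
      define U where "U k = (\<Union>i<k. A i)" for k :: nat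
      have Um [measurable]: "U k \<in> sets borel" for k unfolding U_def by measurable
      have QU: "Q (I (U k \<inter> N n))" for k
      proof (induction k)
        case 0 then show ?case by (simp add: U_def Q_def I_def)
      next
        case (Suc k)
        have "U k \<inter> A k = {}"
        proof -
          have "A i \<inter> A k = {}" if "i < k" for i
            using union(1) that unfolding disjoint_family_on_def by simp
          then show ?thesis by (auto simp: U_def)
        qed
        then have "I (U (Suc k) \<inter> N n) = (\<lambda>x. I (U k \<inter> N n) x + I (A k \<inter> N n) x)"
          by (auto simp: I_def indicator_def fun_eq_iff U_def lessThan_Suc)
        then show ?case using Qadd[OF Suc union(3)[of k] Iint Iint] by simp
      qed
      show ?case
      proof (rule Qlim[where h="\<lambda>k. I (U k \<inter> N n)" and w="indicator (N n)"])
        show "AE x in lborel. (\<lambda>k. I (U k \<inter> N n) x) \<longlonglongrightarrow> I (\<Union> (range A) \<inter> N n) x"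
        proof (intro always_eventually allI)
          fix x
          show "(\<lambda>k. I (U k \<inter> N n) x) \<longlonglongrightarrow> I (\<Union> (range A) \<inter> N n) x"
          proof (cases "x \<in> \<Union> (range A)")
            case True
            then obtain j where "x \<in> A j" by auto
            then have "\<forall>k\<ge>Suc j. I (U k \<inter> N n) x = I (\<Union> (range A) \<inter> N n) x"
              by (auto simp: I_def U_def indicator_def)
            then show ?thesis by (intro tendsto_eventually) (auto simp: eventually_sequentially)
          next
            case False
            then have "I (U k \<inter> N n) x = I (\<Union> (range A) \<inter> N n) x" for k
              by (auto simp: I_def U_def indicator_def)
            then show ?thesis by simp
          qed
        qed
        show "AE x in lborel. cmod (I (U k \<inter> N n) x) \<le> indicator (N n) x" for k
          by (auto simp: I_def indicator_def)
      qed (use Nfin QU in auto)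
    qed
  qed
  from f have "Q f"
  proof (induction rule: integrable_induct)
    case (base A c)
    then have A [measurable]: "A \<in> sets borel" and fin: "emeasure lborel A < \<infinity>" by auto
    have "Q (I A)"
    proof (rule Qlim[where h="\<lambda>n. I (A \<inter> N n)" and w="indicator A"])
      show "AE x in lborel. (\<lambda>n. I (A \<inter> N n) x) \<longlonglongrightarrow> I A x"
      proof (intro always_eventually allI)
        fix x
        show "(\<lambda>n. I (A \<inter> N n) x) \<longlonglongrightarrow> I A x"
          by (intro tendsto_eventually eventually_mono[OF inN[of x]]) (auto simp: I_def indicator_def)
      qed
      show "integrable lborel (indicator A :: 'a \<Rightarrow> real)" using fin A by (auto intro!: integrable_real_indicator)
      show "AE x in lborel. cmod (I (A \<inter> N n) x) \<le> indicator A x" for n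
        by (auto simp: I_def indicator_def)
    qed (use sets in simp_all)
    moreover have "(\<lambda>x. indicator A x *\<^sub>R c) = (\<lambda>x. c * I A x)"
      by (auto simp: fun_eq_iff I_def indicator_def)
    ultimately show ?case using Qmult[of "I A" c] by simp
  next
    case (add f g)
    then show ?case by (intro Qadd) auto
  next
    case (lim f s)
    show ?case
      by (rule Qlim[where h=s and w="\<lambda>x. 2 * norm (f x)"]) (use lim in auto)
  qed
  then show ?thesis by (simp add: Q_def)
qed

text \<open>Off the boundary of the box, which is a null set, the two indicators eventually agree.\<close>

lemma tendsto_integral_box_shift:
  fixes a b :: "'a :: euclidean_space" and u :: "nat \<Rightarrow> 'a"
  assumes u: "u \<longlonglongrightarrow> 0"
  shows "(\<lambda>n. LINT x|lborel. \<bar>indicator (box a b) x - indicator (box a b) (x + u n) :: real\<bar>) \<longlonglongrightarrow> 0"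
proof -
  obtain R where "\<forall>x\<in>box a b. norm x \<le> R" using bounded_box[of a b] unfolding bounded_iff by (elim exE)
  then have R: "box a b \<subseteq> cball 0 R" by auto
  obtain M where M: "\<And>n. norm (u n) \<le> M"
    using convergent_imp_Bseq[OF convergentI[OF u]] BseqE by metis
  have ae: "AE x in lborel. x \<notin> cbox a b - box a b"
  proof (rule AE_I[where N="cbox a b - box a b"])
    have "cbox a b - box a b \<in> null_sets lebesgue" using negligible_frontier_interval[of a b] by (simp add: negligible_iff_null_sets)
    then show "emeasure lborel (cbox a b - box a b) = 0" by (auto simp: null_sets_def)
  qed auto
  have "(\<lambda>n. LINT x|lborel. \<bar>indicator (box a b) x - indicator (box a b) (x + u n) :: real\<bar>) \<longlonglongrightarrow> (LINT (x :: 'a)|lborel. (0 :: real))"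
  proof (rule integral_dominated_convergence[where w="\<lambda>x. indicator (cball (0 :: 'a) (R + M)) x :: real"])
    show "integrable lborel (\<lambda>x. indicator (cball (0 :: 'a) (R + M)) x :: real)"
      using emeasure_lborel_cball_finite[of "0 :: 'a" "R + M"] by (auto intro!: integrable_real_indicator)
    show "AE x in lborel. (\<lambda>n. \<bar>indicator (box a b) x - indicator (box a b) (x + u n) :: real\<bar>) \<longlonglongrightarrow> 0"
      using ae
    proof eventually_elim
      case (elim x)
      have t: "(\<lambda>n. x + u n) \<longlonglongrightarrow> x" using tendsto_add[OF tendsto_const u, of x] by simp
      have "\<forall>\<^sub>F n in sequentially. (x \<in> box a b \<longleftrightarrow> x + u n \<in> box a b)"
      proof (cases "x \<in> box a b")
        case True
        with topological_tendstoD[OF t open_box] show ?thesis by (auto elim: eventually_mono)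
      next
        case False
        then have "x \<in> - cbox a b" using elim by auto
        with topological_tendstoD[OF t, of "- cbox a b"] open_Compl[OF closed_cbox[of a b]] have "\<forall>\<^sub>F n in sequentially. x + u n \<in> - cbox a b" by simp
        then show ?thesis by eventually_elim (use False box_subset_cbox[of a b] in auto)
      qed
      then show ?case by (intro tendsto_eventually) (auto elim!: eventually_mono simp: indicator_def)
    qed
    show "AE x in lborel. norm \<bar>indicator (box a b) x - indicator (box a b) (x + u n) :: real\<bar> \<le> indicator (cball 0 (R + M)) x" for n
    proof (intro always_eventually allI)
      fix x
      have M0: "0 \<le> M" using M[of n] norm_ge_zero[of "u n"] by linarith
      have 1: "x \<in> cball 0 (R + M)" if "x \<in> box a b" using that R M0 by (auto simp: subset_iff intro: add_increasing2)
      have 2: "x \<in> cball 0 (R + M)" if "x + u n \<in> box a b"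
      proof -
        have "norm (x + u n) \<le> R" using that R by (auto simp: subset_iff)
        then show ?thesis using M[of n] norm_triangle_ineq4[of "x + u n" "u n"] by simp
      qed
      show "norm \<bar>indicator (box a b) x - indicator (box a b) (x + u n) :: real\<bar> \<le> indicator (cball 0 (R + M)) x"
        using 1 2 by (auto simp: indicator_def)
    qed
  qed auto
  then show ?thesis by simp
qed

text \<open>Translation by \<open>u = \<pi> k / |k|\<^sup>2\<close> reverses the sign of the exponential, so twice the modulus of the integral over a box is at most
  the measure of the symmetric difference between the box and its translate.\<close>

lemma riemann_lebesgue:
  fixes f :: "'a :: euclidean_space \<Rightarrow> complex" and k :: "nat \<Rightarrow> 'a"
  assumes f: "integrable lborel f" and k: "filterlim k at_infinity sequentially"
  shows "(\<lambda>n. LINT x|lborel. cis (- (k n \<bullet> x)) * f x) \<longlonglongrightarrow> 0"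
proof (rule multipliers_tendsto_0_of_boxes[OF _ _ _ f])
  fix a b :: 'a
  define u where "u n = (pi / (norm (k n))\<^sup>2) *\<^sub>R k n" for n
  have nk: "filterlim (\<lambda>n. norm (k n)) at_top sequentially"
    using k by (simp add: filterlim_at_infinity_conv_norm_at_top)
  have "(\<lambda>n. pi / norm (k n)) \<longlonglongrightarrow> 0"
    by (intro tendsto_divide_0[OF tendsto_const] filterlim_at_top_imp_at_infinity nk)
  moreover have "norm (u n) = pi / norm (k n)" for n by (simp add: u_def power2_eq_square)
  ultimately have "(\<lambda>n. norm (u n)) \<longlonglongrightarrow> 0" by simp
  then have u0: "u \<longlonglongrightarrow> 0" by (rule tendsto_norm_zero_cancel)
  have ev: "\<forall>\<^sub>F n in sequentially. 0 < norm (k n)" using nk unfolding filterlim_at_top_dense by blast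
  let ?B = "\<lambda>x. indicator (box a b) x :: complex"
  let ?T = "\<lambda>n. LINT x|lborel. \<bar>indicator (box a b) x - indicator (box a b) (x + u n) :: real\<bar>"
  show "(\<lambda>n. LINT x|lborel. cis (- (k n \<bullet> x)) * ?B x) \<longlonglongrightarrow> 0"
  proof (rule Lim_null_comparison[OF _ tendsto_integral_box_shift[OF u0, of a b]])
    show "\<forall>\<^sub>F n in sequentially. cmod (LINT x|lborel. cis (- (k n \<bullet> x)) * ?B x) \<le> ?T n"
      using ev
    proof eventually_elim
      case (elim n)
      have ku: "k n \<bullet> u n = pi" using elim by (simp add: u_def power2_norm_eq_inner)
      have Bint: "integrable lborel ?B"
      proof (rule Bochner_Integration.integrable_bound)
        show "integrable lborel (\<lambda>x. indicator (box a b) x :: real)"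
          using emeasure_lborel_box_finite[of a b] by (intro integrable_real_indicator) auto
      qed (auto simp: indicator_def)
      have i1: "integrable lborel (\<lambda>x. cis (- (k n \<bullet> x)) * ?B x)"
        by (rule Bochner_Integration.integrable_bound[OF Bint]) (auto simp: norm_mult)
      have shift: "(LINT x|lborel. h (x + u n)) = (LINT x|lborel. h x)" if "h \<in> borel_measurable borel" for h :: "'a \<Rightarrow> complex"
      proof -
        have "(LINT x|lborel. h x) = (LINT x|distr lborel borel ((+) (u n)). h x)" by (simp add: lborel_distr_plus)
        also have "\<dots> = (LINT x|lborel. h (u n + x))" by (rule integral_distr) (use that in auto)
        finally show ?thesis by (simp add: add.commute)
      qed
      have c: "cis (- (k n \<bullet> (x + u n))) = - cis (- (k n \<bullet> x))" for x
      proof -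
        have "- (k n \<bullet> (x + u n)) = - (k n \<bullet> x) + - pi" using ku by (simp add: inner_add_right)
        moreover have "cis (- pi) = - 1" by (simp add: complex_eq_iff)
        ultimately show ?thesis by (simp only: cis_mult[symmetric]) simp
      qed
      have i2: "integrable lborel (\<lambda>x. cis (- (k n \<bullet> x)) * ?B (x + u n))"
      proof -
        have "integrable (distr lborel borel ((+) (u n))) ?B" using Bint by (simp add: lborel_distr_plus)
        then have "integrable lborel (\<lambda>x. ?B (x + u n))" by (subst (asm) integrable_distr_eq) (auto simp: add.commute)
        then show ?thesis by (rule Bochner_Integration.integrable_bound) (auto simp: norm_mult)
      qed
      have "(LINT x|lborel. cis (- (k n \<bullet> x)) * ?B x) = (LINT x|lborel. cis (- (k n \<bullet> (x + u n))) * ?B (x + u n))"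
        by (rule shift[symmetric]) measurable
      also have "\<dots> = - (LINT x|lborel. cis (- (k n \<bullet> x)) * ?B (x + u n))"
        unfolding c by simp
      finally have "2 * (LINT x|lborel. cis (- (k n \<bullet> x)) * ?B x)
         = (LINT x|lborel. cis (- (k n \<bullet> x)) * ?B x) - (LINT x|lborel. cis (- (k n \<bullet> x)) * ?B (x + u n))" by simp
      also have "\<dots> = (LINT x|lborel. cis (- (k n \<bullet> x)) * (?B x - ?B (x + u n)))"
        using i1 i2 by (simp add: right_diff_distrib)
      finally have "cmod (2 * (LINT x|lborel. cis (- (k n \<bullet> x)) * ?B x)) = cmod (LINT x|lborel. cis (- (k n \<bullet> x)) * (?B x - ?B (x + u n)))"
        by (rule arg_cong)
      then have "2 * cmod (LINT x|lborel. cis (- (k n \<bullet> x)) * ?B x) = cmod (LINT x|lborel. cis (- (k n \<bullet> x)) * (?B x - ?B (x + u n)))"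
        by (simp only: norm_mult norm_numeral)
      also have "\<dots> \<le> (LINT x|lborel. cmod (cis (- (k n \<bullet> x)) * (?B x - ?B (x + u n))))"
        by (rule integral_norm_bound)
      also have "\<dots> = ?T n"
        by (intro Bochner_Integration.integral_cong refl) (auto simp: norm_mult indicator_def)
      finally show ?case using norm_ge_zero[of "LINT x|lborel. cis (- (k n \<bullet> x)) * ?B x"] by linarith
    qed
  qed
qed auto

lemma norm_integral_exp_interval_le:
  fixes z :: complex
  assumes z: "z \<noteq> 0" "0 \<le> Re z" and ab: "0 \<le> a" "a \<le> b"
  shows "cmod (LINT s|lborel. indicator {a..b} s *\<^sub>R exp (- (z * complex_of_real s))) \<le> 2 / cmod z"
proof -
  define F where "F s = - exp (- (z * complex_of_real s)) / z" for s
  have "(LINT s|lborel. indicator {a..b} s *\<^sub>R exp (- (z * complex_of_real s))) = F b - F a"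
  proof (rule integral_FTC_Icc)
    fix s :: real
    have "((\<lambda>w. - exp (- (z * w)) / z) has_field_derivative exp (- (z * complex_of_real s))) (at (complex_of_real s))"
      using z by (auto intro!: derivative_eq_intros)
    from has_vector_derivative_real_field[OF this]
    show "(F has_vector_derivative exp (- (z * complex_of_real s))) (at s within {a..b})"
      unfolding F_def by (rule has_vector_derivative_at_within)
  qed (auto intro!: continuous_intros ab)
  also have "cmod \<dots> \<le> cmod (F b) + cmod (F a)" by (rule norm_triangle_ineq4)
  also have "\<dots> \<le> 1 / cmod z + 1 / cmod z"
    using z ab by (intro add_mono) (auto simp: F_def norm_divide intro!: divide_right_mono)
  finally show ?thesis by simp
qed

text \<open>The bound \<open>2 / |z|\<close> for the integral over an interval does not deteriorate as \<open>z\<close> approaches the imaginary axis.\<close>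

lemma riemann_lebesgue_half_plane:
  fixes f :: "real \<Rightarrow> complex" and z :: "nat \<Rightarrow> complex"
  assumes f: "integrable lborel f" and z: "filterlim z at_infinity sequentially" "\<And>n. 0 \<le> Re (z n)"
  shows "(\<lambda>n. LINT s|lborel. indicator {0..} s * exp (- (z n * complex_of_real s)) * f s) \<longlonglongrightarrow> 0"
proof (rule multipliers_tendsto_0_of_boxes[OF _ _ _ f])
  show "cmod (indicator {0..} s * exp (- (z n * complex_of_real s))) \<le> 1" for n s
    using z(2)[of n] by (auto simp: indicator_def norm_mult)
  fix a b :: real
  have nz: "filterlim (\<lambda>n. cmod (z n)) at_top sequentially"
    using z(1) by (simp add: filterlim_at_infinity_conv_norm_at_top)
  then have ev: "\<forall>\<^sub>F n in sequentially. 0 < cmod (z n)" unfolding filterlim_at_top_dense by blast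
  show "(\<lambda>n. LINT s|lborel. indicator {0..} s * exp (- (z n * complex_of_real s)) * indicator (box a b) s) \<longlonglongrightarrow> 0"
  proof (rule Lim_null_comparison)
    show "(\<lambda>n. 2 / cmod (z n)) \<longlonglongrightarrow> 0"
      by (intro tendsto_divide_0[OF tendsto_const] filterlim_at_top_imp_at_infinity nz)
    show "\<forall>\<^sub>F n in sequentially. cmod (LINT s|lborel. indicator {0..} s * exp (- (z n * complex_of_real s)) * indicator (box a b) s) \<le> 2 / cmod (z n)"
      using ev
    proof eventually_elim
      case (elim n)
      have eq: "(LINT s|lborel. indicator {0..} s * exp (- (z n * complex_of_real s)) * indicator (box a b) s)
        = (LINT s|lborel. indicator {max 0 a..max (max 0 a) b} s *\<^sub>R exp (- (z n * complex_of_real s)))"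
      proof (rule integral_cong_AE)
        show "AE s in lborel. indicator {0..} s * exp (- (z n * complex_of_real s)) * indicator (box a b) s = 
          indicator {max 0 a..max (max 0 a) b} s *\<^sub>R exp (- (z n * complex_of_real s))"
          using AE_lborel_singleton[of a] AE_lborel_singleton[of b] AE_lborel_singleton[of 0]
          by eventually_elim (auto simp: indicator_def)
      qed auto
      show ?case unfolding eq using elim z(2)[of n] by (intro norm_integral_exp_interval_le) auto
    qed
  qed
qed auto

section \<open>Laplace transforms in the right half plane\<close>

text \<open>The half line is encoded by an indicator: on the closed right half plane, the transform is then an integral
  over the line with a multiplier bounded by 1.\<close>

definition laplace :: "(real \<Rightarrow> complex) \<Rightarrow> complex \<Rightarrow> complex" where
  "laplace \<psi> z = (LINT s|lborel. indicator {0..} s * exp (- (z * complex_of_real s)) * \<psi> s)"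

lemma norm_laplace_factor: "0 \<le> Re z \<Longrightarrow> cmod (indicator {0..} s * exp (- (z * complex_of_real s))) \<le> 1"
  by (auto simp: indicator_def norm_mult)

lemma integrable_laplace:
  assumes "integrable lborel \<psi>" "0 \<le> Re z"
  shows "integrable lborel (\<lambda>s. indicator {0..} s * exp (- (z * complex_of_real s)) * \<psi> s)"
  using norm_laplace_factor[OF assms(2)] assms(1) by (intro integrable_mult_of_norm_le_1) auto

lemma norm_laplace_diff_le:
  assumes "integrable lborel \<psi>" "integrable lborel \<psi>'" "0 \<le> Re z"
  shows "cmod (laplace \<psi> z - laplace \<psi>' z) \<le> (LINT s|lborel. cmod (\<psi> s - \<psi>' s))"
proof -
  have "laplace \<psi> z - laplace \<psi>' z = (LINT s|lborel. indicator {0..} s * exp (- (z * complex_of_real s)) * (\<psi> s - \<psi>' s))"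
    unfolding laplace_def using integrable_laplace[OF assms(1,3)] integrable_laplace[OF assms(2,3)]
    by (simp add: right_diff_distrib)
  also have "cmod \<dots> \<le> (LINT s|lborel. cmod (indicator {0..} s * exp (- (z * complex_of_real s)) * (\<psi> s - \<psi>' s)))"
    by (rule integral_norm_bound)
  also have "\<dots> \<le> (LINT s|lborel. cmod (\<psi> s - \<psi>' s))"
  proof (rule integral_mono)
    show "integrable lborel (\<lambda>s. cmod (indicator {0..} s * exp (- (z * complex_of_real s)) * (\<psi> s - \<psi>' s)))"
      by (intro integrable_norm integrable_laplace Bochner_Integration.integrable_diff assms)
    show "integrable lborel (\<lambda>s. cmod (\<psi> s - \<psi>' s))"
      by (intro integrable_norm Bochner_Integration.integrable_diff assms)
    show "cmod (indicator {0..} s * exp (- (z * complex_of_real s)) * (\<psi> s - \<psi>' s)) \<le> cmod (\<psi> s - \<psi>' s)" for s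
      unfolding norm_mult[of "indicator {0..} s * exp (- (z * complex_of_real s))"]
      using norm_laplace_factor[OF assms(3), of s] by (intro mult_left_le_one_le) auto
  qed
  finally show ?thesis .
qed

lemma tendsto_laplace_argument:
  assumes \<psi>: "integrable lborel \<psi>" and z: "z \<longlonglongrightarrow> z0" "\<And>n. 0 \<le> Re (z n)"
  shows "(\<lambda>n. laplace \<psi> (z n)) \<longlonglongrightarrow> laplace \<psi> z0"
  unfolding laplace_def
proof (rule integral_dominated_convergence[where w="\<lambda>s. cmod (\<psi> s)"])
  have [measurable]: "\<psi> \<in> borel_measurable borel" using \<psi> by auto
  show "(\<lambda>s. indicator {0..} s * exp (- (z n * complex_of_real s)) * \<psi> s) \<in> borel_measurable lborel" for n
    by measurable
  show "(\<lambda>s. indicator {0..} s * exp (- (z0 * complex_of_real s)) * \<psi> s) \<in> borel_measurable lborel"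
    by measurable
  show "AE s in lborel. (\<lambda>n. indicator {0..} s * exp (- (z n * complex_of_real s)) * \<psi> s)
     \<longlonglongrightarrow> indicator {0..} s * exp (- (z0 * complex_of_real s)) * \<psi> s"
    by (intro always_eventually allI tendsto_intros z)
  show "AE s in lborel. cmod (indicator {0..} s * exp (- (z n * complex_of_real s)) * \<psi> s) \<le> cmod (\<psi> s)" for n
  proof (intro always_eventually allI)
    fix s
    show "cmod (indicator {0..} s * exp (- (z n * complex_of_real s)) * \<psi> s) \<le> cmod (\<psi> s)"
      unfolding norm_mult[of "indicator {0..} s * exp (- (z n * complex_of_real s))"]
      using norm_laplace_factor[OF z(2)[of n], of s] by (intro mult_left_le_one_le) auto
  qed
qed (use \<psi> in auto)

text \<open>The multiplier being bounded by 1, \<open>L\<^sup>1\<close> convergence of the integrands is uniform over the half plane.\<close>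

lemma
  assumes \<psi>: "integrable lborel \<psi>" "\<And>n. integrable lborel (\<psi>s n)"
    and L1: "(\<lambda>n. LINT s|lborel. cmod (\<psi>s n s - \<psi> s)) \<longlonglongrightarrow> 0" and re: "\<And>n. 0 \<le> Re (z n)"
  shows tendsto_laplace: "z \<longlonglongrightarrow> z0 \<Longrightarrow> (\<lambda>n. laplace (\<psi>s n) (z n)) \<longlonglongrightarrow> laplace \<psi> z0"
    and tendsto_laplace_infinity: "filterlim z at_infinity sequentially \<Longrightarrow> (\<lambda>n. laplace (\<psi>s n) (z n)) \<longlonglongrightarrow> 0"
proof -
  have "(\<lambda>n. laplace (\<psi>s n) (z n) - laplace \<psi> (z n)) \<longlonglongrightarrow> 0"
    by (rule Lim_null_comparison[OF always_eventually L1]) (auto intro: norm_laplace_diff_le \<psi> re)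
  note add = tendsto_add[OF this]
  show "(\<lambda>n. laplace (\<psi>s n) (z n)) \<longlonglongrightarrow> laplace \<psi> z0" if "z \<longlonglongrightarrow> z0"
    using add[OF tendsto_laplace_argument[OF \<psi>(1) that re]] by simp
  show "(\<lambda>n. laplace (\<psi>s n) (z n)) \<longlonglongrightarrow> 0" if "filterlim z at_infinity sequentially"
    using add[OF riemann_lebesgue_half_plane[OF \<psi>(1) that re, folded laplace_def]] by simp
qed

lemma norm_exp_diff_le:
  assumes c: "0 < c" "c \<le> Re w" "c \<le> Re z" and s: "0 \<le> s"
  shows "cmod (exp (- (w * complex_of_real s)) - exp (- (z * complex_of_real s))) \<le> 1 / c * cmod (w - z)"
proof (rule field_differentiable_bound[of "{z. c \<le> Re z}" "\<lambda>w. exp (- (w * complex_of_real s))" "\<lambda>w. - (complex_of_real s * exp (- (w * complex_of_real s)))"])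
  show "convex {z. c \<le> Re z}" by (rule convex_halfspace_Re_ge)
  fix w assume w: "w \<in> {z. c \<le> Re z}"
  show "((\<lambda>w. exp (- (w * complex_of_real s))) has_field_derivative - (complex_of_real s * exp (- (w * complex_of_real s)))) (at w within {z. c \<le> Re z})"
    by (auto intro!: derivative_eq_intros)
  have "c * s \<le> exp (c * s)" using exp_ge_add_one_self[of "c * s"] by linarith
  also have "\<dots> \<le> exp (Re w * s)" using w s by (auto intro!: mult_right_mono)
  finally have "s * exp (- (Re w * s)) \<le> 1 / c" using c by (simp add: exp_minus field_simps)
  then show "cmod (- (complex_of_real s * exp (- (w * complex_of_real s)))) \<le> 1 / c"
    using s by (simp add: norm_mult)
qed (use c in auto)

text \<open>Differentiation under the integral sign: on \<open>c \<le> Re z\<close>, the difference quotients of the exponential are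
  bounded by \<open>1 / c\<close> for all \<open>s \<ge> 0\<close>.\<close>

lemma laplace_holomorphic:
  assumes \<psi>: "integrable lborel \<psi>"
  shows "laplace \<psi> holomorphic_on {z. 0 < Re z}"
proof (rule holomorphic_onI)
  have [measurable]: "\<psi> \<in> borel_measurable borel" using \<psi> by auto
  fix z assume "z \<in> {z. 0 < Re z}"
  then have z: "0 < Re z" by simp
  define c where "c = Re z / 2"
  have c: "0 < c" using z by (simp add: c_def)
  define D where "D = (LINT s|lborel. indicator {0..} s * (- (complex_of_real s * exp (- (z * complex_of_real s)))) * \<psi> s)"
  have "((\<lambda>h. (laplace \<psi> (z + h) - laplace \<psi> z) / h) \<longlongrightarrow> D) (at 0)"
    unfolding tendsto_at_iff_sequentially comp_def
  proof (intro allI impI)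
    fix h :: "nat \<Rightarrow> complex" assume h: "\<forall>n. h n \<in> UNIV - {0}" "h \<longlonglongrightarrow> 0"
    have "\<forall>\<^sub>F n in sequentially. cmod (h n) < c"
      using tendsto_norm[OF h(2)] c by (intro order_tendstoD(2)) auto
    then obtain n0 where n0: "\<And>n. n0 \<le> n \<Longrightarrow> cmod (h n) < c" by (auto simp: eventually_sequentially)
    define k where "k n = h (n + n0)" for n
    have k: "k n \<noteq> 0" "cmod (k n) < c" for n using h(1) n0 by (auto simp: k_def)
    have k0: "k \<longlonglongrightarrow> 0" unfolding k_def using h(2) by (rule LIMSEQ_ignore_initial_segment)
    have re: "c \<le> Re (z + k n)" for n
      using k(2)[of n] abs_Re_le_cmod[of "k n"] by (simp add: c_def)
    have re': "0 \<le> Re (z + k n)" for n using re[of n] c by linarith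
    have "(\<lambda>n. LINT s|lborel. indicator {0..} s * ((exp (- ((z + k n) * complex_of_real s)) - exp (- (z * complex_of_real s))) / k n) * \<psi> s) \<longlonglongrightarrow> D"
      unfolding D_def
    proof (rule integral_dominated_convergence[where w="\<lambda>s. 1 / c * cmod (\<psi> s)"])
      show "AE s in lborel. (\<lambda>n. indicator {0..} s * ((exp (- ((z + k n) * complex_of_real s)) - exp (- (z * complex_of_real s))) / k n) * \<psi> s)
        \<longlonglongrightarrow> indicator {0..} s * (- (complex_of_real s * exp (- (z * complex_of_real s)))) * \<psi> s"
      proof (intro always_eventually allI tendsto_intros)
        fix s :: real
        have "((\<lambda>w. exp (- (w * complex_of_real s))) has_field_derivative - (complex_of_real s * exp (- (z * complex_of_real s)))) (at z)"
          by (auto intro!: derivative_eq_intros)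
        then show "(\<lambda>n. (exp (- ((z + k n) * complex_of_real s)) - exp (- (z * complex_of_real s))) / k n) \<longlonglongrightarrow> - (complex_of_real s * exp (- (z * complex_of_real s)))"
          unfolding DERIV_def tendsto_at_iff_sequentially comp_def using k k0 by simp
      qed
      show "AE s in lborel. cmod (indicator {0..} s * ((exp (- ((z + k n) * complex_of_real s)) - exp (- (z * complex_of_real s))) / k n) * \<psi> s) \<le> 1 / c * cmod (\<psi> s)" for n
      proof (intro always_eventually allI)
        fix s :: real
        show "cmod (indicator {0..} s * ((exp (- ((z + k n) * complex_of_real s)) - exp (- (z * complex_of_real s))) / k n) * \<psi> s) \<le> 1 / c * cmod (\<psi> s)"
        proof (cases "0 \<le> s")
          case True
          have "cmod (exp (- ((z + k n) * complex_of_real s)) - exp (- (z * complex_of_real s))) \<le> 1 / c * cmod (z + k n - z)"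
            using c re[of n] True by (intro norm_exp_diff_le) (auto simp: c_def)
          then have "cmod ((exp (- ((z + k n) * complex_of_real s)) - exp (- (z * complex_of_real s))) / k n) \<le> 1 / c"
            using k(1)[of n] by (simp add: norm_divide field_simps)
          then have "cmod ((exp (- ((z + k n) * complex_of_real s)) - exp (- (z * complex_of_real s))) / k n) * cmod (\<psi> s) \<le> 1 / c * cmod (\<psi> s)"
            by (rule mult_right_mono) simp
          then show ?thesis using True by (simp add: norm_mult norm_divide)
        qed (use c in auto)
      qed
      show "integrable lborel (\<lambda>s. 1 / c * cmod (\<psi> s))" using \<psi> by auto
    qed measurable
    also have "(\<lambda>n. LINT s|lborel. indicator {0..} s * ((exp (- ((z + k n) * complex_of_real s)) - exp (- (z * complex_of_real s))) / k n) * \<psi> s)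
       = (\<lambda>n. (laplace \<psi> (z + k n) - laplace \<psi> z) / k n)"
    proof
      fix n
      have "(laplace \<psi> (z + k n) - laplace \<psi> z) / k n = 
        (LINT s|lborel. (indicator {0..} s * exp (- ((z + k n) * complex_of_real s)) * \<psi> s - indicator {0..} s * exp (- (z * complex_of_real s)) * \<psi> s) / k n)"
        unfolding laplace_def using integrable_laplace[OF \<psi> re'[of n]] integrable_laplace[OF \<psi>, of z] z by simp
      also have "\<dots> = (LINT s|lborel. indicator {0..} s * ((exp (- ((z + k n) * complex_of_real s)) - exp (- (z * complex_of_real s))) / k n) * \<psi> s)"
        by (intro Bochner_Integration.integral_cong refl) (simp add: field_simps)
      finally show "(LINT s|lborel. indicator {0..} s * ((exp (- ((z + k n) * complex_of_real s)) - exp (- (z * complex_of_real s))) / k n) * \<psi> s)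
         = (laplace \<psi> (z + k n) - laplace \<psi> z) / k n" ..
    qed
    finally show "(\<lambda>n. (laplace \<psi> (z + h n) - laplace \<psi> z) / h n) \<longlonglongrightarrow> D"
      unfolding k_def by (rule LIMSEQ_offset)
  qed
  then have "(laplace \<psi> has_field_derivative D) (at z)" by (simp add: DERIV_def)
  then show "laplace \<psi> field_differentiable at z within {z. 0 < Re z}"
    by (auto simp: field_differentiable_def intro: has_field_derivative_at_within)
qed

text \<open>The points where \<open>f\<close> is real and at most \<open>- 1\<close> form a compact set, because \<open>f\<close> vanishes at infinity. If it were
  nonempty, \<open>f\<close> would attain a smallest value on it, in the open half plane by the boundary condition. But there
  \<open>f\<close> is an open map, so it takes values further to the left on the real axis.\<close>

lemma half_plane_avoids_slit:
  fixes f :: "complex \<Rightarrow> complex"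
  assumes hol: "f holomorphic_on {z. 0 < Re z}" and cont: "continuous_on {z. 0 \<le> Re z} f"
    and inf: "\<And>z :: nat \<Rightarrow> complex. (\<And>n. 0 \<le> Re (z n)) \<Longrightarrow> filterlim z at_infinity sequentially \<Longrightarrow> (\<lambda>n. f (z n)) \<longlonglongrightarrow> 0"
    and bdry: "\<And>b. Im (f (Complex 0 b)) = 0 \<Longrightarrow> -1 < Re (f (Complex 0 b))"
    and z: "0 \<le> Re z"
  shows "f z \<noteq> -1"
proof
  assume fz: "f z = -1"
  define Z where "Z = {z. 0 \<le> Re z} \<inter> f -` {w. Im w = 0 \<and> Re w \<le> -1}"
  have "closed {w. Im w = 0 \<and> Re w \<le> -1}"
    by (intro closed_Collect_conj closed_Collect_eq closed_Collect_le continuous_intros)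
  then have "closed Z"
    unfolding Z_def by (rule continuous_closed_preimage[OF cont closed_halfspace_Re_ge])
  moreover have "bounded Z"
  proof (rule ccontr)
    assume "\<not> bounded Z"
    then have nb: "\<not> (\<forall>x\<in>Z. cmod x \<le> a)" for a by (auto simp: bounded_iff)
    have "\<exists>w. w \<in> Z \<and> real n < cmod w" for n :: nat using nb[of "real n"] by (auto simp: not_le)
    then obtain y where y: "\<And>n. y n \<in> Z" "\<And>n :: nat. real n < cmod (y n)" by metis
    have "filterlim (\<lambda>n. cmod (y n)) at_top sequentially"
      by (rule filterlim_at_top_mono[OF filterlim_real_sequentially]) (intro always_eventually allI less_imp_le y(2))
    then have "filterlim y at_infinity sequentially" by (simp add: filterlim_at_infinity_conv_norm_at_top)
    then have "(\<lambda>n. f (y n)) \<longlonglongrightarrow> 0" using y(1) by (intro inf) (auto simp: Z_def)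
    from tendsto_Re[OF this] have "(\<lambda>n. Re (f (y n))) \<longlonglongrightarrow> 0" by simp
    then have "0 \<le> (-1 :: real)" by (rule LIMSEQ_le_const2) (use y(1) in \<open>auto simp: Z_def\<close>)
    then show False by simp
  qed
  ultimately have "compact Z" by (simp add: compact_eq_bounded_closed)
  moreover have "z \<in> Z" using z fz by (simp add: Z_def)
  moreover have "continuous_on Z (\<lambda>w. Re (f w))"
    by (intro continuous_intros continuous_on_subset[OF cont]) (auto simp: Z_def)
  ultimately have "\<exists>z0\<in>Z. \<forall>w\<in>Z. Re (f z0) \<le> Re (f w)"
    by (intro continuous_attains_inf) auto
  then obtain z0 where z0: "z0 \<in> Z" "\<And>w. w \<in> Z \<Longrightarrow> Re (f z0) \<le> Re (f w)" by auto
  have re0: "0 < Re z0"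
  proof (rule ccontr)
    assume "\<not> 0 < Re z0"
    then have "z0 = Complex 0 (Im z0)" using z0(1) by (simp add: Z_def complex_eq_iff)
    then show False using bdry[of "Im z0"] z0(1) by (auto simp: Z_def)
  qed
  have op: "open {z. 0 < Re z}" by (rule open_halfspace_Re_gt)
  have nc: "\<not> f constant_on {z. 0 < Re z}"
  proof
    assume "f constant_on {z. 0 < Re z}"
    then obtain a where a: "\<And>w. 0 < Re w \<Longrightarrow> f w = a" by (auto simp: constant_on_def)
    have "filterlim (\<lambda>n. complex_of_real (real (Suc n))) at_infinity sequentially"
      unfolding filterlim_at_infinity_conv_norm_at_top norm_of_real
      by (rule filterlim_at_top_mono[OF filterlim_real_sequentially]) (intro always_eventually allI, simp)
    then have "(\<lambda>n. f (complex_of_real (real (Suc n)))) \<longlonglongrightarrow> 0" by (intro inf) auto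
    then have "(\<lambda>n :: nat. a) \<longlonglongrightarrow> 0" using a by simp
    then have "a = 0" by (simp add: LIMSEQ_const_iff)
    then show False using a[OF re0] z0(1) by (auto simp: Z_def)
  qed
  have "open (f ` {z. 0 < Re z})"
    by (rule open_mapping_thm[OF hol op _ op order_refl nc]) (intro convex_connected convex_halfspace_Re_gt)
  moreover have "f z0 \<in> f ` {z. 0 < Re z}" using re0 by auto
  ultimately obtain \<epsilon> where \<epsilon>: "0 < \<epsilon>" "ball (f z0) \<epsilon> \<subseteq> f ` {z. 0 < Re z}" by (auto simp: open_contains_ball)
  have "f z0 - complex_of_real (\<epsilon> / 2) \<in> ball (f z0) \<epsilon>" using \<epsilon>(1) by (simp add: dist_norm)
  from subsetD[OF \<epsilon>(2) this] obtain w where w: "0 < Re w" "f w = f z0 - complex_of_real (\<epsilon> / 2)"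
    by (auto simp: image_iff)
  then have "w \<in> Z" using z0(1) \<epsilon>(1) by (auto simp: Z_def)
  from z0(2)[OF this] w(2) \<epsilon>(1) show False by simp
qed

section \<open>Principal values and the Hilbert transform\<close>

lemma integrable_indicator_bounded:
  fixes f :: "real \<Rightarrow> 'b :: {banach, second_countable_topology}"
  assumes [measurable]: "A \<in> sets borel" "f \<in> borel_measurable borel" and A: "A \<subseteq> {a..b}" and bd: "\<And>x. x \<in> A \<Longrightarrow> norm (f x) \<le> B"
  shows "integrable lborel (\<lambda>x. indicator A x *\<^sub>R f x)"
proof (rule Bochner_Integration.integrable_bound)
  show "integrable lborel (\<lambda>x. indicator {a..b} x * \<bar>B\<bar>)"
    by (intro integrable_mult_left integrable_real_indicator) (auto simp: emeasure_lborel_Icc_eq)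
  show "AE x in lborel. norm (indicator A x *\<^sub>R f x) \<le> norm (indicator {a..b} x * \<bar>B\<bar>)"
  proof (intro AE_I2)
    fix x
    show "norm (indicator A x *\<^sub>R f x) \<le> norm (indicator {a..b} x * \<bar>B\<bar>)"
      using A bd[of x] by (cases "x \<in> A") (auto simp: subset_iff)
  qed
qed measurable

lemma LBINT_reflect:
  fixes f :: "real \<Rightarrow> 'b :: {banach, second_countable_topology}"
  shows "(LINT x|lborel. f (- x)) = (LINT x|lborel. f x)"
  using lborel_integral_real_affine[of "-1" f 0] by simp

text \<open>The even part of \<open>cis (- (s q))\<close> cancels against \<open>1 / q\<close>; the odd part gives sine integrals.\<close>

lemma truncated_hilbert_kernel:
  assumes \<epsilon>: "0 < \<epsilon>" "\<epsilon> \<le> N"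
  shows "(LINT q|lborel. indicator {q. \<epsilon> < \<bar>q\<bar> \<and> \<bar>q\<bar> \<le> N} q *\<^sub>R (cis (- (s * q)) / complex_of_real q))
     = - 2 * \<i> * complex_of_real (sgn s * (Si (N * \<bar>s\<bar>) - Si (\<epsilon> * \<bar>s\<bar>)))"
proof -
  define f where "f q = cis (- (s * q)) / complex_of_real q" for q
  define A where "A = {\<epsilon><..N}"
  have [measurable]: "f \<in> borel_measurable borel" unfolding f_def by measurable
  have i1: "integrable lborel (\<lambda>q. indicator A q *\<^sub>R f q)"
    by (rule integrable_indicator_bounded[where a=\<epsilon> and b=N and B="1 / \<epsilon>"])
      (use \<epsilon> in \<open>auto simp: A_def f_def norm_divide frac_le\<close>)
  have i2: "integrable lborel (\<lambda>q. indicator A q *\<^sub>R f (- q))"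
    by (rule integrable_indicator_bounded[where a=\<epsilon> and b=N and B="1 / \<epsilon>"])
      (use \<epsilon> in \<open>auto simp: A_def f_def norm_divide frac_le\<close>)
  have i3: "integrable lborel (\<lambda>q. indicator A (- q) *\<^sub>R f q)"
    using lborel_integrable_real_affine[OF i2, of "-1" 0] by simp
  have sinI: "(LINT q|lborel. indicator A q *\<^sub>R (sin (q * s) / q)) = sgn s * (Si (N * \<bar>s\<bar>) - Si (\<epsilon> * \<bar>s\<bar>))"
  proof -
    have "(LINT q|lborel. indicator A q *\<^sub>R (sin (q * s) / q)) = (LBINT q=ereal \<epsilon>..ereal N. sin (q * s) / q)"
      using \<epsilon> by (simp add: interval_integral_Ioc A_def set_lebesgue_integral_def)
    also have "\<dots> = (LBINT q=ereal 0..ereal N. sin (q * s) / q) - (LBINT q=ereal 0..ereal \<epsilon>. sin (q * s) / q)"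
      using interval_integral_sum[of "ereal 0" "ereal \<epsilon>" "ereal N" "\<lambda>q. sin (q * s) / q"] \<epsilon> integrable_sinc'[of N s]
      by (simp add: min_def max_def)
    also have "\<dots> = sgn s * Si (N * \<bar>s\<bar>) - sgn s * Si (\<epsilon> * \<bar>s\<bar>)"
      using LBINT_I0c_sin_scale_divide[of N s] LBINT_I0c_sin_scale_divide[of \<epsilon> s] \<epsilon> by (simp add: zero_ereal_def)
    finally show ?thesis by (simp add: right_diff_distrib)
  qed
  have "(LINT q|lborel. indicator {q. \<epsilon> < \<bar>q\<bar> \<and> \<bar>q\<bar> \<le> N} q *\<^sub>R f q) = (LINT q|lborel. indicator A q *\<^sub>R f q + indicator A (- q) *\<^sub>R f q)"
    using AE_lborel_singleton[of "- \<epsilon>"] AE_lborel_singleton[of "- N"] \<epsilon>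
    by (intro integral_cong_AE) (auto simp: A_def indicator_def)
  also have "\<dots> = (LINT q|lborel. indicator A q *\<^sub>R f q) + (LINT q|lborel. indicator A (- q) *\<^sub>R f q)"
    by (rule Bochner_Integration.integral_add[OF i1 i3])
  also have "(LINT q|lborel. indicator A (- q) *\<^sub>R f q) = (LINT q|lborel. indicator A q *\<^sub>R f (- q))"
    using LBINT_reflect[of "\<lambda>q. indicator A q *\<^sub>R f (- q)"] by simp
  also have "(LINT q|lborel. indicator A q *\<^sub>R f q) + (LINT q|lborel. indicator A q *\<^sub>R f (- q)) = (LINT q|lborel. indicator A q *\<^sub>R f q + indicator A q *\<^sub>R f (- q))"
    by (rule Bochner_Integration.integral_add[OF i1 i2, symmetric])
  also have "\<dots> = (LINT q|lborel. (- 2 * \<i>) * complex_of_real (indicator A q *\<^sub>R (sin (q * s) / q)))"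
  proof (rule Bochner_Integration.integral_cong[OF refl])
    fix q :: real
    have "cis (- (s * q)) - cis (s * q) = - 2 * \<i> * complex_of_real (sin (q * s))"
      by (simp add: complex_eq_iff mult.commute)
    then have "f q + f (- q) = - 2 * \<i> * complex_of_real (sin (q * s)) / complex_of_real q"
      unfolding f_def by (simp add: diff_divide_distrib[symmetric])
    then show "indicator A q *\<^sub>R f q + indicator A q *\<^sub>R f (- q) = (- 2 * \<i>) * complex_of_real (indicator A q *\<^sub>R (sin (q * s) / q))"
      by (cases "q \<in> A") simp_all
  qed
  also have "\<dots> = (- 2 * \<i>) * complex_of_real (LINT q|lborel. indicator A q *\<^sub>R (sin (q * s) / q))"
    by (simp only: integral_mult_right_zero integral_complex_of_real)
  finally show ?thesis unfolding sinI f_def .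
qed

lemma truncated_hilbert_transform:
  fixes \<phi> :: "real \<Rightarrow> complex"
  assumes \<phi>: "integrable lborel \<phi>" and \<epsilon>: "0 < \<epsilon>" "\<epsilon> \<le> N"
  defines "F \<equiv> \<lambda>p. LINT s|lborel. cis (- (s * p)) * \<phi> s"
  shows "(LINT p|lborel. indicator {p. \<epsilon> < \<bar>p - b\<bar> \<and> \<bar>p - b\<bar> \<le> N} p *\<^sub>R (F p / complex_of_real (p - b)))
     = (LINT s|lborel. cis (- (s * b)) * \<phi> s * (- 2 * \<i> * complex_of_real (sgn s * (Si (N * \<bar>s\<bar>) - Si (\<epsilon> * \<bar>s\<bar>)))))"
proof -
  have [measurable]: "\<phi> \<in> borel_measurable borel" using \<phi> by auto
  let ?A = "{p. \<epsilon> < \<bar>p - b\<bar> \<and> \<bar>p - b\<bar> \<le> N}"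
  define k where "k p = indicator ?A p *\<^sub>R (1 / complex_of_real (p - b))" for p
  have [measurable]: "k \<in> borel_measurable borel" unfolding k_def by measurable
  have k: "integrable lborel k"
    unfolding k_def
    by (rule integrable_indicator_bounded[where a="b - N" and b="b + N" and B="1 / \<epsilon>"])
      (use \<epsilon> in \<open>auto simp: norm_divide abs_le_iff abs_if intro!: frac_le simp flip: of_real_diff\<close>)
  define q where "q p s = k p * (cis (- (s * p)) * \<phi> s)" for p s
  have q: "integrable (lborel \<Otimes>\<^sub>M lborel) (\<lambda>(p, s). q p s)"
  proof (rule Bochner_Integration.integrable_bound[OF integrable_pair_mult[OF sigma_finite_lborel sigma_finite_lborel k \<phi>]])
    show "(\<lambda>(p, s). q p s) \<in> borel_measurable (lborel \<Otimes>\<^sub>M lborel)" unfolding q_def by measurable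
  qed (auto simp: q_def norm_mult)
  have "(LINT p|lborel. indicator ?A p *\<^sub>R (F p / complex_of_real (p - b))) = (LINT p|lborel. LINT s|lborel. q p s)"
  proof (rule Bochner_Integration.integral_cong[OF refl])
    fix p :: real
    have "(LINT s|lborel. q p s) = k p * F p" unfolding q_def F_def by (rule integral_mult_right_zero)
    then show "indicator ?A p *\<^sub>R (F p / complex_of_real (p - b)) = (LINT s|lborel. q p s)"
      by (simp add: k_def scaleR_conv_of_real)
  qed
  also have "\<dots> = (LINT s|lborel. LINT p|lborel. q p s)"
    by (rule lborel_pair.Fubini_integral[OF q, symmetric])
  also have "\<dots> = (LINT s|lborel. cis (- (s * b)) * \<phi> s * (- 2 * \<i> * complex_of_real (sgn s * (Si (N * \<bar>s\<bar>) - Si (\<epsilon> * \<bar>s\<bar>)))))"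
  proof (rule Bochner_Integration.integral_cong[OF refl])
    fix s :: real
    have "(LINT p|lborel. q p s) = (LINT p|lborel. q (b + 1 * p) s)"
      using lborel_integral_real_affine[of 1 "\<lambda>p. q p s" b] by simp
    also have "\<dots> = (LINT p|lborel. cis (- (s * b)) * \<phi> s * (indicator {q. \<epsilon> < \<bar>q\<bar> \<and> \<bar>q\<bar> \<le> N} p *\<^sub>R (cis (- (s * p)) / complex_of_real p)))"
    proof (rule Bochner_Integration.integral_cong[OF refl])
      fix p :: real
      have "- (s * (b + 1 * p)) = - (s * b) + - (s * p)" by (simp add: algebra_simps)
      then have c: "cis (- (s * (b + 1 * p))) = cis (- (s * b)) * cis (- (s * p))" by (simp only: cis_mult)
      show "q (b + 1 * p) s = cis (- (s * b)) * \<phi> s * (indicator {q. \<epsilon> < \<bar>q\<bar> \<and> \<bar>q\<bar> \<le> N} p *\<^sub>R (cis (- (s * p)) / complex_of_real p))"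
        unfolding q_def c k_def by (simp add: indicator_def)
    qed
    also have "\<dots> = cis (- (s * b)) * \<phi> s * (- 2 * \<i> * complex_of_real (sgn s * (Si (N * \<bar>s\<bar>) - Si (\<epsilon> * \<bar>s\<bar>))))"
      unfolding integral_mult_right_zero truncated_hilbert_kernel[OF \<epsilon>] ..
    finally show "(LINT p|lborel. q p s) = cis (- (s * b)) * \<phi> s * (- 2 * \<i> * complex_of_real (sgn s * (Si (N * \<bar>s\<bar>) - Si (\<epsilon> * \<bar>s\<bar>))))" .
  qed
  finally show ?thesis .
qed

text \<open>The principal value integral against \<open>1 / (p - b)\<close> acts on the Fourier side as the multiplier \<open>- \<i> \<pi> sgn s\<close>.
  By Fubini's theorem, the doubly truncated integral carries \<open>Si (N |s|) - Si (\<epsilon> |s|)\<close> in place of \<open>\<pi> / 2\<close>.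
  As \<open>Si\<close> is bounded, dominated convergence lets \<open>N\<close> tend to infinity and then \<open>\<epsilon>\<close> to 0.\<close>

lemma hilbert_transform_tendsto:
  fixes \<phi> :: "real \<Rightarrow> complex"
  assumes \<phi>: "integrable lborel \<phi>"
  defines "F \<equiv> \<lambda>p. LINT s|lborel. cis (- (s * p)) * \<phi> s"
  assumes int: "\<And>\<epsilon>. 0 < \<epsilon> \<Longrightarrow> integrable lborel (\<lambda>p. indicator {p. \<epsilon> < \<bar>p - b\<bar>} p *\<^sub>R (F p / complex_of_real (p - b)))"
  shows "((\<lambda>\<epsilon>. LINT p|lborel. indicator {p. \<epsilon> < \<bar>p - b\<bar>} p *\<^sub>R (F p / complex_of_real (p - b)))
     \<longlongrightarrow> - \<i> * complex_of_real pi * (LINT s|lborel. complex_of_real (sgn s) * (cis (- (s * b)) * \<phi> s))) (at_right 0)"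
proof -
  have [measurable]: "\<phi> \<in> borel_measurable borel" using \<phi> by auto
  obtain B where B: "\<And>T. \<bar>Si T\<bar> \<le> B" using bounded_Si by auto
  have B0: "0 \<le> B" using B[of 0] by linarith
  let ?T = "\<lambda>\<epsilon>. LINT p|lborel. indicator {p. \<epsilon> < \<bar>p - b\<bar>} p *\<^sub>R (F p / complex_of_real (p - b))"
  let ?R = "\<lambda>x \<epsilon>. LINT s|lborel. cis (- (s * b)) * \<phi> s * (- 2 * \<i> * complex_of_real (sgn s * (x s - Si (\<epsilon> * \<bar>s\<bar>))))"
  \<comment> \<open>The value \<open>x\<close> is either \<open>Si (N |s|)\<close> or its limit \<open>\<pi> / 2\<close>; the summand \<open>\<pi>\<close> covers the latter.\<close>
  have dom: "cmod (cis (- (s * b)) * \<phi> s * (- 2 * \<i> * complex_of_real (sgn s * (x - Si y)))) \<le> 2 * (B + pi + B) * cmod (\<phi> s)"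
    if "\<bar>x\<bar> \<le> B + pi" for s x y
  proof -
    have "\<bar>sgn s\<bar> \<le> 1" by (simp add: sgn_if)
    moreover have "\<bar>x - Si y\<bar> \<le> B + pi + B" using that B[of y] by linarith
    ultimately have "\<bar>sgn s * (x - Si y)\<bar> \<le> 1 * (B + pi + B)" unfolding abs_mult by (intro mult_mono) auto
    then have "cmod (\<phi> s) * (2 * \<bar>sgn s * (x - Si y)\<bar>) \<le> cmod (\<phi> s) * (2 * (B + pi + B))" by (intro mult_left_mono) auto
    moreover have nrm: "cmod (cis (- (s * b)) * \<phi> s * (- 2 * \<i> * complex_of_real y)) = cmod (\<phi> s) * (2 * \<bar>y\<bar>)" for y
      by (simp add: norm_mult)
    ultimately show ?thesis unfolding nrm by (simp only: mult.commute[of "cmod (\<phi> s)" "2 * (B + pi + B)"])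
  qed
  have Fm [measurable]: "F \<in> borel_measurable borel" unfolding F_def by measurable
  have eq: "?T \<epsilon> = ?R (\<lambda>s. pi / 2) \<epsilon>" if \<epsilon>: "0 < \<epsilon>" for \<epsilon>
  proof -
    define N where "N n = \<epsilon> + real n" for n
    have N: "filterlim N at_top sequentially" unfolding N_def
      by (rule filterlim_tendsto_add_at_top[OF tendsto_const filterlim_real_sequentially])
    have "(\<lambda>n. LINT p|lborel. indicator {p. \<epsilon> < \<bar>p - b\<bar> \<and> \<bar>p - b\<bar> \<le> N n} p *\<^sub>R (F p / complex_of_real (p - b))) \<longlonglongrightarrow> ?T \<epsilon>"
    proof (rule integral_dominated_convergence)
      show "integrable lborel (\<lambda>p. cmod (indicator {p. \<epsilon> < \<bar>p - b\<bar>} p *\<^sub>R (F p / complex_of_real (p - b))))"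
        by (rule integrable_norm[OF int[OF \<epsilon>]])
      show "AE p in lborel. (\<lambda>n. indicator {p. \<epsilon> < \<bar>p - b\<bar> \<and> \<bar>p - b\<bar> \<le> N n} p *\<^sub>R (F p / complex_of_real (p - b)))
         \<longlonglongrightarrow> indicator {p. \<epsilon> < \<bar>p - b\<bar>} p *\<^sub>R (F p / complex_of_real (p - b))"
      proof (intro AE_I2 tendsto_eventually)
        fix p
        have "\<forall>\<^sub>F n in sequentially. \<bar>p - b\<bar> \<le> N n" using N by (simp add: filterlim_at_top)
        then show "\<forall>\<^sub>F n in sequentially. indicator {p. \<epsilon> < \<bar>p - b\<bar> \<and> \<bar>p - b\<bar> \<le> N n} p *\<^sub>R (F p / complex_of_real (p - b))
          = indicator {p. \<epsilon> < \<bar>p - b\<bar>} p *\<^sub>R (F p / complex_of_real (p - b))"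
          by eventually_elim (simp add: indicator_def)
      qed
      show "AE p in lborel. norm (indicator {p. \<epsilon> < \<bar>p - b\<bar> \<and> \<bar>p - b\<bar> \<le> N n} p *\<^sub>R (F p / complex_of_real (p - b)))
         \<le> cmod (indicator {p. \<epsilon> < \<bar>p - b\<bar>} p *\<^sub>R (F p / complex_of_real (p - b)))" for n
        by (intro AE_I2) (simp add: indicator_def)
    qed measurable
    moreover have "(LINT p|lborel. indicator {p. \<epsilon> < \<bar>p - b\<bar> \<and> \<bar>p - b\<bar> \<le> N n} p *\<^sub>R (F p / complex_of_real (p - b)))
       = ?R (\<lambda>s. Si (N n * \<bar>s\<bar>)) \<epsilon>" for n
      unfolding F_def by (rule truncated_hilbert_transform[OF \<phi> \<epsilon>]) (simp add: N_def)
    ultimately have "(\<lambda>n. ?R (\<lambda>s. Si (N n * \<bar>s\<bar>)) \<epsilon>) \<longlonglongrightarrow> ?T \<epsilon>" by (simp only:)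
    moreover have "(\<lambda>n. ?R (\<lambda>s. Si (N n * \<bar>s\<bar>)) \<epsilon>) \<longlonglongrightarrow> ?R (\<lambda>s. pi / 2) \<epsilon>"
    proof (rule integral_dominated_convergence[where w="\<lambda>s. 2 * (B + pi + B) * cmod (\<phi> s)"])
      show "integrable lborel (\<lambda>s. 2 * (B + pi + B) * cmod (\<phi> s))" using \<phi> by auto
      show "AE s in lborel. (\<lambda>n. cis (- (s * b)) * \<phi> s * (- 2 * \<i> * complex_of_real (sgn s * (Si (N n * \<bar>s\<bar>) - Si (\<epsilon> * \<bar>s\<bar>)))))
        \<longlonglongrightarrow> cis (- (s * b)) * \<phi> s * (- 2 * \<i> * complex_of_real (sgn s * (pi / 2 - Si (\<epsilon> * \<bar>s\<bar>))))"
      proof (intro AE_I2)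
        fix s :: real
        show "(\<lambda>n. cis (- (s * b)) * \<phi> s * (- 2 * \<i> * complex_of_real (sgn s * (Si (N n * \<bar>s\<bar>) - Si (\<epsilon> * \<bar>s\<bar>)))))
          \<longlonglongrightarrow> cis (- (s * b)) * \<phi> s * (- 2 * \<i> * complex_of_real (sgn s * (pi / 2 - Si (\<epsilon> * \<bar>s\<bar>))))"
        proof (cases "s = 0")
          case False
          have "(\<lambda>n. Si (N n * \<bar>s\<bar>)) \<longlonglongrightarrow> pi / 2"
            by (rule filterlim_compose[OF Si_at_top filterlim_at_top_mult_tendsto_pos[OF tendsto_const _ N]]) (use False in simp)
          then show ?thesis by (intro tendsto_intros)
        qed simp
      qed
      show "AE s in lborel. cmod (cis (- (s * b)) * \<phi> s * (- 2 * \<i> * complex_of_real (sgn s * (Si (N n * \<bar>s\<bar>) - Si (\<epsilon> * \<bar>s\<bar>)))))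
         \<le> 2 * (B + pi + B) * cmod (\<phi> s)" for n
        using B by (intro AE_I2 dom) (simp add: add_increasing2)
    qed measurable
    ultimately show ?thesis by (rule LIMSEQ_unique)
  qed
  have lim: "(?R (\<lambda>s. pi / 2) \<longlongrightarrow> ?R (\<lambda>s. pi / 2) 0) (at_right 0)"
  proof (rule tendsto_at_right_sequentially[of 0 1])
    fix S :: "nat \<Rightarrow> real" assume S: "S \<longlonglongrightarrow> 0"
    show "(\<lambda>n. ?R (\<lambda>s. pi / 2) (S n)) \<longlonglongrightarrow> ?R (\<lambda>s. pi / 2) 0"
    proof (rule integral_dominated_convergence[where w="\<lambda>s. 2 * (B + pi + B) * cmod (\<phi> s)"])
      show "integrable lborel (\<lambda>s. 2 * (B + pi + B) * cmod (\<phi> s))" using \<phi> by auto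
      show "AE s in lborel. (\<lambda>n. cis (- (s * b)) * \<phi> s * (- 2 * \<i> * complex_of_real (sgn s * (pi / 2 - Si (S n * \<bar>s\<bar>)))))
        \<longlonglongrightarrow> cis (- (s * b)) * \<phi> s * (- 2 * \<i> * complex_of_real (sgn s * (pi / 2 - Si (0 * \<bar>s\<bar>))))"
        by (intro AE_I2 tendsto_intros isCont_tendsto_compose[OF isCont_Si] S)
      show "AE s in lborel. cmod (cis (- (s * b)) * \<phi> s * (- 2 * \<i> * complex_of_real (sgn s * (pi / 2 - Si (S n * \<bar>s\<bar>)))))
         \<le> 2 * (B + pi + B) * cmod (\<phi> s)" for n
        using B0 by (intro AE_I2 dom) (simp add: field_simps)
    qed measurable
  qed simp
  have "Si 0 = 0" using Si_neg[of 0] by simp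
  then have "?R (\<lambda>s. pi / 2) 0 = (LINT s|lborel. (- \<i> * complex_of_real pi) * (complex_of_real (sgn s) * (cis (- (s * b)) * \<phi> s)))"
    by (intro Bochner_Integration.integral_cong refl) (simp add: mult_ac)
  also have "\<dots> = - \<i> * complex_of_real pi * (LINT s|lborel. complex_of_real (sgn s) * (cis (- (s * b)) * \<phi> s))"
    by (rule integral_mult_right_zero)
  finally have "(?R (\<lambda>s. pi / 2) \<longlongrightarrow> - \<i> * complex_of_real pi * (LINT s|lborel. complex_of_real (sgn s) * (cis (- (s * b)) * \<phi> s))) (at_right 0)"
    using lim by simp
  then show ?thesis
    by (rule Lim_transform_eventually) (rule eventually_mono[OF eventually_at_right_less], rule eq[symmetric])
qed

text \<open>The case \<open>X s = s\<close> and \<open>a = 1\<close> of \<open>fourier_line_L2_bound\<close>.\<close>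

lemma plancherel_le:
  fixes \<phi> :: "real \<Rightarrow> complex"
  assumes \<phi>: "integrable lborel \<phi>"
  shows "(\<integral>\<^sup>+ u. ennreal ((cmod (LINT s|lborel. cis (- (s * u)) * \<phi> s))\<^sup>2) \<partial>lborel)
    \<le> ennreal (2 * pi) * (\<integral>\<^sup>+ s. ennreal ((cmod (\<phi> s))\<^sup>2) \<partial>lborel)"
  using fourier_line_L2_bound[OF sigma_finite_lborel _ _ \<phi>, of "\<lambda>s. s" "\<lambda>_. 1" 1]
  by (simp add: mult.commute[of _ "_ :: real"])

text \<open>Away from \<open>b\<close>, \<open>|F| / |p - b|\<close> is at most \<open>|F|\<^sup>2 + 1 / (p - b)\<^sup>2\<close>.\<close>

lemma integrable_div_off_singularity:
  fixes F :: "real \<Rightarrow> complex"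
  assumes [measurable]: "F \<in> borel_measurable borel" and F2: "(\<integral>\<^sup>+ u. ennreal ((cmod (F u))\<^sup>2) \<partial>lborel) < \<infinity>" and \<epsilon>: "0 < \<epsilon>"
  shows "integrable lborel (\<lambda>p. indicator {p. \<epsilon> < \<bar>p - b\<bar>} p *\<^sub>R (F p / complex_of_real (p - b)))"
proof (rule Bochner_Integration.integrable_bound)
  have F2i: "integrable lborel (\<lambda>p. (cmod (F p))\<^sup>2)"
    using F2 by (intro integrableI_bounded) auto
  have "(\<integral>\<^sup>+ c. ennreal ((1 + c\<^sup>2) powr (- 1)) \<partial>lborel) < \<infinity>" by (rule nn_integral_bracket_powr_finite) simp
  then have "integrable lborel (\<lambda>c :: real. (1 + c\<^sup>2) powr (- 1))" by (intro integrableI_bounded) auto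
  from lborel_integrable_real_affine[OF this, of 1 "- b"]
  have w: "integrable lborel (\<lambda>p. (1 + (p - b)\<^sup>2) powr (- 1))" by (simp add: add.commute)
  show "integrable lborel (\<lambda>p. (cmod (F p))\<^sup>2 + (1 + 1 / \<epsilon>\<^sup>2) * (1 + (p - b)\<^sup>2) powr (- 1))"
    by (intro Bochner_Integration.integrable_add F2i integrable_mult_right w)
  show "AE p in lborel. norm (indicator {p. \<epsilon> < \<bar>p - b\<bar>} p *\<^sub>R (F p / complex_of_real (p - b)))
     \<le> norm ((cmod (F p))\<^sup>2 + (1 + 1 / \<epsilon>\<^sup>2) * (1 + (p - b)\<^sup>2) powr (- 1))"
  proof (intro AE_I2)
    fix p
    define x where "x = p - b"
    show "norm (indicator {p. \<epsilon> < \<bar>p - b\<bar>} p *\<^sub>R (F p / complex_of_real (p - b)))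
     \<le> norm ((cmod (F p))\<^sup>2 + (1 + 1 / \<epsilon>\<^sup>2) * (1 + (p - b)\<^sup>2) powr (- 1))"
    proof (cases "\<epsilon> < \<bar>x\<bar>")
      case True
      have e2: "\<epsilon>\<^sup>2 < x\<^sup>2" using power_strict_mono[of \<epsilon> "\<bar>x\<bar>" 2] True \<epsilon> by simp
      then have x2: "0 < x\<^sup>2" using zero_le_power2[of \<epsilon>] by linarith
      have "cmod (F p) / \<bar>x\<bar> \<le> (cmod (F p))\<^sup>2 + (1 / \<bar>x\<bar>)\<^sup>2"
      proof -
        have "0 \<le> cmod (F p) * (1 / \<bar>x\<bar>)" by simp
        then have "cmod (F p) * (1 / \<bar>x\<bar>) \<le> (cmod (F p))\<^sup>2 + (1 / \<bar>x\<bar>)\<^sup>2"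
          using sum_squares_bound[of "cmod (F p)" "1 / \<bar>x\<bar>"] unfolding mult.assoc by linarith
        then show ?thesis by simp
      qed
      also have "(1 / \<bar>x\<bar>)\<^sup>2 = 1 / x\<^sup>2" by (simp add: power_divide)
      also have "1 / x\<^sup>2 \<le> (1 + 1 / \<epsilon>\<^sup>2) * (1 + x\<^sup>2) powr (- 1)"
      proof -
        have "1 + x\<^sup>2 \<le> (1 + 1 / \<epsilon>\<^sup>2) * x\<^sup>2" using e2 \<epsilon> by (simp add: field_simps)
        then have "(1 + x\<^sup>2) / x\<^sup>2 \<le> 1 + 1 / \<epsilon>\<^sup>2" using x2 by (simp only: pos_divide_le_eq)
        moreover have pos: "0 < 1 + x\<^sup>2" using x2 by linarith
        ultimately have "1 / x\<^sup>2 \<le> (1 + 1 / \<epsilon>\<^sup>2) / (1 + x\<^sup>2)"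
          by (subst pos_le_divide_eq) auto
        then show ?thesis using pos by (simp add: powr_minus_divide)
      qed
      finally show ?thesis using True by (simp add: x_def[symmetric] norm_divide flip: of_real_diff)
    qed (simp add: x_def)
  qed
qed measurable

section \<open>The dispersion function of a line profile\<close>

lemma integral_pos_of_pos_on_interval:
  fixes f :: "real \<Rightarrow> real"
  assumes f: "integrable lborel f" "\<And>x. 0 \<le> f x" and pos: "\<And>x. x \<in> {a..b} \<Longrightarrow> 0 < f x" and ab: "a < b"
  shows "0 < (LINT x|lborel. f x)"
proof (rule ccontr)
  assume "\<not> 0 < (LINT x|lborel. f x)"
  moreover have "0 \<le> (LINT x|lborel. f x)" using f by (intro integral_nonneg_AE) auto
  ultimately have "(LINT x|lborel. f x) = 0" by linarith
  then have "AE x in lborel. f x = 0" using f by (subst (asm) integral_nonneg_eq_0_iff_AE) auto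
  then have "AE x in lborel. x \<notin> {a..b}" by eventually_elim (use pos in fastforce)
  moreover have "{x \<in> space lborel. \<not> x \<notin> {a..b}} = {a..b}" by auto
  then have "(AE x in lborel. x \<notin> {a..b}) \<longleftrightarrow> emeasure lborel {a..b} = 0"
    by (intro AE_iff_measurable) auto
  ultimately have "emeasure lborel {a..b} = 0" by blast
  then show False using ab by simp
qed

text \<open>This is \<open>(2 / r) sin (r s / 2)\<close>, continued to its limit \<open>s\<close> at \<open>r = 0\<close>; written with \<open>sinc\<close>, it is visibly continuous in \<open>r\<close>.\<close>

definition kern :: "real \<Rightarrow> real \<Rightarrow> real" where
  "kern r s = s * sinc (r * s / 2)"

lemma borel_measurable_kern [measurable]: "kern r \<in> borel_measurable borel"
  unfolding kern_def[abs_def] by measurable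

lemma abs_kern_le: "\<bar>kern r s\<bar> \<le> \<bar>s\<bar>"
proof -
  have "\<bar>sinc x\<bar> \<le> 1" for x :: real
    using abs_sin_x_le_abs_x[of x] by (cases "x = 0") (auto simp: divide_le_eq)
  from mult_left_mono[OF this[of "r * s / 2"], of "\<bar>s\<bar>"] show ?thesis by (simp add: kern_def abs_mult)
qed

lemma kern_uminus: "kern r (- s) = - kern r s"
  by (simp add: kern_def)

lemma kern_0 [simp]: "kern 0 s = s"
  by (simp add: kern_def)

lemma kern_eq_sin: "r \<noteq> 0 \<Longrightarrow> kern r s = 2 / r * sin (r * s / 2)"
  by (cases "s = 0") (auto simp: kern_def)

lemma exp_imaginary: "exp (- (Complex 0 b * complex_of_real s)) = cis (- (s * b))"
  by (simp add: cis_conv_exp Complex_eq mult_ac)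

text \<open>The constant for which \<open>|s|\<close> is \<open>1 / cos_integral\<close> times the integral of \<open>(1 - cos (s x)) / x\<^sup>2\<close> over \<open>x\<close>.\<close>

definition cos_integral :: real where
  "cos_integral = (LINT x|lborel. (1 - cos x) / x\<^sup>2)"

lemma one_minus_cos_bound: "(1 - cos x) / x\<^sup>2 \<le> 4 * (1 + x\<^sup>2) powr (- 1)" for x :: real
proof (cases "x = 0")
  case False
  then have x2: "0 < x\<^sup>2" by simp
  have "1 - cos x = 2 * (sin (x / 2))\<^sup>2"
    using cos_double_sin[of "x / 2"] by simp
  moreover have "(sin (x / 2))\<^sup>2 \<le> (x / 2)\<^sup>2"
    using abs_sin_x_le_abs_x[of "x / 2"] by (simp only: abs_le_square_iff)
  ultimately have "1 - cos x \<le> x\<^sup>2 / 2" by (simp add: power_divide)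
  moreover have "1 - cos x \<le> 2" using cos_ge_minus_one[of x] by linarith
  then have "(1 - cos x) * x\<^sup>2 \<le> 2 * x\<^sup>2" by (rule mult_right_mono) simp
  ultimately have "(1 - cos x) * (1 + x\<^sup>2) \<le> 4 * x\<^sup>2"
    unfolding distrib_left mult_1_right using x2 by linarith
  then have "(1 - cos x) / x\<^sup>2 * (1 + x\<^sup>2) \<le> 4"
    using x2 by (simp add: pos_divide_le_eq)
  moreover have "0 < 1 + x\<^sup>2" using x2 by linarith
  ultimately have "(1 - cos x) / x\<^sup>2 \<le> 4 / (1 + x\<^sup>2)" by (simp only: pos_le_divide_eq)
  then show ?thesis using x2 by (simp add: powr_minus_divide)
qed simp

lemma integrable_one_minus_cos: "integrable lborel (\<lambda>x :: real. (1 - cos x) / x\<^sup>2)"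
proof (rule Bochner_Integration.integrable_bound)
  have "(\<integral>\<^sup>+ c. ennreal ((1 + c\<^sup>2) powr (- 1)) \<partial>lborel) < \<infinity>" by (rule nn_integral_bracket_powr_finite) simp
  then have "integrable lborel (\<lambda>c :: real. (1 + c\<^sup>2) powr (- 1))" by (intro integrableI_bounded) auto
  then show "integrable lborel (\<lambda>c :: real. 4 * (1 + c\<^sup>2) powr (- 1))" by (rule integrable_mult_right)
  show "AE x :: real in lborel. norm ((1 - cos x) / x\<^sup>2) \<le> norm (4 * (1 + x\<^sup>2) powr (- 1))"
    using one_minus_cos_bound by (intro AE_I2) simp
qed measurable

lemma cos_integral_pos: "0 < cos_integral"
  unfolding cos_integral_def
proof (rule integral_pos_of_pos_on_interval[OF integrable_one_minus_cos, of "pi / 2" pi])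
  fix x :: real assume x: "x \<in> {pi / 2..pi}"
  then have "cos x \<le> cos (pi / 2)" by (intro cos_monotone_0_pi_le) auto
  moreover have "x \<noteq> 0" using x pi_gt_zero by auto
  ultimately show "0 < (1 - cos x) / x\<^sup>2" by simp
qed auto

lemma cos_integral_scale: "(LINT x|lborel. (1 - cos (s * x)) / x\<^sup>2) = \<bar>s\<bar> * cos_integral"
proof (cases "s = 0")
  case False
  have "cos_integral = \<bar>s\<bar> *\<^sub>R (LINT x|lborel. (1 - cos (0 + s * x)) / (0 + s * x)\<^sup>2)"
    unfolding cos_integral_def by (rule lborel_integral_real_affine[OF False])
  also have "(LINT x|lborel. (1 - cos (0 + s * x)) / (0 + s * x)\<^sup>2) = (LINT x|lborel. (1 / s\<^sup>2) * ((1 - cos (s * x)) / x\<^sup>2))"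
    by (intro Bochner_Integration.integral_cong refl) (simp add: power_mult_distrib)
  also have "\<dots> = (1 / s\<^sup>2) * (LINT x|lborel. (1 - cos (s * x)) / x\<^sup>2)"
    by (rule integral_mult_right_zero)
  finally have ci: "cos_integral = \<bar>s\<bar> * ((1 / s\<^sup>2) * (LINT x|lborel. (1 - cos (s * x)) / x\<^sup>2))" by simp
  have "I = a * J" if "J = a * ((1 / (a * a)) * I)" "a \<noteq> 0" for a I J :: real
    using that by simp
  from this[of cos_integral "\<bar>s\<bar>"] show ?thesis
    using ci False by (simp only: power2_eq_square abs_mult_self_eq)
qed simp

lemma integrable_one_minus_cos_scale: "integrable lborel (\<lambda>x :: real. (1 - cos (s * x)) / x\<^sup>2)"
proof (cases "s = 0")
  case False
  have "integrable lborel (\<lambda>x. s\<^sup>2 * ((1 - cos (0 + s * x)) / (0 + s * x)\<^sup>2))"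
    by (intro integrable_mult_right lborel_integrable_real_affine[OF integrable_one_minus_cos False])
  then show ?thesis using False by (simp add: power_mult_distrib)
qed simp

text \<open>The restriction \<open>\<gamma> s\<close> of the Fourier transform of a real function to the points \<open>s e\<close> of a line, with the
  integrability that weighted Sobolev regularity provides. The parameter \<open>r\<close> of \<open>slope\<close> and \<open>dispersion\<close> stands for
  the semiclassical parameter times \<open>|k|\<close>, and \<open>r = 0\<close> is the classical limit.\<close>

locale line_profile =
  fixes \<gamma> :: "real \<Rightarrow> complex"
  assumes integrable_profile: "integrable lborel \<gamma>"
    and integrable_moment: "integrable lborel (\<lambda>s. \<bar>s\<bar> * cmod (\<gamma> s))"
    and L2_moment: "(\<integral>\<^sup>+ s. ennreal ((1 + s\<^sup>2) * (cmod (\<gamma> s))\<^sup>2) \<partial>lborel) < \<infinity>"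
    and hermitian: "\<gamma> (- s) = cnj (\<gamma> s)"
begin

lemma profile_measurable [measurable]: "\<gamma> \<in> borel_measurable borel"
  using integrable_profile by auto

text \<open>The inverse Fourier transform of \<open>\<gamma>\<close>, reflected: the sign of the exponent is the one that belongs to marginals
  along \<open>- e\<close>.\<close>

definition dens :: "real \<Rightarrow> complex" where
  "dens u = complex_of_real (1 / (2 * pi)) * (LINT s|lborel. cis (- (s * u)) * \<gamma> s)"

text \<open>The symmetric difference quotient of \<open>dens\<close> over an interval of length \<open>r\<close> centred at \<open>u\<close>, and the derivative
  of \<open>dens\<close> if \<open>r = 0\<close>. The form on the Fourier side treats both cases alike.\<close>

definition slope :: "real \<Rightarrow> real \<Rightarrow> complex" where
  "slope r u = complex_of_real (1 / (2 * pi)) * (LINT s|lborel. cis (- (s * u)) * (- \<i> * complex_of_real (kern r s) * \<gamma> s))"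

definition dispersion :: "real \<Rightarrow> complex \<Rightarrow> complex" where
  "dispersion r z = laplace (\<lambda>s. complex_of_real (kern r s) * \<gamma> s) z"

lemma integrable_kern_profile: "integrable lborel (\<lambda>s. complex_of_real (kern r s) * \<gamma> s)"
  by (rule Bochner_Integration.integrable_bound[OF integrable_moment])
    (auto simp: norm_mult intro!: AE_I2 mult_right_mono abs_kern_le)

lemma integrable_cis_mult: "integrable lborel \<phi> \<Longrightarrow> integrable lborel (\<lambda>s. cis (- (s * u)) * \<phi> s)" for \<phi> :: "real \<Rightarrow> complex"
  by (rule integrable_mult_of_norm_le_1) auto

lemma integral_hermitian_real:
  fixes q :: "real \<Rightarrow> complex"
  assumes "\<And>s. q (- s) = cnj (q s)"
  shows "Im (LINT s|lborel. q s) = 0"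
proof -
  have "(LINT s|lborel. q s) = (LINT s|lborel. cnj (q s))"
    using LBINT_reflect[of q] assms by simp
  then have "(LINT s|lborel. q s) = cnj (LINT s|lborel. q s)" by simp
  then show ?thesis by (metis complex_cnj_cancel_iff Reals_cnj_iff complex_is_Real_iff)
qed

lemma Im_dens: "Im (dens u) = 0"
proof -
  have "Im (LINT s|lborel. cis (- (s * u)) * \<gamma> s) = 0"
    by (rule integral_hermitian_real) (simp add: hermitian cis_cnj)
  then show ?thesis by (simp add: dens_def)
qed

lemma Im_slope: "Im (slope r u) = 0"
proof -
  have "Im (LINT s|lborel. cis (- (s * u)) * (- \<i> * complex_of_real (kern r s) * \<gamma> s)) = 0"
    by (rule integral_hermitian_real) (simp add: hermitian cis_cnj kern_uminus)
  then show ?thesis by (simp add: slope_def)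
qed

text \<open>If \<open>P\<close> is the integral over the positive half line, then the one over the negative half line is minus the
  conjugate of \<open>P\<close>, since \<open>q (- s)\<close> is minus the conjugate of \<open>q s\<close>.\<close>

lemma boundary_integrals:
  fixes r b :: real
  defines "q \<equiv> \<lambda>s. cis (- (s * b)) * (complex_of_real (kern r s) * \<gamma> s)"
  shows "(LINT s|lborel. q s) = 2 * \<i> * complex_of_real (Im (dispersion r (Complex 0 b)))"
    and "(LINT s|lborel. complex_of_real (sgn s) * q s) = 2 * complex_of_real (Re (dispersion r (Complex 0 b)))"
proof -
  have q: "integrable lborel q" unfolding q_def by (intro integrable_cis_mult integrable_kern_profile)
  have [measurable]: "q \<in> borel_measurable borel" using q by auto
  have anti: "q (- s) = - cnj (q s)" for s by (simp add: q_def kern_uminus hermitian cis_cnj)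
  define P where "P = (LINT s|lborel. indicator {0..} s * q s)"
  have boundary_value: "dispersion r (Complex 0 b) = P"
    unfolding dispersion_def laplace_def exp_imaginary P_def q_def by (simp add: mult.assoc)
  have i1: "integrable lborel (\<lambda>s. indicator {0..} s * q s)"
    by (rule integrable_mult_of_norm_le_1[OF _ _ q]) (auto simp: indicator_def)
  have i2: "integrable lborel (\<lambda>s. indicator {0..} (- s) * q s)"
    by (rule integrable_mult_of_norm_le_1[OF _ _ q]) (auto simp: indicator_def)
  have neg: "(LINT s|lborel. indicator {0..} (- s) * q s) = - cnj P"
  proof -
    have "(LINT s|lborel. indicator {0..} (- s) * q s) = (LINT s|lborel. indicator {0..} s * q (- s))"
      using LBINT_reflect[of "\<lambda>s. indicator {0..} s * q (- s)"] by simp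
    also have "\<dots> = (LINT s|lborel. - cnj (indicator {0..} s * q s))"
      by (intro Bochner_Integration.integral_cong refl) (simp add: anti indicator_def)
    also have "\<dots> = - cnj P"
      unfolding P_def by (simp only: Bochner_Integration.integral_minus Bochner_Integration.integral_cnj)
    finally show ?thesis .
  qed
  have "(LINT s|lborel. q s) = (LINT s|lborel. indicator {0..} s * q s + indicator {0..} (- s) * q s)"
    using AE_lborel_singleton[of 0] by (intro integral_cong_AE) (auto simp: indicator_def)
  also have "\<dots> = P - cnj P"
    using i1 i2 neg by (simp add: P_def)
  also have "\<dots> = 2 * \<i> * complex_of_real (Im P)" by (simp add: complex_eq_iff)
  finally show "(LINT s|lborel. q s) = 2 * \<i> * complex_of_real (Im (dispersion r (Complex 0 b)))" by (simp add: boundary_value)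
  have "(LINT s|lborel. complex_of_real (sgn s) * q s) = (LINT s|lborel. indicator {0..} s * q s - indicator {0..} (- s) * q s)"
    using AE_lborel_singleton[of 0] by (intro integral_cong_AE) (auto simp: indicator_def sgn_if)
  also have "\<dots> = P + cnj P"
    using i1 i2 neg by (simp add: P_def)
  also have "\<dots> = 2 * complex_of_real (Re P)" by (simp add: complex_eq_iff)
  finally show "(LINT s|lborel. complex_of_real (sgn s) * q s) = 2 * complex_of_real (Re (dispersion r (Complex 0 b)))" by (simp add: boundary_value)
qed

text \<open>One half of the Plemelj formula on the imaginary axis; the other half is \<open>pv_slope\<close>.\<close>

lemma slope_eq_Im_dispersion: "slope r b = complex_of_real (Im (dispersion r (Complex 0 b)) / pi)"
proof -
  have "(LINT s|lborel. cis (- (s * b)) * (- \<i> * complex_of_real (kern r s) * \<gamma> s))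
    = (LINT s|lborel. (- \<i>) * (cis (- (s * b)) * (complex_of_real (kern r s) * \<gamma> s)))"
    by (intro Bochner_Integration.integral_cong refl) simp
  also have "\<dots> = - \<i> * (2 * \<i> * complex_of_real (Im (dispersion r (Complex 0 b))))"
    by (simp only: integral_mult_right_zero boundary_integrals(1))
  finally show ?thesis by (simp add: slope_def)
qed

lemma L2_profile: "(\<integral>\<^sup>+ s. ennreal ((cmod (\<gamma> s))\<^sup>2) \<partial>lborel) < \<infinity>"
  "(\<integral>\<^sup>+ s. ennreal ((cmod (complex_of_real (kern r s) * \<gamma> s))\<^sup>2) \<partial>lborel) < \<infinity>"
proof -
  have "(\<integral>\<^sup>+ s. ennreal ((cmod (\<gamma> s))\<^sup>2) \<partial>lborel) \<le> (\<integral>\<^sup>+ s. ennreal ((1 + s\<^sup>2) * (cmod (\<gamma> s))\<^sup>2) \<partial>lborel)"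
    by (intro nn_integral_mono ennreal_leI) (simp add: distrib_right)
  then show "(\<integral>\<^sup>+ s. ennreal ((cmod (\<gamma> s))\<^sup>2) \<partial>lborel) < \<infinity>" using L2_moment by (rule le_less_trans)
  have "(\<integral>\<^sup>+ s. ennreal ((cmod (complex_of_real (kern r s) * \<gamma> s))\<^sup>2) \<partial>lborel) \<le> (\<integral>\<^sup>+ s. ennreal ((1 + s\<^sup>2) * (cmod (\<gamma> s))\<^sup>2) \<partial>lborel)"
  proof (intro nn_integral_mono ennreal_leI)
    fix s
    have "(kern r s)\<^sup>2 \<le> s\<^sup>2" using abs_kern_le[of r s] by (simp only: abs_le_square_iff)
    then have "(kern r s)\<^sup>2 * (cmod (\<gamma> s))\<^sup>2 \<le> (1 + s\<^sup>2) * (cmod (\<gamma> s))\<^sup>2" by (intro mult_right_mono) auto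
    then show "(cmod (complex_of_real (kern r s) * \<gamma> s))\<^sup>2 \<le> (1 + s\<^sup>2) * (cmod (\<gamma> s))\<^sup>2"
      by (simp add: norm_mult power_mult_distrib)
  qed
  then show "(\<integral>\<^sup>+ s. ennreal ((cmod (complex_of_real (kern r s) * \<gamma> s))\<^sup>2) \<partial>lborel) < \<infinity>" using L2_moment by (rule le_less_trans)
qed

text \<open>By Plancherel's estimate, square integrability of \<open>\<phi>\<close> is what gives integrability away from the singularity.\<close>

lemma pv_of_transform:
  fixes \<phi> :: "real \<Rightarrow> complex"
  assumes \<phi>: "integrable lborel \<phi>" and L2: "(\<integral>\<^sup>+ s. ennreal ((cmod (\<phi> s))\<^sup>2) \<partial>lborel) < \<infinity>"
  defines "F \<equiv> \<lambda>p. LINT s|lborel. cis (- (s * p)) * \<phi> s"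
  shows "0 < \<epsilon> \<Longrightarrow> integrable lborel (\<lambda>p. indicator {p. \<epsilon> < \<bar>p - b\<bar>} p *\<^sub>R (F p / complex_of_real (p - b)))"
    and "((\<lambda>\<epsilon>. LINT p|lborel. indicator {p. \<epsilon> < \<bar>p - b\<bar>} p *\<^sub>R (F p / complex_of_real (p - b)))
     \<longlongrightarrow> - \<i> * complex_of_real pi * (LINT s|lborel. complex_of_real (sgn s) * (cis (- (s * b)) * \<phi> s))) (at_right 0)"
proof -
  have [measurable]: "\<phi> \<in> borel_measurable borel" using \<phi> by auto
  have [measurable]: "F \<in> borel_measurable borel" unfolding F_def by measurable
  have "(\<integral>\<^sup>+ u. ennreal ((cmod (F u))\<^sup>2) \<partial>lborel) \<le> ennreal (2 * pi) * (\<integral>\<^sup>+ s. ennreal ((cmod (\<phi> s))\<^sup>2) \<partial>lborel)"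
    unfolding F_def by (rule plancherel_le[OF \<phi>])
  also have "\<dots> < \<infinity>" using L2 by (simp add: ennreal_mult_less_top)
  finally have F2: "(\<integral>\<^sup>+ u. ennreal ((cmod (F u))\<^sup>2) \<partial>lborel) < \<infinity>" .
  show int: "0 < \<epsilon> \<Longrightarrow> integrable lborel (\<lambda>p. indicator {p. \<epsilon> < \<bar>p - b\<bar>} p *\<^sub>R (F p / complex_of_real (p - b)))" for \<epsilon>
    by (rule integrable_div_off_singularity[OF _ F2]) auto
  show "((\<lambda>\<epsilon>. LINT p|lborel. indicator {p. \<epsilon> < \<bar>p - b\<bar>} p *\<^sub>R (F p / complex_of_real (p - b)))
     \<longlongrightarrow> - \<i> * complex_of_real pi * (LINT s|lborel. complex_of_real (sgn s) * (cis (- (s * b)) * \<phi> s))) (at_right 0)"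
    unfolding F_def by (rule hilbert_transform_tendsto[OF \<phi>]) (use int in \<open>simp add: F_def\<close>)
qed

lemma slope_alt: "slope r = (\<lambda>u. LINT s|lborel. cis (- (s * u)) * (complex_of_real (1 / (2 * pi)) * (- \<i> * complex_of_real (kern r s) * \<gamma> s)))"
proof
  fix u
  have "slope r u = (LINT s|lborel. complex_of_real (1 / (2 * pi)) * (cis (- (s * u)) * (- \<i> * complex_of_real (kern r s) * \<gamma> s)))"
    unfolding slope_def by (rule integral_mult_right_zero[symmetric])
  then show "slope r u = (LINT s|lborel. cis (- (s * u)) * (complex_of_real (1 / (2 * pi)) * (- \<i> * complex_of_real (kern r s) * \<gamma> s)))"
    by (simp only: mult.left_commute)
qed

lemma dens_alt: "dens = (\<lambda>u. LINT s|lborel. cis (- (s * u)) * (complex_of_real (1 / (2 * pi)) * \<gamma> s))"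
proof
  fix u
  have "dens u = (LINT s|lborel. complex_of_real (1 / (2 * pi)) * (cis (- (s * u)) * \<gamma> s))"
    unfolding dens_def by (rule integral_mult_right_zero[symmetric])
  then show "dens u = (LINT s|lborel. cis (- (s * u)) * (complex_of_real (1 / (2 * pi)) * \<gamma> s))"
    by (simp only: mult.left_commute)
qed

lemma nn_integral_norm2_cmult:
  assumes [measurable]: "\<phi> \<in> borel_measurable borel" and L2: "(\<integral>\<^sup>+ s. ennreal ((cmod (\<phi> s))\<^sup>2) \<partial>lborel) < \<infinity>"
  shows "(\<integral>\<^sup>+ s. ennreal ((cmod (c * \<phi> s :: complex))\<^sup>2) \<partial>(lborel :: real measure)) < \<infinity>"
proof -
  have "(\<integral>\<^sup>+ s. ennreal ((cmod (c * \<phi> s))\<^sup>2) \<partial>lborel) = (\<integral>\<^sup>+ s. ennreal ((cmod c)\<^sup>2) * ennreal ((cmod (\<phi> s))\<^sup>2) \<partial>lborel)"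
    by (intro nn_integral_cong) (simp add: norm_mult power_mult_distrib ennreal_mult)
  also have "\<dots> = ennreal ((cmod c)\<^sup>2) * (\<integral>\<^sup>+ s. ennreal ((cmod (\<phi> s))\<^sup>2) \<partial>lborel)"
    by (rule nn_integral_cmult) measurable
  also have "\<dots> < \<infinity>" using L2 by (simp add: ennreal_mult_less_top)
  finally show ?thesis .
qed

lemma
  shows integrable_slope_div: "0 < \<epsilon> \<Longrightarrow> integrable lborel (\<lambda>p. indicator {p. \<epsilon> < \<bar>p - b\<bar>} p *\<^sub>R (slope r p / complex_of_real (p - b)))"
    and pv_slope: "((\<lambda>\<epsilon>. LINT p|lborel. indicator {p. \<epsilon> < \<bar>p - b\<bar>} p *\<^sub>R (slope r p / complex_of_real (p - b)))
       \<longlongrightarrow> - complex_of_real (Re (dispersion r (Complex 0 b)))) (at_right 0)"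
proof -
  let ?\<phi> = "\<lambda>s. complex_of_real (1 / (2 * pi)) * (- \<i> * complex_of_real (kern r s) * \<gamma> s)"
  have eq: "?\<phi> = (\<lambda>s. (complex_of_real (1 / (2 * pi)) * - \<i>) * (complex_of_real (kern r s) * \<gamma> s))" by (simp add: mult_ac)
  have \<phi>: "integrable lborel ?\<phi>" unfolding eq by (intro integrable_mult_right integrable_kern_profile)
  have L2: "(\<integral>\<^sup>+ s. ennreal ((cmod (?\<phi> s))\<^sup>2) \<partial>lborel) < \<infinity>"
    unfolding fun_cong[OF eq] by (rule nn_integral_norm2_cmult[OF _ L2_profile(2)]) measurable
  show "0 < \<epsilon> \<Longrightarrow> integrable lborel (\<lambda>p. indicator {p. \<epsilon> < \<bar>p - b\<bar>} p *\<^sub>R (slope r p / complex_of_real (p - b)))"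
    unfolding slope_alt by (rule pv_of_transform(1)[OF \<phi> L2])
  have "(LINT s|lborel. complex_of_real (sgn s) * (cis (- (s * b)) * ?\<phi> s))
     = (LINT s|lborel. (complex_of_real (1 / (2 * pi)) * - \<i>) * (complex_of_real (sgn s) * (cis (- (s * b)) * (complex_of_real (kern r s) * \<gamma> s))))"
    by (intro Bochner_Integration.integral_cong refl) (simp add: mult_ac)
  also have "\<dots> = (complex_of_real (1 / (2 * pi)) * - \<i>) * (2 * complex_of_real (Re (dispersion r (Complex 0 b))))"
    by (simp only: integral_mult_right_zero boundary_integrals(2))
  finally have "- \<i> * complex_of_real pi * (LINT s|lborel. complex_of_real (sgn s) * (cis (- (s * b)) * ?\<phi> s))
     = - complex_of_real (Re (dispersion r (Complex 0 b)))" by simp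
  then show "((\<lambda>\<epsilon>. LINT p|lborel. indicator {p. \<epsilon> < \<bar>p - b\<bar>} p *\<^sub>R (slope r p / complex_of_real (p - b)))
       \<longlongrightarrow> - complex_of_real (Re (dispersion r (Complex 0 b)))) (at_right 0)"
    using pv_of_transform(2)[OF \<phi> L2, of b] unfolding slope_alt by simp
qed

lemma slope_eq_difference_quotient:
  assumes r: "r \<noteq> 0"
  shows "slope r u = (dens (u + r / 2) - dens (u - r / 2)) / complex_of_real r"
proof -
  have i: "integrable lborel (\<lambda>s. cis (- (s * v)) * \<gamma> s)" for v by (intro integrable_cis_mult integrable_profile)
  have "(dens (u + r / 2) - dens (u - r / 2)) / complex_of_real r
    = complex_of_real (1 / (2 * pi)) * (LINT s|lborel. (cis (- (s * (u + r / 2))) * \<gamma> s - cis (- (s * (u - r / 2))) * \<gamma> s) / complex_of_real r)"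
    unfolding dens_def using i[of "u + r / 2"] i[of "u - r / 2"] by (simp add: right_diff_distrib diff_divide_distrib)
  also have "(LINT s|lborel. (cis (- (s * (u + r / 2))) * \<gamma> s - cis (- (s * (u - r / 2))) * \<gamma> s) / complex_of_real r)
     = (LINT s|lborel. cis (- (s * u)) * (- \<i> * complex_of_real (kern r s) * \<gamma> s))"
  proof (intro Bochner_Integration.integral_cong refl)
    fix s
    have "- (s * (u + r / 2)) = - (s * u) + - (r * s / 2)" "- (s * (u - r / 2)) = - (s * u) + r * s / 2" by (simp_all add: field_simps)
    then have c: "cis (- (s * (u + r / 2))) = cis (- (s * u)) * cis (- (r * s / 2))" "cis (- (s * (u - r / 2))) = cis (- (s * u)) * cis (r * s / 2)"
      by (simp_all only: cis_mult)
    have d: "cis (- (r * s / 2)) - cis (r * s / 2) = - \<i> * complex_of_real (r * kern r s)"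
      using r by (simp add: kern_eq_sin complex_eq_iff)
    have "cis (- (s * (u + r / 2))) * \<gamma> s - cis (- (s * (u - r / 2))) * \<gamma> s = cis (- (s * u)) * ((cis (- (r * s / 2)) - cis (r * s / 2)) * \<gamma> s)"
      unfolding c by (simp add: algebra_simps)
    then show "(cis (- (s * (u + r / 2))) * \<gamma> s - cis (- (s * (u - r / 2))) * \<gamma> s) / complex_of_real r = cis (- (s * u)) * (- \<i> * complex_of_real (kern r s) * \<gamma> s)"
      unfolding d using r by simp
  qed
  finally show ?thesis unfolding slope_def by simp
qed

lemma dens_has_derivative: "((\<lambda>u. Re (dens u)) has_real_derivative Re (slope 0 u)) (at u)"
proof -
  have i: "integrable lborel (\<lambda>s. cis (- (s * v)) * \<gamma> s)" for v by (intro integrable_cis_mult integrable_profile)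
  have "((\<lambda>h. (dens (u + h) - dens u) / complex_of_real h) \<longlongrightarrow> slope 0 u) (at 0)"
    unfolding tendsto_at_iff_sequentially comp_def
  proof (intro allI impI)
    fix h :: "nat \<Rightarrow> real" assume h: "\<forall>n. h n \<in> UNIV - {0}" "h \<longlonglongrightarrow> 0"
    then have h0: "h n \<noteq> 0" for n by auto
    let ?c = "\<lambda>n s. (cis (- (s * (u + h n))) - cis (- (s * u))) / complex_of_real (h n)"
    have "(\<lambda>n. LINT s|lborel. ?c n s * \<gamma> s) \<longlonglongrightarrow> (LINT s|lborel. cis (- (s * u)) * (- \<i> * complex_of_real (kern 0 s) * \<gamma> s))"
    proof (rule integral_dominated_convergence[OF _ _ integrable_moment])
      show "AE s in lborel. (\<lambda>n. ?c n s * \<gamma> s) \<longlonglongrightarrow> cis (- (s * u)) * (- \<i> * complex_of_real (kern 0 s) * \<gamma> s)"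
      proof (intro AE_I2)
        fix s :: real
        have "((\<lambda>w. exp (- (\<i> * complex_of_real s * w))) has_field_derivative exp (- (\<i> * complex_of_real s * complex_of_real u)) * (- (\<i> * complex_of_real s))) (at (complex_of_real u))"
          by (auto intro!: derivative_eq_intros)
        moreover have "exp (- (\<i> * complex_of_real s * complex_of_real v)) = cis (- (s * v))" for v
          by (simp add: cis_conv_exp mult.assoc)
        ultimately have lim: "((\<lambda>w. (exp (- (\<i> * complex_of_real s * (complex_of_real u + w))) - cis (- (s * u))) / w) \<longlongrightarrow> cis (- (s * u)) * (- (\<i> * complex_of_real s))) (at 0)"
          by (simp add: DERIV_def)
        have "filterlim (\<lambda>n. complex_of_real (h n)) (at 0) sequentially"
          using h h0 by (auto simp: filterlim_at intro!: tendsto_of_real_iff[THEN iffD2, of _ 0, simplified])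
        from filterlim_compose[OF lim this]
        have "(\<lambda>n. (exp (- (\<i> * complex_of_real s * (complex_of_real u + complex_of_real (h n)))) - cis (- (s * u))) / complex_of_real (h n)) \<longlonglongrightarrow> cis (- (s * u)) * (- (\<i> * complex_of_real s))" .
        also have "(\<lambda>n. (exp (- (\<i> * complex_of_real s * (complex_of_real u + complex_of_real (h n)))) - cis (- (s * u))) / complex_of_real (h n)) = (\<lambda>n. ?c n s)"
          by (simp add: cis_conv_exp mult.assoc)
        finally have "(\<lambda>n. ?c n s * \<gamma> s) \<longlonglongrightarrow> cis (- (s * u)) * (- (\<i> * complex_of_real s)) * \<gamma> s"
          by (intro tendsto_mult tendsto_const)
        then show "(\<lambda>n. ?c n s * \<gamma> s) \<longlonglongrightarrow> cis (- (s * u)) * (- \<i> * complex_of_real (kern 0 s) * \<gamma> s)"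
          by (simp add: mult.assoc)
      qed
      show "AE s in lborel. norm (?c n s * \<gamma> s) \<le> \<bar>s\<bar> * cmod (\<gamma> s)" for n
      proof (intro AE_I2)
        fix s :: real
        have "- (s * (u + h n)) = - (s * u) + - (s * h n)" by (simp add: algebra_simps)
        then have "cis (- (s * (u + h n))) = cis (- (s * u)) * cis (- (s * h n))" by (simp only: cis_mult)
        then have "cmod (cis (- (s * (u + h n))) - cis (- (s * u))) = cmod (cis (- (s * u)) * (cis (- (s * h n)) - 1))" by (simp add: algebra_simps)
        also have "\<dots> = cmod (iexp (- (s * h n)) - 1)" by (simp add: norm_mult cis_conv_exp)
        also have "\<dots> \<le> \<bar>s * h n\<bar>" using iexp_approx1[of "- (s * h n)" 0] by simp
        finally have "cmod (?c n s) \<le> \<bar>s\<bar>" using h0[of n] by (simp add: norm_divide abs_mult field_simps)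
        from mult_right_mono[OF this norm_ge_zero[of "\<gamma> s"]] show "norm (?c n s * \<gamma> s) \<le> \<bar>s\<bar> * cmod (\<gamma> s)" by (simp only: norm_mult)
      qed
    qed measurable
    from tendsto_mult[OF tendsto_const this, of "complex_of_real (1 / (2 * pi))"]
    have lim: "(\<lambda>n. complex_of_real (1 / (2 * pi)) * (LINT s|lborel. ?c n s * \<gamma> s)) \<longlonglongrightarrow> slope 0 u" by (simp only: slope_def)
    have "complex_of_real (1 / (2 * pi)) * (LINT s|lborel. ?c n s * \<gamma> s) = (dens (u + h n) - dens u) / complex_of_real (h n)" for n
    proof -
      have "(LINT s|lborel. ?c n s * \<gamma> s) = (LINT s|lborel. (cis (- (s * (u + h n))) * \<gamma> s - cis (- (s * u)) * \<gamma> s) / complex_of_real (h n))"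
        by (intro Bochner_Integration.integral_cong refl) (simp add: left_diff_distrib)
      also have "\<dots> = ((LINT s|lborel. cis (- (s * (u + h n))) * \<gamma> s) - (LINT s|lborel. cis (- (s * u)) * \<gamma> s)) / complex_of_real (h n)"
        using i by simp
      finally have e: "(LINT s|lborel. ?c n s * \<gamma> s) = ((LINT s|lborel. cis (- (s * (u + h n))) * \<gamma> s) - (LINT s|lborel. cis (- (s * u)) * \<gamma> s)) / complex_of_real (h n)" .
      show ?thesis unfolding e dens_def by (simp add: right_diff_distrib diff_divide_distrib)
    qed
    then show "(\<lambda>n. (dens (u + h n) - dens u) / complex_of_real (h n)) \<longlonglongrightarrow> slope 0 u" using lim by (simp only:)
  qed
  from tendsto_Re[OF this] show ?thesis
    by (simp add: DERIV_def Re_divide_of_real)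
qed

lemma continuous_dens: "continuous_on UNIV (\<lambda>u. Re (dens u))"
  using dens_has_derivative by (auto intro!: continuous_at_imp_continuous_on DERIV_isCont)

lemma dens_tendsto_0:
  assumes "filterlim u at_infinity sequentially"
  shows "(\<lambda>n. Re (dens (u n))) \<longlonglongrightarrow> 0"
proof -
  have "(\<lambda>n. LINT s|lborel. cis (- (u n \<bullet> s)) * \<gamma> s) \<longlonglongrightarrow> 0"
    by (rule riemann_lebesgue[OF integrable_profile assms])
  then have "(\<lambda>n. dens (u n)) \<longlonglongrightarrow> complex_of_real (1 / (2 * pi)) * 0"
    unfolding dens_def by (intro tendsto_mult tendsto_const) (simp add: mult.commute)
  from tendsto_Re[OF this] show ?thesis by simp
qed

text \<open>The integral of \<open>(1 - cos (s x)) / x\<^sup>2\<close> over \<open>x\<close> is a multiple of \<open>|s|\<close>, and \<open>|s| = sgn s * s\<close> is the multiplier that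
  produces the real part of \<open>dispersion 0\<close> on the imaginary axis.\<close>

lemma integral_second_difference:
  fixes b :: real
  defines "S \<equiv> \<lambda>x. (2 * Re (dens b) - Re (dens (b + x)) - Re (dens (b - x))) / x\<^sup>2"
  shows "integrable lborel S" and "(LINT x|lborel. S x) = 2 * cos_integral / pi * Re (dispersion 0 (Complex 0 b))"
proof -
  define c where "c x s = (1 - cos (s * x)) / x\<^sup>2" for x s :: real
  define q where "q s x = complex_of_real (c x s) * (cis (- (s * b)) * (complex_of_real (1 / pi) * \<gamma> s))" for s x
  have c0: "0 \<le> c x s" for x s by (simp add: c_def)
  have ci: "integrable lborel (\<lambda>x. c x s)" "(LINT x|lborel. c x s) = \<bar>s\<bar> * cos_integral" for s
    unfolding c_def by (rule integrable_one_minus_cos_scale cos_integral_scale)+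
  have qi: "integrable (lborel \<Otimes>\<^sub>M lborel) (\<lambda>(s, x). q s x)"
  proof (rule lborel_pair.Fubini_integrable)
    show "(\<lambda>(s, x). q s x) \<in> borel_measurable (lborel \<Otimes>\<^sub>M lborel)" unfolding q_def c_def by measurable
    show "AE s in lborel. integrable lborel (\<lambda>x. case (s, x) of (s, x) \<Rightarrow> q s x)"
      unfolding q_def using ci(1) by (intro AE_I2) auto
    have "(LINT x|lborel. norm (q s x)) = cos_integral / pi * (\<bar>s\<bar> * cmod (\<gamma> s))" for s
    proof -
      have "(LINT x|lborel. norm (q s x)) = (LINT x|lborel. c x s * (cmod (\<gamma> s) / pi))"
        unfolding q_def using c0 by (intro Bochner_Integration.integral_cong refl) (simp add: norm_mult norm_divide)
      then show ?thesis by (simp add: ci)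
    qed
    then show "integrable lborel (\<lambda>s. LINT x|lborel. norm (case (s, x) of (s, x) \<Rightarrow> q s x))"
      using integrable_moment by simp
  qed
  have inner: "(LINT s|lborel. q s x) = complex_of_real (S x)" for x
  proof -
    have i: "integrable lborel (\<lambda>s. cis (- (s * v)) * \<gamma> s)" for v by (intro integrable_cis_mult integrable_profile)
    have "(LINT s|lborel. q s x) = (LINT s|lborel. complex_of_real (1 / (2 * pi)) * ((2 * (cis (- (s * b)) * \<gamma> s) - cis (- (s * (b + x))) * \<gamma> s - cis (- (s * (b - x))) * \<gamma> s) / complex_of_real (x\<^sup>2)))"
    proof (intro Bochner_Integration.integral_cong refl)
      fix s :: real
      have "- (s * (b + x)) = - (s * b) + - (s * x)" "- (s * (b - x)) = - (s * b) + s * x" by (simp_all add: algebra_simps)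
      then have cc: "cis (- (s * (b + x))) = cis (- (s * b)) * cis (- (s * x))" "cis (- (s * (b - x))) = cis (- (s * b)) * cis (s * x)"
        by (simp_all only: cis_mult)
      have d: "2 - cis (- (s * x)) - cis (s * x) = complex_of_real (2 * (1 - cos (s * x)))"
        by (simp add: complex_eq_iff)
      have "2 * (cis (- (s * b)) * \<gamma> s) - cis (- (s * (b + x))) * \<gamma> s - cis (- (s * (b - x))) * \<gamma> s
         = (2 - cis (- (s * x)) - cis (s * x)) * (cis (- (s * b)) * \<gamma> s)"
        unfolding cc by (simp add: algebra_simps)
      then have e: "2 * (cis (- (s * b)) * \<gamma> s) - cis (- (s * (b + x))) * \<gamma> s - cis (- (s * (b - x))) * \<gamma> s
         = complex_of_real (2 * (1 - cos (s * x))) * (cis (- (s * b)) * \<gamma> s)" unfolding d .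
      show "q s x = complex_of_real (1 / (2 * pi)) * ((2 * (cis (- (s * b)) * \<gamma> s) - cis (- (s * (b + x))) * \<gamma> s - cis (- (s * (b - x))) * \<gamma> s) / complex_of_real (x\<^sup>2))"
      proof -
        have "complex_of_real (1 / (2 * pi)) * (complex_of_real (2 * y) * (A * Z) / complex_of_real (x\<^sup>2)) = complex_of_real (y / x\<^sup>2) * (A * (complex_of_real (1 / pi) * Z))" for y A Z
          by simp
        then show ?thesis unfolding e q_def c_def by (simp only:)
      qed
    qed
    also have "\<dots> = (2 * dens b - dens (b + x) - dens (b - x)) / complex_of_real (x\<^sup>2)"
      unfolding dens_def using i[of b] i[of "b + x"] i[of "b - x"] by (simp add: algebra_simps diff_divide_distrib)
    also have "\<dots> = complex_of_real (S x)"
    proof -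
      have "dens u = complex_of_real (Re (dens u))" for u by (simp add: complex_eq_iff Im_dens)
      then have "2 * dens b - dens (b + x) - dens (b - x) = complex_of_real (2 * Re (dens b) - Re (dens (b + x)) - Re (dens (b - x)))"
        by (simp add: complex_eq_iff Im_dens)
      then show ?thesis by (simp add: S_def)
    qed
    finally show ?thesis .
  qed
  have "integrable lborel (\<lambda>x. LINT s|lborel. q s x)"
    using lborel_pair.integrable_snd[OF qi] by simp
  then show S: "integrable lborel S" unfolding inner using complex_of_real_integrable_eq by blast
  have "complex_of_real (LINT x|lborel. S x) = (LINT x|lborel. LINT s|lborel. q s x)"
    unfolding inner by (rule integral_complex_of_real[symmetric])
  also have "\<dots> = (LINT s|lborel. LINT x|lborel. q s x)"
    by (rule lborel_pair.Fubini_integral[OF qi])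
  also have "\<dots> = (LINT s|lborel. complex_of_real (cos_integral / pi) * (complex_of_real (sgn s) * (cis (- (s * b)) * (complex_of_real (kern 0 s) * \<gamma> s))))"
  proof (intro Bochner_Integration.integral_cong refl)
    fix s :: real
    have "(LINT x|lborel. q s x) = complex_of_real (LINT x|lborel. c x s) * (cis (- (s * b)) * (complex_of_real (1 / pi) * \<gamma> s))"
      unfolding q_def by (simp only: integral_mult_left_zero integral_complex_of_real)
    then have "(LINT x|lborel. q s x) = complex_of_real (\<bar>s\<bar> * cos_integral) * (cis (- (s * b)) * (complex_of_real (1 / pi) * \<gamma> s))"
      by (simp only: ci)
    moreover have "\<bar>s\<bar> = sgn s * s" by (simp add: sgn_if)
    ultimately show "(LINT x|lborel. q s x) = complex_of_real (cos_integral / pi) * (complex_of_real (sgn s) * (cis (- (s * b)) * (complex_of_real (kern 0 s) * \<gamma> s)))"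
      by (simp add: mult_ac)
  qed
  also have "\<dots> = complex_of_real (cos_integral / pi) * (2 * complex_of_real (Re (dispersion 0 (Complex 0 b))))"
    by (simp only: integral_mult_right_zero boundary_integrals(2))
  also have "\<dots> = complex_of_real (2 * cos_integral / pi * Re (dispersion 0 (Complex 0 b)))" by simp
  finally show "(LINT x|lborel. S x) = 2 * cos_integral / pi * Re (dispersion 0 (Complex 0 b))"
    by (simp only: of_real_eq_iff)
qed

text \<open>At a maximum all second differences are nonnegative, and those over long distances are positive because
  \<open>dens\<close> vanishes at infinity.\<close>

lemma dispersion_pos_at_maximum:
  assumes max: "\<And>u. Re (dens u) \<le> Re (dens b)" and pos: "0 < Re (dens b)"
  shows "0 < Re (dispersion 0 (Complex 0 b))"
proof -
  have "\<exists>X>0. \<forall>x\<ge>X. Re (dens (b + x)) < Re (dens b) "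
  proof (rule ccontr)
    assume "\<not> (\<exists>X>0. \<forall>x\<ge>X. Re (dens (b + x)) < Re (dens b))"
    then have "\<exists>x. real (Suc n) \<le> x \<and> Re (dens b) \<le> Re (dens (b + x))" for n
      by (metis not_less of_nat_0_less_iff zero_less_Suc)
    then obtain x where x: "\<And>n. real (Suc n) \<le> x n" "\<And>n. Re (dens b) \<le> Re (dens (b + x n))" by metis
    have "filterlim x at_top sequentially"
      by (rule filterlim_at_top_mono[OF filterlim_real_sequentially]) (use x(1) in \<open>intro always_eventually allI, simp add: le_less_trans less_imp_le order_trans[OF _ x(1)]\<close>)
    then have "filterlim (\<lambda>n. b + x n) at_top sequentially" by (rule filterlim_tendsto_add_at_top[OF tendsto_const])
    then have "(\<lambda>n. Re (dens (b + x n))) \<longlonglongrightarrow> 0" by (intro dens_tendsto_0 filterlim_at_top_imp_at_infinity)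
    then have "Re (dens b) \<le> 0" by (rule LIMSEQ_le_const) (use x(2) in auto)
    then show False using pos by simp
  qed
  then obtain X where X: "0 < X" "\<And>x. X \<le> x \<Longrightarrow> Re (dens (b + x)) < Re (dens b)" by auto
  let ?S = "\<lambda>x. (2 * Re (dens b) - Re (dens (b + x)) - Re (dens (b - x))) / x\<^sup>2"
  have "0 < (LINT x|lborel. ?S x)"
  proof (rule integral_pos_of_pos_on_interval[OF integral_second_difference(1), of _ X "X + 1"])
    show "0 \<le> ?S x" for x using max[of "b + x"] max[of "b - x"] by simp
    fix x assume "x \<in> {X..X + 1}"
    then show "0 < ?S x" using max[of "b - x"] X(2)[of x] X(1) by (intro divide_pos_pos) auto
  qed simp
  then have "0 < 2 * cos_integral / pi * Re (dispersion 0 (Complex 0 b))" unfolding integral_second_difference(2) .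
  moreover have "0 < 2 * cos_integral / pi" using cos_integral_pos by simp
  ultimately show ?thesis by (rule zero_less_mult_pos)
qed

end

section \<open>Marginals as inverse Fourier transforms\<close>

lemma hyperplane_measure_scale:
  assumes "k \<noteq> 0"
  shows "hyperplane_measure (k /\<^sub>R norm k) = hyperplane_measure k"
  using assms by (simp add: hyperplane_measure_def)

lemma marginal_scale:
  assumes k: "k \<noteq> 0"
  shows "marginal g (k /\<^sub>R norm k) = marginal g k"
  using k by (simp add: marginal_def hyperplane_measure_scale)

lemma sets_hyperplane_measure [measurable_cong, simp]: "sets (hyperplane_measure k) = sets borel"
  by (simp add: hyperplane_measure_def Let_def)

lemma nn_integral_hyperplane_inner:
  fixes f :: "real ^ 'n \<Rightarrow> ennreal" and \<phi> :: "real \<Rightarrow> ennreal"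
  assumes e: "norm e = 1" and [measurable]: "f \<in> borel_measurable borel" "\<phi> \<in> borel_measurable borel"
  shows "(\<integral>\<^sup>+ y. \<phi> (e \<bullet> (u *\<^sub>R e + y)) * f (u *\<^sub>R e + y) \<partial>hyperplane_measure e) = \<phi> u * (\<integral>\<^sup>+ y. f (u *\<^sub>R e + y) \<partial>hyperplane_measure e)"
proof -
  obtain B where B: "finite B" "pairwise orthogonal (insert e B)" "\<And>b. b \<in> insert e B \<Longrightarrow> norm b = 1"
    "span (insert e B) = UNIV" "e \<notin> B" "\<And>b. b \<in> B \<Longrightarrow> e \<bullet> b = 0" "card B = CARD('n) - 1"
    and hyp: "hyperplane_measure e = distr (\<Pi>\<^sub>M b\<in>B. lborel) borel (\<lambda>c. \<Sum>b\<in>B. c b *\<^sub>R b)"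
    by (rule hyperplane_measure_orthonormal[OF e], rule that)
  have ip: "e \<bullet> (u *\<^sub>R e + (\<Sum>b\<in>B. c b *\<^sub>R b)) = u" for c
    using e B(6) by (simp add: inner_add_right inner_sum_right dot_square_norm)
  have "(\<integral>\<^sup>+ y. \<phi> (e \<bullet> (u *\<^sub>R e + y)) * f (u *\<^sub>R e + y) \<partial>hyperplane_measure e)
    = (\<integral>\<^sup>+ c. \<phi> (e \<bullet> (u *\<^sub>R e + (\<Sum>b\<in>B. c b *\<^sub>R b))) * f (u *\<^sub>R e + (\<Sum>b\<in>B. c b *\<^sub>R b)) \<partial>(\<Pi>\<^sub>M b\<in>B. lborel))"
    unfolding hyp by (rule nn_integral_distr) measurable
  also have "\<dots> = \<phi> u * (\<integral>\<^sup>+ c. f (u *\<^sub>R e + (\<Sum>b\<in>B. c b *\<^sub>R b)) \<partial>(\<Pi>\<^sub>M b\<in>B. lborel))"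
    unfolding ip by (rule nn_integral_cmult) measurable
  also have "(\<integral>\<^sup>+ c. f (u *\<^sub>R e + (\<Sum>b\<in>B. c b *\<^sub>R b)) \<partial>(\<Pi>\<^sub>M b\<in>B. lborel)) = (\<integral>\<^sup>+ y. f (u *\<^sub>R e + y) \<partial>hyperplane_measure e)"
    unfolding hyp by (rule nn_integral_distr[symmetric]) measurable
  finally show ?thesis .
qed

text \<open>For a nonnegative \<open>f\<close>, the integrals over the hyperplanes orthogonal to \<open>e\<close> are the density of \<open>- (e \<bullet> x)\<close>
  under the measure with density \<open>f\<close>.\<close>

lemma distr_hyperplane_density:
  fixes f :: "real ^ 'n \<Rightarrow> ennreal"
  assumes e: "norm e = 1" and [measurable]: "f \<in> borel_measurable borel"
  defines "m \<equiv> \<lambda>u. \<integral>\<^sup>+ y. f (- (u *\<^sub>R e) + y) \<partial>hyperplane_measure e"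
  shows "m \<in> borel_measurable borel" and "distr (density lborel f) borel (\<lambda>x. - (e \<bullet> x)) = density lborel m"
proof -
  define m0 where "m0 u = (\<integral>\<^sup>+ y. f (u *\<^sub>R e + y) \<partial>hyperplane_measure e)" for u
  have [measurable]: "m0 \<in> borel_measurable borel"
    unfolding m0_def by (rule measurable_nn_integral_hyperplane[OF e]) measurable
  have mm: "m = (\<lambda>u. m0 (- u))" unfolding m_def m0_def by simp
  show m [measurable]: "m \<in> borel_measurable borel" unfolding mm by measurable
  show "distr (density lborel f) borel (\<lambda>x. - (e \<bullet> x)) = density lborel m"
  proof (rule measure_eqI)
    fix A assume "A \<in> sets (distr (density lborel f) borel (\<lambda>x. - (e \<bullet> x)))"
    then have A [measurable]: "A \<in> sets borel" by simp
    have "emeasure (distr (density lborel f) borel (\<lambda>x. - (e \<bullet> x))) A = (\<integral>\<^sup>+ x. indicator A (- (e \<bullet> x)) * f x \<partial>lborel)"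
    proof -
      have "emeasure (distr (density lborel f) borel (\<lambda>x. - (e \<bullet> x))) A = emeasure (density lborel f) ((\<lambda>x. - (e \<bullet> x)) -` A)"
        by (subst emeasure_distr) auto
      also have "\<dots> = (\<integral>\<^sup>+ x. f x * indicator ((\<lambda>x. - (e \<bullet> x)) -` A) x \<partial>lborel)"
        by (rule emeasure_density) (auto intro!: measurable_sets_borel[OF _ A])
      finally show ?thesis by (simp add: indicator_def mult.commute)
    qed
    also have "\<dots> = (\<integral>\<^sup>+ u. \<integral>\<^sup>+ y. indicator A (- (e \<bullet> (u *\<^sub>R e + y))) * f (u *\<^sub>R e + y) \<partial>hyperplane_measure e \<partial>lborel)"
      by (rule nn_integral_hyperplanes[OF e]) measurable
    also have "\<dots> = (\<integral>\<^sup>+ u. indicator A (- u) * m0 u \<partial>lborel)"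
      unfolding m0_def
      by (intro nn_integral_cong nn_integral_hyperplane_inner[OF e, where \<phi>="\<lambda>v. indicator A (- v)"]) auto
    also have "\<dots> = (\<integral>\<^sup>+ u. indicator A u * m0 (- u) \<partial>lborel)"
      using nn_integral_real_affine[of "\<lambda>u. indicator A u * m0 (- u)" "-1" 0] by simp
    also have "\<dots> = emeasure (density lborel m) A"
      by (subst emeasure_density) (auto simp: mm mult.commute)
    finally show "emeasure (distr (density lborel f) borel (\<lambda>x. - (e \<bullet> x))) A = emeasure (density lborel m) A" .
  qed simp
qed

lemma levy_kernel_integral:
  assumes "t \<noteq> 0" "a \<le> b"
  shows "(LINT u|lborel. indicator {a..b} u *\<^sub>R cis (- (t * u))) = (iexp (- (t * a)) - iexp (- (t * b))) / (\<i> * complex_of_real t)"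
proof -
  define F where "F u = - iexp (- (t * u)) / (\<i> * complex_of_real t)" for u
  have "(LINT u|lborel. indicator {a..b} u *\<^sub>R cis (- (t * u))) = F b - F a"
  proof (rule integral_FTC_Icc[OF assms(2)])
    fix u :: real
    have "((\<lambda>w. - exp (\<i> * (- (complex_of_real t * w))) / (\<i> * complex_of_real t)) has_field_derivative exp (\<i> * (- (complex_of_real t * complex_of_real u)))) (at (complex_of_real u))"
    proof -
      have "- (\<i> * (z * \<i>)) = z" for z by (simp add: complex_eq_iff)
      then show ?thesis using assms(1) by (auto intro!: derivative_eq_intros)
    qed
    from has_vector_derivative_real_field[OF this]
    show "(F has_vector_derivative cis (- (t * u))) (at u within {a..b})"
      unfolding F_def by (simp add: cis_conv_exp has_vector_derivative_at_within)
  qed (auto simp: cis_conv_exp intro!: continuous_intros)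
  then show ?thesis by (simp add: F_def diff_divide_distrib)
qed

lemma (in line_profile) integral_dens_interval:
  assumes ab: "a \<le> b"
  shows "(LINT u|lborel. indicator {a..b} u *\<^sub>R dens u)
     = complex_of_real (1 / (2 * pi)) * (LINT t|lborel. (iexp (- (t * a)) - iexp (- (t * b))) / (\<i> * complex_of_real t) * \<gamma> t)"
proof -
  define q where "q u s = complex_of_real (indicator {a..b} u) * (cis (- (s * u)) * \<gamma> s)" for u s
  have i: "integrable lborel (\<lambda>u. complex_of_real (indicator {a..b} u))"
    by (intro integrable_of_real integrable_real_indicator) (auto simp: emeasure_lborel_Icc_eq)
  have q: "integrable (lborel \<Otimes>\<^sub>M lborel) (\<lambda>(u, s). q u s)"
  proof (rule Bochner_Integration.integrable_bound[OF integrable_pair_mult[OF sigma_finite_lborel sigma_finite_lborel i integrable_profile]])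
    show "(\<lambda>(u, s). q u s) \<in> borel_measurable (lborel \<Otimes>\<^sub>M lborel)" unfolding q_def by measurable
  qed (auto simp: q_def norm_mult)
  have "(LINT u|lborel. indicator {a..b} u *\<^sub>R dens u) = (LINT u|lborel. complex_of_real (1 / (2 * pi)) * (LINT s|lborel. q u s))"
  proof (intro Bochner_Integration.integral_cong refl)
    fix u :: real
    have "(LINT s|lborel. q u s) = complex_of_real (indicator {a..b} u) * (LINT s|lborel. cis (- (s * u)) * \<gamma> s)"
      unfolding q_def by (rule integral_mult_right_zero)
    then show "indicator {a..b} u *\<^sub>R dens u = complex_of_real (1 / (2 * pi)) * (LINT s|lborel. q u s)"
      by (simp add: dens_def scaleR_conv_of_real)
  qed
  also have "\<dots> = complex_of_real (1 / (2 * pi)) * (LINT u|lborel. LINT s|lborel. q u s)"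
    by (rule integral_mult_right_zero)
  also have "(LINT u|lborel. LINT s|lborel. q u s) = (LINT s|lborel. LINT u|lborel. q u s)"
    by (rule lborel_pair.Fubini_integral[OF q, symmetric])
  also have "\<dots> = (LINT t|lborel. (iexp (- (t * a)) - iexp (- (t * b))) / (\<i> * complex_of_real t) * \<gamma> t)"
  proof (rule integral_cong_AE)
    show "(\<lambda>s. LINT u|lborel. q u s) \<in> borel_measurable lborel" unfolding q_def by measurable
    show "AE s in lborel. (LINT u|lborel. q u s) = (iexp (- (s * a)) - iexp (- (s * b))) / (\<i> * complex_of_real s) * \<gamma> s"
      using AE_lborel_singleton[of 0]
    proof eventually_elim
      case (elim s)
      have "(LINT u|lborel. q u s) = (LINT u|lborel. (indicator {a..b} u *\<^sub>R cis (- (s * u))) * \<gamma> s)"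
        by (intro Bochner_Integration.integral_cong refl) (simp add: q_def scaleR_conv_of_real)
      also have "\<dots> = (LINT u|lborel. indicator {a..b} u *\<^sub>R cis (- (s * u))) * \<gamma> s"
        by (rule integral_mult_left_zero)
      finally show ?case using levy_kernel_integral[OF elim ab] by simp
    qed
  qed measurable
  finally show ?thesis .
qed

lemma (in line_profile) levy_limit:
  assumes ab: "a \<le> b"
  shows "(\<lambda>T :: nat. CLBINT t=-real T..real T. (iexp (- (t * a)) - iexp (- (t * b))) / (\<i> * complex_of_real t) * \<gamma> t)
     \<longlonglongrightarrow> (LINT t|lborel. (iexp (- (t * a)) - iexp (- (t * b))) / (\<i> * complex_of_real t) * \<gamma> t)"
proof -
  let ?F = "\<lambda>t. (iexp (- (t * a)) - iexp (- (t * b))) / (\<i> * complex_of_real t)"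
  have F: "cmod (?F t) \<le> b - a" for t :: real
  proof (cases "t = 0")
    case False
    have "(iexp (- t * b) - iexp (- t * a)) / (\<i> * complex_of_real (- t)) = ?F t"
      using False by (simp add: field_simps)
    then show ?thesis using Levy_Inversion_aux2[OF ab, of "- t"] False by simp
  qed (use ab in simp)
  have "(\<lambda>T :: nat. LINT t|lborel. indicator {- real T<..<real T} t *\<^sub>R (?F t * \<gamma> t)) \<longlonglongrightarrow> (LINT t|lborel. ?F t * \<gamma> t)"
  proof (rule integral_dominated_convergence[where w="\<lambda>t. (b - a) * cmod (\<gamma> t)"])
    show "integrable lborel (\<lambda>t. (b - a) * cmod (\<gamma> t))" using integrable_profile by auto
    show "AE t in lborel. (\<lambda>T :: nat. indicator {- real T<..<real T} t *\<^sub>R (?F t * \<gamma> t)) \<longlonglongrightarrow> ?F t * \<gamma> t"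
    proof (intro AE_I2 tendsto_eventually)
      fix t :: real
      obtain n0 :: nat where n0: "\<bar>t\<bar> < real n0" using reals_Archimedean2 by blast
      show "\<forall>\<^sub>F T in sequentially. indicator {- real T<..<real T} t *\<^sub>R (?F t * \<gamma> t) = ?F t * \<gamma> t"
        using eventually_ge_at_top[of n0]
      proof eventually_elim
        case (elim T)
        then have "real n0 \<le> real T" by simp
        then have "t \<in> {- real T<..<real T}" using n0 by auto
        then show ?case by simp
      qed
    qed
    show "AE t in lborel. norm (indicator {- real T<..<real T} t *\<^sub>R (?F t * \<gamma> t)) \<le> (b - a) * cmod (\<gamma> t)" for T :: nat
    proof (intro AE_I2)
      fix t :: real
      have "cmod (?F t) * cmod (\<gamma> t) \<le> (b - a) * cmod (\<gamma> t)" by (intro mult_right_mono F) simp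
      then show "norm (indicator {- real T<..<real T} t *\<^sub>R (?F t * \<gamma> t)) \<le> (b - a) * cmod (\<gamma> t)"
        using ab by (cases "t \<in> {- real T<..<real T}") (simp_all only: norm_scaleR norm_mult indicator_simps, simp_all)
    qed
  qed measurable
  moreover have "(CLBINT t=-real T..real T. ?F t * \<gamma> t) = (LINT t|lborel. indicator {- real T<..<real T} t *\<^sub>R (?F t * \<gamma> t))" for T :: nat
    by (simp add: interval_lebesgue_integral_def set_lebesgue_integral_def einterval_eq)
  ultimately show ?thesis by (simp only:)
qed

text \<open>Levy's inversion formula; as \<open>\<gamma>\<close> is integrable, its principal value limit is an absolutely convergent integral,
  and Fubini's theorem identifies it with the integral of \<open>dens\<close> over the interval.\<close>

lemma (in line_profile) levy_density:
  assumes P: "real_distribution P" and char: "\<And>t. char P t = complex_of_real \<kappa> * \<gamma> t"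
    and single: "\<And>x. measure P {x} = 0" and ab: "a \<le> b"
  shows "complex_of_real (measure P {a<..b}) = complex_of_real \<kappa> * (LINT u|lborel. indicator {a..b} u *\<^sub>R dens u)"
proof -
  let ?F = "\<lambda>t. (iexp (- (t * a)) - iexp (- (t * b))) / (\<i> * complex_of_real t)"
  have 1: "(\<lambda>T :: nat. 1 / (2 * pi) * (CLBINT t=-real T..real T. ?F t * char P t)) \<longlonglongrightarrow> complex_of_real (measure P {a<..b})"
    using real_distribution.Levy_Inversion[OF P ab single single] by simp
  have "(CLBINT t=-real T..real T. ?F t * char P t) = complex_of_real \<kappa> * (CLBINT t=-real T..real T. ?F t * \<gamma> t)" for T
  proof -
    have "(CLBINT t=-real T..real T. ?F t * char P t) = (CLBINT t=-real T..real T. complex_of_real \<kappa> * (?F t * \<gamma> t))"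
      unfolding char by (simp only: mult.left_commute)
    then show ?thesis by (simp only: interval_lebesgue_integral_mult_right)
  qed
  then have 2: "(\<lambda>T :: nat. 1 / (2 * pi) * (complex_of_real \<kappa> * (CLBINT t=-real T..real T. ?F t * \<gamma> t))) \<longlonglongrightarrow> complex_of_real (measure P {a<..b})"
    using 1 by (simp only:)
  have 3: "(\<lambda>T :: nat. 1 / (2 * pi) * (complex_of_real \<kappa> * (CLBINT t=-real T..real T. ?F t * \<gamma> t)))
       \<longlonglongrightarrow> 1 / (2 * pi) * (complex_of_real \<kappa> * (LINT t|lborel. ?F t * \<gamma> t))"
    by (intro tendsto_mult tendsto_const levy_limit[OF ab])
  from LIMSEQ_unique[OF 2 3] show ?thesis
    unfolding integral_dens_interval[OF ab] by simp
qed

lemma eq_of_continuous_AE_eq: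
  fixes f g :: "real \<Rightarrow> real"
  assumes "continuous_on UNIV f" "continuous_on UNIV g" "AE x in lborel. f x = g x"
  shows "f = g"
proof (rule ccontr)
  assume "f \<noteq> g"
  then obtain x where x: "f x \<noteq> g x" by auto
  have "open {x. f x \<noteq> g x}" using assms(1,2) by (rule open_Collect_neq)
  then obtain d where d: "0 < d" "ball x d \<subseteq> {x. f x \<noteq> g x}" using x unfolding open_contains_ball by blast
  have "{y \<in> space lborel. \<not> y \<notin> ball x d} = ball x d" by auto
  then have "(AE y in lborel. y \<notin> ball x d) \<longleftrightarrow> emeasure lborel (ball x d) = 0"
    by (intro AE_iff_measurable) auto
  moreover have "AE y in lborel. y \<notin> ball x d" using assms(3) by eventually_elim (use d(2) in auto)
  ultimately have "measure lborel (ball x d) = 0" by (simp add: measure_def)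
  moreover have "0 < measure lborel (ball x d)" using d(1) by (rule content_ball_pos)
  ultimately show False by simp
qed

text \<open>If \<open>g\<close> has positive mass \<open>c\<close>, the law of \<open>- (e \<bullet> x)\<close> under \<open>g / c\<close> has characteristic function \<open>\<gamma> / c\<close>, so by
  \<open>levy_density\<close> it assigns to intervals the integrals of \<open>dens / c\<close>. Its density is also given by hyperplane integrals of
  \<open>g / c\<close>; hence these agree with \<open>dens / c\<close> almost everywhere, and \<open>dens\<close> is the continuous representative that
  \<open>marginal\<close> selects.\<close>

lemma
  fixes g :: "real ^ 'n \<Rightarrow> real"
  assumes g: "\<And>x. 0 \<le> g x" "integrable lborel g" and e: "norm e = 1"
    and lp: "line_profile (\<lambda>s. fourier g (s *\<^sub>R e))"
  defines "d \<equiv> \<lambda>u. Re (line_profile.dens (\<lambda>s. fourier g (s *\<^sub>R e)) u)"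
  shows marginal_eq_dens: "marginal g e = d"
    and dens_pos_somewhere: "\<not> (AE x in lborel. g x = 0) \<Longrightarrow> \<exists>u. 0 < d u"
proof -
  define \<gamma> where "\<gamma> = (\<lambda>s. fourier g (s *\<^sub>R e))"
  interpret line_profile \<gamma> using lp by (simp only: \<gamma>_def)
  have [measurable]: "g \<in> borel_measurable borel" using g(2) by auto
  have d_eq: "d u = Re (dens u)" for u by (simp only: d_def \<gamma>_def)
  have cont_d: "continuous_on UNIV d" using continuous_dens by (simp only: d_eq[abs_def])
  then have [measurable]: "d \<in> borel_measurable borel" by (rule borel_measurable_continuous_onI)
  define m where "m u = (\<integral>\<^sup>+ y. ennreal (g (- (u *\<^sub>R e) + y)) \<partial>hyperplane_measure e)" for u
  have m [measurable]: "m \<in> borel_measurable borel"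
    and distr: "distr (density lborel (\<lambda>x. ennreal (g x))) borel (\<lambda>x. - (e \<bullet> x)) = density lborel m"
    unfolding m_def by (intro distr_hyperplane_density[OF e], simp)+
  define c where "c = (LINT x|lborel. g x)"
  have c0: "0 \<le> c" unfolding c_def using g(1) by (intro integral_nonneg_AE) auto
  have cnn: "(\<integral>\<^sup>+ x. ennreal (g x) \<partial>lborel) = ennreal c"
    unfolding c_def using g by (intro nn_integral_eq_integral) auto
  have c_AE: "c = 0 \<longleftrightarrow> (AE x in lborel. g x = 0)"
    unfolding c_def using g by (intro integral_nonneg_eq_0_iff_AE) auto
  have mtotal: "(\<integral>\<^sup>+ u. m u \<partial>lborel) = ennreal c"
  proof -
    have "emeasure (density lborel m) UNIV = emeasure (density lborel (\<lambda>x. ennreal (g x))) UNIV"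
      unfolding distr[symmetric] by (subst emeasure_distr) auto
    then show ?thesis by (simp add: emeasure_density cnn)
  qed
  have interval: "(LINT u|lborel. indicator {a..b} u *\<^sub>R dens u) = complex_of_real (measure (density lborel m) {a<..b})" if ab: "a \<le> b" and c: "0 < c" for a b
  proof -
    define P where "P = distr (density lborel (\<lambda>x. ennreal (g x / c))) borel (\<lambda>x. - (e \<bullet> x))"
    have dens_scale: "density lborel (\<lambda>x. ennreal (g x / c)) = scale_measure (ennreal (1 / c)) (density lborel (\<lambda>x. ennreal (g x)))"
    proof (rule measure_eqI)
      fix A assume "A \<in> sets (density lborel (\<lambda>x. ennreal (g x / c)))"
      then have [measurable]: "A \<in> sets borel" by simp
      have "(\<integral>\<^sup>+ x. ennreal (g x / c) * indicator A x \<partial>lborel) = (\<integral>\<^sup>+ x. ennreal (1 / c) * (ennreal (g x) * indicator A x) \<partial>lborel)"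
      proof (rule nn_integral_cong)
        fix x
        have "ennreal (g x / c) = ennreal (1 / c) * ennreal (g x)" using c g(1) by (subst ennreal_mult[symmetric]) auto
        then show "ennreal (g x / c) * indicator A x = ennreal (1 / c) * (ennreal (g x) * indicator A x)" by (simp add: mult.assoc)
      qed
      then show "emeasure (density lborel (\<lambda>x. ennreal (g x / c))) A = emeasure (scale_measure (ennreal (1 / c)) (density lborel (\<lambda>x. ennreal (g x)))) A"
        by (simp add: emeasure_density nn_integral_cmult)
    qed simp
    have P_emeasure: "emeasure P A = ennreal (1 / c) * emeasure (density lborel m) A" if "A \<in> sets borel" for A
      unfolding P_def distr[symmetric] dens_scale using that by (simp add: emeasure_distr space_scale_measure)
    have spP: "space P = UNIV" "sets P = sets borel" by (simp_all add: P_def)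
    have "emeasure (density lborel m) UNIV = ennreal c" by (simp add: emeasure_density mtotal)
    then have "emeasure P (space P) = 1"
      using c by (simp add: spP P_emeasure ennreal_mult[symmetric])
    then have "prob_space P" by (rule prob_spaceI)
    then have P: "real_distribution P"
      by (intro real_distribution.intro real_distribution_axioms.intro) (simp_all add: spP)
    have single: "measure P {x} = 0" for x
    proof -
      have "emeasure (density lborel m) {x} = (\<integral>\<^sup>+ u. m u * indicator {x} u \<partial>lborel)" by (rule emeasure_density) auto
      also have "\<dots> = (\<integral>\<^sup>+ u. 0 \<partial>(lborel :: real measure))"
      proof (rule nn_integral_cong_AE)
        show "AE u in lborel. m u * indicator {x} u = 0"
          using AE_lborel_singleton[of x] by eventually_elim auto
      qed
      finally show ?thesis by (simp add: measure_def P_emeasure)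
    qed
    have char: "char P t = complex_of_real (1 / c) * \<gamma> t" for t
    proof -
      have "char P t = (LINT x|density lborel (\<lambda>x. ennreal (g x / c)). iexp (t * - (e \<bullet> x)))"
        unfolding char_def P_def by (subst integral_distr) auto
      also have "\<dots> = (LINT x|lborel. (g x / c) *\<^sub>R iexp (t * - (e \<bullet> x)))"
        using g(1) c by (subst integral_density) auto
      also have "\<dots> = (LINT x|lborel. complex_of_real (1 / c) * (cis (- ((t *\<^sub>R e) \<bullet> x)) * complex_of_real (g x)))"
      proof (intro Bochner_Integration.integral_cong refl)
        fix x
        have i: "iexp (t * - (e \<bullet> x)) = cis (- ((t *\<^sub>R e) \<bullet> x))" by (simp add: cis_conv_exp)
        have "(g x / c) *\<^sub>R z = complex_of_real (1 / c) * (z * complex_of_real (g x))" for z by (simp add: scaleR_conv_of_real)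
        then show "(g x / c) *\<^sub>R iexp (t * - (e \<bullet> x)) = complex_of_real (1 / c) * (cis (- ((t *\<^sub>R e) \<bullet> x)) * complex_of_real (g x))"
          unfolding i .
      qed
      finally show ?thesis unfolding fourier_cis \<gamma>_def by (simp only: integral_mult_right_zero)
    qed
    have "complex_of_real (measure P {a<..b}) = complex_of_real (1 / c) * (LINT u|lborel. indicator {a..b} u *\<^sub>R dens u)"
      by (rule levy_density[OF P char single ab])
    moreover have "measure P {a<..b} = 1 / c * measure (density lborel m) {a<..b}"
      using c by (simp add: measure_def P_emeasure enn2real_mult)
    ultimately show ?thesis using c by simp
  qed
  have dint: "integrable lborel (\<lambda>u. indicator {a..b} u *\<^sub>R d u)" for a b
    by (rule borel_integrable_compact) (auto intro: continuous_on_subset[OF cont_d])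
  have dens_d: "dens u = complex_of_real (d u)" for u by (simp add: d_eq complex_eq_iff Im_dens)
  have interval_d: "(LINT u|lborel. indicator {a..b} u *\<^sub>R d u) = measure (density lborel m) {a<..b}" if "a \<le> b" "0 < c" for a b
  proof -
    have "complex_of_real (LINT u|lborel. indicator {a..b} u *\<^sub>R d u) = (LINT u|lborel. complex_of_real (indicator {a..b} u *\<^sub>R d u))"
      by (rule integral_complex_of_real[symmetric])
    also have "\<dots> = (LINT u|lborel. indicator {a..b} u *\<^sub>R dens u)"
      by (intro Bochner_Integration.integral_cong refl) (simp add: dens_d scaleR_conv_of_real)
    finally show ?thesis unfolding interval[OF that] by (simp only: of_real_eq_iff)
  qed
  have zero: "d u = 0" if "c = 0" for u
  proof -
    have "AE x in lborel. g x = 0" using that c_AE by simp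
    then have "fourier g k = (LINT (x :: real ^ 'n)|lborel. 0)" for k
      unfolding fourier_cis by (intro integral_cong_AE) auto
    then have "\<gamma> s = 0" for s by (simp add: \<gamma>_def)
    then show ?thesis by (simp add: d_eq dens_def)
  qed
  have nonneg: "0 \<le> d u" for u
  proof (rule ccontr)
    assume neg: "\<not> 0 \<le> d u"
    then have c: "0 < c" using zero[of u] c0 by (cases "c = 0") auto
    have op: "open {x. d x < 0}" by (rule open_Collect_less[OF cont_d continuous_on_const])
    have u_in: "u \<in> {x. d x < 0}" using neg by simp
    obtain \<epsilon> where \<epsilon>: "0 < \<epsilon>" "cball u \<epsilon> \<subseteq> {x. d x < 0}"
      using op[unfolded open_contains_cball, THEN bspec, OF u_in] by (elim exE conjE)
    have "0 < (LINT x|lborel. - (indicator {u..u + \<epsilon>} x *\<^sub>R d x))"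
    proof (rule integral_pos_of_pos_on_interval[of _ u "u + \<epsilon>"])
      show "integrable lborel (\<lambda>x. - (indicator {u..u + \<epsilon>} x *\<^sub>R d x))" using dint by (rule Bochner_Integration.integrable_minus)
      have neg': "d x < 0" if "x \<in> {u..u + \<epsilon>}" for x using that \<epsilon>(2) by (auto simp: subset_iff dist_real_def)
      show "0 \<le> - (indicator {u..u + \<epsilon>} x *\<^sub>R d x)" for x using neg'[of x] by (cases "x \<in> {u..u + \<epsilon>}") auto
      show "0 < - (indicator {u..u + \<epsilon>} x *\<^sub>R d x)" if "x \<in> {u..u + \<epsilon>}" for x using neg'[OF that] that by simp
    qed (use \<epsilon> in simp)
    also have "\<dots> = - measure (density lborel m) {u<..u + \<epsilon>}" using interval_d[of u "u + \<epsilon>"] \<epsilon>(1) c by simp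
    finally show False using measure_nonneg[of "density lborel m" "{u<..u + \<epsilon>}"] by linarith
  qed
  have mAE: "AE u in lborel. ennreal (d u) = m u"
  proof (cases "c = 0")
    case True
    then have "(\<integral>\<^sup>+ u. m u \<partial>lborel) = 0" using mtotal by simp
    then have "AE u in lborel. m u = 0" by (subst (asm) nn_integral_0_iff_AE) auto
    then show ?thesis by eventually_elim (simp add: zero[OF True])
  next
    case False
    then have c: "0 < c" using c0 by simp
    have fin: "emeasure (density lborel m) A < \<infinity>" if "A \<in> sets borel" for A
    proof -
      have "emeasure (density lborel m) A \<le> emeasure (density lborel m) UNIV" by (intro emeasure_mono) auto
      then show ?thesis by (simp add: emeasure_density mtotal le_less_trans)
    qed
    have "density lborel (\<lambda>u. ennreal (d u)) = density lborel m"
    proof (rule measure_eqI_generator_eq[where \<Omega>=UNIV and E="range (\<lambda>(a, b). {a<..b :: real})" and A="\<lambda>n. {- real n<..real n}"])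
      show "Int_stable (range (\<lambda>(a, b). {a<..b :: real}))"
      proof (rule Int_stableI)
        fix A B :: "real set" assume "A \<in> range (\<lambda>(a, b). {a<..b})" "B \<in> range (\<lambda>(a, b). {a<..b})"
        then obtain a b a' b' where "A = {a<..b}" "B = {a'<..b'}" by auto
        then have "A \<inter> B = (\<lambda>(a, b). {a<..b}) (max a a', min b b')" by auto
        then show "A \<inter> B \<in> range (\<lambda>(a, b). {a<..b})" by (rule range_eqI)
      qed
      fix A :: "real set" assume "A \<in> range (\<lambda>(a, b). {a<..b})"
      then obtain a b where A: "A = {a<..b}" by auto
      show "emeasure (density lborel (\<lambda>u. ennreal (d u))) A = emeasure (density lborel m) A"
      proof (cases "a \<le> b")
        case True
        have "emeasure (density lborel (\<lambda>u. ennreal (d u))) A = (\<integral>\<^sup>+ u. ennreal (indicator {a..b} u *\<^sub>R d u) \<partial>lborel)"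
          unfolding A using AE_lborel_singleton[of a]
          by (subst emeasure_density) (auto intro!: nn_integral_cong_AE simp: indicator_def)
        also have "\<dots> = ennreal (LINT u|lborel. indicator {a..b} u *\<^sub>R d u)"
          using nonneg by (intro nn_integral_eq_integral dint) auto
        also have "\<dots> = emeasure (density lborel m) A"
          unfolding interval_d[OF True c] A using fin[of "{a<..b}"] by (intro emeasure_eq_ennreal_measure[symmetric]) auto
        finally show ?thesis .
      qed (simp add: A)
    next
      show "sets (density lborel (\<lambda>u. ennreal (d u))) = sigma_sets UNIV (range (\<lambda>(a, b). {a<..b :: real}))"
        by (simp add: borel_sigma_sets_Ioc sets_measure_of)
      show "sets (density lborel m) = sigma_sets UNIV (range (\<lambda>(a, b). {a<..b :: real}))"
        by (simp add: borel_sigma_sets_Ioc sets_measure_of)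
      show "(\<Union>n. {- real n<..real n}) = UNIV"
      proof (intro set_eqI iffI UNIV_I)
        fix x :: real
        obtain n where "\<bar>x\<bar> < real n" using reals_Archimedean2 by blast
        then have "x \<in> {- real n<..real n}" by auto
        then show "x \<in> (\<Union>n. {- real n<..real n})" by blast
      qed
      show "emeasure (density lborel (\<lambda>u. ennreal (d u))) {- real n<..real n} \<noteq> \<infinity>" for n
      proof -
        have "emeasure (density lborel (\<lambda>u. ennreal (d u))) {- real n<..real n} \<le> (\<integral>\<^sup>+ u. ennreal (indicator {- real n..real n} u *\<^sub>R d u) \<partial>lborel)"
          by (subst emeasure_density) (auto intro!: nn_integral_mono simp: indicator_def)
        also have "\<dots> = ennreal (LINT u|lborel. indicator {- real n..real n} u *\<^sub>R d u)"
          using nonneg by (intro nn_integral_eq_integral dint) auto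
        finally show ?thesis by (auto simp: top_unique)
      qed
    qed auto
    then show ?thesis by (rule sigma_finite_measure.density_unique[OF sigma_finite_lborel, rotated 2]) auto
  qed
  have AEd: "AE u in lborel. d u = (LINT w'|hyperplane_measure e. g (- (u *\<^sub>R (e /\<^sub>R norm e)) + w'))"
    using mAE
  proof eventually_elim
    case (elim u)
    have "(LINT w'|hyperplane_measure e. g (- (u *\<^sub>R e) + w')) = enn2real (m u)"
      unfolding m_def using g(1) by (intro integral_eq_nn_integral) auto
    also have "\<dots> = d u" using elim[symmetric] nonneg[of u] by simp
    finally show ?case using e by simp
  qed
  show "marginal g e = d"
    unfolding marginal_def
  proof (rule the_equality)
    show "continuous_on UNIV d \<and> (AE u in lborel. d u = (LINT w'|hyperplane_measure e. g (- (u *\<^sub>R (e /\<^sub>R norm e)) + w')))"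
      using cont_d AEd by simp
    fix G assume G: "continuous_on UNIV G \<and> (AE u in lborel. G u = (LINT w'|hyperplane_measure e. g (- (u *\<^sub>R (e /\<^sub>R norm e)) + w')))"
    then have "AE u in lborel. G u = (LINT w'|hyperplane_measure e. g (- (u *\<^sub>R (e /\<^sub>R norm e)) + w'))" by simp
    with AEd have "AE u in lborel. G u = d u" by eventually_elim simp
    then show "G = d" using G cont_d by (intro eq_of_continuous_AE_eq) auto
  qed
  show "\<exists>u. 0 < d u" if "\<not> (AE x in lborel. g x = 0)"
  proof (rule ccontr)
    assume "\<not> (\<exists>u. 0 < d u)"
    then have "d u \<le> 0" for u by (simp add: not_less)
    then have "d u = 0" for u using nonneg[of u] by (intro antisym)
    then have "AE u in lborel. m u = 0" using mAE by simp
    then have "(\<integral>\<^sup>+ u. m u \<partial>lborel) = 0" by (subst nn_integral_0_iff_AE) auto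
    then show False using mtotal c_AE that c0 by simp
  qed
qed

section \<open>Reduction to lines and the smallness condition\<close>

lemma abs_le_moment_weight:
  assumes "0 \<le> \<kappa>"
  shows "\<bar>s\<bar> \<le> \<bar>s\<bar> * japanese_bracket s powr \<kappa>"
proof -
  have "1 \<le> japanese_bracket s powr \<kappa>"
    using japanese_bracket_ge_1[of s] assms by (rule ge_one_powr_ge_zero)
  from mult_left_mono[OF this, of "\<bar>s\<bar>"] show ?thesis by simp
qed

text \<open>The transform is bounded by the \<open>L\<^sup>1\<close> norm for \<open>|s| \<le> 1\<close> and dominated by its first moment beyond.\<close>

lemma sobolev_line_profile:
  fixes g :: "real ^ 'n \<Rightarrow> real"
  assumes \<delta>: "0 < \<delta>" and g: "integrable lborel g" "in_weighted_sobolev (3 / 2 + \<delta>) (half_dim TYPE('n)) g" and e: "norm e = 1"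
  shows "line_profile (\<lambda>s. fourier g (s *\<^sub>R e))"
proof -
  define \<gamma> where "\<gamma> s = fourier g (s *\<^sub>R e)" for s
  obtain C where C: "0 \<le> C"
    "\<And>(g :: real ^ 'n \<Rightarrow> real) e. integrable lborel g \<Longrightarrow>
      in_weighted_sobolev (3 / 2 + \<delta>) (half_dim TYPE('n)) g \<Longrightarrow> norm e = 1 \<Longrightarrow>
      (\<integral>\<^sup>+ s. ennreal (\<bar>s\<bar> * japanese_bracket s powr (\<delta> / 2) * cmod (fourier g (s *\<^sub>R e))) \<partial>lborel)
        \<le> ennreal (C * weighted_sobolev_norm (3 / 2 + \<delta>) (half_dim TYPE('n)) g)"
    "\<And>(g :: real ^ 'n \<Rightarrow> real) e. integrable lborel g \<Longrightarrow>
      in_weighted_sobolev (3 / 2 + \<delta>) (half_dim TYPE('n)) g \<Longrightarrow> norm e = 1 \<Longrightarrow>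
      (\<integral>\<^sup>+ s. ennreal ((1 + s\<^sup>2) * (cmod (fourier g (s *\<^sub>R e)))\<^sup>2) \<partial>lborel) < \<infinity>"
    by (rule sobolev_line_bounds[OF \<delta>], rule that)
  have [measurable]: "\<gamma> \<in> borel_measurable borel"
    unfolding \<gamma>_def using borel_measurable_fourier[OF g(1)] by measurable
  have bd: "cmod (\<gamma> s) \<le> L1_norm g" for s unfolding \<gamma>_def by (rule norm_fourier_le)
  have "(\<integral>\<^sup>+ s. ennreal (\<bar>s\<bar> * cmod (\<gamma> s)) \<partial>lborel) \<le> (\<integral>\<^sup>+ s. ennreal (\<bar>s\<bar> * japanese_bracket s powr (\<delta> / 2) * cmod (\<gamma> s)) \<partial>lborel)"
    using \<delta> by (intro nn_integral_mono ennreal_leI mult_right_mono abs_le_moment_weight) auto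
  also have "\<dots> \<le> ennreal (C * weighted_sobolev_norm (3 / 2 + \<delta>) (half_dim TYPE('n)) g)"
    unfolding \<gamma>_def by (rule C(2)[OF g e])
  finally have mom: "integrable lborel (\<lambda>s. \<bar>s\<bar> * cmod (\<gamma> s))"
    by (intro integrableI_bounded) (auto simp: le_less_trans abs_mult)
  have int: "integrable lborel \<gamma>"
  proof (rule Bochner_Integration.integrable_bound)
    show "integrable lborel (\<lambda>s. indicator {-1..1} s * L1_norm g + \<bar>s\<bar> * cmod (\<gamma> s))"
      by (intro Bochner_Integration.integrable_add mom integrable_mult_left integrable_real_indicator) auto
    show "AE s in lborel. norm (\<gamma> s) \<le> norm (indicator {-1..1} s * L1_norm g + \<bar>s\<bar> * cmod (\<gamma> s))"
    proof (intro AE_I2)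
      fix s
      have L0: "0 \<le> L1_norm g" using bd[of s] norm_ge_zero[of "\<gamma> s"] by linarith
      show "norm (\<gamma> s) \<le> norm (indicator {-1..1} s * L1_norm g + \<bar>s\<bar> * cmod (\<gamma> s))"
      proof (cases "\<bar>s\<bar> \<le> 1")
        case True
        then have "s \<in> {-1..1}" by auto
        then have "indicator {-1..1} s * L1_norm g + \<bar>s\<bar> * cmod (\<gamma> s) = L1_norm g + \<bar>s\<bar> * cmod (\<gamma> s)" by simp
        moreover have "0 \<le> \<bar>s\<bar> * cmod (\<gamma> s)" by simp
        ultimately show ?thesis unfolding real_norm_def using bd[of s] L0 by linarith
      next
        case False
        then have "s \<notin> {-1..1}" by auto
        moreover have "1 * cmod (\<gamma> s) \<le> \<bar>s\<bar> * cmod (\<gamma> s)" using False by (intro mult_right_mono) auto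
        ultimately show ?thesis by (simp add: abs_mult)
      qed
    qed
  qed measurable
  have herm: "\<gamma> (- s) = cnj (\<gamma> s)" for s
    unfolding \<gamma>_def fourier_cis
    by (simp only: Bochner_Integration.integral_cnj[symmetric] complex_cnj_mult cis_cnj complex_cnj_complex_of_real) simp
  have "line_profile \<gamma>"
    by (unfold_locales) (use int mom herm C(3)[OF g e] in \<open>simp_all only: \<gamma>_def\<close>)
  then show ?thesis by (simp only: \<gamma>_def[abs_def])
qed

text \<open>The function \<open>dispersion\<close> of the profile in direction \<open>e\<close>, in a form that permits the direction to vary.\<close>

definition ray_dispersion :: "(real ^ 'n \<Rightarrow> real) \<Rightarrow> real ^ 'n \<Rightarrow> real \<Rightarrow> complex \<Rightarrow> complex" where
  "ray_dispersion g e r z = laplace (\<lambda>s. complex_of_real (kern r s) * fourier g (s *\<^sub>R e)) z"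

text \<open>The substitution \<open>s = t |k|\<close>; the powers of \<open>|k|\<close> combine so that only the direction, the product of \<open>hb\<close> with \<open>|k|\<close> and the
  rescaled spectral parameter remain.\<close>

lemma Ltilde_eq_ray_dispersion:
  assumes k: "k \<noteq> 0"
  shows "Ltilde w g z k hb = fourier w k * ray_dispersion g (k /\<^sub>R norm k) (hb * norm k) (z / complex_of_real (norm k))"
proof -
  define N where "N = norm k"
  have N: "0 < N" using k by (simp add: N_def)
  let ?e = "k /\<^sub>R N"
  have ex: "exp (- (z / complex_of_real N * complex_of_real s)) = exp (- (z * complex_of_real (s / N)))" for s
    by simp
  show ?thesis
  proof (cases "hb = 0")
    case True
    have "(LBINT s:{0..}. exp (- (z * complex_of_real (s / N))) * complex_of_real s * fourier g (s *\<^sub>R ?e)) = ray_dispersion g ?e 0 (z / complex_of_real N)"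
      unfolding set_lebesgue_integral_def ray_dispersion_def laplace_def ex kern_0
      by (intro Bochner_Integration.integral_cong refl) (simp add: indicator_def mult.assoc)
    then show ?thesis using k True by (simp add: Ltilde_def N_def)
  next
    case False
    define f where "f t = indicator {0..} t *\<^sub>R (exp (- (z * complex_of_real t)) * complex_of_real (sin (1 / 2 * hb * t * N\<^sup>2)) * fourier g (t *\<^sub>R k))" for t
    have N1: "1 / N \<noteq> 0" using N by simp
    have "(LINT t|lborel. f t) = \<bar>1 / N\<bar> *\<^sub>R (LINT s|lborel. f (0 + 1 / N * s))"
      by (rule lborel_integral_real_affine[OF N1])
    then have "complex_of_real (2 / hb) * (LINT t|lborel. f t) = complex_of_real (2 / (hb * N)) * (LINT s|lborel. f (0 + 1 / N * s))"
      using N by (simp add: scaleR_conv_of_real)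
    also have "\<dots> = (LINT s|lborel. complex_of_real (2 / (hb * N)) * f (0 + 1 / N * s))"
      by (rule integral_mult_right_zero[symmetric])
    also have "\<dots> = ray_dispersion g ?e (hb * N) (z / complex_of_real N)"
      unfolding ray_dispersion_def laplace_def
    proof (intro Bochner_Integration.integral_cong refl)
      fix s :: real
      have "0 + 1 / N * s = s / N" by simp
      have sc: "(s / N) *\<^sub>R k = s *\<^sub>R ?e" by (simp add: divide_inverse)
      have sn: "1 / 2 * hb * (s / N) * N\<^sup>2 = hb * N * s / 2" using N by (simp add: power2_eq_square)
      have ind: "indicator {0..} (s / N) = (indicator {0..} s :: real)" using N by (auto simp: indicator_def zero_le_divide_iff)
      have kn: "kern (hb * N) s = 2 / (hb * N) * sin (hb * N * s / 2)" using N False by (intro kern_eq_sin) simp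
      have "complex_of_real (2 / (hb * N)) * f (s / N) = complex_of_real (2 / (hb * N)) * (indicator {0..} s *\<^sub>R (exp (- (z * complex_of_real (s / N))) * complex_of_real (sin (hb * N * s / 2)) * fourier g (s *\<^sub>R ?e)))"
        unfolding f_def ind sn sc ..
      also have "\<dots> = indicator {0..} s * exp (- (z * complex_of_real (s / N))) * (complex_of_real (kern (hb * N) s) * fourier g (s *\<^sub>R ?e))"
        unfolding kn by (simp add: indicator_def)
      finally show "complex_of_real (2 / (hb * N)) * f (0 + 1 / N * s) = indicator {0..} s * exp (- (z / complex_of_real N * complex_of_real s)) * (complex_of_real (kern (hb * N) s) * fourier g (s *\<^sub>R ?e))"
        unfolding ex \<open>0 + 1 / N * s = s / N\<close> .
    qed
    finally have I: "complex_of_real (2 / hb) * (LINT t|lborel. f t) = ray_dispersion g ?e (hb * N) (z / complex_of_real N)" .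
    have "Ltilde w g z k hb = complex_of_real (2 / hb) * fourier w k * (LINT t|lborel. f t)"
      using k False by (simp only: Ltilde_def f_def set_lebesgue_integral_def N_def if_False)
    also have "\<dots> = fourier w k * (complex_of_real (2 / hb) * (LINT t|lborel. f t))" by (simp only: mult_ac)
    finally show ?thesis unfolding I N_def .
  qed
qed

lemma norm_ray_dispersion_le:
  fixes g :: "real ^ 'n \<Rightarrow> real"
  assumes lp: "line_profile (\<lambda>s. fourier g (s *\<^sub>R e))" and z: "0 \<le> Re z" and \<kappa>: "0 \<le> \<kappa>" and A: "0 \<le> A"
    and bd: "(\<integral>\<^sup>+ s. ennreal (\<bar>s\<bar> * japanese_bracket s powr \<kappa> * cmod (fourier g (s *\<^sub>R e))) \<partial>lborel) \<le> ennreal A"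
  shows "cmod (ray_dispersion g e r z) \<le> A"
proof -
  define \<gamma> where "\<gamma> = (\<lambda>s. fourier g (s *\<^sub>R e))"
  interpret line_profile \<gamma> using lp by (simp only: \<gamma>_def)
  have "cmod (ray_dispersion g e r z) = cmod (laplace (\<lambda>s. complex_of_real (kern r s) * \<gamma> s) z - laplace (\<lambda>_. 0) z)"
    by (simp add: ray_dispersion_def \<gamma>_def laplace_def[of "\<lambda>_. 0"])
  also have "\<dots> \<le> (LINT s|lborel. cmod (complex_of_real (kern r s) * \<gamma> s - 0))"
    by (intro norm_laplace_diff_le integrable_kern_profile z) auto
  finally have "ennreal (cmod (ray_dispersion g e r z)) \<le> ennreal (LINT s|lborel. cmod (complex_of_real (kern r s) * \<gamma> s))"
    by (intro ennreal_leI) simp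
  also have "\<dots> = (\<integral>\<^sup>+ s. ennreal (cmod (complex_of_real (kern r s) * \<gamma> s)) \<partial>lborel)"
    by (intro nn_integral_eq_integral[symmetric] integrable_norm integrable_kern_profile) auto
  also have "\<dots> \<le> (\<integral>\<^sup>+ s. ennreal (\<bar>s\<bar> * japanese_bracket s powr \<kappa> * cmod (\<gamma> s)) \<partial>lborel)"
  proof (intro nn_integral_mono ennreal_leI)
    fix s
    have "\<bar>kern r s\<bar> \<le> \<bar>s\<bar> * japanese_bracket s powr \<kappa>"
      using abs_kern_le[of r s] abs_le_moment_weight[OF \<kappa>, of s] by (rule order_trans)
    then show "cmod (complex_of_real (kern r s) * \<gamma> s) \<le> \<bar>s\<bar> * japanese_bracket s powr \<kappa> * cmod (\<gamma> s)"
      unfolding norm_mult norm_of_real by (rule mult_right_mono) simp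
  qed
  also have "\<dots> \<le> ennreal A" using bd by (simp only: \<gamma>_def)
  finally show ?thesis using A by simp
qed

lemma L1_norm_nonneg: "0 \<le> L1_norm f"
  unfolding L1_norm_def by (intro integral_nonneg_AE) simp

text \<open>By \<open>|kern r s| \<le> |s|\<close>, the dispersion function is at most the first moment of the transform on the line, for which
  \<open>sobolev_line_bounds\<close> has a constant independent of the direction.\<close>

lemma smallness_constant_exists:
  assumes \<delta>: "0 < \<delta>"
  shows "\<exists>C. smallness_constant TYPE('n::finite) \<delta> C"
proof -
  obtain C where C: "0 \<le> C"
    "\<And>(g :: real ^ 'n \<Rightarrow> real) e. integrable lborel g \<Longrightarrow>
      in_weighted_sobolev (3 / 2 + \<delta>) (half_dim TYPE('n)) g \<Longrightarrow> norm e = 1 \<Longrightarrow>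
      (\<integral>\<^sup>+ s. ennreal (\<bar>s\<bar> * japanese_bracket s powr (\<delta> / 2) * cmod (fourier g (s *\<^sub>R e))) \<partial>lborel)
        \<le> ennreal (C * weighted_sobolev_norm (3 / 2 + \<delta>) (half_dim TYPE('n)) g)"
    "\<And>(g :: real ^ 'n \<Rightarrow> real) e. integrable lborel g \<Longrightarrow>
      in_weighted_sobolev (3 / 2 + \<delta>) (half_dim TYPE('n)) g \<Longrightarrow> norm e = 1 \<Longrightarrow>
      (\<integral>\<^sup>+ s. ennreal ((1 + s\<^sup>2) * (cmod (fourier g (s *\<^sub>R e)))\<^sup>2) \<partial>lborel) < \<infinity>"
    by (rule sobolev_line_bounds[OF \<delta>], rule that)
  have "smallness_constant TYPE('n) \<delta> C"
    unfolding smallness_constant_def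
  proof (intro allI impI)
    fix w g :: "real ^ 'n \<Rightarrow> real" and z :: complex and k :: "real ^ 'n" and hb :: real
    assume w: "integrable lborel w" and adm: "admissible_profile g"
      and sob: "in_weighted_sobolev (3 / 2 + \<delta>) (half_dim TYPE('n)) g" and z: "0 \<le> Re z"
    have g: "integrable lborel g" using adm by (simp add: admissible_profile_def)
    define S where "S = weighted_sobolev_norm (3 / 2 + \<delta>) (half_dim TYPE('n)) g"
    have S0: "0 \<le> C * S" using C(1) by (simp add: S_def weighted_sobolev_norm_nonneg)
    show "cmod (Ltilde w g z k hb) \<le> C * L1_norm w * weighted_sobolev_norm (3 / 2 + \<delta>) (half_dim TYPE('n)) g"
    proof (cases "k = 0")
      case True
      then show ?thesis using C(1) by (simp add: Ltilde_def L1_norm_nonneg weighted_sobolev_norm_nonneg)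
    next
      case False
      then have e: "norm (k /\<^sub>R norm k) = 1" by simp
      have "0 \<le> Re (z / complex_of_real (norm k))" using z by (simp add: Re_divide_of_real)
      then have "cmod (ray_dispersion g (k /\<^sub>R norm k) (hb * norm k) (z / complex_of_real (norm k))) \<le> C * S"
        using \<delta> C(2)[OF g sob e] S0 unfolding S_def
        by (intro norm_ray_dispersion_le[where \<kappa>="\<delta> / 2"] sobolev_line_profile[OF \<delta> g sob e]) auto
      then have "cmod (Ltilde w g z k hb) \<le> L1_norm w * (C * S)"
        unfolding Ltilde_eq_ray_dispersion[OF False] norm_mult
        by (intro mult_mono norm_fourier_le L1_norm_nonneg) auto
      then show ?thesis by (simp add: S_def mult_ac)
    qed
  qed
  then show ?thesis by blast
qed

lemma uniform_penrose_of_smallness: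
  assumes C: "smallness_constant TYPE('n::finite) \<delta> C" and g: "admissible_profile g"
    and small: "smallness_condition \<delta> C w (g :: real ^ 'n \<Rightarrow> real)"
  shows "uniform_penrose w g"
proof -
  define q where "q = C * L1_norm w * weighted_sobolev_norm (3 / 2 + \<delta>) (half_dim TYPE('n)) g"
  have q: "q < 1" using small by (simp add: smallness_condition_def q_def)
  have bd: "cmod (Ltilde w g z k hb) \<le> q" if "0 \<le> Re z" "0 < hb" "hb \<le> 1" for z k hb
    using C g small that unfolding smallness_constant_def smallness_condition_def q_def by simp
  show ?thesis
    unfolding uniform_penrose_def
  proof (intro exI[of _ "1 - q"] conjI allI impI)
    fix hb :: real assume hb: "0 < hb" "hb \<le> 1"
    show "1 - q \<le> Inf {cmod (1 + Ltilde w g z k hb) | z k. 0 \<le> Re z}"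
    proof (rule cInf_greatest)
      have "cmod (1 + Ltilde w g 0 0 hb) \<in> {cmod (1 + Ltilde w g z k hb) | z k. 0 \<le> Re z}"
        by (rule CollectI, rule exI[of _ 0], rule exI[of _ 0]) simp
      then show "{cmod (1 + Ltilde w g z k hb) | z k. 0 \<le> Re z} \<noteq> {}" by blast
      fix x assume "x \<in> {cmod (1 + Ltilde w g z k hb) | z k. 0 \<le> Re z}"
      then obtain z k where x: "x = cmod (1 + Ltilde w g z k hb)" "0 \<le> Re z" by auto
      have "1 - cmod (Ltilde w g z k hb) \<le> x" unfolding x(1) using norm_triangle_ineq4[of "1 + Ltilde w g z k hb" "Ltilde w g z k hb"] by simp
      then show "1 - q \<le> x" using bd[OF x(2) hb, of k] by linarith
    qed
  qed (use q in simp)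
qed

section \<open>From pointwise to uniform bounds\<close>

text \<open>No integrable function dominates the profiles in all directions at once. On \<open>[- M, M]\<close> they are uniformly bounded,
  and beyond, \<open>1 \<le> M powr (- \<delta> / 2) * \<langle>s\<rangle> powr (\<delta> / 2)\<close> turns the uniform weighted moment bound into a uniform tail bound.\<close>

lemma tendsto_ray_integrand_L1:
  fixes g :: "real ^ 'n \<Rightarrow> real"
  assumes \<delta>: "0 < \<delta>" and g: "integrable lborel g" "in_weighted_sobolev (3 / 2 + \<delta>) (half_dim TYPE('n)) g"
    and e: "\<And>n. norm (e n) = 1" "e \<longlonglongrightarrow> e0" "norm e0 = 1" and r: "r \<longlonglongrightarrow> r0"
  shows "(\<lambda>n. LINT s|lborel. cmod (complex_of_real (kern (r n) s) * fourier g (s *\<^sub>R e n) - complex_of_real (kern r0 s) * fourier g (s *\<^sub>R e0))) \<longlonglongrightarrow> 0"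
proof -
  obtain C where C: "0 \<le> C"
    "\<And>(g :: real ^ 'n \<Rightarrow> real) e. integrable lborel g \<Longrightarrow>
      in_weighted_sobolev (3 / 2 + \<delta>) (half_dim TYPE('n)) g \<Longrightarrow> norm e = 1 \<Longrightarrow>
      (\<integral>\<^sup>+ s. ennreal (\<bar>s\<bar> * japanese_bracket s powr (\<delta> / 2) * cmod (fourier g (s *\<^sub>R e))) \<partial>lborel)
        \<le> ennreal (C * weighted_sobolev_norm (3 / 2 + \<delta>) (half_dim TYPE('n)) g)"
    "\<And>(g :: real ^ 'n \<Rightarrow> real) e. integrable lborel g \<Longrightarrow>
      in_weighted_sobolev (3 / 2 + \<delta>) (half_dim TYPE('n)) g \<Longrightarrow> norm e = 1 \<Longrightarrow>
      (\<integral>\<^sup>+ s. ennreal ((1 + s\<^sup>2) * (cmod (fourier g (s *\<^sub>R e)))\<^sup>2) \<partial>lborel) < \<infinity>"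
    by (rule sobolev_line_bounds[OF \<delta>], rule that)
  define A where "A = C * weighted_sobolev_norm (3 / 2 + \<delta>) (half_dim TYPE('n)) g"
  have A0: "0 \<le> A" using C(1) by (simp add: A_def weighted_sobolev_norm_nonneg)
  have [measurable]: "(\<lambda>s. fourier g (s *\<^sub>R v)) \<in> borel_measurable borel" for v
    using borel_measurable_fourier[OF g(1)] by measurable
  define W where "W v s = \<bar>s\<bar> * japanese_bracket s powr (\<delta> / 2) * cmod (fourier g (s *\<^sub>R v))" for v s
  have W0: "0 \<le> W v s" for v s by (simp add: W_def)
  have [measurable]: "W v \<in> borel_measurable borel" for v unfolding W_def by measurable
  have W: "integrable lborel (W v)" "(LINT s|lborel. W v s) \<le> A" if v: "norm v = 1" for v
  proof -
    have bd: "(\<integral>\<^sup>+ s. ennreal (W v s) \<partial>lborel) \<le> ennreal A" unfolding W_def A_def by (rule C(2)[OF g v])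
    show i: "integrable lborel (W v)"
      using bd W0 by (intro integrableI_bounded) (auto simp: le_less_trans)
    have "ennreal (LINT s|lborel. W v s) \<le> ennreal A"
      using bd W0 by (subst nn_integral_eq_integral[symmetric]) (auto intro: i)
    then show "(LINT s|lborel. W v s) \<le> A" using A0 by simp
  qed
  define q where "q v \<rho> s = complex_of_real (kern \<rho> s) * fourier g (s *\<^sub>R v)" for v \<rho> s
  have [measurable]: "q v \<rho> \<in> borel_measurable borel" for v \<rho> unfolding q_def by measurable
  have qle: "cmod (q v \<rho> s) \<le> \<bar>s\<bar> * cmod (fourier g (s *\<^sub>R v))" for v \<rho> s
    unfolding q_def norm_mult norm_of_real by (intro mult_right_mono abs_kern_le) simp
  have qint: "integrable lborel (q v \<rho>)" if v: "norm v = 1" for v \<rho>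
  proof -
    interpret line_profile "\<lambda>s. fourier g (s *\<^sub>R v)" by (rule sobolev_line_profile[OF \<delta> g v])
    show ?thesis unfolding q_def by (rule integrable_kern_profile)
  qed
  have small: "(\<lambda>n. LINT s|lborel. indicator {-M..M} s * cmod (q (e n) (r n) s - q e0 r0 s)) \<longlonglongrightarrow> 0" if M: "0 \<le> M" for M :: real
  proof -
    have "(\<lambda>n. LINT s|lborel. indicator {-M..M} s * cmod (q (e n) (r n) s - q e0 r0 s)) \<longlonglongrightarrow> (LINT s|(lborel :: real measure). 0)"
    proof (rule integral_dominated_convergence[where w="\<lambda>s. indicator {-M..M} s * (2 * M * L1_norm g)"])
      show "integrable lborel (\<lambda>s. indicator {-M..M} s * (2 * M * L1_norm g))"
        by (intro integrable_mult_left integrable_real_indicator) (auto simp: emeasure_lborel_Icc_eq)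
      show "AE s in lborel. (\<lambda>n. indicator {-M..M} s * cmod (q (e n) (r n) s - q e0 r0 s)) \<longlonglongrightarrow> 0"
      proof (intro AE_I2)
        fix s :: real
        have "(\<lambda>n. fourier g (s *\<^sub>R e n)) \<longlonglongrightarrow> fourier g (s *\<^sub>R e0)"
        proof (rule isCont_tendsto_compose[where g="fourier g"])
          show "isCont (fourier g) (s *\<^sub>R e0)" using continuous_fourier[OF g(1)] by (simp add: continuous_on_eq_continuous_at)
          show "(\<lambda>n. s *\<^sub>R e n) \<longlonglongrightarrow> s *\<^sub>R e0" by (intro tendsto_intros e)
        qed
        moreover have "(\<lambda>n. kern (r n) s) \<longlonglongrightarrow> kern r0 s"
          unfolding kern_def by (intro tendsto_mult tendsto_const isCont_tendsto_compose[OF isCont_sinc] tendsto_divide r) auto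
        ultimately have "(\<lambda>n. q (e n) (r n) s) \<longlonglongrightarrow> q e0 r0 s" unfolding q_def by (intro tendsto_mult tendsto_of_real)
        then have "(\<lambda>n. cmod (q (e n) (r n) s - q e0 r0 s)) \<longlonglongrightarrow> 0"
          by (intro tendsto_norm_zero) (simp add: LIM_zero)
        from tendsto_mult[OF tendsto_const this, of "indicator {-M..M} s"]
        show "(\<lambda>n. indicator {-M..M} s * cmod (q (e n) (r n) s - q e0 r0 s)) \<longlonglongrightarrow> 0" by simp
      qed
      show "AE s in lborel. norm (indicator {-M..M} s * cmod (q (e n) (r n) s - q e0 r0 s)) \<le> indicator {-M..M} s * (2 * M * L1_norm g)" for n
      proof (intro AE_I2)
        fix s :: real
        have b: "cmod (q v \<rho> s) \<le> M * L1_norm g" if "\<bar>s\<bar> \<le> M" for v \<rho>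
          by (rule order_trans[OF qle mult_mono[OF that norm_fourier_le]]) (use M in auto)
        show "norm (indicator {-M..M} s * cmod (q (e n) (r n) s - q e0 r0 s)) \<le> indicator {-M..M} s * (2 * M * L1_norm g)"
        proof (cases "\<bar>s\<bar> \<le> M")
          case True
          then have "s \<in> {-M..M}" by auto
          then show ?thesis using norm_triangle_ineq4[of "q (e n) (r n) s" "q e0 r0 s"] b[OF True, of "e n" "r n"] b[OF True, of e0 r0] by simp
        next
          case False
          then have "s \<notin> {-M..M}" by auto
          then show ?thesis by simp
        qed
      qed
    qed measurable
    then show ?thesis by simp
  qed
  have split: "(LINT s|lborel. cmod (q (e n) (r n) s - q e0 r0 s)) \<le> (LINT s|lborel. indicator {-M..M} s * cmod (q (e n) (r n) s - q e0 r0 s)) + M powr (- (\<delta> / 2)) * (2 * A)"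
    if M: "0 < M" for M :: real and n
  proof -
    have i1: "integrable lborel (\<lambda>s. cmod (q (e n) (r n) s - q e0 r0 s))"
      by (intro integrable_norm Bochner_Integration.integrable_diff qint e)
    have i2: "integrable lborel (\<lambda>s. indicator {-M..M} s * cmod (q (e n) (r n) s - q e0 r0 s))"
      by (rule Bochner_Integration.integrable_bound[OF i1]) (auto simp: indicator_def)
    have i3: "integrable lborel (\<lambda>s. M powr (- (\<delta> / 2)) * (W (e n) s + W e0 s))"
      by (intro integrable_mult_right Bochner_Integration.integrable_add W e)
    have "(LINT s|lborel. cmod (q (e n) (r n) s - q e0 r0 s)) \<le> (LINT s|lborel. indicator {-M..M} s * cmod (q (e n) (r n) s - q e0 r0 s) + M powr (- (\<delta> / 2)) * (W (e n) s + W e0 s))"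
    proof (rule integral_mono[OF i1 Bochner_Integration.integrable_add[OF i2 i3]])
      fix s :: real
      show "cmod (q (e n) (r n) s - q e0 r0 s) \<le> indicator {-M..M} s * cmod (q (e n) (r n) s - q e0 r0 s) + M powr (- (\<delta> / 2)) * (W (e n) s + W e0 s)"
      proof (cases "s \<in> {-M..M}")
        case True
        have "0 \<le> M powr (- (\<delta> / 2)) * (W (e n) s + W e0 s)" using W0 by (intro mult_nonneg_nonneg add_nonneg_nonneg) auto
        then show ?thesis using True by simp
      next
        case False
        then have s: "M \<le> \<bar>s\<bar>" by auto
        have "\<bar>s\<bar> \<le> japanese_bracket s" unfolding japanese_bracket_def by (rule real_le_rsqrt) simp
        then have "M powr (\<delta> / 2) \<le> japanese_bracket s powr (\<delta> / 2)" using s M \<delta> by (intro powr_mono2) auto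
        then have one: "1 \<le> M powr (- (\<delta> / 2)) * japanese_bracket s powr (\<delta> / 2)"
          using M by (simp add: powr_minus field_simps)
        have tail: "cmod (q v \<rho> s) \<le> M powr (- (\<delta> / 2)) * W v s" for v \<rho>
        proof -
          have "\<bar>s\<bar> * cmod (fourier g (s *\<^sub>R v)) * 1 \<le> \<bar>s\<bar> * cmod (fourier g (s *\<^sub>R v)) * (M powr (- (\<delta> / 2)) * japanese_bracket s powr (\<delta> / 2))"
            by (intro mult_left_mono one) auto
          then show ?thesis using qle[of v \<rho> s] by (simp add: W_def mult_ac)
        qed
        have "cmod (q (e n) (r n) s - q e0 r0 s) \<le> cmod (q (e n) (r n) s) + cmod (q e0 r0 s)" by (rule norm_triangle_ineq4)
        also have "\<dots> \<le> M powr (- (\<delta> / 2)) * W (e n) s + M powr (- (\<delta> / 2)) * W e0 s" by (intro add_mono tail)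
        finally show ?thesis using False by (simp add: distrib_left)
      qed
    qed
    also have "\<dots> = (LINT s|lborel. indicator {-M..M} s * cmod (q (e n) (r n) s - q e0 r0 s)) + M powr (- (\<delta> / 2)) * ((LINT s|lborel. W (e n) s) + (LINT s|lborel. W e0 s))"
      using i2 i3 W(1)[OF e(1)[of n]] W(1)[OF e(3)] by simp
    also have "\<dots> \<le> (LINT s|lborel. indicator {-M..M} s * cmod (q (e n) (r n) s - q e0 r0 s)) + M powr (- (\<delta> / 2)) * (2 * A)"
      using W(2)[OF e(1)[of n]] W(2)[OF e(3)] by (intro add_left_mono mult_left_mono) auto
    finally show ?thesis .
  qed
  have "(\<lambda>n. LINT s|lborel. cmod (q (e n) (r n) s - q e0 r0 s)) \<longlonglongrightarrow> 0"
  proof (rule LIMSEQ_I)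
    fix \<epsilon> :: real assume \<epsilon>: "0 < \<epsilon>"
    have "((\<lambda>M :: real. M powr (- (\<delta> / 2)) * (2 * A)) \<longlongrightarrow> 0 * (2 * A)) at_top"
      by (intro tendsto_mult tendsto_const tendsto_neg_powr filterlim_ident) (use \<delta> in simp)
    then have "\<forall>\<^sub>F M :: real in at_top. M powr (- (\<delta> / 2)) * (2 * A) < \<epsilon> / 2"
      using \<epsilon> by (intro order_tendstoD(2)) auto
    then have "\<forall>\<^sub>F M :: real in at_top. M powr (- (\<delta> / 2)) * (2 * A) < \<epsilon> / 2 \<and> 0 < M"
      using eventually_gt_at_top[of 0] by (rule eventually_conj)
    then obtain M :: real where M: "M powr (- (\<delta> / 2)) * (2 * A) < \<epsilon> / 2" "0 < M"
      by (auto dest: eventually_happens'[rotated])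
    have "\<forall>\<^sub>F n in sequentially. (LINT s|lborel. indicator {-M..M} s * cmod (q (e n) (r n) s - q e0 r0 s)) < \<epsilon> / 2"
      by (rule order_tendstoD(2)[OF small]) (use M \<epsilon> in auto)
    then obtain n0 where n0: "\<And>n. n0 \<le> n \<Longrightarrow> (LINT s|lborel. indicator {-M..M} s * cmod (q (e n) (r n) s - q e0 r0 s)) < \<epsilon> / 2"
      by (auto simp: eventually_sequentially)
    show "\<exists>no. \<forall>n\<ge>no. norm ((LINT s|lborel. cmod (q (e n) (r n) s - q e0 r0 s)) - 0) < \<epsilon>"
    proof (intro exI[of _ n0] allI impI)
      fix n assume "n0 \<le> n"
      then have "(LINT s|lborel. cmod (q (e n) (r n) s - q e0 r0 s)) < \<epsilon>" using split[OF M(2), of n] n0[of n] M(1) by linarith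
      moreover have "0 \<le> (LINT s|lborel. cmod (q (e n) (r n) s - q e0 r0 s))" by (intro integral_nonneg_AE) auto
      ultimately show "norm ((LINT s|lborel. cmod (q (e n) (r n) s - q e0 r0 s)) - 0) < \<epsilon>" by simp
    qed
  qed
  then show ?thesis by (simp only: q_def)
qed

text \<open>Along a sequence of parameters with \<open>1 + Ltilde\<close> tending to 0, the wave vectors are bounded because the transform
  of \<open>w\<close> vanishes at infinity. A subsequence of the directions, wave vectors, semiclassical and rescaled spectral parameters
  converges, and the limit is a zero of the continuous extension of \<open>1 + Ltilde\<close>. The direction is kept as a separate
  variable, since it need not be determined by the limit of the wave vectors if that limit is 0.\<close>

lemma uniform_penrose_of_pointwise:
  fixes w g :: "real ^ 'n \<Rightarrow> real"
  assumes \<delta>: "0 < \<delta>" and w: "integrable lborel w"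
    and g: "integrable lborel g" "in_weighted_sobolev (3 / 2 + \<delta>) (half_dim TYPE('n)) g"
    and nz: "\<And>k hb z. k \<noteq> 0 \<Longrightarrow> 0 \<le> hb \<Longrightarrow> hb \<le> 1 \<Longrightarrow> 0 \<le> Re z \<Longrightarrow> 1 + fourier w k * ray_dispersion g (k /\<^sub>R norm k) (hb * norm k) z \<noteq> 0"
    and nz0: "\<And>e z. norm e = 1 \<Longrightarrow> 0 \<le> Re z \<Longrightarrow> 1 + fourier w 0 * ray_dispersion g e 0 z \<noteq> 0"
  shows "uniform_penrose w g"
proof (rule ccontr)
  assume contr: "\<not> uniform_penrose w g"
  have "\<exists>hb z k. 0 < hb \<and> hb \<le> 1 \<and> 0 \<le> Re z \<and> cmod (1 + Ltilde w g z k hb) < 1 / real (Suc n)" for n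
  proof -
    have "\<not> (\<forall>hb. 0 < hb \<longrightarrow> hb \<le> 1 \<longrightarrow> 1 / real (Suc n) \<le> Inf {cmod (1 + Ltilde w g z k hb) | z k. 0 \<le> Re z})"
      using contr unfolding uniform_penrose_def not_ex by (auto dest: spec[of _ "1 / real (Suc n)"])
    then obtain hb where hb: "0 < hb" "hb \<le> 1" "Inf {cmod (1 + Ltilde w g z k hb) | z k. 0 \<le> Re z} < 1 / real (Suc n)"
      by (auto simp: not_le)
    have "cmod (1 + Ltilde w g 0 0 hb) \<in> {cmod (1 + Ltilde w g z k hb) | z k. 0 \<le> Re z}"
      by (rule CollectI, rule exI[of _ 0], rule exI[of _ 0]) simp
    then have "{cmod (1 + Ltilde w g z k hb) | z k. 0 \<le> Re z} \<noteq> {}" by blast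
    from cInf_lessD[OF this hb(3)] obtain x where "x \<in> {cmod (1 + Ltilde w g z k hb) | z k. 0 \<le> Re z}" "x < 1 / real (Suc n)"
      by blast
    then show ?thesis using hb(1,2) by auto
  qed
  then obtain hb z k where hzk: "\<And>n. 0 < hb n \<and> hb n \<le> 1 \<and> 0 \<le> Re (z n) \<and> cmod (1 + Ltilde w g (z n) (k n) (hb n)) < 1 / real (Suc n)"
    by metis
  have k0: "k n \<noteq> 0" for n
  proof
    assume "k n = 0"
    then have "1 < 1 / real (Suc n)" using hzk[of n] by (simp add: Ltilde_def)
    then show False by simp
  qed
  obtain C where C: "0 \<le> C"
    "\<And>(g :: real ^ 'n \<Rightarrow> real) e. integrable lborel g \<Longrightarrow>
      in_weighted_sobolev (3 / 2 + \<delta>) (half_dim TYPE('n)) g \<Longrightarrow> norm e = 1 \<Longrightarrow>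
      (\<integral>\<^sup>+ s. ennreal (\<bar>s\<bar> * japanese_bracket s powr (\<delta> / 2) * cmod (fourier g (s *\<^sub>R e))) \<partial>lborel)
        \<le> ennreal (C * weighted_sobolev_norm (3 / 2 + \<delta>) (half_dim TYPE('n)) g)"
    "\<And>(g :: real ^ 'n \<Rightarrow> real) e. integrable lborel g \<Longrightarrow>
      in_weighted_sobolev (3 / 2 + \<delta>) (half_dim TYPE('n)) g \<Longrightarrow> norm e = 1 \<Longrightarrow>
      (\<integral>\<^sup>+ s. ennreal ((1 + s\<^sup>2) * (cmod (fourier g (s *\<^sub>R e)))\<^sup>2) \<partial>lborel) < \<infinity>"
    by (rule sobolev_line_bounds[OF \<delta>], rule that)
  define A where "A = C * weighted_sobolev_norm (3 / 2 + \<delta>) (half_dim TYPE('n)) g"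
  have A0: "0 \<le> A" using C(1) by (simp add: A_def weighted_sobolev_norm_nonneg)
  have disp_le: "cmod (ray_dispersion g e r z) \<le> A" if "norm e = 1" "0 \<le> Re z" for e r z
    using \<delta> C(2)[OF g that(1)] A0 unfolding A_def
    by (intro norm_ray_dispersion_le[where \<kappa>="\<delta> / 2"] sobolev_line_profile[OF \<delta> g that(1)] that(2)) auto
  define e where "e n = k n /\<^sub>R norm (k n)" for n
  define \<zeta> where "\<zeta> n = z n / complex_of_real (norm (k n))" for n
  define L where "L n = fourier w (k n) * ray_dispersion g (e n) (hb n * norm (k n)) (\<zeta> n)" for n
  have e1: "norm (e n) = 1" for n using k0[of n] by (simp add: e_def)
  have \<zeta>re: "0 \<le> Re (\<zeta> n)" for n using hzk[of n] by (simp add: \<zeta>_def Re_divide_of_real)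
  have L1: "cmod (1 + L n) < 1 / real (Suc n)" for n
    using hzk[of n] unfolding Ltilde_eq_ray_dispersion[OF k0] L_def e_def \<zeta>_def by simp
  have Llim: "L \<longlonglongrightarrow> - 1"
  proof -
    have "(\<lambda>n. 1 + L n) \<longlonglongrightarrow> 0"
      by (rule Lim_null_comparison[OF _ LIMSEQ_inverse_real_of_nat])
        (intro always_eventually allI, use L1 in \<open>simp only: inverse_eq_divide less_imp_le\<close>)
    from tendsto_add[OF tendsto_const[of "- 1"] this] show ?thesis by simp
  qed
  have rl: "(\<lambda>n. fourier w (\<kappa> n)) \<longlonglongrightarrow> 0" if "filterlim \<kappa> at_infinity sequentially" for \<kappa>
    using riemann_lebesgue[of "\<lambda>x. complex_of_real (w x)", OF _ that] w unfolding fourier_cis by simp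
  have "\<exists>R. \<forall>n. norm (k n) \<le> R"
  proof (rule ccontr)
    assume "\<not> (\<exists>R. \<forall>n. norm (k n) \<le> R)"
    then have "\<exists>n. real j < norm (k n)" for j :: nat by (metis not_le)
    then obtain \<nu> where \<nu>: "\<And>j :: nat. real j < norm (k (\<nu> j))" by metis
    have "filterlim (\<lambda>j. norm (k (\<nu> j))) at_top sequentially"
      by (rule filterlim_at_top_mono[OF filterlim_real_sequentially]) (intro always_eventually allI less_imp_le \<nu>)
    then have inf: "filterlim (\<lambda>j. k (\<nu> j)) at_infinity sequentially" by (simp only: filterlim_at_infinity_conv_norm_at_top)
    have "(\<lambda>j. cmod (fourier w (k (\<nu> j))) * A) \<longlonglongrightarrow> 0 * A"
      by (intro tendsto_mult tendsto_const tendsto_norm_zero rl[OF inf])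
    then have "\<forall>\<^sub>F j in sequentially. cmod (fourier w (k (\<nu> j))) * A < 1 / 2"
      by (intro order_tendstoD(2)) auto
    then obtain j0 where j0: "\<And>j. j0 \<le> j \<Longrightarrow> cmod (fourier w (k (\<nu> j))) * A < 1 / 2" by (auto simp: eventually_sequentially)
    \<comment> \<open>For indices \<open>n \<ge> 1\<close>, \<open>1 + L n\<close> has modulus below \<open>1 / 2\<close>, which is impossible where \<open>L\<close> itself has modulus below \<open>1 / 2\<close>.\<close>
    have "\<nu> j = 0" if "j0 \<le> j" for j
    proof (rule ccontr)
      assume "\<nu> j \<noteq> 0"
      then have "1 / real (Suc (\<nu> j)) \<le> 1 / 2" by (intro divide_left_mono) auto
      then have "cmod (1 + L (\<nu> j)) < 1 / 2" using L1[of "\<nu> j"] by linarith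
      moreover have "1 - cmod (L (\<nu> j)) \<le> cmod (1 + L (\<nu> j))" using norm_triangle_ineq4[of "1 + L (\<nu> j)" "L (\<nu> j)"] by simp
      moreover have "cmod (L (\<nu> j)) \<le> cmod (fourier w (k (\<nu> j))) * A"
        unfolding L_def norm_mult by (intro mult_left_mono disp_le e1 \<zeta>re) simp
      ultimately show False using j0[OF that] by linarith
    qed
    then have "real j < norm (k 0)" if "j0 \<le> j" for j using \<nu>[of j] that by simp
    moreover obtain j1 where "norm (k 0) < real j1" using reals_Archimedean2 by blast
    ultimately have "real (max j0 j1) < real j1" by (meson less_trans max.cobounded1)
    then show False by simp
  qed
  then obtain R where R: "\<And>n. norm (k n) \<le> R" by auto
  \<comment> \<open>This compactifies the right half plane; a limit 0 means that the spectral parameter escapes to infinity.\<close>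
  define \<omega> where "\<omega> n = 1 / (1 + \<zeta> n)" for n
  have \<zeta>1: "1 + \<zeta> n \<noteq> 0" for n using \<zeta>re[of n] by (auto simp: complex_eq_iff)
  have \<omega>1: "cmod (\<omega> n) \<le> 1"  for n
  proof -
    have "1 \<le> Re (1 + \<zeta> n)" using \<zeta>re[of n] by simp
    also have "\<dots> \<le> cmod (1 + \<zeta> n)" by (rule complex_Re_le_cmod)
    finally have "1 \<le> cmod (1 + \<zeta> n)" .
    moreover from this have "0 < cmod (1 + \<zeta> n)" by linarith
    ultimately show ?thesis unfolding \<omega>_def norm_divide norm_one by (subst divide_le_eq_1_pos)
  qed
  let ?K = "sphere (0 :: real ^ 'n) 1 \<times> cball (0 :: real ^ 'n) R \<times> {0..1 :: real} \<times> cball (0 :: complex) 1"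
  have "compact ?K" by (intro compact_Times compact_sphere compact_cball compact_Icc)
  then have "seq_compact ?K" by (simp add: compact_imp_seq_compact)
  moreover have "\<forall>n. (e n, k n, hb n, \<omega> n) \<in> ?K"
    using e1 R hzk \<omega>1 by (auto intro: less_imp_le)
  ultimately obtain l \<sigma> where l: "l \<in> ?K" "strict_mono \<sigma>" "((\<lambda>n. (e n, k n, hb n, \<omega> n)) \<circ> \<sigma>) \<longlonglongrightarrow> l"
    by (rule seq_compactE)
  obtain e' k' h' \<omega>' where l_eq: "l = (e', k', h', \<omega>')" by (cases l) auto
  have lim: "(\<lambda>n. e (\<sigma> n)) \<longlonglongrightarrow> e'" "(\<lambda>n. k (\<sigma> n)) \<longlonglongrightarrow> k'" "(\<lambda>n. hb (\<sigma> n)) \<longlonglongrightarrow> h'" "(\<lambda>n. \<omega> (\<sigma> n)) \<longlonglongrightarrow> \<omega>'"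
  proof -
    have l3: "(\<lambda>n. (e (\<sigma> n), k (\<sigma> n), hb (\<sigma> n), \<omega> (\<sigma> n))) \<longlonglongrightarrow> (e', k', h', \<omega>')" using l(3) by (simp add: l_eq comp_def)
    show "(\<lambda>n. e (\<sigma> n)) \<longlonglongrightarrow> e'" using tendsto_fst[OF l3] by simp
    note l2 = tendsto_snd[OF l3, simplified]
    show "(\<lambda>n. k (\<sigma> n)) \<longlonglongrightarrow> k'" using tendsto_fst[OF l2] by simp
    note l1 = tendsto_snd[OF l2, simplified]
    show "(\<lambda>n. hb (\<sigma> n)) \<longlonglongrightarrow> h'" using tendsto_fst[OF l1] by simp
    show "(\<lambda>n. \<omega> (\<sigma> n)) \<longlonglongrightarrow> \<omega>'" using tendsto_snd[OF l1] by simp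
  qed
  have e': "norm e' = 1" and h': "0 \<le> h'" "h' \<le> 1" using l(1) by (auto simp: l_eq)
  have w_lim: "(\<lambda>n. fourier w (k (\<sigma> n))) \<longlonglongrightarrow> fourier w k'"
    using continuous_fourier[OF w] lim(2) by (intro isCont_tendsto_compose[where g="fourier w"]) (simp_all add: continuous_on_eq_continuous_at)
  have r_lim: "(\<lambda>n. hb (\<sigma> n) * norm (k (\<sigma> n))) \<longlonglongrightarrow> h' * norm k'" by (intro tendsto_intros lim)
  have Lsub: "(\<lambda>n. L (\<sigma> n)) \<longlonglongrightarrow> - 1" using LIMSEQ_subseq_LIMSEQ[OF Llim l(2)] by (simp add: comp_def)
  have int: "integrable lborel (\<lambda>s. complex_of_real (kern \<rho> s) * fourier g (s *\<^sub>R v))" if "norm v = 1" for v \<rho>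
    by (rule line_profile.integrable_kern_profile[OF sobolev_line_profile[OF \<delta> g that]])
  note conv = tendsto_ray_integrand_L1[OF \<delta> g e1 lim(1) e' r_lim]
  show False
  proof (cases "\<omega>' = 0")
    case True
    have "filterlim (\<lambda>n. 1 + \<zeta> (\<sigma> n)) at_infinity sequentially"
    proof -
      have "filterlim (\<lambda>n. \<omega> (\<sigma> n)) (at 0) sequentially"
        using lim(4) \<zeta>1 by (auto simp: filterlim_at True \<omega>_def)
      then have "filterlim (\<lambda>n. inverse (\<omega> (\<sigma> n))) at_infinity sequentially"
        by (rule filterlim_compose[OF filterlim_inverse_at_infinity])
      then show ?thesis by (simp add: \<omega>_def)
    qed
    then have "filterlim (\<lambda>n. - 1 + (1 + \<zeta> (\<sigma> n))) at_infinity sequentially"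
      by (rule tendsto_add_filterlim_at_infinity[OF tendsto_const])
    then have "filterlim (\<lambda>n. \<zeta> (\<sigma> n)) at_infinity sequentially" by simp
    then have "(\<lambda>n. ray_dispersion g (e (\<sigma> n)) (hb (\<sigma> n) * norm (k (\<sigma> n))) (\<zeta> (\<sigma> n))) \<longlonglongrightarrow> 0"
      unfolding ray_dispersion_def by (intro tendsto_laplace_infinity[OF int[OF e'] int[OF e1] conv \<zeta>re])
    from tendsto_mult[OF w_lim this] have "(\<lambda>n. L (\<sigma> n)) \<longlonglongrightarrow> 0" by (simp add: L_def)
    from LIMSEQ_unique[OF this Lsub] show False by simp
  next
    case False
    define \<zeta>' where "\<zeta>' = 1 / \<omega>' - 1"
    have "(\<lambda>n. 1 / \<omega> (\<sigma> n) - 1) \<longlonglongrightarrow> \<zeta>'" unfolding \<zeta>'_def by (intro tendsto_intros lim False)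
    then have \<zeta>lim: "(\<lambda>n. \<zeta> (\<sigma> n)) \<longlonglongrightarrow> \<zeta>'" by (simp add: \<omega>_def)
    have \<zeta>'re: "0 \<le> Re \<zeta>'"
      by (rule LIMSEQ_le_const[OF tendsto_Re[OF \<zeta>lim]]) (use \<zeta>re in auto)
    have "(\<lambda>n. ray_dispersion g (e (\<sigma> n)) (hb (\<sigma> n) * norm (k (\<sigma> n))) (\<zeta> (\<sigma> n))) \<longlonglongrightarrow> ray_dispersion g e' (h' * norm k') \<zeta>'"
      unfolding ray_dispersion_def by (intro tendsto_laplace[OF int[OF e'] int[OF e1] conv \<zeta>re \<zeta>lim])
    from tendsto_mult[OF w_lim this] have "(\<lambda>n. L (\<sigma> n)) \<longlonglongrightarrow> fourier w k' * ray_dispersion g e' (h' * norm k') \<zeta>'" by (simp add: L_def)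
    from LIMSEQ_unique[OF this Lsub] have zero: "1 + fourier w k' * ray_dispersion g e' (h' * norm k') \<zeta>' = 0" by simp
    show False
    proof (cases "k' = 0")
      case True
      then show False using nz0[OF e' \<zeta>'re] zero by simp
    next
      case False
      have "(\<lambda>n. k (\<sigma> n) /\<^sub>R norm (k (\<sigma> n))) \<longlonglongrightarrow> k' /\<^sub>R norm k'"
        by (intro tendsto_intros lim) (use False in simp)
      then have "e' = k' /\<^sub>R norm k'" using lim(1) unfolding e_def by (rule LIMSEQ_unique[symmetric])
      then show False using nz[OF False h' \<zeta>'re] zero by simp
    qed
  qed
qed

section \<open>The Penrose conditions on the imaginary axis\<close>

lemma pv_integral_eqI:
  assumes "((\<lambda>\<epsilon>. LINT p|lborel. indicator {p. \<forall>s\<in>S. \<epsilon> < \<bar>p - s\<bar>} p *\<^sub>R complex_of_real (f p)) \<longlongrightarrow> complex_of_real L) (at_right 0)"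
  shows "pv_integral S f = L"
proof -
  have "(LINT p|lborel. indicator {p. \<forall>s\<in>S. \<epsilon> < \<bar>p - s\<bar>} p *\<^sub>R complex_of_real (f p))
    = complex_of_real (LBINT p:{p. \<forall>s\<in>S. \<epsilon> < \<bar>p - s\<bar>}. f p)" for \<epsilon>
  proof -
    have "(LINT p|lborel. indicator {p. \<forall>s\<in>S. \<epsilon> < \<bar>p - s\<bar>} p *\<^sub>R complex_of_real (f p))
       = (LINT p|lborel. complex_of_real (indicator {p. \<forall>s\<in>S. \<epsilon> < \<bar>p - s\<bar>} p *\<^sub>R f p))"
      by (intro Bochner_Integration.integral_cong refl) (simp add: scaleR_conv_of_real)
    then show ?thesis unfolding set_lebesgue_integral_def by (simp only: integral_complex_of_real)
  qed
  with assms have "((\<lambda>\<epsilon>. complex_of_real (LBINT p:{p. \<forall>s\<in>S. \<epsilon> < \<bar>p - s\<bar>}. f p)) \<longlongrightarrow> complex_of_real L) (at_right 0)"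
    by (simp only:)
  from tendsto_Re[OF this] have "((\<lambda>\<epsilon>. LBINT p:{p. \<forall>s\<in>S. \<epsilon> < \<bar>p - s\<bar>}. f p) \<longlongrightarrow> L) (at_right 0)" by simp
  then show ?thesis unfolding pv_integral_def by (intro tendsto_Lim) auto
qed

text \<open>For real \<open>\<omega>\<close>, \<open>half_plane_avoids_slit\<close> applies: by \<open>slope_eq_Im_dispersion\<close>, the boundary values are real exactly
  where \<open>slope r\<close> vanishes, unless \<open>\<omega> = 0\<close>.\<close>

lemma (in line_profile) dispersion_nonzero:
  assumes bdry: "\<And>b. slope r b = 0 \<Longrightarrow> -1 < \<omega> * Re (dispersion r (Complex 0 b))" and z: "0 \<le> Re z"
  shows "1 + complex_of_real \<omega> * dispersion r z \<noteq> 0"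
proof -
  let ?f = "\<lambda>z. complex_of_real \<omega> * dispersion r z"
  have "?f z \<noteq> - 1"
  proof (rule half_plane_avoids_slit[OF _ _ _ _ z])
    show "?f holomorphic_on {z. 0 < Re z}"
      unfolding dispersion_def by (intro holomorphic_intros laplace_holomorphic integrable_kern_profile)
    show "continuous_on {z. 0 \<le> Re z} ?f"
      unfolding continuous_on_sequentially comp_def dispersion_def
      by (intro allI ballI impI tendsto_mult tendsto_const tendsto_laplace_argument integrable_kern_profile) auto
    show "(\<lambda>n. ?f (y n)) \<longlonglongrightarrow> 0" if "\<And>n. 0 \<le> Re (y n)" "filterlim y at_infinity sequentially" for y
      using tendsto_mult[OF tendsto_const riemann_lebesgue_half_plane[OF integrable_kern_profile that(2,1), folded laplace_def], of "complex_of_real \<omega>"]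
      by (simp add: dispersion_def)
    show "- 1 < Re (?f (Complex 0 b))" if "Im (?f (Complex 0 b)) = 0" for b
    proof (cases "\<omega> = 0")
      case False
      then have "slope r b = 0" using that by (simp add: slope_eq_Im_dispersion)
      from bdry[OF this] show ?thesis by simp
    qed simp
  qed
  then show ?thesis by (metis add.commute add_eq_0_iff)
qed

text \<open>The sign pattern forces \<open>b = 0\<close>, and then \<open>slope r p / p\<close> is negative for all \<open>p \<noteq> 0\<close>, so its principal value integral, which
  is minus the real part of the dispersion function, is at most 0.\<close>

lemma (in line_profile) dispersion_nonneg_of_decreasing:
  assumes neg: "\<And>u. 0 < u \<Longrightarrow> Re (slope r u) < 0" and pos: "\<And>u. u < 0 \<Longrightarrow> 0 < Re (slope r u)" and b: "slope r b = 0"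
  shows "0 \<le> Re (dispersion r (Complex 0 b))"
proof -
  have b0: "b = 0" using neg[of b] pos[of b] b by (cases b "0 :: real" rule: linorder_cases) auto
  let ?I = "\<lambda>\<epsilon>. LINT p|lborel. indicator {p. \<epsilon> < \<bar>p - 0\<bar>} p *\<^sub>R (slope r p / complex_of_real (p - 0))"
  have lim: "((\<lambda>\<epsilon>. Re (?I \<epsilon>)) \<longlongrightarrow> - Re (dispersion r (Complex 0 0))) (at_right 0)"
    using tendsto_Re[OF pv_slope[where b=0 and r=r]] by simp
  have le: "Re (?I \<epsilon>) \<le> 0" if "0 < \<epsilon>" for \<epsilon>
  proof -
    have "Re (?I \<epsilon>) = (LINT p|lborel. Re (indicator {p. \<epsilon> < \<bar>p - 0\<bar>} p *\<^sub>R (slope r p / complex_of_real (p - 0))))"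
      by (rule integral_Re[OF integrable_slope_div[OF that], symmetric])
    also have "\<dots> \<le> 0"
    proof -
      have "0 \<le> (LINT p|lborel. - Re (indicator {p. \<epsilon> < \<bar>p - 0\<bar>} p *\<^sub>R (slope r p / complex_of_real (p - 0))))"
      proof (rule integral_nonneg_AE, intro AE_I2)
        fix p :: real
        have "Re (slope r p) / p \<le> 0"
          using neg[of p] pos[of p] by (cases p "0 :: real" rule: linorder_cases) (auto simp: divide_le_0_iff)
        then show "0 \<le> - Re (indicator {p. \<epsilon> < \<bar>p - 0\<bar>} p *\<^sub>R (slope r p / complex_of_real (p - 0)))"
          by (simp add: indicator_def Re_divide_of_real)
      qed
      then show ?thesis by (simp only: Bochner_Integration.integral_minus neg_0_le_iff_le)
    qed
    finally show ?thesis .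
  qed
  have "- Re (dispersion r (Complex 0 0)) \<le> 0"
    by (rule tendsto_upperbound[OF lim eventually_mono[OF eventually_at_right_less le]]) simp_all
  then show ?thesis by (simp add: b0)
qed

lemma (in line_profile) Re_slope_eq: "r \<noteq> 0 \<Longrightarrow> Re (slope r u) = (Re (dens (u + r / 2)) - Re (dens (u - r / 2))) / r"
  by (simp add: slope_eq_difference_quotient Re_divide_of_real)

text \<open>An even density which decreases on the positive half line is a decreasing function of \<open>|u|\<close>, and \<open>|u - r / 2| < |u + r / 2|\<close> if
  \<open>u\<close> and \<open>r\<close> are positive.\<close>

lemma (in line_profile) slope_sign_of_even_decreasing:
  assumes even: "\<And>s. \<gamma> (- s) = \<gamma> s" and neg: "\<And>u. 0 < u \<Longrightarrow> Re (slope 0 u) < 0" and r: "0 < r"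
  shows "0 < u \<Longrightarrow> Re (slope r u) < 0" and "u < 0 \<Longrightarrow> 0 < Re (slope r u)"
proof -
  have dens_even: "dens (- v) = dens v" for v
    unfolding dens_def using LBINT_reflect[of "\<lambda>s. cis (- (s * v)) * \<gamma> s"] by (simp add: even)
  have decr: "Re (dens y) < Re (dens x)" if xy: "0 \<le> x" "x < y" for x y
  proof (rule DERIV_neg_imp_decreasing_open[OF xy(2)])
    fix v assume "x < v" "v < y"
    then show "\<exists>w. ((\<lambda>u. Re (dens u)) has_real_derivative w) (at v) \<and> w < 0"
      using dens_has_derivative[of v] neg[of v] xy(1) by auto
  qed (rule continuous_on_subset[OF continuous_dens], simp)
  have dens_abs: "dens \<bar>v\<bar> = dens v" for v using dens_even[of v] by (simp add: abs_if)
  have decr': "Re (dens y) < Re (dens x)" if "\<bar>x\<bar> < \<bar>y\<bar>" for x y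
    using decr[of "\<bar>x\<bar>" "\<bar>y\<bar>"] that by (simp add: dens_abs)
  show "Re (slope r u) < 0" if "0 < u"
  proof -
    have "\<bar>u - r / 2\<bar> < \<bar>u + r / 2\<bar>" using that r by (simp add: abs_if)
    from decr'[OF this] r show ?thesis by (simp add: Re_slope_eq divide_less_0_iff)
  qed
  show "0 < Re (slope r u)" if "u < 0"
  proof -
    have "\<bar>u + r / 2\<bar> < \<bar>u - r / 2\<bar>" using that r by (simp add: abs_if)
    from decr'[OF this] r show ?thesis by (simp add: Re_slope_eq)
  qed
qed

lemma (in line_profile) pv_integral_slope:
  "pv_integral {b} (\<lambda>p. Re (slope r p) / (p - b)) = - Re (dispersion r (Complex 0 b))"
proof (rule pv_integral_eqI)
  have "complex_of_real (Re (slope r p) / (p - b)) = slope r p / complex_of_real (p - b)" for p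
    by (simp add: complex_eq_iff Re_divide_of_real Im_divide_of_real Im_slope)
  moreover have "{p. \<forall>s\<in>{b}. \<epsilon> < \<bar>p - s\<bar>} = {p. \<epsilon> < \<bar>p - b\<bar>}" for \<epsilon> by simp
  ultimately show "((\<lambda>\<epsilon>. LINT p|lborel. indicator {p. \<forall>s\<in>{b}. \<epsilon> < \<bar>p - s\<bar>} p *\<^sub>R complex_of_real (Re (slope r p) / (p - b)))
     \<longlongrightarrow> complex_of_real (- Re (dispersion r (Complex 0 b)))) (at_right 0)"
    using pv_slope[where b=b and r=r] by (simp only: of_real_minus)
qed

lemma (in line_profile) norm_dens_le: "cmod (dens u) \<le> 1 / (2 * pi) * (LINT s|lborel. cmod (\<gamma> s))"
proof -
  have "cmod (LINT s|lborel. cis (- (s * u)) * \<gamma> s) \<le> (LINT s|lborel. cmod (cis (- (s * u)) * \<gamma> s))" by (rule integral_norm_bound)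
  then have "cmod (LINT s|lborel. cis (- (s * u)) * \<gamma> s) \<le> (LINT s|lborel. cmod (\<gamma> s))" by (simp add: norm_mult)
  then have "1 / (2 * pi) * cmod (LINT s|lborel. cis (- (s * u)) * \<gamma> s) \<le> 1 / (2 * pi) * (LINT s|lborel. cmod (\<gamma> s))"
    by (rule mult_left_mono) simp
  then show ?thesis by (simp add: dens_def norm_mult norm_divide)
qed

lemma (in line_profile) dens_measurable [measurable]: "dens \<in> borel_measurable borel"
  unfolding dens_def by measurable

lemma (in line_profile)
  shows integrable_dens_div: "0 < \<epsilon> \<Longrightarrow> integrable lborel (\<lambda>p. indicator {p. \<epsilon> < \<bar>p - b\<bar>} p *\<^sub>R (dens p / complex_of_real (p - b)))"
    and pv_dens: "((\<lambda>\<epsilon>. LINT p|lborel. indicator {p. \<epsilon> < \<bar>p - b\<bar>} p *\<^sub>R (dens p / complex_of_real (p - b)))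
       \<longlongrightarrow> - \<i> / 2 * (LINT s|lborel. complex_of_real (sgn s) * (cis (- (s * b)) * \<gamma> s))) (at_right 0)"
proof -
  let ?\<phi> = "\<lambda>s. complex_of_real (1 / (2 * pi)) * \<gamma> s"
  have \<phi>: "integrable lborel ?\<phi>" by (intro integrable_mult_right integrable_profile)
  have L2: "(\<integral>\<^sup>+ s. ennreal ((cmod (?\<phi> s))\<^sup>2) \<partial>lborel) < \<infinity>"
    by (rule nn_integral_norm2_cmult[OF _ L2_profile(1)]) measurable
  show "0 < \<epsilon> \<Longrightarrow> integrable lborel (\<lambda>p. indicator {p. \<epsilon> < \<bar>p - b\<bar>} p *\<^sub>R (dens p / complex_of_real (p - b)))"
    unfolding dens_alt by (rule pv_of_transform(1)[OF \<phi> L2])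
  have "(LINT s|lborel. complex_of_real (sgn s) * (cis (- (s * b)) * ?\<phi> s))
     = (LINT s|lborel. complex_of_real (1 / (2 * pi)) * (complex_of_real (sgn s) * (cis (- (s * b)) * \<gamma> s)))"
    by (intro Bochner_Integration.integral_cong refl) (simp only: mult_ac)
  also have "\<dots> = complex_of_real (1 / (2 * pi)) * (LINT s|lborel. complex_of_real (sgn s) * (cis (- (s * b)) * \<gamma> s))"
    by (rule integral_mult_right_zero)
  finally have e: "- \<i> * complex_of_real pi * (LINT s|lborel. complex_of_real (sgn s) * (cis (- (s * b)) * ?\<phi> s))
     = - \<i> / 2 * (LINT s|lborel. complex_of_real (sgn s) * (cis (- (s * b)) * \<gamma> s))" by simp
  show "((\<lambda>\<epsilon>. LINT p|lborel. indicator {p. \<epsilon> < \<bar>p - b\<bar>} p *\<^sub>R (dens p / complex_of_real (p - b)))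
       \<longlongrightarrow> - \<i> / 2 * (LINT s|lborel. complex_of_real (sgn s) * (cis (- (s * b)) * \<gamma> s))) (at_right 0)"
    using pv_of_transform(2)[OF \<phi> L2, of b] unfolding e dens_alt .
qed

text \<open>With two singularities, the truncation around one of them also removes a small interval from the principal value integral
  at the other; this part is negligible in the limit.\<close>

lemma (in line_profile)
  assumes c: "c' \<noteq> c"
  shows integrable_dens_div_near: "0 < \<epsilon> \<Longrightarrow> \<epsilon> < \<bar>c - c'\<bar> / 2 \<Longrightarrow> integrable lborel (\<lambda>p. indicator {p. \<bar>p - c'\<bar> \<le> \<epsilon>} p *\<^sub>R (dens p / complex_of_real (p - c)))"
    and dens_div_near_tendsto_0: "((\<lambda>\<epsilon>. LINT p|lborel. indicator {p. \<bar>p - c'\<bar> \<le> \<epsilon>} p *\<^sub>R (dens p / complex_of_real (p - c))) \<longlongrightarrow> 0) (at_right 0)"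
proof -
  define D where "D = 1 / (2 * pi) * (LINT s|lborel. cmod (\<gamma> s))"
  define \<rho> where "\<rho> = \<bar>c - c'\<bar> / 2"
  have \<rho>: "0 < \<rho>" using c by (simp add: \<rho>_def)
  have D0: "0 \<le> D" unfolding D_def by (intro mult_nonneg_nonneg integral_nonneg_AE) auto
  have bd: "cmod (dens p / complex_of_real (p - c)) \<le> D / \<rho>" if "\<bar>p - c'\<bar> \<le> \<epsilon>" "\<epsilon> < \<rho>" for p \<epsilon>
  proof -
    have "\<bar>c - c'\<bar> \<le> \<bar>p - c\<bar> + \<bar>p - c'\<bar>"
      using abs_triangle_ineq[of "c - p" "p - c'"] by (simp add: abs_minus_commute)
    moreover have "a / 2 \<le> x" if "a \<le> x + y" "y \<le> e" "e < a / 2" for a x y e :: real using that by linarith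
    ultimately have "\<rho> \<le> \<bar>p - c\<bar>" using that unfolding \<rho>_def by blast
    then show ?thesis unfolding norm_divide norm_of_real using norm_dens_le[of p] D0 \<rho> by (intro frac_le) (auto simp: D_def)
  qed
  have set_eq: "{p. \<bar>p - c'\<bar> \<le> \<epsilon>} = {c' - \<epsilon>..c' + \<epsilon>}" for \<epsilon> :: real by (auto simp: abs_le_iff)
  have int: "integrable lborel (\<lambda>p. indicator {p. \<bar>p - c'\<bar> \<le> \<epsilon>} p *\<^sub>R (dens p / complex_of_real (p - c)))" if "\<epsilon> < \<rho>" for \<epsilon>
  proof (rule integrable_indicator_bounded[where a="c' - \<epsilon>" and b="c' + \<epsilon>" and B="D / \<rho>"])
    show "cmod (dens p / complex_of_real (p - c)) \<le> D / \<rho>" if "p \<in> {p. \<bar>p - c'\<bar> \<le> \<epsilon>}" for p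
      using that \<open>\<epsilon> < \<rho>\<close> by (intro bd[of p \<epsilon>]) simp_all
  qed (simp_all add: set_eq)
  then show "0 < \<epsilon> \<Longrightarrow> \<epsilon> < \<bar>c - c'\<bar> / 2 \<Longrightarrow> integrable lborel (\<lambda>p. indicator {p. \<bar>p - c'\<bar> \<le> \<epsilon>} p *\<^sub>R (dens p / complex_of_real (p - c)))"
    by (simp add: \<rho>_def)
  have le: "cmod (LINT p|lborel. indicator {p. \<bar>p - c'\<bar> \<le> \<epsilon>} p *\<^sub>R (dens p / complex_of_real (p - c))) \<le> 2 * \<epsilon> * (D / \<rho>)" if \<epsilon>: "0 < \<epsilon>" "\<epsilon> < \<rho>" for \<epsilon>
  proof -
    have "cmod (LINT p|lborel. indicator {p. \<bar>p - c'\<bar> \<le> \<epsilon>} p *\<^sub>R (dens p / complex_of_real (p - c)))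
      \<le> (LINT p|lborel. cmod (indicator {p. \<bar>p - c'\<bar> \<le> \<epsilon>} p *\<^sub>R (dens p / complex_of_real (p - c))))" by (rule integral_norm_bound)
    also have "\<dots> \<le> (LINT p|lborel. indicator {c' - \<epsilon>..c' + \<epsilon>} p * (D / \<rho>))"
    proof (rule integral_mono)
      show "integrable lborel (\<lambda>p. cmod (indicator {p. \<bar>p - c'\<bar> \<le> \<epsilon>} p *\<^sub>R (dens p / complex_of_real (p - c))))"
        by (intro integrable_norm int \<epsilon>)
      show "integrable lborel (\<lambda>p. indicator {c' - \<epsilon>..c' + \<epsilon>} p * (D / \<rho>))"
        by (intro integrable_mult_left integrable_real_indicator) (auto simp: emeasure_lborel_Icc_eq)
      show "cmod (indicator {p. \<bar>p - c'\<bar> \<le> \<epsilon>} p *\<^sub>R (dens p / complex_of_real (p - c))) \<le> indicator {c' - \<epsilon>..c' + \<epsilon>} p * (D / \<rho>)" for p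
        unfolding set_eq[symmetric] using bd[OF _ \<epsilon>(2), of p] by (cases "\<bar>p - c'\<bar> \<le> \<epsilon>") (simp_all del: of_real_diff)
    qed
    also have "\<dots> = 2 * \<epsilon> * (D / \<rho>)" using \<epsilon> by simp
    finally show ?thesis .
  qed
  show "((\<lambda>\<epsilon>. LINT p|lborel. indicator {p. \<bar>p - c'\<bar> \<le> \<epsilon>} p *\<^sub>R (dens p / complex_of_real (p - c))) \<longlongrightarrow> 0) (at_right 0)"
  proof (rule Lim_null_comparison)
    have "\<forall>\<^sub>F \<epsilon> in at_right 0. \<epsilon> \<in> {0<..<\<rho>}" by (rule eventually_at_right_real[OF \<rho>])
    then show "\<forall>\<^sub>F \<epsilon> in at_right 0. cmod (LINT p|lborel. indicator {p. \<bar>p - c'\<bar> \<le> \<epsilon>} p *\<^sub>R (dens p / complex_of_real (p - c))) \<le> 2 * \<epsilon> * (D / \<rho>)"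
      by eventually_elim (rule le, simp_all)
    have "((\<lambda>\<epsilon>. 2 * \<epsilon> * (D / \<rho>)) \<longlongrightarrow> 2 * 0 * (D / \<rho>)) (at_right 0)" by (intro tendsto_intros)
    then show "((\<lambda>\<epsilon>. 2 * \<epsilon> * (D / \<rho>)) \<longlongrightarrow> 0) (at_right 0)" by simp
  qed
qed

text \<open>The two partial fractions have separate principal values, given by the multiplier \<open>- \<i> \<pi> sgn s\<close> and phases at \<open>b - r / 2\<close>
  and \<open>b + r / 2\<close>; the difference of the phases is \<open>\<i> r * kern r s\<close> times the phase at \<open>b\<close>.\<close>

lemma (in line_profile) pv_integral_dens_pair:
  assumes r: "0 < r"
  shows "pv_integral {b - r / 2, b + r / 2} (\<lambda>p. Re (dens p) * (1 / (p - b + r / 2) - 1 / (p - b - r / 2)))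
    = r * Re (dispersion r (Complex 0 b))"
proof (rule pv_integral_eqI)
  define c1 where "c1 = b - r / 2"
  define c2 where "c2 = b + r / 2"
  have ne: "c2 \<noteq> c1" "c1 \<noteq> c2" using r by (auto simp: c1_def c2_def)
  have dist: "\<bar>c1 - c2\<bar> / 2 = r / 2" "\<bar>c2 - c1\<bar> / 2 = r / 2" using r by (auto simp: c1_def c2_def)
  let ?h = "\<lambda>c p. dens p / complex_of_real (p - c)"
  let ?T = "\<lambda>c \<epsilon>. LINT p|lborel. indicator {p. \<epsilon> < \<bar>p - c\<bar>} p *\<^sub>R ?h c p"
  let ?E = "\<lambda>c' c \<epsilon>. LINT p|lborel. indicator {p. \<bar>p - c'\<bar> \<le> \<epsilon>} p *\<^sub>R ?h c p"
  let ?U = "\<lambda>\<epsilon>. LINT p|lborel. indicator {p. \<forall>s\<in>{b - r / 2, b + r / 2}. \<epsilon> < \<bar>p - s\<bar>} p *\<^sub>R complex_of_real (Re (dens p) * (1 / (p - b + r / 2) - 1 / (p - b - r / 2)))"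
  have lim: "((\<lambda>\<epsilon>. (?T c1 \<epsilon> - ?E c2 c1 \<epsilon>) - (?T c2 \<epsilon> - ?E c1 c2 \<epsilon>)) \<longlongrightarrow>
     (- \<i> / 2 * (LINT s|lborel. complex_of_real (sgn s) * (cis (- (s * c1)) * \<gamma> s)) - 0) - (- \<i> / 2 * (LINT s|lborel. complex_of_real (sgn s) * (cis (- (s * c2)) * \<gamma> s)) - 0)) (at_right 0)"
    by (intro tendsto_diff pv_dens dens_div_near_tendsto_0 ne)
  have val: "(- \<i> / 2 * (LINT s|lborel. complex_of_real (sgn s) * (cis (- (s * c1)) * \<gamma> s)) - 0) - (- \<i> / 2 * (LINT s|lborel. complex_of_real (sgn s) * (cis (- (s * c2)) * \<gamma> s)) - 0)
     = complex_of_real (r * Re (dispersion r (Complex 0 b)))"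
  proof -
    have i: "integrable lborel (\<lambda>s. complex_of_real (sgn s) * (cis (- (s * c)) * \<gamma> s))" for c
      by (rule integrable_mult_of_norm_le_1[OF _ _ integrable_cis_mult[OF integrable_profile]]) (auto simp: sgn_if)
    have "(LINT s|lborel. complex_of_real (sgn s) * (cis (- (s * c1)) * \<gamma> s)) - (LINT s|lborel. complex_of_real (sgn s) * (cis (- (s * c2)) * \<gamma> s))
      = (LINT s|lborel. complex_of_real (sgn s) * (cis (- (s * c1)) * \<gamma> s) - complex_of_real (sgn s) * (cis (- (s * c2)) * \<gamma> s))"
      by (rule Bochner_Integration.integral_diff[OF i i, symmetric])
    also have "\<dots> = (LINT s|lborel. (\<i> * complex_of_real r) * (complex_of_real (sgn s) * (cis (- (s * b)) * (complex_of_real (kern r s) * \<gamma> s))))"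
    proof (intro Bochner_Integration.integral_cong refl)
      fix s :: real
      have "- (s * c1) = - (s * b) + r * s / 2" "- (s * c2) = - (s * b) + - (r * s / 2)" by (simp_all add: c1_def c2_def field_simps)
      then have cc: "cis (- (s * c1)) = cis (- (s * b)) * cis (r * s / 2)" "cis (- (s * c2)) = cis (- (s * b)) * cis (- (r * s / 2))"
        by (simp_all only: cis_mult)
      have d: "cis (r * s / 2) - cis (- (r * s / 2)) = \<i> * complex_of_real r * complex_of_real (kern r s)"
        using r by (simp add: kern_eq_sin complex_eq_iff)
      have "complex_of_real (sgn s) * (cis (- (s * c1)) * \<gamma> s) - complex_of_real (sgn s) * (cis (- (s * c2)) * \<gamma> s)
        = complex_of_real (sgn s) * (cis (- (s * b)) * ((cis (r * s / 2) - cis (- (r * s / 2))) * \<gamma> s))"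
        unfolding cc by (simp add: algebra_simps)
      then show "complex_of_real (sgn s) * (cis (- (s * c1)) * \<gamma> s) - complex_of_real (sgn s) * (cis (- (s * c2)) * \<gamma> s)
        = (\<i> * complex_of_real r) * (complex_of_real (sgn s) * (cis (- (s * b)) * (complex_of_real (kern r s) * \<gamma> s)))"
        unfolding d by (simp only: mult_ac)
    qed
    also have "\<dots> = (\<i> * complex_of_real r) * (2 * complex_of_real (Re (dispersion r (Complex 0 b))))"
      by (simp only: integral_mult_right_zero boundary_integrals(2))
    finally have e: "(LINT s|lborel. complex_of_real (sgn s) * (cis (- (s * c1)) * \<gamma> s)) - (LINT s|lborel. complex_of_real (sgn s) * (cis (- (s * c2)) * \<gamma> s))
      = (\<i> * complex_of_real r) * (2 * complex_of_real (Re (dispersion r (Complex 0 b))))" .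
    have "(- \<i> / 2 * x - 0) - (- \<i> / 2 * y - 0) = - \<i> / 2 * (x - y)" for x y :: complex by (simp add: field_simps)
    then show ?thesis unfolding e by (simp only: e) simp
  qed
  \<comment> \<open>For \<open>\<epsilon> < r / 2\<close> the two removed intervals are disjoint.\<close>
  have eq: "(?T c1 \<epsilon> - ?E c2 c1 \<epsilon>) - (?T c2 \<epsilon> - ?E c1 c2 \<epsilon>) = ?U \<epsilon>" if \<epsilon>: "0 < \<epsilon>" "\<epsilon> < r / 2" for \<epsilon>
  proof -
    note i1 = integrable_dens_div[OF \<epsilon>(1), of c1] and i2 = integrable_dens_div[OF \<epsilon>(1), of c2]
      and i3 = integrable_dens_div_near[OF ne(1) \<epsilon>(1), unfolded dist, OF \<epsilon>(2)] and i4 = integrable_dens_div_near[OF ne(2) \<epsilon>(1), unfolded dist, OF \<epsilon>(2)]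
    have "(?T c1 \<epsilon> - ?E c2 c1 \<epsilon>) - (?T c2 \<epsilon> - ?E c1 c2 \<epsilon>) = (LINT p|lborel.
       (indicator {p. \<epsilon> < \<bar>p - c1\<bar>} p *\<^sub>R ?h c1 p - indicator {p. \<bar>p - c2\<bar> \<le> \<epsilon>} p *\<^sub>R ?h c1 p)
       - (indicator {p. \<epsilon> < \<bar>p - c2\<bar>} p *\<^sub>R ?h c2 p - indicator {p. \<bar>p - c1\<bar> \<le> \<epsilon>} p *\<^sub>R ?h c2 p))"
      by (simp only: Bochner_Integration.integral_diff[OF Bochner_Integration.integrable_diff[OF i1 i3] Bochner_Integration.integrable_diff[OF i2 i4]]
          Bochner_Integration.integral_diff[OF i1 i3] Bochner_Integration.integral_diff[OF i2 i4])
    also have "\<dots> = ?U \<epsilon>"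
    proof (intro Bochner_Integration.integral_cong refl)
      fix p :: real
      have re: "dens p = complex_of_real (Re (dens p))" by (simp add: complex_eq_iff Im_dens)
      have sh: "p - b + r / 2 = p - c1" "p - b - r / 2 = p - c2" by (simp_all add: c1_def c2_def)
      have "complex_of_real (x * (1 / y - 1 / z)) = complex_of_real x / complex_of_real y - complex_of_real x / complex_of_real z" for x y z
        by (simp add: right_diff_distrib)
      from this[of "Re (dens p)" "p - c1" "p - c2"]
      have h: "complex_of_real (Re (dens p) * (1 / (p - b + r / 2) - 1 / (p - b - r / 2))) = ?h c1 p - ?h c2 p"
        unfolding sh re[symmetric] .
      have far: "\<not> (\<bar>p - c1\<bar> \<le> \<epsilon> \<and> \<bar>p - c2\<bar> \<le> \<epsilon>)" using \<epsilon> unfolding c1_def c2_def by linarith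
      show "(indicator {p. \<epsilon> < \<bar>p - c1\<bar>} p *\<^sub>R ?h c1 p - indicator {p. \<bar>p - c2\<bar> \<le> \<epsilon>} p *\<^sub>R ?h c1 p)
       - (indicator {p. \<epsilon> < \<bar>p - c2\<bar>} p *\<^sub>R ?h c2 p - indicator {p. \<bar>p - c1\<bar> \<le> \<epsilon>} p *\<^sub>R ?h c2 p)
       = indicator {p. \<forall>s\<in>{b - r / 2, b + r / 2}. \<epsilon> < \<bar>p - s\<bar>} p *\<^sub>R complex_of_real (Re (dens p) * (1 / (p - b + r / 2) - 1 / (p - b - r / 2)))"
        unfolding h c1_def[symmetric] c2_def[symmetric] using far
        by (cases "\<bar>p - c1\<bar> \<le> \<epsilon>"; cases "\<bar>p - c2\<bar> \<le> \<epsilon>") (simp_all add: not_le not_less del: of_real_diff)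
    qed
    finally show ?thesis .
  qed
  have ev: "\<forall>\<^sub>F \<epsilon> in at_right 0. \<epsilon> \<in> {0<..<r / 2}" by (rule eventually_at_right_real) (use r in simp)
  show "(?U \<longlongrightarrow> complex_of_real (r * Re (dispersion r (Complex 0 b)))) (at_right 0)"
    by (rule Lim_transform_eventually[OF lim[unfolded val] eventually_mono[OF ev]]) (rule eq, auto)
qed

lemma (in line_profile) dens_attains_maximum:
  assumes u0: "0 < Re (dens u0)"
  obtains b where "\<And>u. Re (dens u) \<le> Re (dens b)"
proof -
  have "\<exists>R. \<forall>u. R < \<bar>u\<bar> \<longrightarrow> Re (dens u) < Re (dens u0)"
  proof (rule ccontr)
    assume "\<not> (\<exists>R. \<forall>u. R < \<bar>u\<bar> \<longrightarrow> Re (dens u) < Re (dens u0))"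
    then have "\<forall>n :: nat. \<exists>u. real n < \<bar>u\<bar> \<and> Re (dens u0) \<le> Re (dens u)" by (simp only: not_ex not_all not_imp not_less) simp
    from choice[OF this] obtain u where u: "\<And>n :: nat. real n < \<bar>u n\<bar>" "\<And>n. Re (dens u0) \<le> Re (dens (u n))" by auto
    have "filterlim (\<lambda>n. norm (u n)) at_top sequentially"
      unfolding real_norm_def by (rule filterlim_at_top_mono[OF filterlim_real_sequentially]) (intro always_eventually allI less_imp_le u(1))
    then have "filterlim u at_infinity sequentially" by (simp only: filterlim_at_infinity_conv_norm_at_top)
    then have "(\<lambda>n. Re (dens (u n))) \<longlonglongrightarrow> 0" by (rule dens_tendsto_0)
    then have "Re (dens u0) \<le> 0" by (rule LIMSEQ_le_const) (use u(2) in auto)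
    then show False using u0 by simp
  qed
  then obtain R where R: "\<And>u. R < \<bar>u\<bar> \<Longrightarrow> Re (dens u) < Re (dens u0)" by auto
  define S where "S = max R \<bar>u0\<bar>"
  have u0S: "u0 \<in> {-S..S}" by (auto simp: S_def abs_le_iff)
  have "\<exists>b\<in>{-S..S}. \<forall>u\<in>{-S..S}. Re (dens u) \<le> Re (dens b)"
    using u0S by (intro continuous_attains_sup continuous_on_subset[OF continuous_dens]) auto
  then obtain b where b: "\<And>u. u \<in> {-S..S} \<Longrightarrow> Re (dens u) \<le> Re (dens b)" by blast
  have "Re (dens u) \<le> Re (dens b)" for u
  proof (cases "u \<in> {-S..S}")
    case False
    then have "R < \<bar>u\<bar>" by (auto simp: S_def)
    then show ?thesis using R[of u] b[OF u0S] by linarith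
  qed (rule b)
  then show thesis by (rule that)
qed

text \<open>Strictly comparable complex numbers have equal imaginary parts.\<close>

lemma less_complex_times_real_iff:
  "(\<omega> * complex_of_real x > - 1) \<longleftrightarrow> -1 < Re \<omega> * x \<and> Im \<omega> * x = 0"
  by (auto simp: less_complex_def)

text \<open>Radial symmetry makes the transform of \<open>g\<close> even on each line, so the sign of the derivative of the marginal passes on to its
  symmetric difference quotients, and real boundary values of the dispersion function are nonnegative.\<close>

lemma uniform_penrose_of_repulsive_decreasing:
  fixes w g :: "real ^ 'n \<Rightarrow> real"
  assumes \<delta>: "0 < \<delta>" and adm: "admissible_profile g" and cond: "repulsive_decreasing_condition \<delta> w g"
  shows "uniform_penrose w g"
proof -
  have w: "integrable lborel w" and pos: "\<And>k. 0 \<le> fourier w k"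
    and sob': "in_weighted_sobolev (3 / 2 + \<delta>) (1 + half_dim TYPE('n)) g" and rad: "radial g"
    and decr: "\<And>k u. k \<noteq> 0 \<Longrightarrow> 0 < u \<Longrightarrow> deriv (marginal g k) u < 0"
    and incr: "\<And>k u. k \<noteq> 0 \<Longrightarrow> u < 0 \<Longrightarrow> 0 < deriv (marginal g k) u"
    using cond by (auto simp: repulsive_decreasing_condition_def)
  have g0: "\<And>x. 0 \<le> g x" and g: "integrable lborel g" using adm by (auto simp: admissible_profile_def)
  have sob: "in_weighted_sobolev (3 / 2 + \<delta>) (half_dim TYPE('n)) g"
    by (rule in_weighted_sobolev_mono[OF sob']) simp
  have wk: "fourier w k = complex_of_real (Re (fourier w k))" "0 \<le> Re (fourier w k)" for k
    using pos[of k] by (auto simp: less_eq_complex_def complex_eq_iff)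
  have nonzero: "1 + fourier w k * ray_dispersion g e r z \<noteq> 0" if e: "norm e = 1" and r: "0 \<le> r" and z: "0 \<le> Re z" for k e :: "real ^ 'n" and r z
  proof -
    define \<gamma> where "\<gamma> = (\<lambda>s. fourier g (s *\<^sub>R e))"
    interpret line_profile \<gamma> unfolding \<gamma>_def by (rule sobolev_line_profile[OF \<delta> g sob e])
    have e0: "e \<noteq> 0" using e by auto
    have "marginal g e = (\<lambda>u. Re (dens u))"
      unfolding \<gamma>_def by (rule marginal_eq_dens[OF g0 g e sobolev_line_profile[OF \<delta> g sob e]])
    then have der: "deriv (marginal g e) u = Re (slope 0 u)" for u
      using DERIV_imp_deriv[OF dens_has_derivative] by simp
    have neg0: "Re (slope 0 u) < 0" if "0 < u" for u using decr[OF e0 that] by (simp add: der)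
    have pos0: "0 < Re (slope 0 u)" if "u < 0" for u using incr[OF e0 that] by (simp add: der)
    have "fourier g (- \<kappa>) = fourier g \<kappa>" for \<kappa> :: "real ^ 'n"
    proof -
      have "distr lborel borel (uminus :: real ^ 'n \<Rightarrow> real ^ 'n) = lborel"
        by (rule distr_lborel_orthogonal_transformation) (simp add: orthogonal_transformation_def linear_uminus module_hom_uminus)
      then have "fourier g \<kappa> = (LINT x|distr lborel borel (uminus :: real ^ 'n \<Rightarrow> real ^ 'n). cis (- (\<kappa> \<bullet> x)) * complex_of_real (g x))"
        by (simp add: fourier_cis)
      also have "\<dots> = (LINT x|lborel. cis (- (\<kappa> \<bullet> (- x))) * complex_of_real (g (- x)))"
        using g by (intro integral_distr) auto
      also have "\<dots> = fourier g (- \<kappa>)"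
      proof -
        have "g (- x) = g x" for x by (rule rad[unfolded radial_def, rule_format]) simp
        then show ?thesis by (simp add: fourier_cis)
      qed
      finally show ?thesis ..
    qed
    then have even: "\<gamma> (- s) = \<gamma> s" for s unfolding \<gamma>_def by (simp only: scaleR_minus_left)
    have sl: "(0 < u \<longrightarrow> Re (slope r u) < 0) \<and> (u < 0 \<longrightarrow> 0 < Re (slope r u))" for u
      using slope_sign_of_even_decreasing[OF even neg0, of r u] neg0[of u] pos0[of u] r by (cases "r = 0") auto
    have "1 + complex_of_real (Re (fourier w k)) * dispersion r z \<noteq> 0"
    proof (rule dispersion_nonzero[OF _ z])
      fix b assume "slope r b = 0"
      then have "0 \<le> Re (dispersion r (Complex 0 b))"
        using sl by (intro dispersion_nonneg_of_decreasing) auto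
      then have "0 \<le> Re (fourier w k) * Re (dispersion r (Complex 0 b))" using wk(2) by (rule mult_nonneg_nonneg[rotated])
      then show "- 1 < Re (fourier w k) * Re (dispersion r (Complex 0 b))" by linarith
    qed
    moreover have "ray_dispersion g e r z = dispersion r z" unfolding dispersion_def unfolding ray_dispersion_def \<gamma>_def ..
    ultimately show ?thesis using wk(1)[of k] by simp
  qed
  show ?thesis
  proof (rule uniform_penrose_of_pointwise[OF \<delta> w g sob])
    fix k :: "real ^ 'n" and hb :: real and z
    assume "k \<noteq> 0" "0 \<le> hb" "0 \<le> Re z"
    then show "1 + fourier w k * ray_dispersion g (k /\<^sub>R norm k) (hb * norm k) z \<noteq> 0" by (intro nonzero) simp_all
  next
    fix e :: "real ^ 'n" and z
    assume "norm e = 1" "0 \<le> Re z"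
    then show "1 + fourier w 0 * ray_dispersion g e 0 z \<noteq> 0" by (intro nonzero) simp_all
  qed
qed

text \<open>The condition asserts that \<open>Re (w D) > - 1\<close> at all boundary points where \<open>D\<close> is real. It also contains that the
  transform of \<open>w\<close> is real at \<open>k\<close> and 0: the comparison with \<open>- 1\<close> is one of complex numbers, and at a maximum of the marginal
  the principal value is not 0 by \<open>dispersion_pos_at_maximum\<close>.\<close>

lemma uniform_penrose_of_generalised_penrose:
  fixes w g :: "real ^ 'n \<Rightarrow> real"
  assumes \<delta>: "0 < \<delta>" and adm: "admissible_profile g" and cond: "generalised_penrose_condition \<delta> w g"
  shows "uniform_penrose w g"
proof -
  have w: "integrable lborel w" and sob': "in_weighted_sobolev (3 / 2 + \<delta>) (1 + half_dim TYPE('n)) g"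
    using cond by (auto simp: generalised_penrose_condition_def)
  have cond1: "deriv (marginal g k) (\<tau> / norm k) = 0 \<Longrightarrow>
       - fourier w k * complex_of_real (pv_integral {\<tau> / norm k} (\<lambda>p. deriv (marginal g k) p / (p - \<tau> / norm k))) > -1"
    and cond2: "deriv (marginal g k) (\<tau> / norm k) = 0 \<Longrightarrow>
       - fourier w 0 * complex_of_real (pv_integral {\<tau> / norm k} (\<lambda>p. deriv (marginal g k) p / (p - \<tau> / norm k))) > -1"
    and cond3: "0 < hb \<Longrightarrow> hb \<le> 1 \<Longrightarrow> marginal g k (\<tau> / norm k + hb * norm k / 2) = marginal g k (\<tau> / norm k - hb * norm k / 2) \<Longrightarrow>
       fourier w k * complex_of_real (1 / (hb * norm k) *
             pv_integral {\<tau> / norm k - hb * norm k / 2, \<tau> / norm k + hb * norm k / 2}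
               (\<lambda>p. marginal g k p *
                  (1 / (p - \<tau> / norm k + hb * norm k / 2) - 1 / (p - \<tau> / norm k - hb * norm k / 2)))) > -1"
    if "k \<noteq> 0" for k :: "real ^ 'n" and \<tau> hb
  proof -
    note c = cond[unfolded generalised_penrose_condition_def, THEN conjunct2, THEN conjunct2, rule_format, OF that]
    show "deriv (marginal g k) (\<tau> / norm k) = 0 \<Longrightarrow>
       - fourier w k * complex_of_real (pv_integral {\<tau> / norm k} (\<lambda>p. deriv (marginal g k) p / (p - \<tau> / norm k))) > -1"
      by (rule c[THEN conjunct1, rule_format])
    show "deriv (marginal g k) (\<tau> / norm k) = 0 \<Longrightarrow>
       - fourier w 0 * complex_of_real (pv_integral {\<tau> / norm k} (\<lambda>p. deriv (marginal g k) p / (p - \<tau> / norm k))) > -1"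
      by (rule c[THEN conjunct2, THEN conjunct1, rule_format])
    show "0 < hb \<Longrightarrow> hb \<le> 1 \<Longrightarrow> marginal g k (\<tau> / norm k + hb * norm k / 2) = marginal g k (\<tau> / norm k - hb * norm k / 2) \<Longrightarrow>
       fourier w k * complex_of_real (1 / (hb * norm k) *
             pv_integral {\<tau> / norm k - hb * norm k / 2, \<tau> / norm k + hb * norm k / 2}
               (\<lambda>p. marginal g k p *
                  (1 / (p - \<tau> / norm k + hb * norm k / 2) - 1 / (p - \<tau> / norm k - hb * norm k / 2)))) > -1"
      by (rule c[THEN conjunct2, THEN conjunct2, rule_format])
  qed
  have g0: "\<And>x. 0 \<le> g x" and g: "integrable lborel g" using adm by (auto simp: admissible_profile_def)
  have sob: "in_weighted_sobolev (3 / 2 + \<delta>) (half_dim TYPE('n)) g"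
    by (rule in_weighted_sobolev_mono[OF sob']) simp
  \<comment> \<open>Here \<open>\<omega>\<close> is the transform of \<open>w\<close> at \<open>k\<close> or, with \<open>r = 0\<close>, at 0.\<close>
  have real_case: "1 + \<omega> * ray_dispersion g e r z \<noteq> 0"
    if k: "k \<noteq> 0" and e: "e = k /\<^sub>R norm k" and z: "0 \<le> Re z"
      and bd0: "\<And>b. deriv (marginal g k) b = 0 \<Longrightarrow> - \<omega> * complex_of_real (pv_integral {b} (\<lambda>p. deriv (marginal g k) p / (p - b))) > -1"
      and bdr: "\<And>b. 0 < r \<Longrightarrow> marginal g k (b + r / 2) = marginal g k (b - r / 2) \<Longrightarrow>
         \<omega> * complex_of_real (1 / r * pv_integral {b - r / 2, b + r / 2} (\<lambda>p. marginal g k p * (1 / (p - b + r / 2) - 1 / (p - b - r / 2)))) > -1"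
      and r: "0 \<le> r"
    for k e :: "real ^ 'n" and \<omega> r z
  proof -
    have e1: "norm e = 1" using k e by simp
    define \<gamma> where "\<gamma> = (\<lambda>s. fourier g (s *\<^sub>R e))"
    note lp = sobolev_line_profile[OF \<delta> g sob e1]
    interpret line_profile \<gamma> unfolding \<gamma>_def by (rule lp)
    have disp_eq: "ray_dispersion g e r z = dispersion r z" unfolding dispersion_def unfolding ray_dispersion_def \<gamma>_def ..
    have marg: "marginal g k = (\<lambda>u. Re (dens u))"
      using marginal_eq_dens[OF g0 g e1 lp] marginal_scale[OF k, of g] by (simp add: \<gamma>_def e)
    then have der: "deriv (marginal g k) u = Re (slope 0 u)" for u
      using DERIV_imp_deriv[OF dens_has_derivative] by simp
    have bd0': "-1 < Re \<omega> * Re (dispersion 0 (Complex 0 b)) \<and> Im \<omega> * Re (dispersion 0 (Complex 0 b)) = 0" if "slope 0 b = 0" for b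
    proof -
      have "- \<omega> * complex_of_real (- Re (dispersion 0 (Complex 0 b))) > -1"
        using bd0[of b] that by (simp only: der pv_integral_slope) simp
      then have "\<omega> * complex_of_real (Re (dispersion 0 (Complex 0 b))) > -1" by simp
      then show ?thesis by (simp only: less_complex_times_real_iff)
    qed
    show ?thesis
    proof (cases "AE x in lborel. g x = 0")
      case True
      then have "fourier g \<kappa> = (LINT (x :: real ^ 'n)|lborel. 0)" for \<kappa>
        unfolding fourier_cis using g by (intro integral_cong_AE) auto
      then show ?thesis by (simp add: ray_dispersion_def laplace_def)
    next
      case False
      then obtain u0 where "0 < Re (dens u0)"
        using dens_pos_somewhere[OF g0 g e1 lp] by (auto simp: \<gamma>_def)
      then obtain b0 where b0: "\<And>u. Re (dens u) \<le> Re (dens b0)" using dens_attains_maximum by blast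
      have pos: "0 < Re (dens b0)" using \<open>0 < Re (dens u0)\<close> b0[of u0] by linarith
      have "Re (slope 0 b0) = 0"
        by (rule DERIV_local_max[OF dens_has_derivative, of 1 b0]) (use b0 in auto)
      then have "slope 0 b0 = 0" by (simp add: complex_eq_iff Im_slope)
      from bd0'[OF this] dispersion_pos_at_maximum[OF b0 pos] have Im: "Im \<omega> = 0" by simp
      then have \<omega>: "\<omega> = complex_of_real (Re \<omega>)" by (simp add: complex_eq_iff)
      have "1 + complex_of_real (Re \<omega>) * dispersion r z \<noteq> 0"
      proof (rule dispersion_nonzero[OF _ z])
        fix b assume sl: "slope r b = 0"
        show "- 1 < Re \<omega> * Re (dispersion r (Complex 0 b))"
        proof (cases "r = 0")
          case True
          then show ?thesis using bd0'[of b] sl by simp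
        next
          case False
          then have r0: "0 < r" using r by simp
          have "Re (dens (b + r / 2)) = Re (dens (b - r / 2))"
            using Re_slope_eq[OF False, of b] sl False by simp
          then have "\<omega> * complex_of_real (1 / r * (r * Re (dispersion r (Complex 0 b)))) > -1"
            using bdr[OF r0, of b] by (simp only: marg pv_integral_dens_pair[OF r0])
          then have "\<omega> * complex_of_real (Re (dispersion r (Complex 0 b))) > -1" using False by simp
          then show ?thesis by (simp only: less_complex_times_real_iff)
        qed
      qed
      then show ?thesis using \<omega> disp_eq by simp
    qed
  qed
  show ?thesis
  proof (rule uniform_penrose_of_pointwise[OF \<delta> w g sob])
    fix k :: "real ^ 'n" and hb :: real and z assume k: "k \<noteq> 0" and hb: "0 \<le> hb" "hb \<le> 1" and z: "0 \<le> Re z"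
    have quot: "b * norm k / norm k = b" for b using k by simp
    show "1 + fourier w k * ray_dispersion g (k /\<^sub>R norm k) (hb * norm k) z \<noteq> 0"
    proof (rule real_case[OF k refl z])
      show "- fourier w k * complex_of_real (pv_integral {b} (\<lambda>p. deriv (marginal g k) p / (p - b))) > -1"
        if "deriv (marginal g k) b = 0" for b
        by (rule cond1[OF k, of "b * norm k", unfolded quot, OF that])
      show "fourier w k * complex_of_real (1 / (hb * norm k) * pv_integral {b - hb * norm k / 2, b + hb * norm k / 2} (\<lambda>p. marginal g k p * (1 / (p - b + hb * norm k / 2) - 1 / (p - b - hb * norm k / 2)))) > -1"
        if "0 < hb * norm k" "marginal g k (b + hb * norm k / 2) = marginal g k (b - hb * norm k / 2)" for b
      proof -
        have "0 < hb" using that(1) k by (simp add: zero_less_mult_iff)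
        then show ?thesis by (rule cond3[OF k, of hb "b * norm k", unfolded quot, OF _ hb(2) that(2)])
      qed
    qed (use hb in simp)
  next
    fix e :: "real ^ 'n" and z assume e: "norm e = 1" and z: "0 \<le> Re z"
    have e0: "e \<noteq> 0" using e by auto
    show "1 + fourier w 0 * ray_dispersion g e 0 z \<noteq> 0"
    proof (rule real_case[OF e0 _ z])
      show "e = e /\<^sub>R norm e" using e by simp
      show "- fourier w 0 * complex_of_real (pv_integral {b} (\<lambda>p. deriv (marginal g e) p / (p - b))) > -1"
        if "deriv (marginal g e) b = 0" for b
        by (rule cond2[OF e0, of b, unfolded e div_by_1, OF that])
    qed simp_all
  qed
qed

theorem proposition2p6:
  fixes \<delta>\<^sub>0 :: real
  assumes "0 < \<delta>\<^sub>0" and "\<delta>\<^sub>0 < 1 / 2"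
  shows "(\<exists>C\<^sub>1. smallness_constant TYPE('n::finite) \<delta>\<^sub>0 C\<^sub>1) \<and>
    (\<forall>C\<^sub>1 (w :: real ^ 'n \<Rightarrow> real) (g :: real ^ 'n \<Rightarrow> real).
       smallness_constant TYPE('n) \<delta>\<^sub>0 C\<^sub>1 \<longrightarrow>
       admissible_profile g \<longrightarrow>
       smallness_condition \<delta>\<^sub>0 C\<^sub>1 w g \<or>
       repulsive_decreasing_condition \<delta>\<^sub>0 w g \<or>
       generalised_penrose_condition \<delta>\<^sub>0 w g \<longrightarrow>
       uniform_penrose w g)"
proof (intro conjI allI impI)
  show "\<exists>C\<^sub>1. smallness_constant TYPE('n) \<delta>\<^sub>0 C\<^sub>1" by (rule smallness_constant_exists[OF assms(1)])
next
  fix C\<^sub>1 :: real and w g :: "real ^ 'n \<Rightarrow> real"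
  assume C: "smallness_constant TYPE('n) \<delta>\<^sub>0 C\<^sub>1" and adm: "admissible_profile g"
  assume "smallness_condition \<delta>\<^sub>0 C\<^sub>1 w g \<or> repulsive_decreasing_condition \<delta>\<^sub>0 w g \<or> generalised_penrose_condition \<delta>\<^sub>0 w g"
  then show "uniform_penrose w g"
  proof (elim disjE)
    assume "smallness_condition \<delta>\<^sub>0 C\<^sub>1 w g"
    then show ?thesis by (rule uniform_penrose_of_smallness[OF C adm])
  next
    assume "repulsive_decreasing_condition \<delta>\<^sub>0 w g"
    then show ?thesis by (rule uniform_penrose_of_repulsive_decreasing[OF assms(1) adm])
  next
    assume "generalised_penrose_condition \<delta>\<^sub>0 w g"
    then show ?thesis by (rule uniform_penrose_of_generalised_penrose[OF assms(1) adm])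
  qed
qed

end
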